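(* Let $(M,Z,\omega_M)$ be a compact $2n$-dimensional $b$-symplectic toric manifold and let $X_{\mathrm{sing}}$ be a connected component of $M\setminus Z$. Let $X_{\mathrm{sing}}/Z$ be the closed smooth manifold obtained from $X_{\mathrm{sing}}$ by adjoining the adjacent components of $Z$ and collapsing, in each of them, the circle factor of the local model. Then $X_{\mathrm{sing}}/Z$ possesses a toric structure: there is a symplectic form on $X_{\mathrm{sing}}/Z$ for which the $\mathbb{T}^n$-action induced from $M$ is an effective Hamiltonian action.
   Context: **$b$-geometry.** A $b$-manifold $(M,Z)$ is an oriented smooth manifold $M$ with a closed smooth hypersurface $Z$ (possibly disconnected). ${}^bTM$ is the vector bundle whose sections are the vector fields tangent to $Z$ along $Z$, and ${}^bT^*M$ is its dual. $b$-forms are sections of $\Lambda^k({}^bT^*M)$; locally they are $\alpha\wedge\frac{df}{f}+\beta$ with $\alpha,\beta$ smooth forms and $f$ a defining function of $Z$, and $d(\alpha\wedge\frac{df}{f}+\beta)=d\alpha\wedge\frac{df}{f}+d\beta$. A $b$-symplectic form is a closed $b$-form $\omega$ of degree 2 with $\omega^n$ nowhere zero as a section of $\Lambda^{2n}({}^bT^*M)$. A $b$-function is a function locally of the form $c\log|y|+f$, with $c\in\mathbb{R}$, $f$ smooth and $y$ a defining function of $Z$. A $\mathbb{T}^n$-action on $(M,Z,\omega)$ is Hamiltonian if for all $X,Y\in\mathfrak{t}$ the $b$-one-form $\iota_{X^\#}\omega$ is the differential of a $b$-function and $\omega(X^\#,Y^\#)=0$. It is toric if it is also effective and $\dim M=2n$.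 **Local model (known result).** For each connected component $Z'$ of $Z$ there are a compact symplectic toric $\mathbb{T}^{n-1}$-manifold $(X_{\Delta_F},\omega_{\Delta_F})$, a splitting $\mathbb{T}^n=\mathbb{T}^{n-1}\times\mathbb{S}^1$, a constant $c\neq0$ and a $\mathbb{T}^n$-equivariant $b$-symplectomorphism from a neighborhood of $Z'$ to $X_{\Delta_F}\times\mathbb{S}^1\times(-\epsilon,\epsilon)$. The model has coordinates $(x,\theta,h)$ and form $\omega_{\Delta_F}+c\,\frac1h\,dh\wedge d\theta$, and $Z'$ goes to $\{h=0\}$. $\mathbb{T}^{n-1}$ acts on $X_{\Delta_F}$ by its toric action and $\mathbb{S}^1$ acts by rotation in $\theta$. Fix such models for the components adjacent to $X_{\mathrm{sing}}$, chosen so that $X_{\mathrm{sing}}$ corresponds to $\{h>0\}$ near each of them. **The quotient.** $X_{\mathrm{sing}}/Z$ is the quotient of $X_{\mathrm{sing}}$ together with its adjacent components of $Z$ by the relation $(x,\theta,0)\sim(x,\theta',0)$ in each local model. Its smooth structure is the given one on $X_{\mathrm{sing}}$. Near a collapsed component it is that of $X_{\Delta_F}\times(\text{polar cap of a sphere})$, where $(h,\theta)$ are the height above the pole and the angle on a round sphere with area form $dh\wedge d\theta$; equivalently, $\sqrt{2h}\,e^{i\theta}$ is a smooth complex coordinate on the cap. The $\mathbb{T}^n$-action on $X_{\mathrm{sing}}$ extends to the quotient; this is the induced action.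
   Formalization: M is assumed connected: otherwise effectiveness can fail (add to a b-symplectic toric sphere a second sphere with trivial circle action and let X_sing be it). Where the claim holds for disconnected M, it reduces to the component containing X_sing. *)

theory Defs
  imports "HOL-Analysis.Analysis" "HOL-Combinatorics.Permutations"
begin

section \<open>Smooth maps on subsets of normed spaces\<close>

text \<open>
  The domains \<open>U\<close> occurring below are relatively open in a linear subspace. There the
  derivative is only determined along the subspace; it may be extended arbitrarily (for instance
  through a projection), which is why an existential quantifier over \<open>f'\<close> is used.
\<close>

primrec Ck_on :: "nat \<Rightarrow> 'a::real_normed_vector set \<Rightarrow> ('a \<Rightarrow> 'b::real_normed_vector) \<Rightarrow> bool" where
  "Ck_on 0 U f \<longleftrightarrow> continuous_on U f"
| "Ck_on (Suc k) U f \<longleftrightarrow>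
     (\<exists>f'. (\<forall>x\<in>U. (f has_derivative f' x) (at x within U)) \<and> (\<forall>v. Ck_on k U (\<lambda>x. f' x v)))"

definition smooth_on :: "'a::real_normed_vector set \<Rightarrow> ('a \<Rightarrow> 'b::real_normed_vector) \<Rightarrow> bool" where
  "smooth_on U f \<longleftrightarrow> (\<forall>k. Ck_on k U f)"

definition dir_deriv :: "('a::real_normed_vector \<Rightarrow> 'b::real_normed_vector) \<Rightarrow> 'a \<Rightarrow> 'a \<Rightarrow> 'b" where
  "dir_deriv f x u = vector_derivative (\<lambda>s. f (x + s *\<^sub>R u)) (at 0)"


section \<open>Manifolds\<close>

text \<open>
  A manifold is given by an atlas: a set of pairs of a domain and a coordinate map.
  A manifold of dimension \<open>2 * card I\<close>, where \<open>I\<close> is a set of indices of type \<open>'n\<close>, has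
  its charts in the copy \<open>model_space I\<close> of the Euclidean space of that dimension, with
  coordinates \<open>Inl i\<close>, \<open>Inr i\<close> for \<open>i \<in> I\<close>. In this way a manifold of dimension \<open>2n\<close>
  (\<open>I = UNIV\<close>) and one of dimension \<open>2(n-1)\<close> (\<open>I = - {k}\<close>; a point if \<open>n = 1\<close>)
  can occur in the same statement.
\<close>

type_synonym 'n coords = "real^('n + 'n)"
type_synonym ('a, 'n) chart = "'a set \<times> ('a \<Rightarrow> 'n coords)"
type_synonym ('a, 'n) atlas = "('a, 'n) chart set"

definition model_space :: "'n::finite set \<Rightarrow> 'n coords set" where
  "model_space I = {x. \<forall>i. i \<notin> I \<longrightarrow> x $ Inl i = 0 \<and> x $ Inr i = 0}"

definition carrier_of :: "('a, 'n) atlas \<Rightarrow> 'a set" where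
  "carrier_of A = (\<Union>c\<in>A. fst c)"

definition mtop :: "('a, 'n::finite) atlas \<Rightarrow> 'a topology" where
  "mtop A = topology_generated_by {{p \<in> U. \<phi> p \<in> S} | U \<phi> S. (U, \<phi>) \<in> A \<and> open S}"

definition local_expr :: "('a, 'n) chart \<Rightarrow> ('a \<Rightarrow> 'b) \<Rightarrow> 'n coords \<Rightarrow> 'b" where
  "local_expr c f = f \<circ> inv_into (fst c) (snd c)"

definition smooth_manifold :: "'n::finite set \<Rightarrow> ('a, 'n) atlas \<Rightarrow> bool" where
  "smooth_manifold I A \<longleftrightarrow>
     (\<forall>(U, \<phi>)\<in>A. inj_on \<phi> U \<and> openin (top_of_set (model_space I)) (\<phi> ` U)) \<and>
     (\<forall>(U, \<phi>)\<in>A. \<forall>(V, \<psi>)\<in>A.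
        openin (top_of_set (model_space I)) (\<phi> ` (U \<inter> V)) \<and>
        smooth_on (\<phi> ` (U \<inter> V)) (local_expr (U, \<phi>) \<psi>)) \<and>
     Hausdorff_space (mtop A) \<and> second_countable (mtop A)"

text \<open>The differential at \<open>p\<close> of \<open>f\<close> in the coordinates of the chart \<open>c\<close>.\<close>

definition differential ::
    "('a, 'n::finite) chart \<Rightarrow> ('a \<Rightarrow> 'b::real_normed_vector) \<Rightarrow> 'a \<Rightarrow> 'n coords \<Rightarrow> 'b" where
  "differential c f p u = dir_deriv (local_expr c f) (snd c p) u"

definition oriented_atlas :: "('a, 'n::finite) atlas \<Rightarrow> bool" where
  "oriented_atlas A \<longleftrightarrow>
     (\<forall>c\<in>A. \<forall>c'\<in>A. \<forall>p\<in>fst c \<inter> fst c'. det (matrix (differential c (snd c') p)) > 0)"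

definition smooth_fun :: "('a, 'n::finite) atlas \<Rightarrow> ('a \<Rightarrow> real) \<Rightarrow> bool" where
  "smooth_fun A g \<longleftrightarrow> (\<forall>(U, \<phi>)\<in>A. smooth_on (\<phi> ` U) (local_expr (U, \<phi>) g))"

definition smooth_map ::
    "('a, 'n::finite) atlas \<Rightarrow> ('b, 'n) atlas \<Rightarrow> 'a set \<Rightarrow> ('a \<Rightarrow> 'b) \<Rightarrow> bool" where
  "smooth_map A B W f \<longleftrightarrow>
     (\<forall>(U, \<phi>)\<in>A. \<forall>(V, \<psi>)\<in>B.
        openin (top_of_set (\<phi> ` U)) (\<phi> ` {p \<in> U \<inter> W. f p \<in> V}) \<and>
        smooth_on (\<phi> ` {p \<in> U \<inter> W. f p \<in> V}) (local_expr (U, \<phi>) (\<psi> \<circ> f)))"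


section \<open>Two-forms and symplectic forms\<close>

text \<open>
  A two-form assigns to every chart its coefficients: \<open>\<omega> c x u v\<close> is the value at the point
  with coordinates \<open>x\<close> on the tangent vectors with components \<open>u\<close>, \<open>v\<close> in the chart \<open>c\<close>.
\<close>

type_synonym ('a, 'n) form2 =
  "('a, 'n) chart \<Rightarrow> 'n coords \<Rightarrow> 'n coords \<Rightarrow> 'n coords \<Rightarrow> real"

definition coeff_form2 ::
    "'n::finite set \<Rightarrow> 'n coords set \<Rightarrow> ('n coords \<Rightarrow> 'n coords \<Rightarrow> 'n coords \<Rightarrow> real) \<Rightarrow> bool" where
  "coeff_form2 I D b \<longleftrightarrow>
     (\<forall>x\<in>D. bilinear (b x) \<and> (\<forall>u\<in>model_space I. b x u u = 0)) \<and>
     (\<forall>u\<in>model_space I. \<forall>v\<in>model_space I. smooth_on D (\<lambda>x. b x u v))"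

text \<open>\<open>W\<close> is the open set on which the form is defined.\<close>

definition two_form ::
    "'n::finite set \<Rightarrow> ('a, 'n) atlas \<Rightarrow> 'a set \<Rightarrow> ('a, 'n) form2 \<Rightarrow> bool" where
  "two_form I A W \<omega> \<longleftrightarrow>
     (\<forall>(U, \<phi>)\<in>A. coeff_form2 I (\<phi> ` (U \<inter> W)) (\<omega> (U, \<phi>))) \<and>
     (\<forall>c\<in>A. \<forall>c'\<in>A. \<forall>p\<in>fst c \<inter> fst c' \<inter> W. \<forall>u\<in>model_space I. \<forall>v\<in>model_space I.
        \<omega> c (snd c p) u v =
        \<omega> c' (snd c' p) (differential c (snd c') p u) (differential c (snd c') p v))"

definition ext_d1 :: "('e::real_normed_vector \<Rightarrow> 'e \<Rightarrow> real) \<Rightarrow> 'e \<Rightarrow> 'e \<Rightarrow> 'e \<Rightarrow> real" where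
  "ext_d1 a x u v = dir_deriv (\<lambda>y. a y v) x u - dir_deriv (\<lambda>y. a y u) x v"

definition ext_d2 :: "('e::real_normed_vector \<Rightarrow> 'e \<Rightarrow> 'e \<Rightarrow> real) \<Rightarrow> 'e \<Rightarrow> 'e \<Rightarrow> 'e \<Rightarrow> 'e \<Rightarrow> real" where
  "ext_d2 b x u v w =
     dir_deriv (\<lambda>y. b y v w) x u - dir_deriv (\<lambda>y. b y u w) x v + dir_deriv (\<lambda>y. b y u v) x w"

text \<open>
  The exterior power of order \<open>card I\<close> of a skew form \<open>B\<close>, evaluated on the \<open>2 * card I\<close>
  vectors \<open>v (Inl i), v (Inr i)\<close>, \<open>i \<in> I\<close>.
\<close>

definition wedge_power :: "'n::finite set \<Rightarrow> ('v \<Rightarrow> 'v \<Rightarrow> real) \<Rightarrow> ('n + 'n \<Rightarrow> 'v) \<Rightarrow> real" where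
  "wedge_power I B v =
     (\<Sum>\<sigma> | \<sigma> permutes (I <+> I).
        of_int (sign \<sigma>) * (\<Prod>i\<in>I. B (v (\<sigma> (Inl i))) (v (\<sigma> (Inr i))))) / 2 ^ card I"

definition symplectic_form ::
    "'n::finite set \<Rightarrow> ('a, 'n) atlas \<Rightarrow> ('a, 'n) form2 \<Rightarrow> bool" where
  "symplectic_form I A \<omega> \<longleftrightarrow>
     two_form I A (carrier_of A) \<omega> \<and>
     (\<forall>c\<in>A. \<forall>x\<in>snd c ` fst c.
        (\<forall>u\<in>model_space I. \<forall>v\<in>model_space I. \<forall>w\<in>model_space I. ext_d2 (\<omega> c) x u v w = 0) \<and>
        (\<exists>v. (\<forall>j. v j \<in> model_space I) \<and> wedge_power I (\<omega> c x) v \<noteq> 0))"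


section \<open>Torus actions\<close>

text \<open>
  \<open>torus I\<close> is the torus of dimension \<open>card I\<close>; the group operation is the componentwise
  product of \<open>complex^'n\<close>.
\<close>

definition torus :: "'n::finite set \<Rightarrow> (complex^'n) set" where
  "torus I = {t. \<forall>i. norm (t $ i) = 1 \<and> (i \<notin> I \<longrightarrow> t $ i = 1)}"

definition torus_lie :: "'n::finite set \<Rightarrow> (real^'n) set" where
  "torus_lie I = {\<xi>. \<forall>i. i \<notin> I \<longrightarrow> \<xi> $ i = 0}"

definition torus_exp :: "real^'n \<Rightarrow> complex^'n" where
  "torus_exp \<xi> = (\<chi> i. cis (\<xi> $ i))"

text \<open>
  Smoothness of the action map is tested after composition with the exponential map, which is a
  surjective local diffeomorphism onto the torus.
\<close>

definition smooth_torus_action ::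
    "'n::finite set \<Rightarrow> ('a, 'n) atlas \<Rightarrow> (complex^'n \<Rightarrow> 'a \<Rightarrow> 'a) \<Rightarrow> bool" where
  "smooth_torus_action I A act \<longleftrightarrow>
     (\<forall>t\<in>torus I. \<forall>p\<in>carrier_of A. act t p \<in> carrier_of A) \<and>
     (\<forall>p\<in>carrier_of A. act 1 p = p) \<and>
     (\<forall>s\<in>torus I. \<forall>t\<in>torus I. \<forall>p\<in>carrier_of A. act (s * t) p = act s (act t p)) \<and>
     (\<forall>(U, \<phi>)\<in>A. \<forall>(V, \<psi>)\<in>A.
        let D = {(\<xi>, x). \<xi> \<in> torus_lie I \<and> x \<in> \<phi> ` U \<and>
                         act (torus_exp \<xi>) (inv_into U \<phi> x) \<in> V}
        in openin (top_of_set (torus_lie I \<times> \<phi> ` U)) D \<and>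
           smooth_on D (\<lambda>(\<xi>, x). \<psi> (act (torus_exp \<xi>) (inv_into U \<phi> x))))"

definition effective_action ::
    "'n::finite set \<Rightarrow> ('a, 'n) atlas \<Rightarrow> (complex^'n \<Rightarrow> 'a \<Rightarrow> 'a) \<Rightarrow> bool" where
  "effective_action I A act \<longleftrightarrow>
     (\<forall>t\<in>torus I. (\<forall>p\<in>carrier_of A. act t p = p) \<longrightarrow> t = 1)"

text \<open>The fundamental vector field of \<open>\<xi>\<close> at \<open>p\<close>, in the chart \<open>c\<close>.\<close>

definition fundamental_field ::
    "(complex^'n \<Rightarrow> 'a \<Rightarrow> 'a) \<Rightarrow> ('a, 'n::finite) chart \<Rightarrow> real^'n \<Rightarrow> 'a \<Rightarrow> 'n coords" where
  "fundamental_field act c \<xi> p =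
     vector_derivative (\<lambda>s. snd c (act (torus_exp (s *\<^sub>R \<xi>)) p)) (at 0)"

definition hamiltonian_action ::
    "'n::finite set \<Rightarrow> ('a, 'n) atlas \<Rightarrow> ('a, 'n) form2 \<Rightarrow> (complex^'n \<Rightarrow> 'a \<Rightarrow> 'a) \<Rightarrow> bool" where
  "hamiltonian_action I A \<omega> act \<longleftrightarrow>
     (\<forall>\<xi>\<in>torus_lie I. \<exists>\<mu>. smooth_fun A \<mu> \<and>
        (\<forall>c\<in>A. \<forall>p\<in>fst c. \<forall>u\<in>model_space I.
           \<omega> c (snd c p) (fundamental_field act c \<xi> p) u = differential c \<mu> p u)) \<and>
     (\<forall>\<xi>\<in>torus_lie I. \<forall>\<eta>\<in>torus_lie I. \<forall>c\<in>A. \<forall>p\<in>fst c.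
        \<omega> c (snd c p) (fundamental_field act c \<xi> p) (fundamental_field act c \<eta> p) = 0)"

definition compact_symplectic_toric ::
    "'n::finite set \<Rightarrow> ('a, 'n) atlas \<Rightarrow> ('a, 'n) form2 \<Rightarrow> (complex^'n \<Rightarrow> 'a \<Rightarrow> 'a) \<Rightarrow> bool" where
  "compact_symplectic_toric I A \<omega> act \<longleftrightarrow>
     smooth_manifold I A \<and> compact_space (mtop A) \<and> connected_space (mtop A) \<and>
     symplectic_form I A \<omega> \<and> smooth_torus_action I A act \<and>
     hamiltonian_action I A \<omega> act \<and> effective_action I A act"


section \<open>\<open>b\<close>-symplectic toric manifolds\<close>

definition defining_function :: "'e::real_normed_vector set \<Rightarrow> 'e set \<Rightarrow> ('e \<Rightarrow> real) \<Rightarrow> bool" where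
  "defining_function D S f \<longleftrightarrow>
     smooth_on D f \<and> D \<inter> S = {x \<in> D. f x = 0} \<and> (\<forall>x\<in>D \<inter> S. \<exists>u. dir_deriv f x u \<noteq> 0)"

definition b_manifold :: "('a, 'n::finite) atlas \<Rightarrow> 'a set \<Rightarrow> bool" where
  "b_manifold M Z \<longleftrightarrow>
     smooth_manifold UNIV M \<and> oriented_atlas M \<and> closedin (mtop M) Z \<and>
     (\<forall>(U, \<phi>)\<in>M. \<forall>x\<in>\<phi> ` (U \<inter> Z).
        \<exists>D f. open D \<and> x \<in> D \<and> D \<subseteq> \<phi> ` U \<and> defining_function D (\<phi> ` (U \<inter> Z)) f)"

text \<open>
  Locally, for a defining function \<open>f\<close> of \<open>Z\<close>, a \<open>b\<close>-tangent vector is determined by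
  the value \<open>a\<close> of \<open>df/f\<close> on it and by its image \<open>u\<close> in the tangent bundle, and these
  pairs are subject only to \<open>df(u) = f a\<close>. So off \<open>Z\<close> the \<open>b\<close>-tangent space is the tangent
  space of \<open>M\<close>, and on \<open>Z\<close> it consists of all pairs with \<open>u\<close> tangent to \<open>Z\<close>.
\<close>

definition b_tangent :: "('e::real_normed_vector \<Rightarrow> real) \<Rightarrow> 'e \<Rightarrow> (real \<times> 'e) set" where
  "b_tangent f x = {(a, u). dir_deriv f x u = f x * a}"

text \<open>The values on \<open>b\<close>-tangent vectors of \<open>\<alpha> \<and> df/f + \<beta>\<close> and of its differential
  \<open>d\<alpha> \<and> df/f + d\<beta>\<close>.\<close>

definition b_form_value ::
    "('e \<Rightarrow> 'e \<Rightarrow> real) \<Rightarrow> ('e \<Rightarrow> 'e \<Rightarrow> 'e \<Rightarrow> real) \<Rightarrow> 'e \<Rightarrow> real \<times> 'e \<Rightarrow> real \<times> 'e \<Rightarrow> real" where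
  "b_form_value \<alpha> \<beta> x = (\<lambda>(a, u) (b, v). \<alpha> x u * b - \<alpha> x v * a + \<beta> x u v)"

definition b_form_diff ::
    "('e::real_normed_vector \<Rightarrow> 'e \<Rightarrow> real) \<Rightarrow> ('e \<Rightarrow> 'e \<Rightarrow> 'e \<Rightarrow> real) \<Rightarrow>
     'e \<Rightarrow> real \<times> 'e \<Rightarrow> real \<times> 'e \<Rightarrow> real \<times> 'e \<Rightarrow> real" where
  "b_form_diff \<alpha> \<beta> x = (\<lambda>(a, u) (b, v) (c, w).
     ext_d1 \<alpha> x u v * c - ext_d1 \<alpha> x u w * b + ext_d1 \<alpha> x v w * a + ext_d2 \<beta> x u v w)"

text \<open>
  A \<open>b\<close>-form of degree 2 is a two-form on the complement of \<open>Z\<close> which is locally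
  \<open>\<alpha> \<and> df/f + \<beta>\<close>; the complement being dense, the \<open>b\<close>-form and its values on
  \<open>b\<close>-tangent vectors over \<open>Z\<close> do not depend on the choice of \<open>f\<close>, \<open>\<alpha>\<close> and \<open>\<beta>\<close>.
\<close>

definition b_form_repr ::
    "'n::finite coords set \<Rightarrow> 'n coords set \<Rightarrow> ('n coords \<Rightarrow> 'n coords \<Rightarrow> 'n coords \<Rightarrow> real) \<Rightarrow>
     ('n coords \<Rightarrow> real) \<Rightarrow> ('n coords \<Rightarrow> 'n coords \<Rightarrow> real) \<Rightarrow>
     ('n coords \<Rightarrow> 'n coords \<Rightarrow> 'n coords \<Rightarrow> real) \<Rightarrow> bool" where
  "b_form_repr D S b f \<alpha> \<beta> \<longleftrightarrow>
     defining_function D S f \<and>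
     (\<forall>x\<in>D. linear (\<alpha> x)) \<and> (\<forall>u. smooth_on D (\<lambda>x. \<alpha> x u)) \<and>
     coeff_form2 UNIV D \<beta> \<and>
     (\<forall>x\<in>D - S. \<forall>u v. b x u v =
        b_form_value \<alpha> \<beta> x (dir_deriv f x u / f x, u) (dir_deriv f x v / f x, v))"

definition b_symplectic_form ::
    "('a, 'n::finite) atlas \<Rightarrow> 'a set \<Rightarrow> ('a, 'n) form2 \<Rightarrow> bool" where
  "b_symplectic_form M Z \<omega> \<longleftrightarrow>
     two_form UNIV M (carrier_of M - Z) \<omega> \<and>
     (\<forall>(U, \<phi>)\<in>M. \<forall>x\<in>\<phi> ` U. \<exists>D f \<alpha> \<beta>.
        open D \<and> x \<in> D \<and> D \<subseteq> \<phi> ` U \<and>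
        b_form_repr D (\<phi> ` (U \<inter> Z)) (\<omega> (U, \<phi>)) f \<alpha> \<beta> \<and>
        (\<forall>y\<in>D.
           (\<forall>\<xi>\<in>b_tangent f y. \<forall>\<eta>\<in>b_tangent f y. \<forall>\<zeta>\<in>b_tangent f y.
              b_form_diff \<alpha> \<beta> y \<xi> \<eta> \<zeta> = 0) \<and>
           (\<exists>v. (\<forall>j. v j \<in> b_tangent f y) \<and> wedge_power (UNIV :: 'n set) (b_form_value \<alpha> \<beta> y) v \<noteq> 0)))"

text \<open>The values of a \<open>b\<close>-function on \<open>Z\<close> are irrelevant.\<close>

definition b_function :: "('a, 'n::finite) atlas \<Rightarrow> 'a set \<Rightarrow> ('a \<Rightarrow> real) \<Rightarrow> bool" where
  "b_function M Z g \<longleftrightarrow>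
     (\<forall>(U, \<phi>)\<in>M. \<forall>x\<in>\<phi> ` U. \<exists>D c y f.
        open D \<and> x \<in> D \<and> D \<subseteq> \<phi> ` U \<and> defining_function D (\<phi> ` (U \<inter> Z)) y \<and> smooth_on D f \<and>
        (\<forall>x'\<in>D - \<phi> ` (U \<inter> Z). local_expr (U, \<phi>) g x' = c * ln \<bar>y x'\<bar> + f x'))"

text \<open>
  The \<open>b\<close>-one-forms \<open>\<iota>\<^bsub>\<xi>\<^esub> \<omega>\<close> and \<open>d\<mu>\<close> are continuous sections of the dual of the
  \<open>b\<close>-tangent bundle, and \<open>\<omega>(\<xi>, \<eta>)\<close> is a smooth function; hence these equations hold
  on \<open>M\<close> if and only if they hold on the dense complement of \<open>Z\<close>.
\<close>

definition b_hamiltonian_action ::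
    "('a, 'n::finite) atlas \<Rightarrow> 'a set \<Rightarrow> ('a, 'n) form2 \<Rightarrow> (complex^'n \<Rightarrow> 'a \<Rightarrow> 'a) \<Rightarrow> bool" where
  "b_hamiltonian_action M Z \<omega> act \<longleftrightarrow>
     (\<forall>\<xi>. \<exists>\<mu>. b_function M Z \<mu> \<and>
        (\<forall>c\<in>M. \<forall>p\<in>fst c - Z. \<forall>u.
           \<omega> c (snd c p) (fundamental_field act c \<xi> p) u = differential c \<mu> p u)) \<and>
     (\<forall>\<xi> \<eta>. \<forall>c\<in>M. \<forall>p\<in>fst c - Z.
        \<omega> c (snd c p) (fundamental_field act c \<xi> p) (fundamental_field act c \<eta> p) = 0)"

definition b_symplectic_toric ::
    "('a, 'n::finite) atlas \<Rightarrow> 'a set \<Rightarrow> ('a, 'n) form2 \<Rightarrow> (complex^'n \<Rightarrow> 'a \<Rightarrow> 'a) \<Rightarrow> bool" where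
  "b_symplectic_toric M Z \<omega> act \<longleftrightarrow>
     b_manifold M Z \<and> b_symplectic_form M Z \<omega> \<and>
     smooth_torus_action UNIV M act \<and> (\<forall>t\<in>torus UNIV. \<forall>p\<in>Z. act t p \<in> Z) \<and>
     b_hamiltonian_action M Z \<omega> act \<and> effective_action UNIV M act"


section \<open>The local model near a component of \<open>Z\<close>\<close>

text \<open>
  The torus of dimension \<open>n\<close> is split as \<open>torus (- {k}) \<times> \<S>\<close>, the circle being the
  coordinate \<open>k\<close>, after an arbitrary automorphism \<open>splitting\<close>. A point of the model is a triple
  \<open>(x, w, h)\<close> with \<open>w = cis \<theta>\<close>.
\<close>

record ('a, 'x, 'n) local_model =
  nbhd :: "'a set"
  fiber :: "('x, 'n) atlas"
  fiber_form :: "('x, 'n) form2"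
  fiber_act :: "complex^'n \<Rightarrow> 'x \<Rightarrow> 'x"
  splitting :: "complex^'n \<Rightarrow> complex^'n"
  width :: real
  coef :: real
  emb :: "'a \<Rightarrow> 'x \<times> complex \<times> real"

definition torus_automorphism :: "(complex^'n::finite \<Rightarrow> complex^'n) \<Rightarrow> bool" where
  "torus_automorphism \<tau> \<longleftrightarrow>
     bij_betw \<tau> (torus UNIV) (torus UNIV) \<and> continuous_on (torus UNIV) \<tau> \<and>
     (\<forall>s\<in>torus UNIV. \<forall>t\<in>torus UNIV. \<tau> (s * t) = \<tau> s * \<tau> t)"

definition torus_fiber_part :: "'n \<Rightarrow> complex^'n \<Rightarrow> complex^'n" where
  "torus_fiber_part k t = (\<chi> i. if i = k then 1 else t $ i)"

text \<open>
  Charts of \<open>X \<times> \<S> \<times> (-\<epsilon>, \<epsilon>)\<close>: the angle ranges over an interval \<open>(a, a + 2\<pi>)\<close>, and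
  \<open>h\<close>, \<open>\<theta>\<close> are the coordinates \<open>Inl k\<close>, \<open>Inr k\<close>.
\<close>

definition cyl_chart ::
    "'n::finite \<Rightarrow> real \<Rightarrow> ('x, 'n) chart \<Rightarrow> real \<Rightarrow> ('x \<times> complex \<times> real, 'n) chart" where
  "cyl_chart k \<epsilon> d a =
     (fst d \<times> cis ` {a<..<a + 2 * pi} \<times> {-\<epsilon><..<\<epsilon>},
      \<lambda>(x, w, h). snd d x + axis (Inl k) h +
        axis (Inr k) (THE \<theta>. \<theta> \<in> {a<..<a + 2 * pi} \<and> cis \<theta> = w))"

definition cyl_atlas ::
    "'n::finite \<Rightarrow> real \<Rightarrow> ('x, 'n) atlas \<Rightarrow> ('x \<times> complex \<times> real, 'n) atlas" where
  "cyl_atlas k \<epsilon> F = {cyl_chart k \<epsilon> d a | d a. d \<in> F}"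

definition drop_coord :: "'n::finite \<Rightarrow> 'n coords \<Rightarrow> 'n coords" where
  "drop_coord k x = (\<chi> j. if j = Inl k \<or> j = Inr k then 0 else x $ j)"

text \<open>The form \<open>\<omega>\<^sub>F + c (1/h) dh \<and> d\<theta>\<close>, in the chart obtained from the chart \<open>d\<close> of
  the fiber.\<close>

definition cyl_form ::
    "'n::finite \<Rightarrow> ('x, 'n) form2 \<Rightarrow> real \<Rightarrow> ('x, 'n) chart \<Rightarrow>
     'n coords \<Rightarrow> 'n coords \<Rightarrow> 'n coords \<Rightarrow> real" where
  "cyl_form k \<omega>F c d y u v =
     \<omega>F d (drop_coord k y) (drop_coord k u) (drop_coord k v) +
     c * (1 / y $ Inl k) * (u $ Inl k * v $ Inr k - u $ Inr k * v $ Inl k)"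

definition is_local_model ::
    "'n::finite \<Rightarrow> ('a, 'n) atlas \<Rightarrow> 'a set \<Rightarrow> ('a, 'n) form2 \<Rightarrow> (complex^'n \<Rightarrow> 'a \<Rightarrow> 'a) \<Rightarrow>
     'a set \<Rightarrow> ('a, 'x, 'n) local_model \<Rightarrow> bool" where
  "is_local_model k M Z \<omega> act Z' L \<longleftrightarrow>
     compact_symplectic_toric (- {k}) (fiber L) (fiber_form L) (fiber_act L) \<and>
     torus_automorphism (splitting L) \<and> width L > 0 \<and> coef L \<noteq> 0 \<and>
     openin (mtop M) (nbhd L) \<and> Z' \<subseteq> nbhd L \<and> nbhd L \<inter> Z = Z' \<and>
     bij_betw (emb L) (nbhd L)
       (carrier_of (fiber L) \<times> sphere 0 1 \<times> {- width L<..<width L}) \<and>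
     smooth_map M (cyl_atlas k (width L) (fiber L)) (nbhd L) (emb L) \<and>
     smooth_map (cyl_atlas k (width L) (fiber L)) M
       (carrier_of (cyl_atlas k (width L) (fiber L))) (inv_into (nbhd L) (emb L)) \<and>
     (\<forall>p\<in>nbhd L. p \<in> Z' \<longleftrightarrow> snd (snd (emb L p)) = 0) \<and>
     (\<forall>t\<in>torus UNIV. \<forall>p\<in>nbhd L. act t p \<in> nbhd L \<and>
        emb L (act t p) =
          (case emb L p of (x, w, h) \<Rightarrow>
             (fiber_act L (torus_fiber_part k (splitting L t)) x, splitting L t $ k * w, h))) \<and>
     (\<forall>c\<in>M. \<forall>d\<in>fiber L. \<forall>a. \<forall>p\<in>(fst c \<inter> nbhd L) - Z. \<forall>u v.
        let e = cyl_chart k (width L) d a in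
        emb L p \<in> fst e \<longrightarrow>
        \<omega> c (snd c p) u v =
          cyl_form k (fiber_form L) (coef L) d (snd e (emb L p))
            (differential c (snd e \<circ> emb L) p u) (differential c (snd e \<circ> emb L) p v))"


section \<open>The quotient \<open>X / Z\<close>\<close>

definition adjacent_components :: "('a, 'n::finite) atlas \<Rightarrow> 'a set \<Rightarrow> 'a set \<Rightarrow> 'a set set" where
  "adjacent_components M Z X =
     {Z' \<in> connected_components_of (subtopology (mtop M) Z). Z' \<inter> (mtop M closure_of X) \<noteq> {}}"

text \<open>\<open>L\<close> assigns a local model to every component of \<open>Z\<close> in the set \<open>C\<close>.\<close>

definition collapse_rel ::
    "'a set \<Rightarrow> 'a set set \<Rightarrow> ('a set \<Rightarrow> ('a, 'x, 'n::finite) local_model) \<Rightarrow> ('a \<times> 'a) set" where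
  "collapse_rel X C L =
     {(p, q). p \<in> X \<union> \<Union>C \<and> q \<in> X \<union> \<Union>C \<and>
        (p = q \<or> (\<exists>Z'\<in>C. p \<in> Z' \<and> q \<in> Z' \<and> fst (emb (L Z') p) = fst (emb (L Z') q)))}"

text \<open>
  The points of the quotient are the equivalence classes, so its type of points is \<open>'a set\<close>.
  The classes of points of \<open>X\<close> are singletons. In the charts around a collapsed component
  \<open>\<surd>(2h) cis \<theta>\<close> is the complex coordinate on the polar cap; for \<open>h = 0\<close> it does not
  depend on the representative.
\<close>

definition open_part_chart ::
    "('a \<times> 'a) set \<Rightarrow> 'a set \<Rightarrow> ('a, 'n) chart \<Rightarrow> ('a set, 'n) chart" where
  "open_part_chart R X c = ((\<lambda>p. R `` {p}) ` (fst c \<inter> X), \<lambda>q. snd c (the_elem q))"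

definition cap_chart ::
    "'n::finite \<Rightarrow> ('a \<times> 'a) set \<Rightarrow> 'a set \<Rightarrow> ('a, 'x, 'n) local_model \<Rightarrow> ('x, 'n) chart \<Rightarrow>
     ('a set, 'n) chart" where
  "cap_chart k R P L d =
     ((\<lambda>p. R `` {p}) ` {p \<in> nbhd L \<inter> P. fst (emb L p) \<in> fst d},
      \<lambda>q. case emb L (SOME p. p \<in> q) of (x, w, h) \<Rightarrow>
            let z = complex_of_real (sqrt (2 * h)) * w
            in snd d x + axis (Inl k) (Re z) + axis (Inr k) (Im z))"

definition quotient_atlas ::
    "'n::finite \<Rightarrow> ('a, 'n) atlas \<Rightarrow> 'a set \<Rightarrow> 'a set set \<Rightarrow>
     ('a set \<Rightarrow> ('a, 'x, 'n) local_model) \<Rightarrow> ('a set, 'n) atlas" where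
  "quotient_atlas k M X C L =
     {open_part_chart (collapse_rel X C L) X c | c. c \<in> M} \<union>
     {cap_chart k (collapse_rel X C L) (X \<union> \<Union>C) (L Z') d | Z' d. Z' \<in> C \<and> d \<in> fiber (L Z')}"

definition induced_action :: "(complex^'n \<Rightarrow> 'a \<Rightarrow> 'a) \<Rightarrow> complex^'n \<Rightarrow> 'a set \<Rightarrow> 'a set" where
  "induced_action act t q = act t ` q"

end

theory Submission
  imports Defs
begin

text \<open>
  With \<open>x + \<i>y = \<surd>(2h) cis \<theta>\<close> one has \<open>dh \<and> d\<theta> = dx \<and> dy\<close>, so only the factor \<open>1/h\<close> prevents the
  model form \<open>\<omega>\<^sub>F + c (1/h) dh \<and> d\<theta>\<close> from extending over the polar cap. Replace \<open>1/h\<close> by a positive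
  smooth function \<open>\<phi>\<close> on \<open>[0, \<delta>]\<close> with \<open>\<phi>(h) = 1/h\<close> for \<open>h \<ge> r\<close>: the form \<open>\<omega>\<^sub>F + c \<phi>(h) dx \<and> dy\<close> is
  symplectic on the cap and agrees with \<open>\<omega>\<close> where \<open>r < h < \<delta>\<close>. If \<open>\<Phi>\<close> is the primitive of \<open>\<phi>\<close> with
  \<open>\<Phi>(h) = ln h\<close> for \<open>h \<ge> r\<close>, then \<open>\<mu>\<^sub>F - c b \<Phi>(h)\<close> is a Hamiltonian function on the cap, where \<open>b\<close> is
  the component of \<open>\<xi>\<close> along the circle. It differs from the given one on the connected set
  \<open>{r < h < \<delta>}\<close> by a constant, so the two can be glued.
\<close>

section \<open>Calculus of smooth maps\<close>

text \<open>What shapes the proof is that the quotient carries two unrelated kinds of charts and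
  that \<theta> is no coordinate at the pole. Everything on a cap is therefore expressed by the
  fiber point, z = sqrt (2h) cis \<theta> and h = |z|^2 / 2. The latter is a polynomial with values
  in [0, \<delta>) on the cap, so a profile that is smooth on a closed interval up to h = 0 is
  enough. The action becomes linear in z, a rotation with speed b = \<open>lift \<xi> $ k\<close>;
  as the model splits the torus only after an automorphism, b exists because that automorphism lifts
  to a linear map of Lie algebras. One \<delta> serves all collapsed components: they are finitely
  many by compactness, and their caps of height \<delta> can be made disjoint. The constant c may
  have either sign on each component, which is harmless because nondegeneracy asks only that c
  \<phi>(h) does not vanish. Projecting from the closure of X gives compactness and connectedness,
  but points of the quotient have to be separated by hand. Effectiveness is read off a collar, where
  an element fixing X acts trivially on both the fiber and the circle.\<close>

lemma Ck_on_cong: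
  assumes "Ck_on k U f" "\<And>x. x \<in> U \<Longrightarrow> f x = g x"
  shows "Ck_on k U g"
proof (cases k)
  case 0
  then show ?thesis using assms continuous_on_cong[of U U f g] by simp
next
  case (Suc m)
  with assms(1) obtain f' where f': "\<forall>x\<in>U. (f has_derivative f' x) (at x within U)" "\<forall>v. Ck_on m U (\<lambda>x. f' x v)"
    by auto
  have "\<forall>x\<in>U. (g has_derivative f' x) (at x within U)"
    using f'(1) assms(2) by (metis has_derivative_transform)
  then show ?thesis using Suc f'(2) by auto
qed

lemma Ck_on_subset: "Ck_on k U f \<Longrightarrow> V \<subseteq> U \<Longrightarrow> Ck_on k V f"
proof (induction k arbitrary: f)
  case 0 then show ?case by (auto intro: continuous_on_subset)
next
  case (Suc k)
  then show ?case by (auto intro: has_derivative_subset) (meson has_derivative_subset subsetD)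
qed

lemma Ck_on_SucI:
  assumes "\<And>x. x \<in> U \<Longrightarrow> (f has_derivative f' x) (at x within U)" "\<And>v. Ck_on k U (\<lambda>x. f' x v)"
  shows "Ck_on (Suc k) U f"
  using assms by auto

lemma Ck_on_SucD: "Ck_on (Suc k) U f \<Longrightarrow> Ck_on k U f"
proof (induction k arbitrary: f)
  case 0 then show ?case by (auto intro: has_derivative_continuous_on)
next
  case (Suc k)
  then obtain f' where f': "\<forall>x\<in>U. (f has_derivative f' x) (at x within U)" "\<forall>v. Ck_on (Suc k) U (\<lambda>x. f' x v)"
    by (metis Ck_on.simps(2))
  then show ?case using Suc.IH by (intro Ck_on_SucI[of U f f']) auto
qed

lemma Ck_on_const: "Ck_on k U (\<lambda>x. c)"
proof (induction k arbitrary: c)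
  case (Suc k) then show ?case by (intro Ck_on_SucI[of U _ "\<lambda>x v. 0"]) auto
qed auto

lemma Ck_on_bounded_linear:
  assumes "bounded_linear f"
  shows "Ck_on k U g \<Longrightarrow> Ck_on k U (\<lambda>x. f (g x))"
proof (induction k arbitrary: g)
  case 0 then show ?case using assms by (auto intro: bounded_linear.continuous_on)
next
  case (Suc k)
  then obtain g' where g': "\<forall>x\<in>U. (g has_derivative g' x) (at x within U)" "\<forall>v. Ck_on k U (\<lambda>x. g' x v)"
    by (metis Ck_on.simps(2))
  then show ?case using Suc.IH assms
    by (intro Ck_on_SucI[of U _ "\<lambda>x v. f (g' x v)"]) (auto intro: bounded_linear.has_derivative)
qed

lemma Ck_on_id: "Ck_on k U (\<lambda>x. x)"
proof (cases k)
  case (Suc m)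
  then show ?thesis by (auto intro!: exI[of _ "\<lambda>x v. v"] Ck_on_const simp del: Ck_on.simps(1))
qed auto

lemma Ck_on_add: "Ck_on k U f \<Longrightarrow> Ck_on k U g \<Longrightarrow> Ck_on k U (\<lambda>x. f x + g x)"
proof (induction k arbitrary: f g)
  case 0 then show ?case by (auto intro: continuous_on_add)
next
  case (Suc k)
  obtain f' where f': "\<forall>x\<in>U. (f has_derivative f' x) (at x within U)" "\<forall>v. Ck_on k U (\<lambda>x. f' x v)"
    using Suc.prems by (metis Ck_on.simps(2))
  obtain g' where g': "\<forall>x\<in>U. (g has_derivative g' x) (at x within U)" "\<forall>v. Ck_on k U (\<lambda>x. g' x v)"
    using Suc.prems by (metis Ck_on.simps(2))
  show ?case using f' g' Suc.IH
    by (intro Ck_on_SucI[of U _ "\<lambda>x v. f' x v + g' x v"]) (auto intro: has_derivative_add)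
qed

lemma Ck_on_sum: "finite I \<Longrightarrow> (\<And>i. i \<in> I \<Longrightarrow> Ck_on k U (f i)) \<Longrightarrow> Ck_on k U (\<lambda>x. \<Sum>i\<in>I. f i x)"
  by (induction I rule: finite_induct) (auto intro: Ck_on_const Ck_on_add)

lemma Ck_on_bounded_bilinear:
  assumes "bounded_bilinear B"
  shows "Ck_on k U f \<Longrightarrow> Ck_on k U g \<Longrightarrow> Ck_on k U (\<lambda>x. B (f x) (g x))"
proof (induction k arbitrary: f g)
  case 0 then show ?case using assms by (auto intro: bounded_bilinear.continuous_on)
next
  case (Suc k)
  obtain f' where f': "\<forall>x\<in>U. (f has_derivative f' x) (at x within U)" "\<forall>v. Ck_on k U (\<lambda>x. f' x v)"
    using Suc.prems by (metis Ck_on.simps(2))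
  obtain g' where g': "\<forall>x\<in>U. (g has_derivative g' x) (at x within U)" "\<forall>v. Ck_on k U (\<lambda>x. g' x v)"
    using Suc.prems by (metis Ck_on.simps(2))
  have "Ck_on k U f" "Ck_on k U g" using Suc.prems Ck_on_SucD by auto
  then show ?case using f' g' Suc.IH
    by (intro Ck_on_SucI[of U _ "\<lambda>x v. B (f x) (g' x v) + B (f' x v) (g x)"])
       (auto intro!: bounded_bilinear.FDERIV[OF assms] Ck_on_add)
qed

text \<open>The chain rule produces \<open>f' (g x) (g' x v)\<close>, whose second argument moves
  with x, while \<open>Ck_on\<close> controls \<open>f'\<close> only on fixed vectors. Expanding
  \<open>g' x v\<close> in an orthonormal basis reduces to fixed vectors; hence the Euclidean space
  in the middle.\<close>

lemma Ck_on_compose: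
  fixes f :: "'b::euclidean_space \<Rightarrow> 'c::real_normed_vector"
  shows "Ck_on k T f \<Longrightarrow> Ck_on k U g \<Longrightarrow> g ` U \<subseteq> T \<Longrightarrow> Ck_on k U (\<lambda>x. f (g x))"
proof (induction k arbitrary: f)
  case 0 then show ?case by (auto intro: continuous_on_compose2)
next
  case (Suc k)
  obtain f' where f': "\<forall>x\<in>T. (f has_derivative f' x) (at x within T)" "\<forall>v. Ck_on k T (\<lambda>x. f' x v)"
    using Suc.prems(1) by (metis Ck_on.simps(2))
  obtain g' where g': "\<forall>x\<in>U. (g has_derivative g' x) (at x within U)" "\<forall>v. Ck_on k U (\<lambda>x. g' x v)"
    using Suc.prems(2) by (metis Ck_on.simps(2))
  have lin: "linear (f' (g x))" if "x \<in> U" for x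
    using f'(1) Suc.prems(3) that has_derivative_linear by blast
  show ?case
  proof (rule Ck_on_SucI)
    fix x assume x: "x \<in> U"
    have "(f has_derivative f' (g x)) (at (g x) within g ` U)"
      using f'(1) Suc.prems(3) x by (blast intro: has_derivative_subset)
    then show "((\<lambda>x. f (g x)) has_derivative (\<lambda>v. f' (g x) (g' x v))) (at x within U)"
      using g'(1) x has_derivative_in_compose by blast
  next
    fix v
    have "Ck_on k U (\<lambda>x. \<Sum>b\<in>Basis. (g' x v \<bullet> b) *\<^sub>R f' (g x) b)"
      using f'(2) g'(2) Suc.prems(3) Ck_on_SucD[OF Suc.prems(2)]
      by (intro Ck_on_sum finite_Basis Ck_on_bounded_bilinear[OF bounded_bilinear_scaleR] 
          Ck_on_bounded_linear[OF bounded_linear_inner_left] Suc.IH) auto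
    then show "Ck_on k U (\<lambda>x. f' (g x) (g' x v))"
    proof (rule Ck_on_cong)
      fix x assume "x \<in> U"
      then have "f' (g x) (\<Sum>b\<in>Basis. (g' x v \<bullet> b) *\<^sub>R b) = (\<Sum>b\<in>Basis. (g' x v \<bullet> b) *\<^sub>R f' (g x) b)"
        using lin by (simp add: linear_sum linear_scale)
      then show "(\<Sum>b\<in>Basis. (g' x v \<bullet> b) *\<^sub>R f' (g x) b) = f' (g x) (g' x v)"
        by (simp add: euclidean_representation)
    qed
  qed
qed

text \<open>\<open>Ck_on\<close> asks for one derivative on all of U, whereas the local hypotheses
  may supply different ones. On open sets the derivative is unique, so the Frechet derivative serves
  for all of them.\<close>

lemma Ck_on_local:
  assumes "\<And>x. x \<in> U \<Longrightarrow> \<exists>S. open S \<and> x \<in> S \<and> S \<subseteq> U \<and> Ck_on k S f"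
  shows "Ck_on k U f"
  using assms
proof (induction k arbitrary: f)
  case 0
  have "isCont f x" if x: "x \<in> U" for x
    using 0[OF x] continuous_on_eq_continuous_at by auto
  then show ?case by (simp add: continuous_at_imp_continuous_on)
next
  case (Suc k)
  let ?f' = "\<lambda>x. frechet_derivative f (at x)"
  have *: "(f has_derivative ?f' x) (at x)" and
    **: "\<exists>S. open S \<and> x \<in> S \<and> S \<subseteq> U \<and> Ck_on k S (\<lambda>y. ?f' y v)" if x: "x \<in> U" for x v
  proof -
    obtain S where S: "open S" "x \<in> S" "S \<subseteq> U" "Ck_on (Suc k) S f"
      using Suc.prems[OF x] by auto
    obtain f' where f': "\<forall>x\<in>S. (f has_derivative f' x) (at x within S)" "\<forall>v. Ck_on k S (\<lambda>x. f' x v)"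
      using S(4) by (metis Ck_on.simps(2))
    have d: "(f has_derivative f' y) (at y)" if "y \<in> S" for y
      using f'(1) that S(1) by (metis at_within_open)
    then have e: "f' y = ?f' y" if "y \<in> S" for y
      using that frechet_derivative_at by blast
    show "(f has_derivative ?f' x) (at x)" using d e S(2) by metis
    have "Ck_on k S (\<lambda>y. ?f' y v)" using f'(2) e by (auto intro: Ck_on_cong)
    then show "\<exists>S. open S \<and> x \<in> S \<and> S \<subseteq> U \<and> Ck_on k S (\<lambda>y. ?f' y v)" using S by auto
  qed
  show ?case
    using * ** Suc.IH by (intro Ck_on_SucI[of U f ?f']) (auto intro: has_derivative_at_withinI)
qed

lemma smooth_on_cong: "smooth_on U f \<Longrightarrow> (\<And>x. x \<in> U \<Longrightarrow> f x = g x) \<Longrightarrow> smooth_on U g"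
  unfolding smooth_on_def using Ck_on_cong by blast

lemma smooth_on_subset: "smooth_on U f \<Longrightarrow> V \<subseteq> U \<Longrightarrow> smooth_on V f"
  unfolding smooth_on_def using Ck_on_subset by blast

lemma smooth_on_imp_continuous_on: "smooth_on U f \<Longrightarrow> continuous_on U f"
  unfolding smooth_on_def by (metis Ck_on.simps(1))

text \<open>Saves an induction over the order whenever the derivative is already known to be
  smooth.\<close>

lemma smooth_on_SucI:
  assumes "\<And>x. x \<in> U \<Longrightarrow> (f has_derivative f' x) (at x within U)" "\<And>v. smooth_on U (\<lambda>x. f' x v)"
  shows "smooth_on U f"
  unfolding smooth_on_def
proof
  fix k
  have "Ck_on (Suc k) U f" using assms unfolding smooth_on_def by (intro Ck_on_SucI[of U f f']) auto
  then show "Ck_on k U f" by (rule Ck_on_SucD)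
qed

lemma smooth_on_const: "smooth_on U (\<lambda>x. c)"
  unfolding smooth_on_def using Ck_on_const by blast

lemma smooth_on_id: "smooth_on U (\<lambda>x. x)"
  unfolding smooth_on_def using Ck_on_id by blast

lemma smooth_on_bounded_linear_compose:
  "bounded_linear f \<Longrightarrow> smooth_on U g \<Longrightarrow> smooth_on U (\<lambda>x. f (g x))"
  unfolding smooth_on_def using Ck_on_bounded_linear by blast

lemma smooth_on_bounded_linear: "bounded_linear f \<Longrightarrow> smooth_on U f"
  using smooth_on_bounded_linear_compose[OF _ smooth_on_id] .

lemma smooth_on_add: "smooth_on U f \<Longrightarrow> smooth_on U g \<Longrightarrow> smooth_on U (\<lambda>x. f x + g x)"
  unfolding smooth_on_def using Ck_on_add by blast

lemma smooth_on_bounded_bilinear: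
  "bounded_bilinear B \<Longrightarrow> smooth_on U f \<Longrightarrow> smooth_on U g \<Longrightarrow> smooth_on U (\<lambda>x. B (f x) (g x))"
  unfolding smooth_on_def using Ck_on_bounded_bilinear by blast

lemma smooth_on_mult:
  fixes f :: "'a::real_normed_vector \<Rightarrow> 'b::real_normed_algebra"
  shows "smooth_on U f \<Longrightarrow> smooth_on U g \<Longrightarrow> smooth_on U (\<lambda>x. f x * g x)"
  by (rule smooth_on_bounded_bilinear[OF bounded_bilinear_mult])

lemma smooth_on_minus: "smooth_on U f \<Longrightarrow> smooth_on U (\<lambda>x. - f x)"
  by (rule smooth_on_bounded_linear_compose[OF bounded_linear_minus[OF bounded_linear_ident]])

lemma smooth_on_diff: "smooth_on U f \<Longrightarrow> smooth_on U g \<Longrightarrow> smooth_on U (\<lambda>x. f x - g x)"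
  using smooth_on_add[OF _ smooth_on_minus, of U f g] by simp

lemma smooth_on_sum:
  "finite I \<Longrightarrow> (\<And>i. i \<in> I \<Longrightarrow> smooth_on U (f i)) \<Longrightarrow> smooth_on U (\<lambda>x. \<Sum>i\<in>I. f i x)"
  unfolding smooth_on_def using Ck_on_sum by blast

lemma smooth_on_compose:
  fixes f :: "'b::euclidean_space \<Rightarrow> 'c::real_normed_vector"
  shows "smooth_on T f \<Longrightarrow> smooth_on U g \<Longrightarrow> g ` U \<subseteq> T \<Longrightarrow> smooth_on U (\<lambda>x. f (g x))"
  unfolding smooth_on_def using Ck_on_compose by blast

lemma smooth_on_local:
  assumes "\<And>x. x \<in> U \<Longrightarrow> \<exists>S. open S \<and> x \<in> S \<and> S \<subseteq> U \<and> smooth_on S f"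
  shows "smooth_on U f"
  unfolding smooth_on_def
proof
  fix k
  show "Ck_on k U f"
  proof (rule Ck_on_local)
    fix x assume "x \<in> U"
    from assms[OF this] show "\<exists>S. open S \<and> x \<in> S \<and> S \<subseteq> U \<and> Ck_on k S f" unfolding smooth_on_def by auto
  qed
qed

lemma smooth_on_Pair:
  assumes "smooth_on U f" "smooth_on U g"
  shows "smooth_on U (\<lambda>x. (f x, g x))"
proof -
  have "smooth_on U (\<lambda>x. (f x, 0) + (0, g x))"
    using assms by (intro smooth_on_add smooth_on_bounded_linear_compose[of "\<lambda>u. (u, 0)"]
      smooth_on_bounded_linear_compose[of "\<lambda>u. (0, u)"] bounded_linear_Pair bounded_linear_ident bounded_linear_zero)
  then show ?thesis by simp
qed

text \<open>The derivative is expressed by the function itself, so the induction over the order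
  closes. \<open>cis\<close> follows the same pattern below, and \<open>sqrt\<close> does so with
  the help of the inverse.\<close>

lemma smooth_on_inverse_id: "smooth_on {x. x \<noteq> 0} (inverse :: 'a::real_normed_field \<Rightarrow> 'a)"
proof -
  have "Ck_on k {x. x \<noteq> 0} (inverse :: 'a \<Rightarrow> 'a)" for k
  proof (induction k)
    case 0 then show ?case by (auto intro!: continuous_intros)
  next
    case (Suc k)
    show ?case
    proof (rule Ck_on_SucI)
      fix x :: 'a assume "x \<in> {x. x \<noteq> 0}"
      then show "(inverse has_derivative (\<lambda>v. - (inverse x * v * inverse x))) (at x within {x. x \<noteq> 0})"
        by (auto intro: has_derivative_inverse')
    next
      fix v :: 'a
      have "Ck_on k {x. x \<noteq> 0} (\<lambda>x. (inverse x * v) * inverse x)"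
        by (intro Ck_on_bounded_bilinear[OF bounded_bilinear_mult] Suc Ck_on_const)
      then show "Ck_on k {x. x \<noteq> 0} (\<lambda>x. - (inverse x * v * inverse x))"
        by (rule Ck_on_bounded_linear[OF bounded_linear_minus[OF bounded_linear_ident]])
    qed
  qed
  then show ?thesis by (simp add: smooth_on_def)
qed

lemma smooth_on_inverse:
  fixes f :: "'a::real_normed_vector \<Rightarrow> 'b::{real_normed_field,euclidean_space}"
  shows "smooth_on U f \<Longrightarrow> (\<And>x. x \<in> U \<Longrightarrow> f x \<noteq> 0) \<Longrightarrow> smooth_on U (\<lambda>x. inverse (f x))"
  by (rule smooth_on_compose[OF smooth_on_inverse_id]) auto

lemma smooth_on_ln: "smooth_on U f \<Longrightarrow> (\<And>x. x \<in> U \<Longrightarrow> f x > 0) \<Longrightarrow> smooth_on U (\<lambda>x. ln (f x :: real))"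
proof (rule smooth_on_compose[of "{0<..}" ln])
  show "smooth_on {0<..} (ln :: real \<Rightarrow> real)"
  proof (rule smooth_on_SucI)
    show "smooth_on {0<..} (\<lambda>x. v * inverse x :: real)" for v
      by (intro smooth_on_mult smooth_on_const smooth_on_inverse smooth_on_id) auto
  qed (auto intro!: derivative_eq_intros)
qed auto

lemma smooth_on_Ln:
  "smooth_on U f \<Longrightarrow> (\<And>x. x \<in> U \<Longrightarrow> f x \<notin> \<real>\<^sub>\<le>\<^sub>0) \<Longrightarrow> smooth_on U (\<lambda>x. Ln (f x))"
proof (rule smooth_on_compose[of "- \<real>\<^sub>\<le>\<^sub>0" Ln])
  show "smooth_on (- \<real>\<^sub>\<le>\<^sub>0) Ln"
  proof (rule smooth_on_SucI)
    show "smooth_on (- \<real>\<^sub>\<le>\<^sub>0) (\<lambda>x. v * inverse x :: complex)" for v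
      by (intro smooth_on_mult smooth_on_const smooth_on_inverse smooth_on_id) auto
    show "(Ln has_derivative (\<lambda>v. v * inverse x)) (at x within - \<real>\<^sub>\<le>\<^sub>0)" if "x \<in> - \<real>\<^sub>\<le>\<^sub>0" for x
    proof -
      have "(\<lambda>v. v * inverse x) = (*) (inverse x)" by (simp add: fun_eq_iff mult.commute)
      then show ?thesis using has_field_derivative_Ln[of x] that
        by (simp add: has_field_derivative_def has_derivative_at_withinI)
    qed
  qed
qed auto

lemma smooth_on_cis: "smooth_on U f \<Longrightarrow> smooth_on U (\<lambda>x. cis (f x))"
proof (rule smooth_on_compose[of UNIV cis])
  have d: "(cis has_derivative (\<lambda>v. v *\<^sub>R (\<i> * cis x))) (at x)" for x
    by (auto intro!: derivative_eq_intros simp: has_vector_derivative_def[symmetric] fun_eq_iff scaleR_conv_of_real algebra_simps)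
  have "Ck_on k UNIV cis" for k
  proof (induction k)
    case 0 then show ?case using d by (auto intro!: continuous_intros)
  next
    case (Suc k)
    show ?case using d Suc
      by (intro Ck_on_SucI[of UNIV cis "\<lambda>x v. v *\<^sub>R (\<i> * cis x)"] Ck_on_bounded_bilinear[OF bounded_bilinear_scaleR]
          Ck_on_bounded_bilinear[OF bounded_bilinear_mult] Ck_on_const) auto
  qed
  then show "smooth_on UNIV cis" by (simp add: smooth_on_def)
qed auto

lemma smooth_on_sqrt: "smooth_on U f \<Longrightarrow> (\<And>x. x \<in> U \<Longrightarrow> f x > 0) \<Longrightarrow> smooth_on U (\<lambda>x. sqrt (f x))"
proof (rule smooth_on_compose[of "{0<..}" sqrt])
  have "Ck_on k {0<..} sqrt" for k
  proof (induction k)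
    case 0 show ?case by (simp add: continuous_on_real_sqrt continuous_on_id)
  next
    case (Suc k)
    have inv: "Ck_on k {x. x \<noteq> 0} (inverse :: real \<Rightarrow> real)"
      using smooth_on_inverse_id unfolding smooth_on_def by blast
    have "Ck_on k {0<..} (\<lambda>x. inverse (sqrt x))"
      by (rule Ck_on_compose[OF inv Suc]) auto
    then have "Ck_on k {0<..} (\<lambda>x. (v / 2) * inverse (sqrt x))" for v
      by (rule Ck_on_bounded_linear[OF bounded_linear_mult_right])
    moreover have "(sqrt has_derivative (\<lambda>v. (v / 2) * inverse (sqrt x))) (at x within {0<..})" if "x \<in> {0<..}" for x
    proof -
      have "(\<lambda>v. (v / 2) * inverse (sqrt x)) = (*) (inverse (sqrt x) / 2)" by (simp add: fun_eq_iff)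
      then show ?thesis using DERIV_real_sqrt[of x] that
        by (simp add: has_field_derivative_def has_derivative_at_withinI)
    qed
    ultimately show ?case by (intro Ck_on_SucI)
  qed
  then show "smooth_on {0<..} sqrt" by (simp add: smooth_on_def)
qed auto

text \<open>The curve derivative is two-sided at 0, whereas f is differentiable only within U. Since
  U is relatively open in V and u lies in V, the line stays in U for small s of either sign. This is
  needed for the fiber, whose charts live in a proper subspace.\<close>

lemma has_vector_derivative_line:
  assumes "subspace V" "openin (top_of_set V) U" "x \<in> U" "u \<in> V" "(f has_derivative f') (at x within U)"
  shows "((\<lambda>s. f (x + s *\<^sub>R u)) has_vector_derivative f' u) (at 0)"
proof -
  obtain T where T: "open T" "U = V \<inter> T" using assms(2) by (metis openin_open)
  define S where "S = (\<lambda>s. x + s *\<^sub>R u) -` T"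
  have S: "open S" "0 \<in> S" unfolding S_def
    using T assms(3) by (auto intro!: open_vimage continuous_intros)
  have im: "(\<lambda>s. x + s *\<^sub>R u) ` S \<subseteq> U" using assms T
    by (auto simp: S_def subspace_add subspace_scale)
  have "((\<lambda>s. x + s *\<^sub>R u) has_derivative (\<lambda>s. s *\<^sub>R u)) (at 0 within S)"
    by (auto intro!: derivative_eq_intros)
  moreover have "(f has_derivative f') (at (x + 0 *\<^sub>R u) within (\<lambda>s. x + s *\<^sub>R u) ` S)"
    using assms(5) im by (auto intro: has_derivative_subset)
  ultimately have "((\<lambda>s. f (x + s *\<^sub>R u)) has_derivative (\<lambda>s. f' (s *\<^sub>R u))) (at 0 within S)"
    by (rule has_derivative_in_compose)
  moreover have "linear f'" using assms(5) by (rule has_derivative_linear)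
  ultimately show ?thesis
    using S unfolding has_vector_derivative_def
    by (metis (no_types, lifting) at_within_open ext linear_scale)
qed

lemma dir_deriv_within:
  assumes "subspace V" "openin (top_of_set V) U" "x \<in> U" "u \<in> V" "(f has_derivative f') (at x within U)"
  shows "dir_deriv f x u = f' u"
  unfolding dir_deriv_def using has_vector_derivative_line[OF assms] by (rule vector_derivative_at)

lemma dir_deriv_eq:
  assumes "(f has_derivative f') (at x)"
  shows "dir_deriv f x u = f' u"
  using dir_deriv_within[of UNIV UNIV x u f f'] assms by simp

lemma dir_deriv_cong_eventually:
  assumes "\<forall>\<^sub>F s in nhds 0. f (x + s *\<^sub>R u) = g (y + s *\<^sub>R w)"
  shows "dir_deriv f x u = dir_deriv g y w"
  unfolding dir_deriv_def
  using assms by (intro vector_derivative_cong_eq) auto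

lemma eventually_line_in_open:
  fixes x u :: "'a::real_normed_vector"
  assumes "open S" "x \<in> S"
  shows "\<forall>\<^sub>F s in nhds 0. x + s *\<^sub>R u \<in> S"
proof -
  have "open ((\<lambda>s. x + s *\<^sub>R u) -` S)" using assms by (auto intro!: open_vimage continuous_intros)
  then show ?thesis using assms by (auto simp: eventually_nhds intro!: exI[of _ "(\<lambda>s. x + s *\<^sub>R u) -` S"])
qed

lemma dir_deriv_cong:
  assumes "open S" "x \<in> S" "\<And>y. y \<in> S \<Longrightarrow> f y = g y"
  shows "dir_deriv f x u = dir_deriv g x u"
  by (rule dir_deriv_cong_eventually)
    (rule eventually_mono[OF eventually_line_in_open[OF assms(1,2)] assms(3)])

lemma smooth_on_has_derivative:
  assumes "smooth_on U f" "open U" "x \<in> U"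
  shows "(f has_derivative dir_deriv f x) (at x)"
proof -
  have "Ck_on (Suc 0) U f" using assms smooth_on_def by blast
  then obtain f' where "(f has_derivative f') (at x)" 
    using assms by (metis Ck_on.simps(2) at_within_open)
  moreover from this have "dir_deriv f x = f'" by (auto simp: dir_deriv_eq)
  ultimately show ?thesis by simp
qed

lemma smooth_on_linear_dir_deriv:
  assumes "smooth_on U f" "open U" "x \<in> U"
  shows "linear (dir_deriv f x)"
  using smooth_on_has_derivative[OF assms] by (rule has_derivative_linear)

lemma smooth_on_dir_deriv:
  assumes "smooth_on U f" "open U"
  shows "smooth_on U (\<lambda>x. dir_deriv f x v)"
  unfolding smooth_on_def
proof
  fix k
  have "Ck_on (Suc k) U f" using assms smooth_on_def by blast
  then obtain f' where f': "\<forall>x\<in>U. (f has_derivative f' x) (at x within U)" "\<forall>v. Ck_on k U (\<lambda>x. f' x v)"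
    by (metis Ck_on.simps(2))
  have "f' x v = dir_deriv f x v" if "x \<in> U" for x
    using f'(1) that assms(2) by (metis at_within_open dir_deriv_eq)
  then show "Ck_on k U (\<lambda>x. dir_deriv f x v)"
    by (rule Ck_on_cong[OF f'(2)[rule_format]])
qed

lemma dir_deriv_compose:
  assumes "(g has_derivative g') (at x)" "(f has_derivative f') (at (g x))"
  shows "dir_deriv (\<lambda>x. f (g x)) x u = f' (g' u)"
  using has_derivative_compose[OF assms] by (rule dir_deriv_eq)

text \<open>The mean value theorem is applied twice: along u to the increment of f over the step h
  v, then along v to the derivative of f in direction u.\<close>

lemma mixed_difference_mean_value:
  fixes f :: "'a::real_normed_vector \<Rightarrow> real"
  assumes f: "smooth_on U f" "open U" and h: "h > 0"
    and seg: "\<And>s t. 0 \<le> s \<Longrightarrow> s \<le> h \<Longrightarrow> 0 \<le> t \<Longrightarrow> t \<le> h \<Longrightarrow> x + s *\<^sub>R u + t *\<^sub>R v \<in> U"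
  obtains s t where "0 < s" "s < h" "0 < t" "t < h"
    "f (x + h *\<^sub>R u + h *\<^sub>R v) - f (x + h *\<^sub>R u) - f (x + h *\<^sub>R v) + f x =
     h * h * dir_deriv (\<lambda>y. dir_deriv f y u) (x + s *\<^sub>R u + t *\<^sub>R v) v"
proof -
  have seg0: "x + s *\<^sub>R u \<in> U" if "0 \<le> s" "s \<le> h" for s using seg[of s 0] that h by simp
  define g where "g s = f (x + s *\<^sub>R u + h *\<^sub>R v) - f (x + s *\<^sub>R u)" for s
  have line: "((\<lambda>s. F (a + s *\<^sub>R w)) has_real_derivative dir_deriv F (a + s *\<^sub>R w) w) (at s)"
    if F: "smooth_on U F" "a + s *\<^sub>R w \<in> U" for F :: "'a \<Rightarrow> real" and a w s
  proof -
    have "((\<lambda>s. a + s *\<^sub>R w) has_derivative (\<lambda>s. s *\<^sub>R w)) (at s)"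
      by (auto intro!: derivative_eq_intros)
    from has_derivative_compose[OF this smooth_on_has_derivative[OF F(1) f(2) F(2)]]
    have "((\<lambda>s. F (a + s *\<^sub>R w)) has_derivative (\<lambda>t. dir_deriv F (a + s *\<^sub>R w) (t *\<^sub>R w))) (at s)" .
    moreover have "(\<lambda>t. dir_deriv F (a + s *\<^sub>R w) (t *\<^sub>R w)) = (*) (dir_deriv F (a + s *\<^sub>R w) w)"
      using linear_scale[OF smooth_on_linear_dir_deriv[OF F(1) f(2) F(2)]] by (simp add: fun_eq_iff mult.commute)
    ultimately show ?thesis unfolding has_field_derivative_def by simp
  qed
  have g': "(g has_real_derivative
      dir_deriv f (x + s *\<^sub>R u + h *\<^sub>R v) u - dir_deriv f (x + s *\<^sub>R u) u) (at s)" if "0 \<le> s" "s \<le> h" for s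
  proof -
    have sw: "x + r *\<^sub>R u + h *\<^sub>R v = (x + h *\<^sub>R v) + r *\<^sub>R u" for r by simp
    have "((\<lambda>s. f ((x + h *\<^sub>R v) + s *\<^sub>R u)) has_real_derivative dir_deriv f ((x + h *\<^sub>R v) + s *\<^sub>R u) u) (at s)"
      using seg[of s h] that h by (intro line f(1)) (simp add: sw)
    moreover have "((\<lambda>s. f (x + s *\<^sub>R u)) has_real_derivative dir_deriv f (x + s *\<^sub>R u) u) (at s)"
      using seg0 that by (intro line f(1))
    ultimately have "((\<lambda>s. f ((x + h *\<^sub>R v) + s *\<^sub>R u) - f (x + s *\<^sub>R u)) has_real_derivative
        dir_deriv f ((x + h *\<^sub>R v) + s *\<^sub>R u) u - dir_deriv f (x + s *\<^sub>R u) u) (at s)"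
      by (rule DERIV_diff)
    then show ?thesis by (simp only: g_def[abs_def] sw)
  qed
  obtain s where s: "0 < s" "s < h" "g h - g 0 = (h - 0) *
      (dir_deriv f (x + s *\<^sub>R u + h *\<^sub>R v) u - dir_deriv f (x + s *\<^sub>R u) u)"
    using MVT2[OF h g'] by auto
  have "((\<lambda>t. dir_deriv f (x + s *\<^sub>R u + t *\<^sub>R v) u) has_real_derivative
      dir_deriv (\<lambda>y. dir_deriv f y u) (x + s *\<^sub>R u + t *\<^sub>R v) v) (at t)" if "0 \<le> t" "t \<le> h" for t
    using that s seg by (intro line smooth_on_dir_deriv f) auto
  from MVT2[OF h this] obtain t where t: "0 < t" "t < h"
    "dir_deriv f (x + s *\<^sub>R u + h *\<^sub>R v) u - dir_deriv f (x + s *\<^sub>R u) u =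
     h * dir_deriv (\<lambda>y. dir_deriv f y u) (x + s *\<^sub>R u + t *\<^sub>R v) v" by auto
  have "f (x + h *\<^sub>R u + h *\<^sub>R v) - f (x + h *\<^sub>R u) - f (x + h *\<^sub>R v) + f x = g h - g 0"
    unfolding g_def by simp
  also have "\<dots> = h * h * dir_deriv (\<lambda>y. dir_deriv f y u) (x + s *\<^sub>R u + t *\<^sub>R v) v"
    unfolding s(3) t(3) by simp
  finally show ?thesis by (rule that[OF s(1,2) t(1,2)])
qed

text \<open>The second difference is symmetric in u and v, so the two mixed derivatives agree at a
  pair of points arbitrarily close to x. Continuity of both derivatives carries the equality to
  x.\<close>

lemma dir_deriv_commute_real:
  fixes f :: "'a::real_normed_vector \<Rightarrow> real"
  assumes f: "smooth_on U f" "open U" "x \<in> U"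
  shows "dir_deriv (\<lambda>y. dir_deriv f y u) x v = dir_deriv (\<lambda>y. dir_deriv f y v) x u"
proof (rule ccontr)
  let ?A = "\<lambda>x. dir_deriv (\<lambda>y. dir_deriv f y u) x v" and ?B = "\<lambda>x. dir_deriv (\<lambda>y. dir_deriv f y v) x u"
  assume ne: "?A x \<noteq> ?B x"
  \<comment> \<open>Half of the supposed gap: two errors below \<open>e\<close> cannot bridge
    it.\<close>
  define e where "e = \<bar>?A x - ?B x\<bar> / 2"
  have e: "e > 0" using ne by (simp add: e_def)
  have "continuous_on U ?A" "continuous_on U ?B"
    by (intro smooth_on_imp_continuous_on smooth_on_dir_deriv f(1,2))+
  then have "isCont ?A x" "isCont ?B x" 
    using continuous_on_eq_continuous_at[OF f(2)] f(3) by metis+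
  then have "\<exists>d>0. \<forall>y. dist y x < d \<longrightarrow> dist (?A y) (?A x) < e"
    and *: "\<exists>d>0. \<forall>y. dist y x < d \<longrightarrow> dist (?B y) (?B x) < e"
    using e unfolding continuous_at_eps_delta by meson+
  then obtain d1 where d1: "d1 > 0" "\<And>y. dist y x < d1 \<Longrightarrow> dist (?A y) (?A x) < e"
    by meson
  obtain d2 where d2: "d2 > 0" "\<And>y. dist y x < d2 \<Longrightarrow> dist (?B y) (?B x) < e"
    using * by meson
  obtain d3 where d3: "d3 > 0" "ball x d3 \<subseteq> U" using f(2,3) openE by blast
  define d where "d = min d1 (min d2 d3)"
  \<comment> \<open>This step keeps s u + t v shorter than d for all s, t in [0, h]; the summand 1
    keeps the denominator positive when u = v = 0.\<close>
  define h where "h = d / (2 * (norm u + norm v + 1))"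
  have d: "d > 0" using d1 d2 d3 by (simp add: d_def)
  have nn: "norm u + norm v + 1 > 0" by (intro add_nonneg_pos add_nonneg_nonneg) auto
  have h: "h > 0" using d nn by (simp add: h_def)
  have close: "dist (x + s *\<^sub>R u + t *\<^sub>R v) x < d" if "0 \<le> s" "s \<le> h" "0 \<le> t" "t \<le> h" for s t
  proof -
    have "dist (x + s *\<^sub>R u + t *\<^sub>R v) x = norm (s *\<^sub>R u + t *\<^sub>R v)" by (simp add: dist_norm add.assoc)
    also have "\<dots> \<le> s * norm u + t * norm v" using that norm_triangle_ineq[of "s *\<^sub>R u" "t *\<^sub>R v"] by simp
    also have "\<dots> \<le> h * norm u + h * norm v" using that by (intro add_mono mult_right_mono) auto
    also have "\<dots> = h * (norm u + norm v)" by (simp add: algebra_simps)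
    also have "\<dots> < h * (2 * (norm u + norm v + 1))"
    proof (rule mult_strict_left_mono[OF _ h])
      have "0 \<le> norm u + norm v" by simp
      then show "norm u + norm v < 2 * (norm u + norm v + 1)" unfolding distrib_left by linarith
    qed
    also have "\<dots> = d" using nn by (simp add: h_def)
    finally show ?thesis .
  qed
  have close': "dist (x + s *\<^sub>R v + t *\<^sub>R u) x < d" if "0 \<le> s" "s \<le> h" "0 \<le> t" "t \<le> h" for s t
    using close[of t s] that by (simp add: algebra_simps)
  have in_U: "x + s *\<^sub>R u + t *\<^sub>R v \<in> U" "x + s *\<^sub>R v + t *\<^sub>R u \<in> U"
    if "0 \<le> s" "s \<le> h" "0 \<le> t" "t \<le> h" for s t
    using close[OF that] close'[OF that] d3 by (auto simp: d_def dist_commute)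
  let ?D = "f (x + h *\<^sub>R u + h *\<^sub>R v) - f (x + h *\<^sub>R u) - f (x + h *\<^sub>R v) + f x"
  obtain s t where st: "0 < s" "s < h" "0 < t" "t < h" "?D = h * h * ?A (x + s *\<^sub>R u + t *\<^sub>R v)"
    using mixed_difference_mean_value[OF f(1,2) h, of x u v] in_U by blast
  obtain s' t' where st': "0 < s'" "s' < h" "0 < t'" "t' < h"
    "f (x + h *\<^sub>R v + h *\<^sub>R u) - f (x + h *\<^sub>R v) - f (x + h *\<^sub>R u) + f x = h * h * ?B (x + s' *\<^sub>R v + t' *\<^sub>R u)"
    using mixed_difference_mean_value[OF f(1,2) h, of x v u] in_U by blast
  have "?D = f (x + h *\<^sub>R v + h *\<^sub>R u) - f (x + h *\<^sub>R v) - f (x + h *\<^sub>R u) + f x"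
    by (simp add: algebra_simps)
  then have eq: "?A (x + s *\<^sub>R u + t *\<^sub>R v) = ?B (x + s' *\<^sub>R v + t' *\<^sub>R u)"
    using st(5) st'(5) h by simp
  have "dist (?A x) (?A (x + s *\<^sub>R u + t *\<^sub>R v)) < e"
    unfolding dist_commute[of "?A x"] using close[of s t] st by (intro d1(2)) (simp add: d_def)
  moreover have "dist (?B x) (?B (x + s' *\<^sub>R v + t' *\<^sub>R u)) < e"
    unfolding dist_commute[of "?B x"] using close'[of s' t'] st' by (intro d2(2)) (simp add: d_def)
  ultimately have "dist (?A x) (?B x) < e + e"
    unfolding eq by (rule dist_triangle_less_add)
  then show False unfolding e_def dist_real_def by simp
qed

lemma dir_deriv_linear_image:
  assumes "bounded_linear L" "(f has_derivative f') (at x)"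
  shows "dir_deriv (\<lambda>y. L (f y)) x u = L (dir_deriv f x u)"
  using dir_deriv_eq[OF bounded_linear.has_derivative[OF assms]] dir_deriv_eq[OF assms(2)] by simp

lemma dir_deriv_commute:
  fixes f :: "'a::real_normed_vector \<Rightarrow> 'b::euclidean_space"
  assumes f: "smooth_on U f" "open U" "x \<in> U"
  shows "dir_deriv (\<lambda>y. dir_deriv f y u) x v = dir_deriv (\<lambda>y. dir_deriv f y v) x u"
proof (rule euclidean_eqI)
  fix b :: 'b assume "b \<in> Basis"
  have *: "dir_deriv (\<lambda>y. dir_deriv f y u) x v \<bullet> b = dir_deriv (\<lambda>y. dir_deriv (\<lambda>z. f z \<bullet> b) y u) x v" for u v
  proof -
    have "dir_deriv (\<lambda>y. dir_deriv f y u) x v \<bullet> b = dir_deriv (\<lambda>y. dir_deriv f y u \<bullet> b) x v"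
      by (rule dir_deriv_linear_image[symmetric, OF bounded_linear_inner_left
            smooth_on_has_derivative[OF smooth_on_dir_deriv[OF f(1,2)] f(2,3)]])
    also have "\<dots> = dir_deriv (\<lambda>y. dir_deriv (\<lambda>z. f z \<bullet> b) y u) x v"
      by (intro dir_deriv_cong[OF f(2,3)])
        (rule dir_deriv_linear_image[symmetric, OF bounded_linear_inner_left smooth_on_has_derivative[OF f(1,2)]])
    finally show ?thesis .
  qed
  have "smooth_on U (\<lambda>z. f z \<bullet> b)"
    by (rule smooth_on_bounded_linear_compose[OF bounded_linear_inner_left f(1)])
  then show "dir_deriv (\<lambda>y. dir_deriv f y u) x v \<bullet> b = dir_deriv (\<lambda>y. dir_deriv f y v) x u \<bullet> b"
    unfolding * by (rule dir_deriv_commute_real[OF _ f(2,3)])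
qed


section \<open>Atlases\<close>

text \<open>The part of \<open>smooth_manifold\<close> that concerns charts only. It is split off
  because the topology of the quotient is studied with the help of its charts, before the Hausdorff
  property and second countability are available.\<close>

definition atlas_charts :: "'n::finite set \<Rightarrow> ('a, 'n) atlas \<Rightarrow> bool" where
  "atlas_charts I A \<longleftrightarrow>
     (\<forall>c\<in>A. inj_on (snd c) (fst c) \<and> openin (top_of_set (model_space I)) (snd c ` fst c)) \<and>
     (\<forall>c\<in>A. \<forall>c'\<in>A.
        openin (top_of_set (model_space I)) (snd c ` (fst c \<inter> fst c')) \<and>
        smooth_on (snd c ` (fst c \<inter> fst c')) (local_expr c (snd c')))"

lemma smooth_manifold_iff:
  "smooth_manifold I A \<longleftrightarrow> atlas_charts I A \<and> Hausdorff_space (mtop A) \<and> second_countable (mtop A)"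
  unfolding smooth_manifold_def atlas_charts_def by (simp add: case_prod_beta conj_assoc)

lemma model_space_UNIV [simp]: "model_space UNIV = UNIV"
  by (simp add: model_space_def)

lemma torus_lie_UNIV [simp]: "torus_lie UNIV = UNIV"
  by (simp add: torus_lie_def)

lemma subspace_model_space: "subspace (model_space I)"
  by (simp add: model_space_def subspace_def)

lemma subspace_torus_lie: "subspace (torus_lie I)"
  by (simp add: torus_lie_def subspace_def)

lemma local_expr_apply: "local_expr c f x = f (inv_into (fst c) (snd c) x)"
  by (simp add: local_expr_def)

lemma local_expr_at: "inj_on (snd c) (fst c) \<Longrightarrow> p \<in> fst c \<Longrightarrow> local_expr c f (snd c p) = f p"
  by (simp add: local_expr_def)

lemma topspace_mtop [simp]: "topspace (mtop A) = carrier_of A"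
proof -
  have "fst c \<subseteq> \<Union>{{p \<in> U. \<phi> p \<in> S} |U \<phi> S. (U, \<phi>) \<in> A \<and> open S}" if "c \<in> A" for c
  proof
    fix p assume "p \<in> fst c"
    then have "p \<in> {p \<in> fst c. snd c p \<in> UNIV}" by simp
    moreover have "{p \<in> fst c. snd c p \<in> UNIV} \<in> {{p \<in> U. \<phi> p \<in> S} |U \<phi> S. (U, \<phi>) \<in> A \<and> open S}"
      using that by (intro CollectI exI[of _ "fst c"] exI[of _ "snd c"] exI[of _ UNIV]) simp
    ultimately show "p \<in> \<Union>{{p \<in> U. \<phi> p \<in> S} |U \<phi> S. (U, \<phi>) \<in> A \<and> open S}" by (rule UnionI[rotated])
  qed
  then have "carrier_of A \<subseteq> \<Union>{{p \<in> U. \<phi> p \<in> S} |U \<phi> S. (U, \<phi>) \<in> A \<and> open S}"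
    unfolding carrier_of_def by (rule UN_least)
  moreover have "\<Union>{{p \<in> U. \<phi> p \<in> S} |U \<phi> S. (U, \<phi>) \<in> A \<and> open S} \<subseteq> carrier_of A"
    unfolding carrier_of_def by (rule Union_least) force
  ultimately show ?thesis unfolding mtop_def topology_generated_by_topspace by (rule equalityI[rotated])
qed

lemma openin_mtop_basic: "c \<in> A \<Longrightarrow> open S \<Longrightarrow> openin (mtop A) {p \<in> fst c. snd c p \<in> S}"
  unfolding mtop_def by (rule topology_generated_by_Basis, cases c) auto

lemma openin_mtop_domain: "c \<in> A \<Longrightarrow> openin (mtop A) (fst c)"
  using openin_mtop_basic[of c A UNIV] by simp

text \<open>The topology is generated by preimages under all charts, so openness of a single chart
  map is not immediate. It follows by induction over the generation: injectivity lets the image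
  commute with intersections, and a generator coming from another chart is handled by continuity of
  the transition map.\<close>

lemma openin_mtop_image:
  assumes A: "atlas_charts I A" and c: "c \<in> A" and W: "openin (mtop A) W"
  shows "openin (top_of_set (model_space I)) (snd c ` (W \<inter> fst c))"
proof -
  have inj: "inj_on (snd c) (fst c)" using A c by (auto simp: atlas_charts_def)
  have "generate_topology_on {{p \<in> U. \<phi> p \<in> S} |U \<phi> S. (U, \<phi>) \<in> A \<and> open S} W"
    using W unfolding mtop_def by (rule openin_topology_generated_by)
  then show ?thesis
  proof induction
    case Empty then show ?case by simp
  next
    case (Int a b)
    have "snd c ` (a \<inter> b \<inter> fst c) = snd c ` (a \<inter> fst c) \<inter> snd c ` (b \<inter> fst c)"
      using inj by (auto simp: inj_on_def)
    then show ?case using Int by (simp add: openin_Int)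
  next
    case (UN K)
    have "snd c ` (\<Union>K \<inter> fst c) = (\<Union>k\<in>K. snd c ` (k \<inter> fst c))" by auto
    then show ?case using UN by (auto intro: openin_Union)
  next
    case (Basis s)
    then obtain V \<psi> S where s: "s = {p \<in> V. \<psi> p \<in> S}" "(V, \<psi>) \<in> A" "open S" by auto
    let ?D = "snd c ` (fst c \<inter> V)" and ?f = "local_expr c \<psi>"
    have D: "openin (top_of_set (model_space I)) ?D" "smooth_on ?D ?f"
      using A c s(2) unfolding atlas_charts_def by (metis fst_conv snd_conv)+
    have "openin (top_of_set ?D) (?D \<inter> ?f -` S)"
      using smooth_on_imp_continuous_on[OF D(2)] s(3) by (simp add: continuous_openin_preimage_gen)
    moreover have "snd c ` (s \<inter> fst c) = ?D \<inter> ?f -` S"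
      using inj by (auto simp: s local_expr_at)
    ultimately show ?case using D(1) by (metis openin_trans)
  qed
qed

lemma continuous_map_chart:
  assumes "c \<in> A"
  shows "continuous_map (subtopology (mtop A) (fst c)) euclidean (snd c)"
proof -
  have "topspace (subtopology (mtop A) (fst c)) = fst c"
    using assms by (auto simp: carrier_of_def)
  moreover have "openin (subtopology (mtop A) (fst c)) {p \<in> fst c. snd c p \<in> S}" if "open S" for S
    using openin_mtop_basic[OF assms that] openin_mtop_domain[OF assms]
    by (auto simp: openin_open_subtopology)
  ultimately show ?thesis unfolding continuous_map_def by simp
qed

lemma continuous_map_chart_inv:
  assumes A: "atlas_charts I A" and c: "c \<in> A"
  shows "continuous_map (top_of_set (snd c ` fst c)) (mtop A) (inv_into (fst c) (snd c))"
  unfolding continuous_map_def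
proof (intro conjI allI impI)
  show "inv_into (fst c) (snd c) \<in> topspace (top_of_set (snd c ` fst c)) \<rightarrow> topspace (mtop A)"
    using c by (auto simp: carrier_of_def intro: inv_into_into)
  fix W assume W: "openin (mtop A) W"
  have "inj_on (snd c) (fst c)" and o: "openin (top_of_set (model_space I)) (snd c ` fst c)"
    using A c by (auto simp: atlas_charts_def)
  then have "{x \<in> topspace (top_of_set (snd c ` fst c)). inv_into (fst c) (snd c) x \<in> W} = snd c ` (W \<inter> fst c)"
    by auto
  then show "openin (top_of_set (snd c ` fst c)) {x \<in> topspace (top_of_set (snd c ` fst c)). inv_into (fst c) (snd c) x \<in> W}"
    using openin_subset_trans[OF openin_mtop_image[OF A c W] _ openin_imp_subset[OF o]] by auto
qed

text \<open>Finitely many chart domains cover, and pulling back a countable base of the coordinate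
  space along each of them gives a countable base.\<close>

lemma compact_atlas_second_countable:
  fixes A :: "('a, 'n::finite) atlas"
  assumes A: "atlas_charts I A" and K: "compact_space (mtop A)"
  shows "second_countable (mtop A)"
proof -
  have "\<exists>\<F>. finite \<F> \<and> \<F> \<subseteq> fst ` A \<and> topspace (mtop A) \<subseteq> \<Union>\<F>"
    using K unfolding compact_space_alt
    by (rule allE[of _ "fst ` A"]) (auto simp: openin_mtop_domain carrier_of_def)
  then obtain \<F> where \<F>: "finite \<F>" "\<F> \<subseteq> fst ` A" "topspace (mtop A) \<subseteq> \<Union>\<F>" by auto
  from finite_subset_image[OF \<F>(1,2)] \<F>(3)
  obtain F where F: "finite F" "F \<subseteq> A" "carrier_of A \<subseteq> (\<Union>c\<in>F. fst c)" by auto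
  obtain B :: "'n coords set set" where B: "countable B" "\<And>C. C \<in> B \<Longrightarrow> open C" 
    "\<And>S. open S \<Longrightarrow> \<exists>U. U \<subseteq> B \<and> S = \<Union>U"
    by (rule univ_second_countable) (rule that)
  define \<B> where "\<B> = (\<lambda>(c, S). {p \<in> fst c. snd c p \<in> S}) ` (F \<times> B)"
  have "countable \<B>" unfolding \<B>_def using B(1) F(1) by (auto intro: countable_finite)
  moreover have "openin (mtop A) V" if "V \<in> \<B>" for V
    using that F(2) B(2) unfolding \<B>_def by (auto intro: openin_mtop_basic)
  moreover have "\<exists>V\<in>\<B>. p \<in> V \<and> V \<subseteq> W" if W: "openin (mtop A) W" and p: "p \<in> W" for W p
  proof -
    obtain c where c: "c \<in> F" "p \<in> fst c"
      using F(3) p openin_subset[OF W] by auto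
    have cA: "c \<in> A" using c F(2) by auto
    obtain S where S: "open S" "snd c ` (W \<inter> fst c) = model_space I \<inter> S"
      using openin_mtop_image[OF A cA W] by (metis openin_open)
    obtain \<U> where \<U>: "\<U> \<subseteq> B" "S = \<Union>\<U>" using B(3)[OF S(1)] by auto
    have "snd c p \<in> S" using S(2) c p by auto
    then obtain T where T: "T \<in> B" "snd c p \<in> T" "T \<subseteq> S" using \<U> by auto
    have inj: "inj_on (snd c) (fst c)" and o: "openin (top_of_set (model_space I)) (snd c ` fst c)"
      using A cA by (auto simp: atlas_charts_def)
    note im = openin_imp_subset[OF o]
    have "{q \<in> fst c. snd c q \<in> T} \<subseteq> W"
    proof
      fix q assume q: "q \<in> {q \<in> fst c. snd c q \<in> T}"
      then have "snd c q \<in> snd c ` (W \<inter> fst c)" using S T im by auto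
      then show "q \<in> W" using inj q by (auto simp: inj_on_def)
    qed
    moreover have "{q \<in> fst c. snd c q \<in> T} \<in> \<B>" unfolding \<B>_def using c T by force
    ultimately show ?thesis using c(2) T(2) by (intro bexI[of _ "{q \<in> fst c. snd c q \<in> T}"]) auto
  qed
  ultimately show ?thesis unfolding second_countable_def by (intro exI[of _ \<B>]) auto
qed

text \<open>The atlas condition localised at one point. It is transitive, which permits comparing
  two charts through a third one that contains the point.\<close>

definition compat_at :: "('a, 'n::finite) chart \<Rightarrow> ('a, 'n) chart \<Rightarrow> 'a \<Rightarrow> bool" where
  "compat_at c c' p \<longleftrightarrow> p \<in> fst c \<and> p \<in> fst c' \<and>
     (\<exists>S. open S \<and> snd c p \<in> S \<and> S \<subseteq> snd c ` (fst c \<inter> fst c') \<and> smooth_on S (local_expr c (snd c')))"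

lemma compat_at_trans:
  assumes inj: "inj_on (snd c) (fst c)" "inj_on (snd c') (fst c')"
    and "compat_at c c' p" "compat_at c' c'' p"
  shows "compat_at c c'' p"
proof -
  let ?T = "local_expr c (snd c')"
  obtain S where S: "p \<in> fst c" "p \<in> fst c'" "open S" "snd c p \<in> S" "S \<subseteq> snd c ` (fst c \<inter> fst c')" "smooth_on S ?T"
    using assms(3) by (auto simp: compat_at_def)
  obtain R where R: "p \<in> fst c''" "open R" "snd c' p \<in> R" "R \<subseteq> snd c' ` (fst c' \<inter> fst c'')"
      "smooth_on R (local_expr c' (snd c''))"
    using assms(4) by (auto simp: compat_at_def)
  define Q where "Q = S \<inter> ?T -` R"
  have "open Q" unfolding Q_def
    by (rule continuous_open_preimage[OF smooth_on_imp_continuous_on[OF S(6)] S(3) R(2)])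
  moreover have "snd c p \<in> Q" using S R inj by (simp add: Q_def local_expr_at)
  moreover have *: "\<exists>q. x = snd c q \<and> q \<in> fst c \<inter> fst c' \<inter> fst c''" if "x \<in> Q" for x
  proof -
    have "x \<in> snd c ` (fst c \<inter> fst c')" using S(5) that unfolding Q_def by blast
    then obtain q where q: "x = snd c q" "q \<in> fst c" "q \<in> fst c'" by auto
    then have "snd c' q \<in> R" using that inj by (simp add: Q_def local_expr_at)
    then have "snd c' q \<in> snd c' ` (fst c' \<inter> fst c'')" using R(4) by auto
    then have "q \<in> fst c''" using inj(2) q(3) by (auto simp: inj_on_def)
    then show ?thesis using q by auto
  qed
  then have "Q \<subseteq> snd c ` (fst c \<inter> fst c'')" by auto
  moreover have "smooth_on Q (\<lambda>x. local_expr c' (snd c'') (?T x))"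
    by (rule smooth_on_compose[OF R(5) smooth_on_subset[OF S(6)]]) (auto simp: Q_def)
  then have "smooth_on Q (local_expr c (snd c''))"
  proof (rule smooth_on_cong)
    fix x assume "x \<in> Q"
    then show "local_expr c' (snd c'') (?T x) = local_expr c (snd c'') x"
      using * inj by (metis IntD1 IntD2 local_expr_at)
  qed
  ultimately show ?thesis using S R by (auto simp: compat_at_def)
qed

text \<open>Openness of the overlaps and smoothness of the transitions are both local, so they can
  be checked one common point at a time.\<close>

lemma atlas_charts_UNIV_I:
  fixes A :: "('a, 'n::finite) atlas"
  assumes "\<And>c. c \<in> A \<Longrightarrow> inj_on (snd c) (fst c)"
    and "\<And>c c' p. c \<in> A \<Longrightarrow> c' \<in> A \<Longrightarrow> p \<in> fst c \<Longrightarrow> p \<in> fst c' \<Longrightarrow> compat_at c c' p"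
  shows "atlas_charts UNIV A"
proof -
  have *: "open (snd c ` (fst c \<inter> fst c'))" "smooth_on (snd c ` (fst c \<inter> fst c')) (local_expr c (snd c'))"
    if "c \<in> A" "c' \<in> A" for c c'
  proof -
    have loc: "\<exists>S. open S \<and> x \<in> S \<and> S \<subseteq> snd c ` (fst c \<inter> fst c') \<and> smooth_on S (local_expr c (snd c'))"
      if "x \<in> snd c ` (fst c \<inter> fst c')" for x
    proof -
      from that obtain p where "x = snd c p" "p \<in> fst c" "p \<in> fst c'" by auto
      then show ?thesis using assms(2)[OF \<open>c \<in> A\<close> \<open>c' \<in> A\<close>, of p] by (simp add: compat_at_def)
    qed
    show "smooth_on (snd c ` (fst c \<inter> fst c')) (local_expr c (snd c'))"
      by (rule smooth_on_local[OF loc])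
    show "open (snd c ` (fst c \<inter> fst c'))"
      by (subst open_subopen) (use loc in fast)
  qed
  have "open (snd c ` fst c)" if "c \<in> A" for c using *(1)[OF that that] by simp
  with * show ?thesis unfolding atlas_charts_def using assms(1) by simp
qed

text \<open>Atlases of full dimension: chart images are open in the whole coordinate space, so
  \<open>differential\<close> of a transition map is a genuine derivative and the chain rule applies
  without reference to subspaces.\<close>

locale univ_atlas =
  fixes A :: "('a, 'n::finite) atlas"
  assumes charts: "atlas_charts UNIV A"
begin

lemma inj: "c \<in> A \<Longrightarrow> inj_on (snd c) (fst c)"
  using charts by (auto simp: atlas_charts_def)

lemma open_image: "c \<in> A \<Longrightarrow> openin (mtop A) W \<Longrightarrow> open (snd c ` (W \<inter> fst c))"
  using openin_mtop_image[OF charts] by simp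

lemma open_overlap: "c \<in> A \<Longrightarrow> c' \<in> A \<Longrightarrow> open (snd c ` (fst c \<inter> fst c'))"
  and smooth_transition: "c \<in> A \<Longrightarrow> c' \<in> A \<Longrightarrow> smooth_on (snd c ` (fst c \<inter> fst c')) (local_expr c (snd c'))"
  using charts by (auto simp: atlas_charts_def)

lemma open_chart_image: "c \<in> A \<Longrightarrow> open (snd c ` fst c)"
  using open_overlap[of c c] by simp

lemma transition_has_derivative:
  assumes "c \<in> A" "c' \<in> A" "p \<in> fst c" "p \<in> fst c'"
  shows "(local_expr c (snd c') has_derivative differential c (snd c') p) (at (snd c p))"
  unfolding differential_def[abs_def]
  using assms by (intro smooth_on_has_derivative[OF smooth_transition[of c c'] open_overlap[of c c']]) auto

lemma linear_differential:
  assumes "c \<in> A" "c' \<in> A" "p \<in> fst c" "p \<in> fst c'"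
  shows "linear (differential c (snd c') p)"
  using transition_has_derivative[OF assms] by (rule has_derivative_linear)

lemma differential_chain:
  assumes c: "c \<in> A" "c' \<in> A" "p \<in> fst c" "p \<in> fst c'"
    and f: "(local_expr c' f has_derivative f') (at (snd c' p))"
  shows "differential c f p u = f' (differential c (snd c') p u)"
proof -
  have "differential c f p u = dir_deriv (\<lambda>x. local_expr c' f (local_expr c (snd c') x)) (snd c p) u"
    unfolding differential_def
  proof (rule dir_deriv_cong[OF open_overlap[OF c(1,2)]])
    show "snd c p \<in> snd c ` (fst c \<inter> fst c')" using c by auto
    show "local_expr c f y = local_expr c' f (local_expr c (snd c') y)" if "y \<in> snd c ` (fst c \<inter> fst c')" for y
      using that inj c by (auto simp: local_expr_at)
  qed
  also have "\<dots> = f' (differential c (snd c') p u)"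
    using f c inj by (intro dir_deriv_compose transition_has_derivative) (auto simp: local_expr_at)
  finally show ?thesis .
qed

lemma differential_chain':
  assumes c: "c \<in> A" "c' \<in> A" "p \<in> fst c" "p \<in> fst c'"
    and f: "local_expr c' f differentiable at (snd c' p)"
  shows "differential c f p u = differential c' f p (differential c (snd c') p u)"
proof -
  obtain f' where f': "(local_expr c' f has_derivative f') (at (snd c' p))" using f by (auto simp: differentiable_def)
  show ?thesis unfolding differential_chain[OF c f'] using dir_deriv_eq[OF f'] by (simp add: differential_def)
qed

lemma differential_cocycle:
  assumes c: "c \<in> A" "c' \<in> A" "c'' \<in> A" "p \<in> fst c" "p \<in> fst c'" "p \<in> fst c''"
  shows "differential c (snd c'') p u = differential c' (snd c'') p (differential c (snd c') p u)"
  by (rule differential_chain) (use c transition_has_derivative in auto)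

lemma differential_self:
  assumes c: "c \<in> A" "p \<in> fst c"
  shows "differential c (snd c) p u = u"
proof -
  have "differential c (snd c) p u = dir_deriv (\<lambda>x. x) (snd c p) u"
    unfolding differential_def
    by (rule dir_deriv_cong[OF open_chart_image[OF c(1)]]) (use c inj in \<open>auto simp: local_expr_at\<close>)
  also have "\<dots> = u" by (rule dir_deriv_eq) (rule has_derivative_ident)
  finally show ?thesis .
qed

lemma differential_inverse:
  assumes c: "c \<in> A" "c' \<in> A" "p \<in> fst c" "p \<in> fst c'"
  shows "differential c' (snd c) p (differential c (snd c') p u) = u"
  using differential_cocycle[of c c' c p u] differential_self[of c p u] c by simp

text \<open>Composition with a smooth transition map carries smoothness near a point from one chart
  to every other chart around it.\<close>

lemma smooth_funI:
  assumes "\<And>p. p \<in> carrier_of A \<Longrightarrow> \<exists>c\<in>A. p \<in> fst c \<and>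
     (\<exists>S. open S \<and> snd c p \<in> S \<and> smooth_on S (local_expr c f))"
  shows "smooth_fun A f"
proof -
  have "smooth_on (snd c ` fst c) (local_expr c f)" if c: "c \<in> A" for c
  proof (rule smooth_on_local)
    fix x assume "x \<in> snd c ` fst c"
    then obtain p where p: "x = snd c p" "p \<in> fst c" by auto
    from p c have "p \<in> carrier_of A" by (auto simp: carrier_of_def)
    from assms[OF this] obtain c' S where
      c': "c' \<in> A" "p \<in> fst c'" "open S" "snd c' p \<in> S" "smooth_on S (local_expr c' f)"
      by blast
    let ?T = "local_expr c (snd c')" and ?D = "snd c ` (fst c \<inter> fst c')"
    define Q where "Q = ?D \<inter> ?T -` S"
    have "open Q" unfolding Q_def
      by (rule continuous_open_preimage[OF smooth_on_imp_continuous_on[OF smooth_transition[OF c c'(1)]]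
            open_overlap[OF c c'(1)] c'(3)])
    moreover have "x \<in> Q" using p c' inj[OF c] by (auto simp: Q_def local_expr_at)
    moreover have "smooth_on Q (\<lambda>y. local_expr c' f (?T y))"
      by (rule smooth_on_compose[OF c'(5) smooth_on_subset[OF smooth_transition[OF c c'(1)]]]) (auto simp: Q_def)
    then have "smooth_on Q (local_expr c f)"
      by (rule smooth_on_cong) (use inj c c'(1) in \<open>auto simp: Q_def local_expr_at\<close>)
    moreover have "Q \<subseteq> snd c ` fst c" by (auto simp: Q_def)
    ultimately show "\<exists>S. open S \<and> x \<in> S \<and> S \<subseteq> snd c ` fst c \<and> smooth_on S (local_expr c f)" by blast
  qed
  then show ?thesis by (auto simp: smooth_fun_def)
qed

end


section \<open>Two-forms\<close>

lemma bilinear_expand: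
  fixes b :: "'e::euclidean_space \<Rightarrow> 'e \<Rightarrow> real"
  assumes "bilinear b"
  shows "b u v = (\<Sum>i\<in>Basis. \<Sum>j\<in>Basis. (u \<bullet> i) * (v \<bullet> j) * b i j)"
proof -
  have l: "linear (\<lambda>u. b u w)" "linear (b w)" for w using assms by (auto simp: bilinear_def)
  have "b u v = b (\<Sum>i\<in>Basis. (u \<bullet> i) *\<^sub>R i) v" by (simp add: euclidean_representation)
  also have "\<dots> = (\<Sum>i\<in>Basis. (u \<bullet> i) * b i v)"
    by (simp add: linear_sum[OF l(1)] linear_scale[OF l(1)])
  also have "\<dots> = (\<Sum>i\<in>Basis. (u \<bullet> i) * b i (\<Sum>j\<in>Basis. (v \<bullet> j) *\<^sub>R j))"
    by (simp add: euclidean_representation)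
  also have "\<dots> = (\<Sum>i\<in>Basis. \<Sum>j\<in>Basis. (u \<bullet> i) * (v \<bullet> j) * b i j)"
    by (simp add: linear_sum[OF l(2)] linear_scale[OF l(2)] sum_distrib_left mult.assoc)
  finally show ?thesis .
qed

lemma bilinear_skew:
  assumes b: "bilinear b" and alt: "\<And>u. b u u = (0::real)"
  shows "b u v = - b v u"
proof -
  have "b (u + v) (u + v) = b u u + b u v + b v u + b v v"
    by (simp add: bilinear_ladd[OF b] bilinear_radd[OF b])
  then show ?thesis by (simp add: alt)
qed

lemma coeff_form2_UNIV_D:
  assumes "coeff_form2 UNIV D b" "x \<in> D"
  shows "bilinear (b x)" "b x u u = 0" "b x u v = - b x v u"
  using assms bilinear_skew[of "b x" u v] by (auto simp: coeff_form2_def)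

lemma coeff_form2_smooth:
  assumes "coeff_form2 UNIV D b"
  shows "smooth_on D (\<lambda>x. b x u v)"
  using assms by (auto simp: coeff_form2_def)

text \<open>\<open>coeff_form2\<close> asserts smoothness only for constant vector arguments, so the
  moving vectors are expanded in a basis.\<close>

lemma smooth_on_form_along:
  fixes b :: "'n::finite coords \<Rightarrow> 'n coords \<Rightarrow> 'n coords \<Rightarrow> real" 
  assumes b: "coeff_form2 UNIV D b" and T: "smooth_on S T" "T ` S \<subseteq> D"
    and p: "smooth_on S p" and q: "smooth_on S q"
  shows "smooth_on S (\<lambda>y. b (T y) (p y) (q y))"
proof (rule smooth_on_cong)
  show "smooth_on S (\<lambda>y. \<Sum>i\<in>Basis. \<Sum>j\<in>Basis. (p y \<bullet> i) * (q y \<bullet> j) * b (T y) i j)"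
    by (intro smooth_on_sum finite_Basis smooth_on_mult
        smooth_on_bounded_linear_compose[OF bounded_linear_inner_left] p q
        smooth_on_compose[OF coeff_form2_smooth[OF b] T])
  show "(\<Sum>i\<in>Basis. \<Sum>j\<in>Basis. (p y \<bullet> i) * (q y \<bullet> j) * b (T y) i j) = b (T y) (p y) (q y)" if "y \<in> S" for y
    using that T(2) by (intro bilinear_expand[symmetric] coeff_form2_UNIV_D[OF b]) auto
qed

text \<open>The product rule in three places: base point, first and second argument. It again goes
  through a basis expansion, because differentiability in the base point is known for constant
  vectors only.\<close>

lemma form_along_has_derivative:
  fixes b :: "'n::finite coords \<Rightarrow> 'n coords \<Rightarrow> 'n coords \<Rightarrow> real" 
    and T p q :: "'n coords \<Rightarrow> 'n coords"
  assumes b: "coeff_form2 UNIV D b" "open D" and S: "open S" "x \<in> S" "T ` S \<subseteq> D"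
    and T: "(T has_derivative T') (at x)"
    and p: "(p has_derivative p') (at x)"
    and q: "(q has_derivative q') (at x)"
  shows "((\<lambda>y. b (T y) (p y) (q y)) has_derivative
    (\<lambda>h. dir_deriv (\<lambda>z. b z (p x) (q x)) (T x) (T' h) + b (T x) (p' h) (q x) + b (T x) (p x) (q' h))) (at x)"
proof -
  have x: "T x \<in> D" using S by auto
  define \<beta> where "\<beta> i j h = dir_deriv (\<lambda>z. b z i j) (T x) h" for i j h
  have \<beta>: "((\<lambda>z. b z i j) has_derivative \<beta> i j) (at (T x))" for i j
    unfolding \<beta>_def[abs_def] by (rule smooth_on_has_derivative[OF coeff_form2_smooth[OF b(1)] b(2) x])
  let ?F = "\<lambda>y. \<Sum>i\<in>Basis. \<Sum>j\<in>Basis. (p y \<bullet> i) * (q y \<bullet> j) * b (T y) i j"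
  let ?F' = "\<lambda>h. \<Sum>i\<in>Basis. \<Sum>j\<in>Basis. (p x \<bullet> i) * (q x \<bullet> j) * \<beta> i j (T' h) +
       ((p x \<bullet> i) * (q' h \<bullet> j) + (p' h \<bullet> i) * (q x \<bullet> j)) * b (T x) i j"
  have "(?F has_derivative ?F') (at x)"
    by (intro has_derivative_sum has_derivative_mult has_derivative_inner_left p q
        has_derivative_compose[OF T \<beta>])
  moreover have "dir_deriv (\<lambda>z. b z P Q) (T x) k = (\<Sum>i\<in>Basis. \<Sum>j\<in>Basis. (P \<bullet> i) * (Q \<bullet> j) * \<beta> i j k)" for P Q k
  proof -
    have "dir_deriv (\<lambda>z. b z P Q) (T x) k = dir_deriv (\<lambda>z. \<Sum>i\<in>Basis. \<Sum>j\<in>Basis. (P \<bullet> i) * (Q \<bullet> j) * b z i j) (T x) k"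
      by (rule dir_deriv_cong[OF b(2) x]) (rule bilinear_expand[OF coeff_form2_UNIV_D(1)[OF b(1)]])
    also have "\<dots> = (\<Sum>i\<in>Basis. \<Sum>j\<in>Basis. (P \<bullet> i) * (Q \<bullet> j) * \<beta> i j k)"
      by (rule dir_deriv_eq) (intro has_derivative_sum has_derivative_mult_right \<beta>)
    finally show ?thesis .
  qed
  then have "?F' = (\<lambda>h. dir_deriv (\<lambda>z. b z (p x) (q x)) (T x) (T' h) + b (T x) (p' h) (q x) + b (T x) (p x) (q' h))"
    using bilinear_expand[OF coeff_form2_UNIV_D(1)[OF b(1) x], of "p' _" "q x"]
      bilinear_expand[OF coeff_form2_UNIV_D(1)[OF b(1) x], of "p x" "q' _"]
    by (simp only: sum.distrib[symmetric]) (simp add: algebra_simps)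
  ultimately have "(?F has_derivative (\<lambda>h. dir_deriv (\<lambda>z. b z (p x) (q x)) (T x) (T' h) + b (T x) (p' h) (q x) + b (T x) (p x) (q' h))) (at x)"
    by simp
  then show ?thesis
  proof (rule has_derivative_transform_within_open[OF _ S(1,2)])
    fix y assume "y \<in> S"
    then have "T y \<in> D" using S(3) by auto
    then show "?F y = b (T y) (p y) (q y)"
      by (rule bilinear_expand[OF coeff_form2_UNIV_D(1)[OF b(1)], symmetric])
  qed
qed

definition pullback :: "('n coords \<Rightarrow> 'n coords \<Rightarrow> 'n coords \<Rightarrow> real) \<Rightarrow> ('n::finite coords \<Rightarrow> 'n coords) \<Rightarrow>
    'n coords \<Rightarrow> 'n coords \<Rightarrow> 'n coords \<Rightarrow> real" where
  "pullback b T x u v = b (T x) (dir_deriv T x u) (dir_deriv T x v)"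

lemma coeff_form2_pullback:
  assumes b: "coeff_form2 UNIV D b" and T: "smooth_on S T" "open S" "T ` S \<subseteq> D"
  shows "coeff_form2 UNIV S (pullback b T)"
  unfolding coeff_form2_def pullback_def[abs_def]
proof (intro conjI ballI)
  fix x assume x: "x \<in> S"
  then have Tx: "T x \<in> D" using T by auto
  have l: "linear (dir_deriv T x)" by (rule smooth_on_linear_dir_deriv[OF T(1,2) x])
  have bl: "bilinear (b (T x))" by (rule coeff_form2_UNIV_D(1)[OF b Tx])
  show "bilinear (\<lambda>u v. b (T x) (dir_deriv T x u) (dir_deriv T x v))"
    using bl l linear_compose[OF l] unfolding bilinear_def by (auto simp: o_def)
  show "b (T x) (dir_deriv T x u) (dir_deriv T x u) = 0" for u
    by (rule coeff_form2_UNIV_D(2)[OF b Tx])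
next
  show "smooth_on S (\<lambda>x. b (T x) (dir_deriv T x u) (dir_deriv T x v))" for u v
    by (rule smooth_on_form_along[OF b T(1,3)]) (intro smooth_on_dir_deriv T)+
qed

text \<open>The product rule leaves six terms containing second derivatives of T. They cancel in
  pairs by symmetry of the mixed derivatives; one of the pairs needs skewness of b in
  addition.\<close>

lemma ext_d2_pullback:
  assumes b: "coeff_form2 UNIV D b" "open D" and T: "smooth_on S T" "open S" "T ` S \<subseteq> D" and x: "x \<in> S"
  shows "ext_d2 (pullback b T) x u v w =
    ext_d2 b (T x) (dir_deriv T x u) (dir_deriv T x v) (dir_deriv T x w)"
proof -
  have Tx: "T x \<in> D" using T x by auto
  have "((\<lambda>y. dir_deriv T y h) has_derivative dir_deriv (\<lambda>y. dir_deriv T y h) x) (at x)" for h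
    by (rule smooth_on_has_derivative[OF smooth_on_dir_deriv[OF T(1,2)] T(2) x])
  then have d: "dir_deriv (\<lambda>y. pullback b T y h k) x g = dir_deriv (\<lambda>z. b z (dir_deriv T x h) (dir_deriv T x k)) (T x) (dir_deriv T x g)
     + b (T x) (dir_deriv (\<lambda>y. dir_deriv T y h) x g) (dir_deriv T x k)
     + b (T x) (dir_deriv T x h) (dir_deriv (\<lambda>y. dir_deriv T y k) x g)" for g h k
    unfolding pullback_def
    by (intro dir_deriv_eq form_along_has_derivative[OF b T(2) x T(3)] smooth_on_has_derivative[OF T(1,2) x])
  have c: "dir_deriv (\<lambda>y. dir_deriv T y h) x g = dir_deriv (\<lambda>y. dir_deriv T y g) x h" for g h
    by (rule dir_deriv_commute[OF T(1,2) x])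
  have s: "b (T x) P Q = - b (T x) Q P" for P Q by (rule coeff_form2_UNIV_D(3)[OF b(1) Tx])
  show ?thesis
    unfolding ext_d2_def d c[of u v] c[of u w] c[of v w]
      s[of "dir_deriv T x v" "dir_deriv (\<lambda>y. dir_deriv T y w) x u"]
    by linarith
qed

lemma wedge_power_cong:
  assumes "\<And>i j. b (v i) (v j) = b' (v' i) (v' j)"
  shows "wedge_power I b v = wedge_power I b' v'"
  using assms by (simp add: wedge_power_def)

lemma ext_d2_cong:
  assumes "open S" "x \<in> S" "\<And>y u v. y \<in> S \<Longrightarrow> b y u v = b' y u v"
  shows "ext_d2 b x u v w = ext_d2 b' x u v w"
proof -
  have e: "dir_deriv (\<lambda>y. b y p q) x r = dir_deriv (\<lambda>y. b' y p q) x r" for p q r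
    by (rule dir_deriv_cong[OF assms(1,2)]) (rule assms(3))
  show ?thesis unfolding ext_d2_def e ..
qed

text \<open>The local forms live on pieces \<open>dm j\<close> that may be smaller than the charts
  \<open>ch j\<close>. This suits forms known only away from the pole in one kind of chart and only
  near it in the other. On each piece the glued form is a pullback under a transition map, so
  smoothness, closedness and nondegeneracy carry over.\<close>

lemma (in univ_atlas) glue_symplectic_form:
  fixes J :: "'j set" and ch :: "'j \<Rightarrow> ('a, 'n) chart" and dm :: "'j \<Rightarrow> 'a set"
    and b :: "'j \<Rightarrow> 'n coords \<Rightarrow> 'n coords \<Rightarrow> 'n coords \<Rightarrow> real"
  assumes J: "\<And>j. j \<in> J \<Longrightarrow> ch j \<in> A" "\<And>j. j \<in> J \<Longrightarrow> dm j \<subseteq> fst (ch j)" 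
      "\<And>j. j \<in> J \<Longrightarrow> openin (mtop A) (dm j)"
    and cover: "carrier_of A \<subseteq> (\<Union>j\<in>J. dm j)"
    and form: "\<And>j. j \<in> J \<Longrightarrow> coeff_form2 UNIV (snd (ch j) ` dm j) (b j)"
    and closed: "\<And>j p u v w. j \<in> J \<Longrightarrow> p \<in> dm j \<Longrightarrow> ext_d2 (b j) (snd (ch j) p) u v w = 0"
    and nondeg: "\<And>j p. j \<in> J \<Longrightarrow> p \<in> dm j \<Longrightarrow> \<exists>v. wedge_power (UNIV :: 'n set) (b j (snd (ch j) p)) v \<noteq> 0"
    and compat: "\<And>j j' p u v. j \<in> J \<Longrightarrow> j' \<in> J \<Longrightarrow> p \<in> dm j \<Longrightarrow> p \<in> dm j' \<Longrightarrow>
      b j (snd (ch j) p) u v =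
      b j' (snd (ch j') p) (differential (ch j) (snd (ch j')) p u) (differential (ch j) (snd (ch j')) p v)"
  obtains \<omega> where "symplectic_form UNIV A \<omega>"
    "\<And>j p u v. j \<in> J \<Longrightarrow> p \<in> dm j \<Longrightarrow> \<omega> (ch j) (snd (ch j) p) u v = b j (snd (ch j) p) u v"
proof -
  \<comment> \<open>The piece is chosen by SOME; \<open>compat\<close> and the cocycle rule for
    differentials show that any other piece through the point gives the same value.\<close>
  define \<omega> where "\<omega> c x u v = (let p = inv_into (fst c) (snd c) x; j = (SOME j. j \<in> J \<and> p \<in> dm j) in
      b j (snd (ch j) p) (differential c (snd (ch j)) p u) (differential c (snd (ch j)) p v))"
    for c :: "('a, 'n) chart" and x u v
  have \<omega>: "\<omega> c (snd c p) u v = b j (snd (ch j) p) (differential c (snd (ch j)) p u) (differential c (snd (ch j)) p v)"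
    if c: "c \<in> A" "p \<in> fst c" and j: "j \<in> J" "p \<in> dm j" for c p j u v
  proof -
    define i where "i = (SOME j. j \<in> J \<and> p \<in> dm j)"
    have i: "i \<in> J \<and> p \<in> dm i" unfolding i_def by (rule someI[of _ j]) (use j in auto)
    have fi: "p \<in> fst (ch i)" and fj: "p \<in> fst (ch j)" using i j J(2) by auto
    have "\<omega> c (snd c p) u v = b i (snd (ch i) p) (differential c (snd (ch i)) p u) (differential c (snd (ch i)) p v)"
      unfolding \<omega>_def Let_def using c inj by (simp add: i_def)
    also have "\<dots> = b j (snd (ch j) p) (differential c (snd (ch j)) p u) (differential c (snd (ch j)) p v)"
      using i j c J(1) fi fj by (simp add: compat[of i j] differential_cocycle[of c "ch i" "ch j" p, symmetric])
    finally show ?thesis .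
  qed
  define S where "S c j = snd c ` (dm j \<inter> fst c)" for c :: "('a, 'n) chart" and j
  define T where "T c j = local_expr c (snd (ch j))" for c :: "('a, 'n) chart" and j
  have S: "open (S c j)" "smooth_on (S c j) (T c j)" "T c j ` S c j \<subseteq> snd (ch j) ` dm j"
    "open (snd (ch j) ` dm j)"
    "\<And>x u v. x \<in> S c j \<Longrightarrow> \<omega> c x u v = pullback (b j) (T c j) x u v"
    if c: "c \<in> A" and j: "j \<in> J" for c j
  proof -
    show "open (S c j)" unfolding S_def by (rule open_image[OF c J(3)[OF j]])
    show "smooth_on (S c j) (T c j)" unfolding T_def
      by (rule smooth_on_subset[OF smooth_transition[OF c J(1)[OF j]]]) (use J(2)[OF j] in \<open>auto simp: S_def\<close>)
    show "T c j ` S c j \<subseteq> snd (ch j) ` dm j"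
      using inj[OF c] by (auto simp: S_def T_def local_expr_at)
    have "snd (ch j) ` (dm j \<inter> fst (ch j)) = snd (ch j) ` dm j" using J(2)[OF j] by auto
    then show "open (snd (ch j) ` dm j)" using open_image[OF J(1)[OF j] J(3)[OF j]] by simp
    fix x u v assume "x \<in> S c j"
    then obtain p where p: "x = snd c p" "p \<in> dm j" "p \<in> fst c" by (auto simp: S_def)
    show "\<omega> c x u v = pullback (b j) (T c j) x u v"
      unfolding p(1) \<omega>[OF c p(3) j p(2)] pullback_def T_def differential_def
      using inj[OF c] p by (simp add: local_expr_at)
  qed
  have ex: "\<exists>j. j \<in> J \<and> p \<in> dm j" if "c \<in> A" "p \<in> fst c" for c p
    using that cover by (auto simp: carrier_of_def)
  have exS: "\<exists>j. j \<in> J \<and> x \<in> S c j" if "c \<in> A" "x \<in> snd c ` fst c" for c x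
    using that ex by (fastforce simp: S_def)
  have pb: "coeff_form2 UNIV (S c j) (pullback (b j) (T c j))" if c: "c \<in> A" and j: "j \<in> J" for c j
    by (rule coeff_form2_pullback[OF form[OF j] S(2,1,3)[OF c j]])
  have tf: "two_form UNIV A (carrier_of A) \<omega>"
  proof -
    have cf: "coeff_form2 UNIV (snd c ` (fst c \<inter> carrier_of A)) (\<omega> c)" if c: "c \<in> A" for c
    proof -
      have e: "snd c ` (fst c \<inter> carrier_of A) = snd c ` fst c" using c by (auto simp: carrier_of_def)
      have "bilinear (\<omega> c x) \<and> (\<forall>u. \<omega> c x u u = 0)" if x: "x \<in> snd c ` fst c" for x
      proof -
        obtain j where j: "j \<in> J" "x \<in> S c j" using exS[OF c x] by auto
        have "\<omega> c x = pullback (b j) (T c j) x" using S(5)[OF c j] by (simp add: fun_eq_iff)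
        then show ?thesis using coeff_form2_UNIV_D(1,2)[OF pb[OF c j(1)] j(2)] by simp
      qed
      moreover have "smooth_on (snd c ` fst c) (\<lambda>x. \<omega> c x u v)" for u v
      proof (rule smooth_on_local)
        fix x assume x: "x \<in> snd c ` fst c"
        obtain j where j: "j \<in> J" "x \<in> S c j" using exS[OF c x] by auto
        have "smooth_on (S c j) (\<lambda>x. \<omega> c x u v)"
          by (rule smooth_on_cong[OF coeff_form2_smooth[OF pb[OF c j(1)]]]) (simp add: S(5)[OF c j(1)])
        moreover have "S c j \<subseteq> snd c ` fst c" by (auto simp: S_def)
        ultimately show "\<exists>S. open S \<and> x \<in> S \<and> S \<subseteq> snd c ` fst c \<and> smooth_on S (\<lambda>x. \<omega> c x u v)"
          using S(1)[OF c j(1)] j(2) by (intro exI[of _ "S c j"]) simp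
      qed
      ultimately show ?thesis unfolding e coeff_form2_def by simp
    qed
    have tl: "\<omega> c (snd c p) u v = \<omega> c' (snd c' p) (differential c (snd c') p u) (differential c (snd c') p v)"
      if c: "c \<in> A" "c' \<in> A" "p \<in> fst c" "p \<in> fst c'" for c c' p u v
    proof -
      obtain j where j: "j \<in> J" "p \<in> dm j" using ex[OF c(1,3)] by auto
      then have pj: "p \<in> fst (ch j)" using J(2) by auto
      have "differential c (snd (ch j)) p u = differential c' (snd (ch j)) p (differential c (snd c') p u)" for u
        by (rule differential_cocycle[OF c(1,2) J(1)[OF j(1)] c(3,4) pj])
      then show ?thesis unfolding \<omega>[OF c(1,3) j] \<omega>[OF c(2,4) j] by simp
    qed
    show ?thesis unfolding two_form_def case_prod_beta using cf
      by (intro conjI ballI tl) auto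
  qed
  have "symplectic_form UNIV A \<omega>"
    unfolding symplectic_form_def
  proof (intro conjI ballI tf)
    fix c x assume c: "c \<in> A" and x: "x \<in> snd c ` fst c"
    obtain j where j: "j \<in> J" "x \<in> S c j" using exS[OF c x] by auto
    obtain p where p: "x = snd c p" "p \<in> dm j" "p \<in> fst c" using j by (auto simp: S_def)
    have pj: "p \<in> fst (ch j)" using J(2) j(1) p(2) by auto
    show "ext_d2 (\<omega> c) x u v w = 0" for u v w
    proof -
      have "ext_d2 (\<omega> c) x u v w = ext_d2 (pullback (b j) (T c j)) x u v w"
        by (rule ext_d2_cong[OF S(1)[OF c j(1)] j(2) S(5)[OF c j(1)]])
      also have "\<dots> = ext_d2 (b j) (T c j x) (dir_deriv (T c j) x u) (dir_deriv (T c j) x v) (dir_deriv (T c j) x w)"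
        by (rule ext_d2_pullback[OF form[OF j(1)] S(4)[OF c j(1)] S(2,1,3)[OF c j(1)] j(2)])
      also have "T c j x = snd (ch j) p" using p inj[OF c] by (simp add: T_def local_expr_at)
      finally show ?thesis using closed[OF j(1) p(2)] by simp
    qed
    obtain v where v: "wedge_power (UNIV :: 'n set) (b j (snd (ch j) p)) v \<noteq> 0" using nondeg[OF j(1) p(2)] by auto
    \<comment> \<open>The frame is carried over by the inverse differential, which leaves all
      pairings and so the top power unchanged.\<close>
    have "wedge_power UNIV (\<omega> c x) (\<lambda>i. differential (ch j) (snd c) p (v i)) = wedge_power UNIV (b j (snd (ch j) p)) v"
      unfolding p(1) by (intro wedge_power_cong)
        (simp add: \<omega>[OF c p(3) j(1) p(2)] differential_inverse[OF J(1)[OF j(1)] c pj p(3)])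
    with v have "wedge_power (UNIV :: 'n set) (\<omega> c x) (\<lambda>i. differential (ch j) (snd c) p (v i)) \<noteq> 0"
      by simp
    then show "\<exists>v. (\<forall>j. v j \<in> model_space UNIV) \<and> wedge_power (UNIV :: 'n set) (\<omega> c x) v \<noteq> 0"
      by (intro exI[of _ "\<lambda>i. differential (ch j) (snd c) p (v i)"]) simp
  qed
  moreover have "\<omega> (ch j) (snd (ch j) p) u v = b j (snd (ch j) p) u v" if "j \<in> J" "p \<in> dm j" for j p u v
    using that J(1,2) by (subst \<omega>[of "ch j" p j]) (auto simp: differential_self subset_iff)
  ultimately show ?thesis by (rule that)
qed


section \<open>Torus actions\<close>

lemma torus_exp_0 [simp]: "torus_exp 0 = 1"
  by (simp add: torus_exp_def vec_eq_iff)

lemma torus_exp_add: "torus_exp (\<xi> + \<eta>) = torus_exp \<xi> * torus_exp \<eta>"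
  by (simp add: torus_exp_def vec_eq_iff cis_mult)

lemma torus_exp_in_torus: "\<xi> \<in> torus_lie I \<Longrightarrow> torus_exp \<xi> \<in> torus I"
  by (simp add: torus_exp_def torus_def torus_lie_def)

lemma torus_exp_surj:
  assumes "t \<in> torus I"
  obtains \<xi> where "\<xi> \<in> torus_lie I" "torus_exp \<xi> = t"
proof
  show "(\<chi> i. if i \<in> I then Arg (t $ i) else 0) \<in> torus_lie I" by (simp add: torus_lie_def)
  have "cis (Arg (t $ i)) = t $ i" for i
  proof -
    have "norm (t $ i) = 1" using assms by (simp add: torus_def)
    then show ?thesis using rcis_cmod_Arg[of "t $ i"] by (simp add: rcis_def)
  qed
  then show "torus_exp (\<chi> i. if i \<in> I then Arg (t $ i) else 0) = t"
    using assms by (auto simp: torus_exp_def vec_eq_iff torus_def)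
qed

lemma one_in_torus: "1 \<in> torus I"
  by (simp add: torus_def)

lemma torus_mult_closed: "s \<in> torus I \<Longrightarrow> t \<in> torus I \<Longrightarrow> s * t \<in> torus I"
  by (simp add: torus_def norm_mult)

lemma torus_inverse:
  assumes "t \<in> torus I"
  obtains s where "s \<in> torus I" "s * t = 1" "t * s = 1"
proof -
  obtain \<xi> where \<xi>: "\<xi> \<in> torus_lie I" "torus_exp \<xi> = t" using torus_exp_surj[OF assms] .
  have "- \<xi> \<in> torus_lie I" using \<xi>(1) by (simp add: torus_lie_def)
  moreover have "torus_exp (- \<xi>) * torus_exp \<xi> = 1" "torus_exp \<xi> * torus_exp (- \<xi>) = 1"
    by (simp_all add: torus_exp_add[symmetric])
  ultimately show ?thesis using that[of "torus_exp (- \<xi>)"] \<xi>(2) torus_exp_in_torus by auto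
qed

text \<open>In the local expression of the action the orbit is the image of a straight line in
  direction (\<xi>, 0), so its velocity is a derivative of that expression. The domain is relatively
  open in a product of two subspaces and therefore contains the line for small s.\<close>

lemma action_curve:
  fixes A :: "('a, 'n::finite) atlas"
  assumes A: "atlas_charts I A" and act: "smooth_torus_action I A act"
    and c: "c \<in> A" "p \<in> fst c" and \<xi>: "\<xi> \<in> torus_lie I"
  shows "((\<lambda>s. snd c (act (torus_exp (s *\<^sub>R \<xi>)) p)) has_vector_derivative fundamental_field act c \<xi> p) (at 0)" 
    and "\<forall>\<^sub>F s in nhds 0. act (torus_exp (s *\<^sub>R \<xi>)) p \<in> fst c"
proof -
  define D where "D = {(\<xi>, x). \<xi> \<in> torus_lie I \<and> x \<in> snd c ` fst c \<and>
                         act (torus_exp \<xi>) (inv_into (fst c) (snd c) x) \<in> fst c}"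
  define F where "F = (\<lambda>(\<xi>, x). snd c (act (torus_exp \<xi>) (inv_into (fst c) (snd c) x)))"
  have inj: "inj_on (snd c) (fst c)" and im: "openin (top_of_set (model_space I)) (snd c ` fst c)"
    using A c by (auto simp: atlas_charts_def)
  have "case c of (U, \<phi>) \<Rightarrow> case c of (V, \<psi>) \<Rightarrow>
        let D = {(\<xi>, x). \<xi> \<in> torus_lie I \<and> x \<in> \<phi> ` U \<and>
                         act (torus_exp \<xi>) (inv_into U \<phi> x) \<in> V}
        in openin (top_of_set (torus_lie I \<times> \<phi> ` U)) D \<and>
           smooth_on D (\<lambda>(\<xi>, x). \<psi> (act (torus_exp \<xi>) (inv_into U \<phi> x)))"
    using act c(1) unfolding smooth_torus_action_def by fast
  then have D: "openin (top_of_set (torus_lie I \<times> snd c ` fst c)) D" "smooth_on D F"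
    unfolding D_def F_def by (simp_all add: case_prod_beta Let_def)
  let ?V = "torus_lie I \<times> model_space I"
  have "openin (top_of_set ?V) (torus_lie I \<times> snd c ` fst c)"
    using im by (intro openin_Times) auto
  then have DV: "openin (top_of_set ?V) D" using D(1) openin_trans by blast
  have V: "subspace ?V" by (intro subspace_Times subspace_torus_lie subspace_model_space)
  have carr: "p \<in> carrier_of A" using c by (auto simp: carrier_of_def)
  have act1: "act 1 p = p" using act carr by (simp add: smooth_torus_action_def)
  have x: "(0, snd c p) \<in> D" using c inj act1 by (simp add: D_def torus_lie_def)
  have u: "(\<xi>, 0) \<in> ?V" using \<xi> by (simp add: model_space_def)
  have "Ck_on (Suc 0) D F" using D(2) by (simp add: smooth_on_def del: Ck_on.simps)
  then obtain F' where "(F has_derivative F') (at (0, snd c p) within D)"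
    using x by auto
  from has_vector_derivative_line[OF V DV x u this]
  have "((\<lambda>s. snd c (act (torus_exp (s *\<^sub>R \<xi>)) p)) has_vector_derivative F' (\<xi>, 0)) (at 0)"
    using c inj by (simp add: F_def)
  then show "((\<lambda>s. snd c (act (torus_exp (s *\<^sub>R \<xi>)) p)) has_vector_derivative fundamental_field act c \<xi> p) (at 0)"
    unfolding fundamental_field_def by (simp add: vector_derivative_at)
  obtain T where T: "open T" "D = ?V \<inter> T" using DV by (metis openin_open)
  have "\<forall>\<^sub>F s in nhds 0. (0, snd c p) + s *\<^sub>R (\<xi>, 0) \<in> T"
    by (rule eventually_line_in_open[OF T(1)]) (use x T(2) in auto)
  then show "\<forall>\<^sub>F s in nhds 0. act (torus_exp (s *\<^sub>R \<xi>)) p \<in> fst c"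
  proof (rule eventually_mono)
    fix s :: real assume s: "(0, snd c p) + s *\<^sub>R (\<xi>, 0) \<in> T"
    have "(0, snd c p) + s *\<^sub>R (\<xi>, 0) \<in> ?V"
      using x u T(2) by (intro subspace_add[OF V] subspace_scale[OF V]) auto
    then have "(0, snd c p) + s *\<^sub>R (\<xi>, 0) \<in> D" using s T(2) by auto
    then show "act (torus_exp (s *\<^sub>R \<xi>)) p \<in> fst c"
      using c inj by (simp add: D_def)
  qed
qed

context univ_atlas
begin

lemma fundamental_field_transform:
  assumes act: "smooth_torus_action UNIV A act"
    and c: "c \<in> A" "c' \<in> A" "p \<in> fst c" "p \<in> fst c'"
  shows "fundamental_field act c' \<xi> p = differential c (snd c') p (fundamental_field act c \<xi> p)"
proof -
  let ?g = "\<lambda>s. act (torus_exp (s *\<^sub>R \<xi>)) p" and ?T = "local_expr c (snd c')" and ?w = "fundamental_field act c \<xi> p"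
  have curve: "((\<lambda>s. snd c (?g s)) has_derivative (\<lambda>s. s *\<^sub>R ?w)) (at 0)"
    using action_curve(1)[OF charts act c(1,3), of \<xi>] by (simp add: has_vector_derivative_def)
  have ev: "\<forall>\<^sub>F s in nhds 0. ?g s \<in> fst c" "\<forall>\<^sub>F s in nhds 0. ?g s \<in> fst c'"
    using action_curve(2)[OF charts act _ _ , of _ p \<xi>] c by auto
  have "act 1 p = p" using act c by (auto simp: smooth_torus_action_def carrier_of_def)
  then have "(?T has_derivative differential c (snd c') p) (at (snd c (?g 0)))"
    using transition_has_derivative[OF c] by simp
  from has_derivative_compose[OF curve this]
  have "((\<lambda>s. ?T (snd c (?g s))) has_derivative (\<lambda>s. differential c (snd c') p (s *\<^sub>R ?w))) (at 0)" .
  then have "((\<lambda>s. ?T (snd c (?g s))) has_vector_derivative differential c (snd c') p ?w) (at 0)"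
    unfolding has_vector_derivative_def by (simp add: linear_scale[OF linear_differential[OF c]])
  then have "vector_derivative (\<lambda>s. ?T (snd c (?g s))) (at 0) = differential c (snd c') p ?w"
    by (rule vector_derivative_at)
  moreover have "vector_derivative (\<lambda>s. ?T (snd c (?g s))) (at 0) = vector_derivative (\<lambda>s. snd c' (?g s)) (at 0)"
  proof (intro vector_derivative_cong_eq refl)
    show "\<forall>\<^sub>F s in nhds 0. s \<in> UNIV \<longrightarrow> ?T (snd c (?g s)) = snd c' (?g s)"
      using ev(1) by eventually_elim (use inj[OF c(1)] in \<open>simp add: local_expr_at\<close>)
  qed auto
  ultimately show ?thesis by (simp add: fundamental_field_def)
qed

text \<open>The definition quantifies over all pairs of charts. One pair near each p and \<xi>
  suffices, since any other pair differs from it by transition maps before and after the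
  action.\<close>

lemma smooth_torus_actionI:
  assumes grp: "\<And>t p. t \<in> torus UNIV \<Longrightarrow> p \<in> carrier_of A \<Longrightarrow> act t p \<in> carrier_of A"
      "\<And>p. p \<in> carrier_of A \<Longrightarrow> act 1 p = p"
      "\<And>s t p. s \<in> torus UNIV \<Longrightarrow> t \<in> torus UNIV \<Longrightarrow> p \<in> carrier_of A \<Longrightarrow> act (s * t) p = act s (act t p)"
    and sm: "\<And>p \<xi>. p \<in> carrier_of A \<Longrightarrow> \<exists>c\<in>A. \<exists>c'\<in>A. p \<in> fst c \<and> (\<exists>S. open S \<and> (\<xi>, snd c p) \<in> S \<and>
      (\<forall>\<eta> x. (\<eta>, x) \<in> S \<longrightarrow> x \<in> snd c ` fst c \<and> act (torus_exp \<eta>) (inv_into (fst c) (snd c) x) \<in> fst c') \<and>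
      smooth_on S (\<lambda>(\<eta>, x). snd c' (act (torus_exp \<eta>) (inv_into (fst c) (snd c) x))))"
  shows "smooth_torus_action UNIV A act"
proof -
  have "openin (top_of_set (UNIV \<times> snd c ` fst c)) D \<and> smooth_on D F"
    if c: "c \<in> A" "c' \<in> A" and D: "D = {(\<xi>, x). x \<in> snd c ` fst c \<and> act (torus_exp \<xi>) (inv_into (fst c) (snd c) x) \<in> fst c'}"
      and F: "F = (\<lambda>(\<xi>, x). snd c' (act (torus_exp \<xi>) (inv_into (fst c) (snd c) x)))" for c c' D F
  proof -
    have loc: "\<exists>S. open S \<and> z \<in> S \<and> S \<subseteq> D \<and> smooth_on S F" if z: "z \<in> D" for z
    proof -
      obtain \<xi> p where p: "z = (\<xi>, snd c p)" "p \<in> fst c" "act (torus_exp \<xi>) p \<in> fst c'"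
        using z inj[OF c(1)] unfolding D by auto
      have "p \<in> carrier_of A" using p c by (auto simp: carrier_of_def)
      from sm[OF this, of \<xi>] obtain d d' S where d: "d \<in> A" "d' \<in> A" "p \<in> fst d" "open S" "(\<xi>, snd d p) \<in> S"
        "\<And>\<eta> x. (\<eta>, x) \<in> S \<Longrightarrow> x \<in> snd d ` fst d \<and> act (torus_exp \<eta>) (inv_into (fst d) (snd d) x) \<in> fst d'"
        "smooth_on S (\<lambda>(\<eta>, x). snd d' (act (torus_exp \<eta>) (inv_into (fst d) (snd d) x)))"
        by metis
      let ?G = "\<lambda>(\<eta>, x). snd d' (act (torus_exp \<eta>) (inv_into (fst d) (snd d) x))"
      let ?T = "local_expr c (snd d)" and ?T' = "local_expr d' (snd c')"
      let ?O = "snd c ` (fst c \<inter> fst d)" and ?O' = "snd d' ` (fst d' \<inter> fst c')"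
      define g where "g z = (fst z, ?T (snd z))" for z :: "(real, 'n) vec \<times> (real, 'n + 'n) vec"
      have O: "open (UNIV \<times> ?O)" "open ?O'"
        by (rule open_Times[OF open_UNIV open_overlap[OF c(1) d(1)]], rule open_overlap[OF d(2) c(2)])
      have g: "smooth_on (UNIV \<times> ?O) g" unfolding g_def
        by (intro smooth_on_Pair smooth_on_bounded_linear[OF bounded_linear_fst]
            smooth_on_compose[OF smooth_transition[OF c(1) d(1)] smooth_on_bounded_linear[OF bounded_linear_snd]]) auto
      \<comment> \<open>\<open>S1\<close> forces the image into the domain of \<open>c'\<close> as
        well; \<open>R\<close> below is the same condition in the coordinates of
        \<open>c\<close>.\<close>
      define S1 where "S1 = S \<inter> ?G -` ?O'"
      have S1: "open S1" unfolding S1_def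
        by (rule continuous_open_preimage[OF smooth_on_imp_continuous_on[OF d(7)] d(4) O(2)])
      define R where "R = (UNIV \<times> ?O) \<inter> g -` S1"
      have R: "open R" unfolding R_def
        by (rule continuous_open_preimage[OF smooth_on_imp_continuous_on[OF g] O(1) S1])
      have gz: "g (\<eta>, snd c q) = (\<eta>, snd d q)" if "q \<in> fst c" for \<eta> q
        using that inj[OF c(1)] by (simp add: g_def local_expr_at)
      have Gz: "?G (\<eta>, snd d q) = snd d' (act (torus_exp \<eta>) q)" if "q \<in> fst d" for \<eta> q
        using that inj[OF d(1)] by simp
      have pd': "act (torus_exp \<xi>) p \<in> fst d'" using d(6)[OF d(5)] d(3) inj[OF d(1)] by simp
      have "?G (\<xi>, snd d p) \<in> ?O'" unfolding Gz[OF d(3)] using pd' p(3) by auto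
      then have "z \<in> R" unfolding R_def S1_def using p d(3,5) gz[OF p(2)] by auto
      moreover have key: "\<exists>q. y = snd c q \<and> q \<in> fst c \<and> q \<in> fst d \<and> act (torus_exp \<eta>) q \<in> fst d' \<and>
          act (torus_exp \<eta>) q \<in> fst c' \<and> (\<eta>, snd d q) \<in> S1" if yR: "(\<eta>, y) \<in> R" for \<eta> y
      proof -
        from yR have "y \<in> ?O" and g1: "g (\<eta>, y) \<in> S1" by (simp_all add: R_def)
        then obtain q where q: "y = snd c q" "q \<in> fst c" "q \<in> fst d" by auto
        have S1q: "(\<eta>, snd d q) \<in> S1" using g1 gz[OF q(2)] q(1) by simp
        then have "(\<eta>, snd d q) \<in> S" and G: "?G (\<eta>, snd d q) \<in> ?O'" unfolding S1_def by blast+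
        then have a: "act (torus_exp \<eta>) q \<in> fst d'" using d(6)[of \<eta> "snd d q"] q(3) inj[OF d(1)] by simp
        from G have "snd d' (act (torus_exp \<eta>) q) \<in> ?O'" unfolding Gz[OF q(3)] .
        then have "act (torus_exp \<eta>) q \<in> fst c'" using a inj[OF d(2)] by (auto simp: inj_on_def)
        then show ?thesis using q a S1q by blast
      qed
      then have "R \<subseteq> D"
      proof (intro subsetI)
        fix z assume "z \<in> R"
        then obtain \<eta> y where z: "z = (\<eta>, y)" "(\<eta>, y) \<in> R" by (cases z) auto
        from key[OF z(2)] obtain q where q: "y = snd c q" "q \<in> fst c" "act (torus_exp \<eta>) q \<in> fst c'" by auto
        then show "z \<in> D" unfolding D z(1) using inj[OF c(1)] by simp
      qed
      moreover have "smooth_on R (\<lambda>z. ?T' (?G (g z)))"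
      proof (rule smooth_on_compose[OF smooth_transition[OF d(2) c(2)]])
        show "smooth_on R (\<lambda>z. ?G (g z))"
          by (rule smooth_on_compose[OF d(7) smooth_on_subset[OF g]]) (auto simp: R_def S1_def)
        show "(\<lambda>z. ?G (g z)) ` R \<subseteq> ?O'" by (auto simp: R_def S1_def)
      qed
      then have "smooth_on R F"
      proof (rule smooth_on_cong)
        fix z assume "z \<in> R"
        then obtain \<eta> y where z: "z = (\<eta>, y)" "(\<eta>, y) \<in> R" by (cases z) auto
        from key[OF z(2)] obtain q where q: "y = snd c q" "q \<in> fst c" "q \<in> fst d"
          "act (torus_exp \<eta>) q \<in> fst d'" by auto
        show "?T' (?G (g z)) = F z"
          unfolding z(1) q(1) gz[OF q(2)] Gz[OF q(3)] F
          using q inj[OF c(1)] inj[OF d(2)] by (simp add: local_expr_at)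
      qed
      ultimately show ?thesis using R by blast
    qed
    have "open D" by (subst open_subopen) (use loc in meson)
    moreover have "D \<subseteq> UNIV \<times> snd c ` fst c" unfolding D by auto
    ultimately have "openin (top_of_set (UNIV \<times> snd c ` fst c)) D"
      by (metis Int_absorb1 openin_open_Int)
    then show ?thesis using smooth_on_local[OF loc] by simp
  qed
  then show ?thesis unfolding smooth_torus_action_def case_prod_beta Let_def
    using grp by simp
qed

text \<open>Form, fundamental fields and differentials transform by the same linear map, so one
  chart around each point decides the equations in all charts.\<close>

lemma hamiltonian_actionI:
  assumes act: "smooth_torus_action UNIV A act" and form: "two_form UNIV A (carrier_of A) \<omega>"
    and ham: "\<And>\<xi>. \<exists>\<mu>. \<forall>p\<in>carrier_of A. \<exists>c\<in>A. p \<in> fst c \<and>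
       (\<exists>S. open S \<and> snd c p \<in> S \<and> smooth_on S (local_expr c \<mu>)) \<and>
       (\<forall>u. \<omega> c (snd c p) (fundamental_field act c \<xi> p) u = differential c \<mu> p u)"
    and iso: "\<And>\<xi> \<eta> p. p \<in> carrier_of A \<Longrightarrow> \<exists>c\<in>A. p \<in> fst c \<and>
       \<omega> c (snd c p) (fundamental_field act c \<xi> p) (fundamental_field act c \<eta> p) = 0"
  shows "hamiltonian_action UNIV A \<omega> act"
proof -
  have tl: "\<omega> c (snd c p) u v = \<omega> c' (snd c' p) (differential c (snd c') p u) (differential c (snd c') p v)"
    if "c \<in> A" "c' \<in> A" "p \<in> fst c" "p \<in> fst c'" for c c' p u v
    by (rule form[unfolded two_form_def model_space_UNIV, THEN conjunct2, rule_format])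
      (use that in \<open>auto simp: carrier_of_def\<close>)
  have "\<exists>\<mu>. smooth_fun A \<mu> \<and>
        (\<forall>c\<in>A. \<forall>p\<in>fst c. \<forall>u. \<omega> c (snd c p) (fundamental_field act c \<xi> p) u = differential c \<mu> p u)" for \<xi>
  proof -
    obtain \<mu> where \<mu>: "\<And>p. p \<in> carrier_of A \<Longrightarrow> \<exists>c\<in>A. p \<in> fst c \<and>
       (\<exists>S. open S \<and> snd c p \<in> S \<and> smooth_on S (local_expr c \<mu>)) \<and>
       (\<forall>u. \<omega> c (snd c p) (fundamental_field act c \<xi> p) u = differential c \<mu> p u)"
      using ham[of \<xi>] by auto
    have "smooth_fun A \<mu>"
    proof (rule smooth_funI)
      fix p assume "p \<in> carrier_of A"
      from \<mu>[OF this] obtain c S where c: "c \<in> A" "p \<in> fst c" "open S" "snd c p \<in> S" "smooth_on S (local_expr c \<mu>)"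
        by meson
      then show "\<exists>c\<in>A. p \<in> fst c \<and> (\<exists>S. open S \<and> snd c p \<in> S \<and> smooth_on S (local_expr c \<mu>))"
        by (intro bexI[of _ c] conjI exI[of _ S]) 
    qed
    moreover have "\<omega> c (snd c p) (fundamental_field act c \<xi> p) u = differential c \<mu> p u"
      if c: "c \<in> A" "p \<in> fst c" for c p u
    proof -
      have "p \<in> carrier_of A" using c by (auto simp: carrier_of_def)
      from \<mu>[OF this] obtain d S where d: "d \<in> A" "p \<in> fst d" "open S" "snd d p \<in> S" "smooth_on S (local_expr d \<mu>)"
        "\<And>u. \<omega> d (snd d p) (fundamental_field act d \<xi> p) u = differential d \<mu> p u" by meson
      have "\<omega> c (snd c p) (fundamental_field act c \<xi> p) u = differential d \<mu> p (differential c (snd d) p u)"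
        unfolding tl[OF c(1) d(1) c(2) d(2)] fundamental_field_transform[OF act c(1) d(1) c(2) d(2), symmetric] d(6) ..
      also have "\<dots> = differential c \<mu> p u"
        using smooth_on_has_derivative[OF d(5,3,4)]
        by (intro differential_chain'[symmetric] c d) (auto simp: differentiable_def)
      finally show ?thesis .
    qed
    ultimately show ?thesis by meson
  qed
  moreover have "\<omega> c (snd c p) (fundamental_field act c \<xi> p) (fundamental_field act c \<eta> p) = 0"
    if c: "c \<in> A" "p \<in> fst c" for c p \<xi> \<eta>
  proof -
    have "p \<in> carrier_of A" using c by (auto simp: carrier_of_def)
    from iso[OF this] obtain d where d: "d \<in> A" "p \<in> fst d"
        "\<omega> d (snd d p) (fundamental_field act d \<xi> p) (fundamental_field act d \<eta> p) = 0" by meson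
    show ?thesis
      unfolding tl[OF c(1) d(1) c(2) d(2)] fundamental_field_transform[OF act c(1) d(1) c(2) d(2), symmetric] by (rule d(3))
  qed
  ultimately show ?thesis unfolding hamiltonian_action_def by simp
qed

end


section \<open>The profile function on the cap\<close>

text \<open>\<open>flat 0\<close> is the classical function exp (-1/x), extended by zero. The powers
  of 1/x make the family closed under differentiation, so one induction yields smoothness of all
  members.\<close>

definition flat :: "nat \<Rightarrow> real \<Rightarrow> real" where
  "flat k x = (if x > 0 then inverse x ^ k / exp (inverse x) else 0)"

lemma flat_tendsto_0: "(flat k \<longlongrightarrow> 0) (at 0)"
proof -
  have "((\<lambda>x::real. inverse x ^ k / exp (inverse x)) \<longlongrightarrow> 0) (at_right 0)"
    by (rule filterlim_compose[OF tendsto_power_div_exp_0 filterlim_inverse_at_top_right])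
  then have "(flat k \<longlongrightarrow> 0) (at_right 0)"
    by (rule tendsto_cong[THEN iffD1, rotated])
       (auto simp: flat_def eventually_at_right_field intro!: exI[of _ 1])
  moreover have "(flat k \<longlongrightarrow> 0) (at_left 0)"
    by (rule tendsto_cong[THEN iffD1, OF _ tendsto_const])
       (auto simp: flat_def eventually_at_left_field intro!: exI[of _ "-1"])
  ultimately show ?thesis by (simp add: filterlim_split_at)
qed

lemma flat_has_derivative:
  "(flat k has_real_derivative - of_nat k * flat (Suc k) x + flat (k + 2) x) (at x)"
proof -
  consider "x > 0" | "x < 0" | "x = 0" by linarith
  then show ?thesis
  proof cases
    case 1
    let ?y = "inverse x"
    have "((\<lambda>y. y ^ k / exp y) has_real_derivative
        (of_nat k * ?y ^ (k - Suc 0) * exp ?y - ?y ^ k * exp ?y) / (exp ?y * exp ?y)) (at ?y)"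
      by (auto intro!: derivative_eq_intros)
    moreover have "(inverse has_real_derivative - (?y ^ Suc (Suc 0))) (at x)"
      using 1 by (intro DERIV_inverse) simp
    ultimately have "((\<lambda>x. inverse x ^ k / exp (inverse x)) has_real_derivative
        (of_nat k * ?y ^ (k - Suc 0) * exp ?y - ?y ^ k * exp ?y) / (exp ?y * exp ?y) * - (?y ^ Suc (Suc 0))) (at x)"
      by (rule DERIV_chain2)
    moreover have "(of_nat k * ?y ^ (k - Suc 0) * exp ?y - ?y ^ k * exp ?y) / (exp ?y * exp ?y) * - (?y ^ Suc (Suc 0)) =
        - of_nat k * (?y ^ Suc k / exp ?y) + ?y ^ (k + 2) / exp ?y"
    proof (cases k)
      case (Suc m)
      have e: "(P * exp ?y - Q * exp ?y) / (exp ?y * exp ?y) = (P - Q) / exp ?y" for P Q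
        by (simp add: left_diff_distrib[symmetric])
      show ?thesis unfolding e Suc by (simp add: diff_divide_distrib algebra_simps)
    qed simp
    ultimately have "((\<lambda>x. inverse x ^ k / exp (inverse x)) has_real_derivative
        - of_nat k * flat (Suc k) x + flat (k + 2) x) (at x)"
      using 1 by (simp add: flat_def)
    then show ?thesis
      by (rule has_field_derivative_transform_within_open[of _ _ _ "{0<..}"]) (use 1 in \<open>auto simp: flat_def\<close>)
  next
    case 2
    have "((\<lambda>x. 0) has_real_derivative - of_nat k * flat (Suc k) x + flat (k + 2) x) (at x)"
      using 2 by (simp add: flat_def)
    then show ?thesis
      by (rule has_field_derivative_transform_within_open[of _ _ _ "{..<0}"]) (use 2 in \<open>auto simp: flat_def\<close>)
  next
    case 3
    \<comment> \<open>At 0 the difference quotient of \<open>flat k\<close> is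
      \<open>flat (Suc k)\<close> itself, which tends to 0.\<close>
    have "(flat (Suc k) \<longlongrightarrow> 0) (at 0)" by (rule flat_tendsto_0)
    moreover have "flat (Suc k) = (\<lambda>y. (flat k y - flat k 0) / (y - 0))"
      by (auto simp: flat_def fun_eq_iff field_simps)
    ultimately show ?thesis unfolding 3 has_field_derivative_iff by (simp add: flat_def)
  qed
qed

lemma smooth_on_flat: "smooth_on UNIV (flat k)"
proof -
  have "Ck_on m UNIV (flat k)" for m
  proof (induction m arbitrary: k)
    case 0
    show ?case using DERIV_isCont[OF flat_has_derivative] by (simp add: continuous_at_imp_continuous_on)
  next
    case (Suc m)
    have "(flat k has_derivative (\<lambda>v. (- of_nat k * flat (Suc k) x + flat (k + 2) x) * v)) (at x)" for x
      using flat_has_derivative[of k x] by (simp add: has_field_derivative_def)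
    moreover have "Ck_on m UNIV (\<lambda>x. (- of_nat k * flat (Suc k) x + flat (k + 2) x) * v)" for v
      by (intro Ck_on_bounded_bilinear[OF bounded_bilinear_mult] Ck_on_add Ck_on_const Suc)
    ultimately show ?case by (intro Ck_on_SucI) auto
  qed
  then show ?thesis by (simp add: smooth_on_def)
qed

lemma flat_nonneg: "flat k x \<ge> 0" and flat_pos: "x > 0 \<Longrightarrow> flat k x > 0" and flat_eq_0: "x \<le> 0 \<Longrightarrow> flat k x = 0"
  by (auto simp: flat_def)

text \<open>Here \<open>\<phi>(h) = 1 / (h + e(r - h))\<close> with \<open>e(x) = exp (-1/x)\<close> for \<open>x > 0\<close> and \<open>e(x) = 0\<close> otherwise.\<close>

lemma cap_profile:
  fixes r \<delta> :: real
  assumes r: "0 < r" "r < \<delta>"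
  obtains \<phi> \<Phi> :: "real \<Rightarrow> real" where "smooth_on {0..\<delta>} \<phi>" "\<And>h. h \<in> {0..\<delta>} \<Longrightarrow> \<phi> h > 0"
    "\<And>h. h \<in> {0..\<delta>} \<Longrightarrow> (\<Phi> has_real_derivative \<phi> h) (at h within {0..\<delta>})" "smooth_on {0..\<delta>} \<Phi>"
    "\<And>h. h \<in> {r..\<delta>} \<Longrightarrow> \<phi> h = 1 / h" "\<And>h. h \<in> {r..\<delta>} \<Longrightarrow> \<Phi> h = ln h"
proof -
  define \<phi> where "\<phi> h = inverse (h + flat 0 (r - h))" for h
  have pos: "h + flat 0 (r - h) > 0" if "h \<in> {0..\<delta>}" for h
  proof (cases "h > 0")
    case True then show ?thesis using flat_nonneg[of 0 "r - h"] by linarith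
  next
    case False then have "h = 0" using that by simp
    then show ?thesis using flat_pos[of r 0] r by simp
  qed
  have sm: "smooth_on {0..\<delta>} \<phi>"
    unfolding \<phi>_def
  proof (rule smooth_on_inverse)
    show "smooth_on {0..\<delta>} (\<lambda>h. h + flat 0 (r - h))"
      by (intro smooth_on_add smooth_on_id smooth_on_compose[OF smooth_on_flat] smooth_on_diff smooth_on_const) auto
  qed (use pos in \<open>auto simp: less_imp_neq[symmetric]\<close>)
  obtain \<Psi> where \<Psi>: "\<And>h. h \<in> {0..\<delta>} \<Longrightarrow> (\<Psi> has_vector_derivative \<phi> h) (at h within {0..\<delta>})"
    using antiderivative_continuous[OF smooth_on_imp_continuous_on[OF sm]] by metis
  \<comment> \<open>The constant is fixed by \<Phi>(r) = ln r. Beyond r the derivatives of \<Phi>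
    and ln agree, hence so do the functions.\<close>
  define \<Phi> where "\<Phi> h = \<Psi> h - \<Psi> r + ln r" for h
  have d: "(\<Phi> has_real_derivative \<phi> h) (at h within {0..\<delta>})" if "h \<in> {0..\<delta>}" for h
    using \<Psi>[OF that] unfolding \<Phi>_def has_real_derivative_iff_has_vector_derivative
    by (auto intro!: derivative_eq_intros)
  have out: "\<phi> h = 1 / h" if "h \<in> {r..\<delta>}" for h
    using that flat_eq_0[of "r - h" 0] by (simp add: \<phi>_def inverse_eq_divide)
  have "\<exists>c. \<forall>h\<in>{r..\<delta>}. \<Phi> h - ln h = c"
  proof (rule has_field_derivative_zero_constant)
    fix h assume h: "h \<in> {r..\<delta>}"
    have "(\<Phi> has_real_derivative 1 / h) (at h within {r..\<delta>})"
      using d[of h] out[OF h] h r by (auto intro: DERIV_subset)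
    moreover have "(ln has_real_derivative 1 / h) (at h within {r..\<delta>})"
      using h r by (auto intro!: derivative_eq_intros)
    ultimately have "((\<lambda>h. \<Phi> h - ln h) has_real_derivative 1 / h - 1 / h) (at h within {r..\<delta>})"
      by (rule DERIV_diff)
    then show "((\<lambda>h. \<Phi> h - ln h) has_real_derivative 0) (at h within {r..\<delta>})" by simp
  qed auto
  then obtain c where c: "\<And>h. h \<in> {r..\<delta>} \<Longrightarrow> \<Phi> h - ln h = c" by auto
  from c[of r] r have "c = 0" by (simp add: \<Phi>_def)
  with c have "\<Phi> h = ln h" if "h \<in> {r..\<delta>}" for h using that by auto
  moreover have "smooth_on {0..\<delta>} \<Phi>"
  proof (rule smooth_on_SucI)
    show "(\<Phi> has_derivative (\<lambda>v. \<phi> h * v)) (at h within {0..\<delta>})" if "h \<in> {0..\<delta>}" for h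
      using d[OF that] by (simp add: has_field_derivative_def)
    show "smooth_on {0..\<delta>} (\<lambda>h. \<phi> h * v)" for v by (intro smooth_on_mult sm smooth_on_const)
  qed
  moreover have "\<phi> h > 0" if "h \<in> {0..\<delta>}" for h using pos[OF that] by (simp add: \<phi>_def)
  ultimately show ?thesis using sm d out that by blast
qed


section \<open>Lifting automorphisms of the torus\<close>

text \<open>Cauchy's functional equation: additivity gives homogeneity over the rationals, and by
  continuity the set of scalars for which it holds is closed.\<close>

lemma additive_continuous_linear:
  fixes f :: "'a::real_normed_vector \<Rightarrow> real"
  assumes add: "\<And>x y. f (x + y) = f x + f y" and cont: "continuous_on UNIV f"
  shows "linear f"
proof (rule linearI[OF add])
  fix r x
  have f0: "f 0 = 0" using add[of 0 0] by simp
  have neg: "f (- x) = - f x" for x using add[of x "- x"] f0 by simp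
  have nat: "f (of_nat n *\<^sub>R x) = of_nat n * f x" for n x
    by (induction n) (simp_all add: f0 add scaleR_left_distrib algebra_simps)
  have int: "f (of_int m *\<^sub>R x) = of_int m * f x" for m x
  proof (cases "m \<ge> 0")
    case True then show ?thesis using nat[of "nat m" x] by simp
  next
    case False
    then have "f (- (of_int m *\<^sub>R x)) = - (of_int m * f x)" using nat[of "nat (- m)" x] by simp
    then show ?thesis unfolding neg by simp
  qed
  have rat: "f (q *\<^sub>R x) - q * f x = 0" if q: "q \<in> \<rat>" for q
  proof -
    obtain a b where ab: "q = of_int a / of_int b" "b > 0" using q by (rule Rats_cases')
    have "of_int b * f (q *\<^sub>R x) = f (of_int b *\<^sub>R (q *\<^sub>R x))" by (simp only: int)
    also have "of_int b *\<^sub>R (q *\<^sub>R x) = of_int a *\<^sub>R x" using ab by simp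
    also have "f \<dots> = of_int b * (q * f x)" using ab by (simp only: int) simp
    finally show ?thesis using ab(2) by simp
  qed
  have "continuous_on UNIV (\<lambda>r. f (r *\<^sub>R x) - r * f x)"
    by (intro continuous_intros continuous_on_compose2[OF cont]) auto
  then have "closed {r. f (r *\<^sub>R x) - r * f x = 0}"
    using continuous_closed_preimage_constant[of UNIV "\<lambda>r. f (r *\<^sub>R x) - r * f x" 0] by simp
  moreover have "\<rat> \<subseteq> {r. f (r *\<^sub>R x) - r * f x = 0}" using rat by auto
  ultimately have "closure \<rat> \<subseteq> {r. f (r *\<^sub>R x) - r * f x = 0}" by (rule closure_minimal[rotated])
  then show "f (r *\<^sub>R x) = r *\<^sub>R f x" by (auto simp: Rats_closure_real)
qed

text \<open>The domain is contractible, so u has a continuous logarithm. Its imaginary part,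
  normalised at 0, is additive up to multiples of 2 pi, and connectedness removes this
  ambiguity.\<close>

lemma circle_character_lift:
  fixes u :: "real^'n \<Rightarrow> complex"
  assumes cont: "continuous_on UNIV u" and norm: "\<And>x. norm (u x) = 1"
    and hom: "\<And>x y. u (x + y) = u x * u y"
  obtains f where "linear f" "\<And>x. u x = cis (f x)"
proof -
  have nz: "u x \<noteq> 0" for x using norm[of x] by auto
  obtain g where g: "continuous_on UNIV g" "\<And>x. u x = exp (g x)"
    using continuous_logarithm_on_contractible[OF cont contractible_UNIV] nz by auto
  have cis: "u x = cis (Im (g x))" for x
  proof -
    have "exp (Re (g x)) = 1" using norm[of x] by (simp add: g(2))
    then show ?thesis unfolding g(2) exp_eq_polar by simp
  qed
  have one: "u 0 = 1" using hom[of 0 0] nz[of 0] by simp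
  define f where "f x = Im (g x) - Im (g 0)" for x
  have f: "u x = cis (f x)" for x
    unfolding f_def cis_divide[symmetric] using cis[of x] cis[of 0] one by simp
  have fc: "continuous_on UNIV f" unfolding f_def by (intro continuous_intros g(1))
  \<comment> \<open>The defect of additivity in units of 2 pi: integer valued and continuous, hence
    constant, and zero at the origin because f vanishes there.\<close>
  define k where "k z = (f (fst z + snd z) - f (fst z) - f (snd z)) / (2 * pi)" for z
  have kc: "continuous_on UNIV k" unfolding k_def
    by (intro continuous_intros continuous_on_compose2[OF fc]) auto
  have kI: "k z \<in> \<int>" for z
  proof -
    have "cis (f (fst z + snd z) - f (fst z) - f (snd z)) = 1"
      using hom[of "fst z" "snd z"] nz f by (simp add: cis_divide[symmetric])
    then obtain n :: int where "f (fst z + snd z) - f (fst z) - f (snd z) = of_int n * (2 * pi)"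
      unfolding complex_eq_iff by (auto simp: cos_one_2pi_int)
    then show ?thesis by (simp add: k_def)
  qed
  have "k constant_on UNIV"
  proof (rule continuous_discrete_range_constant[OF connected_UNIV kc])
    show "\<exists>e>0. \<forall>y. y \<in> UNIV \<and> k y \<noteq> k x \<longrightarrow> e \<le> norm (k y - k x)" for x
    proof (intro exI[of _ 1] conjI allI impI)
      fix y assume y: "y \<in> UNIV \<and> k y \<noteq> k x"
      have "k y - k x \<in> \<int>" using kI by (intro Ints_diff) auto
      then show "1 \<le> norm (k y - k x)" using y by (simp add: Ints_nonzero_abs_ge1)
    qed simp
  qed
  then obtain K where K: "\<And>z. k z = K" unfolding constant_on_def by auto
  have "k z = k (0, 0)" for z unfolding K[of z] K[of "(0, 0)"] ..
  moreover have "k (0, 0) = 0" by (simp add: k_def f_def)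
  ultimately have k0: "k (x, y) = 0" for x y by simp
  have "f (x + y) = f x + f y" for x y using k0[of x y] by (simp add: k_def)
  then have "linear f" by (rule additive_continuous_linear[OF _ fc])
  then show ?thesis using that f by auto
qed

text \<open>Each coordinate of \<tau> after \<open>torus_exp\<close> is a continuous character of
  the Lie algebra, so it has a linear lift. This linearises the splitting of the local model, and
  velocities of orbits can be computed.\<close>

lemma torus_automorphism_lift:
  assumes "torus_automorphism \<tau>"
  obtains L where "linear L" "\<And>\<xi>. \<tau> (torus_exp \<xi>) = torus_exp (L \<xi>)"
proof -
  have \<tau>: "continuous_on (torus UNIV) \<tau>" "\<And>t. t \<in> torus UNIV \<Longrightarrow> \<tau> t \<in> torus UNIV"
    "\<And>s t. s \<in> torus UNIV \<Longrightarrow> t \<in> torus UNIV \<Longrightarrow> \<tau> (s * t) = \<tau> s * \<tau> t"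
    using assms by (auto simp: torus_automorphism_def bij_betw_def)
  have T: "torus_exp \<xi> \<in> torus UNIV" for \<xi> by (simp add: torus_exp_in_torus)
  have ce: "continuous_on UNIV torus_exp" unfolding torus_exp_def
    by (intro continuous_on_vec_lambda continuous_intros)
  have "\<exists>f. linear f \<and> (\<forall>\<xi>. \<tau> (torus_exp \<xi>) $ i = cis (f \<xi>))" for i
  proof -
    have a: "continuous_on UNIV (\<lambda>\<xi>. \<tau> (torus_exp \<xi>) $ i)"
      by (intro continuous_on_component continuous_on_compose2[OF \<tau>(1) ce]) (use T in auto)
    have b: "norm (\<tau> (torus_exp \<xi>) $ i) = 1" for \<xi>
      using \<tau>(2)[OF T] by (simp add: torus_def)
    have c: "\<tau> (torus_exp (\<xi> + \<eta>)) $ i = \<tau> (torus_exp \<xi>) $ i * \<tau> (torus_exp \<eta>) $ i" for \<xi> \<eta>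
      by (simp add: torus_exp_add \<tau>(3)[OF T T])
    from circle_character_lift[OF a b c] obtain f where
      "linear f" "\<And>\<xi>. \<tau> (torus_exp \<xi>) $ i = cis (f \<xi>)" by blast
    then show ?thesis by (intro exI[of _ f]) simp
  qed
  then obtain f where f: "\<And>i. linear (f i)" "\<And>i \<xi>. \<tau> (torus_exp \<xi>) $ i = cis (f i \<xi>)" by metis
  have "linear (\<lambda>\<xi>. \<chi> i. f i \<xi>)"
    by (rule linearI) (simp_all add: vec_eq_iff linear_add[OF f(1)] linear_scale[OF f(1)])
  moreover have "\<tau> (torus_exp \<xi>) = torus_exp (\<chi> i. f i \<xi>)" for \<xi>
    unfolding vec_eq_iff f(2) by (simp add: torus_exp_def)
  ultimately show ?thesis by (rule that)
qed


section \<open>Top powers of block forms\<close>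

context
  fixes k :: "'n::finite" and B :: "'v \<Rightarrow> 'v \<Rightarrow> real" and v :: "'n + 'n \<Rightarrow> 'v"
  assumes block: "\<And>j j'. j \<in> {Inl k, Inr k} \<Longrightarrow> j' \<notin> {Inl k, Inr k} \<Longrightarrow> B (v j) (v j') = 0 \<and> B (v j') (v j) = 0"
    and alt: "B (v (Inl k)) (v (Inl k)) = 0" "B (v (Inr k)) (v (Inr k)) = 0"
      "B (v (Inr k)) (v (Inl k)) = - B (v (Inl k)) (v (Inr k))"
begin

definition pair_term :: "('n + 'n \<Rightarrow> 'n + 'n) \<Rightarrow> real" where
  "pair_term \<sigma> = of_int (sign \<sigma>) * (\<Prod>i\<in>UNIV. B (v (\<sigma> (Inl i))) (v (\<sigma> (Inr i))))"

text \<open>Exchanges pair i with pair k. Being a product of two transpositions of the same kind it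
  is even, also for i = k.\<close>

definition move_pair :: "'n \<Rightarrow> 'n + 'n \<Rightarrow> 'n + 'n" where
  "move_pair i = Transposition.transpose (Inl i) (Inl k) \<circ> Transposition.transpose (Inr i) (Inr k)"

text \<open>Records whether the two members of a pair are exchanged; its sign is compensated by
  skewness of B on the plane of index k.\<close>

definition flip_pair :: "'n \<Rightarrow> bool \<Rightarrow> 'n + 'n \<Rightarrow> 'n + 'n" where
  "flip_pair i e = (if e then Transposition.transpose (Inl i) (Inr i) else id)"

lemma move_pair_apply:
  "move_pair i (Inl j) = Inl (Transposition.transpose i k j)" "move_pair i (Inr j) = Inr (Transposition.transpose i k j)"
  by (auto simp: move_pair_def Transposition.transpose_def)

lemma move_pair_involutory: "move_pair i (move_pair i x) = x"
  by (cases x) (simp_all add: move_pair_apply)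

lemma flip_pair_involutory: "flip_pair i e (flip_pair i e x) = x"
  by (simp add: flip_pair_def)

lemma flip_pair_other: "j \<noteq> i \<Longrightarrow> flip_pair i e (Inl j) = Inl j" "j \<noteq> i \<Longrightarrow> flip_pair i e (Inr j) = Inr j"
  by (auto simp: flip_pair_def Transposition.transpose_def)

lemma flip_pair_self: "flip_pair i e (Inl i) = (if e then Inr i else Inl i)"
    "flip_pair i e (Inr i) = (if e then Inl i else Inr i)"
  by (auto simp: flip_pair_def)

lemma permutes_move_pair: "move_pair i permutes UNIV"
  unfolding move_pair_def by (intro permutes_compose permutes_swap_id) auto

lemma permutes_flip_pair: "flip_pair i e permutes UNIV"
  unfolding flip_pair_def by (auto intro: permutes_swap_id permutes_id)

lemma sign_move_pair: "sign (move_pair i) = 1"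
  unfolding move_pair_def by (simp add: sign_compose permutation_swap_id sign_swap_id)

lemma sign_flip_pair: "sign (flip_pair i e) = (if e then - 1 else 1)"
  unfolding flip_pair_def by (simp add: sign_swap_id sign_id)

abbreviation "fiber_perms \<equiv> {\<tau>. \<tau> permutes ((- {k}) <+> (- {k}))}"

lemma fiber_perms_fix: "\<tau> \<in> fiber_perms \<Longrightarrow> \<tau> (Inl k) = Inl k" "\<tau> \<in> fiber_perms \<Longrightarrow> \<tau> (Inr k) = Inr k"
  by (auto simp: permutes_def)

lemma fiber_perms_UNIV: "\<tau> \<in> fiber_perms \<Longrightarrow> \<tau> permutes UNIV"
  by (auto intro: permutes_subset)

text \<open>The result depends neither on i nor on e: moving the pair is an even permutation, and
  the sign of the flip cancels the sign from exchanging the two plane vectors in B.\<close>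

lemma pair_term_compose:
  assumes \<tau>: "\<tau> \<in> fiber_perms"
  shows "pair_term (\<tau> \<circ> move_pair i \<circ> flip_pair i e) =
    B (v (Inl k)) (v (Inr k)) * (of_int (sign \<tau>) * (\<Prod>j\<in>- {k}. B (v (\<tau> (Inl j))) (v (\<tau> (Inr j)))))"
proof -
  let ?s = "\<tau> \<circ> move_pair i \<circ> flip_pair i e"
  have p: "permutation \<tau>" "permutation (move_pair i)" "permutation (flip_pair i e)"
    using fiber_perms_UNIV[OF \<tau>] permutes_move_pair permutes_flip_pair finite by (auto simp: permutation_permutes)
  have sg: "sign ?s = sign \<tau> * (if e then - 1 else 1)"
    by (simp only: sign_compose[OF permutation_compose[OF p(1,2)] p(3)] sign_compose[OF p(1,2)] sign_move_pair sign_flip_pair mult_1_right)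
  have "(\<Prod>j\<in>UNIV. B (v (?s (Inl j))) (v (?s (Inr j)))) =
      B (v (?s (Inl i))) (v (?s (Inr i))) * (\<Prod>j\<in>UNIV - {i}. B (v (?s (Inl j))) (v (?s (Inr j))))"
    by (rule prod.remove) auto
  also have "B (v (?s (Inl i))) (v (?s (Inr i))) = (if e then - 1 else 1) * B (v (Inl k)) (v (Inr k))"
    using fiber_perms_fix[OF \<tau>] alt(3) by (simp add: flip_pair_self move_pair_apply)
  also have "(\<Prod>j\<in>UNIV - {i}. B (v (?s (Inl j))) (v (?s (Inr j)))) =
      (\<Prod>j\<in>UNIV - {i}. B (v (\<tau> (Inl (Transposition.transpose i k j)))) (v (\<tau> (Inr (Transposition.transpose i k j)))))"
    by (rule prod.cong) (auto simp: flip_pair_other move_pair_apply)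
  also have "\<dots> = (\<Prod>j\<in>- {k}. B (v (\<tau> (Inl j))) (v (\<tau> (Inr j))))"
    by (rule prod.reindex_bij_witness[of _ "Transposition.transpose i k" "Transposition.transpose i k"]) (auto simp: transpose_eq_iff)
  finally show ?thesis unfolding pair_term_def sg by simp
qed

text \<open>This is the identity (\<alpha> + \<beta>)^n = n \<alpha>^(n-1) \<and> \<beta> for a form
  \<beta> on a plane orthogonal to the remaining vectors. In the sum over permutations only those
  survive that keep the two plane vectors in one common pair.\<close>

lemma wedge_power_block:
  "wedge_power UNIV B v = of_nat (CARD('n)) * B (v (Inl k)) (v (Inr k)) * wedge_power (- {k}) B v"
proof -
  let ?b = "B (v (Inl k)) (v (Inr k))"
  let ?W = "\<Sum>\<tau>\<in>fiber_perms. of_int (sign \<tau>) * (\<Prod>j\<in>- {k}. B (v (\<tau> (Inl j))) (v (\<tau> (Inr j))))"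
  define P where "P = {\<sigma> :: 'n + 'n \<Rightarrow> 'n + 'n. \<sigma> permutes UNIV \<and> (\<exists>i. {\<sigma> (Inl i), \<sigma> (Inr i)} = {Inl k, Inr k})}"
  have fin: "finite {\<sigma> :: 'n + 'n \<Rightarrow> 'n + 'n. \<sigma> permutes UNIV}" by (simp add: finite_permutations)
  \<comment> \<open>If the plane vectors are separated, one factor pairs the first of them with a
    vector outside the plane and vanishes.\<close>
  have zero: "pair_term \<sigma> = 0" if "\<sigma> \<in> {\<sigma>. \<sigma> permutes UNIV} - P" for \<sigma>
  proof -
    have \<sigma>: "\<sigma> permutes UNIV" "\<And>i. {\<sigma> (Inl i), \<sigma> (Inr i)} \<noteq> {Inl k, Inr k}" using that by (auto simp: P_def)
    have inj: "inj \<sigma>" and surj: "surj \<sigma>" using \<sigma>(1) by (auto simp: permutes_inj permutes_surj)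
    obtain x where x: "\<sigma> x = Inl k" using surj by (metis surjD)
    obtain i where i: "x = Inl i \<or> x = Inr i" by (cases x) auto
    have "B (v (\<sigma> (Inl i))) (v (\<sigma> (Inr i))) = 0"
    proof (cases "x = Inl i")
      case True
      then have a: "\<sigma> (Inl i) = Inl k" using x by simp
      then have "\<sigma> (Inr i) \<noteq> Inl k" using inj by (metis injD sum.distinct(1))
      moreover have "\<sigma> (Inr i) \<noteq> Inr k" using \<sigma>(2)[of i] a by auto
      ultimately show ?thesis using block[of "Inl k" "\<sigma> (Inr i)"] a by simp
    next
      case False
      then have a: "\<sigma> (Inr i) = Inl k" using x i by simp
      then have "\<sigma> (Inl i) \<noteq> Inl k" using inj by (metis injD sum.distinct(1))
      moreover have "\<sigma> (Inl i) \<noteq> Inr k" using \<sigma>(2)[of i] a by auto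
      ultimately show ?thesis using block[of "Inl k" "\<sigma> (Inl i)"] a by simp
    qed
    then have "(\<Prod>i\<in>UNIV. B (v (\<sigma> (Inl i))) (v (\<sigma> (Inr i)))) = 0" by (intro prod_zero) auto
    then show ?thesis by (simp add: pair_term_def)
  qed
  have "(\<Sum>\<sigma> | \<sigma> permutes UNIV. pair_term \<sigma>) = (\<Sum>\<sigma>\<in>P. pair_term \<sigma>)"
    by (rule sum.mono_neutral_right[OF fin]) (use zero in \<open>auto simp: P_def\<close>)
  \<comment> \<open>A surviving permutation amounts to the position i of the plane pair, its
    orientation e, and a permutation \<tau> of the fiber indices. The two witness functions are the
    decomposition and its inverse.\<close>
  also have "\<dots> = (\<Sum>(i, e, \<tau>)\<in>UNIV \<times> UNIV \<times> fiber_perms. pair_term (\<tau> \<circ> move_pair i \<circ> flip_pair i e))"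
  proof (rule sum.reindex_bij_witness[symmetric,
      of _ "\<lambda>\<sigma>. let i = (THE i. {\<sigma> (Inl i), \<sigma> (Inr i)} = {Inl k, Inr k}); e = (\<sigma> (Inl i) = Inr k) in (i, e, \<sigma> \<circ> flip_pair i e \<circ> move_pair i)"
      "\<lambda>(i, e, \<tau>). \<tau> \<circ> move_pair i \<circ> flip_pair i e"])
    fix z :: "'n \<times> bool \<times> ('n + 'n \<Rightarrow> 'n + 'n)" assume z: "z \<in> UNIV \<times> UNIV \<times> fiber_perms"
    obtain i e \<tau> where ze: "z = (i, e, \<tau>)" by (cases z)
    then have \<tau>: "\<tau> \<in> fiber_perms" using z by simp
    let ?s = "\<tau> \<circ> move_pair i \<circ> flip_pair i e"
    have s: "?s permutes UNIV"
      by (intro permutes_compose permutes_flip_pair permutes_move_pair fiber_perms_UNIV \<tau>)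
    have si: "?s (Inl i) = (if e then Inr k else Inl k)" "?s (Inr i) = (if e then Inl k else Inr k)"
      using fiber_perms_fix[OF \<tau>] by (auto simp: flip_pair_self move_pair_apply)
    have the: "(THE i. {?s (Inl i), ?s (Inr i)} = {Inl k, Inr k}) = i"
    proof (rule the_equality)
      show "{?s (Inl i), ?s (Inr i)} = {Inl k, Inr k}" unfolding si by auto
      fix j assume "{?s (Inl j), ?s (Inr j)} = {Inl k, Inr k}"
      then have "?s (Inl j) = Inl k \<or> ?s (Inl j) = Inr k" by blast
      then have "?s (Inl j) = ?s (Inl i) \<or> ?s (Inl j) = ?s (Inr i)" unfolding si by (cases e) auto
      then show "j = i" unfolding inj_eq[OF permutes_inj[OF s]] by simp
    qed
    have e: "(?s (Inl i) = Inr k) = e" unfolding si by simp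
    have "?s \<circ> flip_pair i e \<circ> move_pair i = \<tau>"
      by (simp add: fun_eq_iff flip_pair_involutory move_pair_involutory)
    then show "(let i = (THE i. {(case z of (i, e, \<tau>) \<Rightarrow> \<tau> \<circ> move_pair i \<circ> flip_pair i e) (Inl i), (case z of (i, e, \<tau>) \<Rightarrow> \<tau> \<circ> move_pair i \<circ> flip_pair i e) (Inr i)} = {Inl k, Inr k});
          e = ((case z of (i, e, \<tau>) \<Rightarrow> \<tau> \<circ> move_pair i \<circ> flip_pair i e) (Inl i) = Inr k)
        in (i, e, (case z of (i, e, \<tau>) \<Rightarrow> \<tau> \<circ> move_pair i \<circ> flip_pair i e) \<circ> flip_pair i e \<circ> move_pair i)) = z"
      unfolding ze prod.case Let_def the e by simp
    have "{?s (Inl i), ?s (Inr i)} = {Inl k, Inr k}" unfolding si by auto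
    then show "(case z of (i, e, \<tau>) \<Rightarrow> \<tau> \<circ> move_pair i \<circ> flip_pair i e) \<in> P"
      using s unfolding P_def ze prod.case by blast
    show "pair_term (case z of (i, e, \<tau>) \<Rightarrow> \<tau> \<circ> move_pair i \<circ> flip_pair i e) = (case z of (i, e, \<tau>) \<Rightarrow> pair_term (\<tau> \<circ> move_pair i \<circ> flip_pair i e))"
      unfolding ze by simp
  next
    fix \<sigma> assume \<sigma>: "\<sigma> \<in> P"
    define i where "i = (THE i. {\<sigma> (Inl i), \<sigma> (Inr i)} = {Inl k, Inr k})"
    define e where "e = (\<sigma> (Inl i) = Inr k)"
    have perm: "\<sigma> permutes UNIV" using \<sigma> by (simp add: P_def)
    have inj: "inj \<sigma>" using perm by (rule permutes_inj)
    obtain j where j: "{\<sigma> (Inl j), \<sigma> (Inr j)} = {Inl k, Inr k}" using \<sigma> by (auto simp: P_def)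
    have uniq: "j' = j" if j': "{\<sigma> (Inl j'), \<sigma> (Inr j')} = {Inl k, Inr k}" for j'
    proof -
      have "\<sigma> (Inl j') \<in> {\<sigma> (Inl j), \<sigma> (Inr j)}" using j j' by blast
      then show ?thesis using inj by (auto dest: injD)
    qed
    have "i = j" unfolding i_def by (rule the_equality, rule j, rule uniq)
    with j have ii: "{\<sigma> (Inl i), \<sigma> (Inr i)} = {Inl k, Inr k}" by simp
    let ?t = "\<sigma> \<circ> flip_pair i e \<circ> move_pair i"
    have tp: "?t permutes UNIV"
      by (intro permutes_compose permutes_flip_pair permutes_move_pair perm)
    have "(\<sigma> (Inl i) = Inl k \<and> \<sigma> (Inr i) = Inr k) \<or> (\<sigma> (Inl i) = Inr k \<and> \<sigma> (Inr i) = Inl k)"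
      using ii by (simp add: doubleton_eq_iff)
    then have \<sigma>i: "\<sigma> (Inl i) = (if e then Inr k else Inl k)" "\<sigma> (Inr i) = (if e then Inl k else Inr k)"
      unfolding e_def by (metis sum.distinct(1))+
    have "?t (Inl k) = \<sigma> (flip_pair i e (Inl i))" "?t (Inr k) = \<sigma> (flip_pair i e (Inr i))"
      by (simp_all add: move_pair_apply)
    then have t: "?t (Inl k) = Inl k" "?t (Inr k) = Inr k"
      unfolding flip_pair_self using \<sigma>i by (cases e; simp)+
    have "?t \<in> fiber_perms"
    proof -
      have "\<forall>x. x \<notin> (- {k}) <+> (- {k}) \<longrightarrow> ?t x = x"
      proof (intro allI impI)
        fix x :: "'n + 'n" assume "x \<notin> (- {k}) <+> (- {k})"
        then have "x = Inl k \<or> x = Inr k" by (cases x) auto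
        then show "?t x = x" using t by auto
      qed
      then show ?thesis using tp unfolding permutes_def by blast
    qed
    moreover have "?t \<circ> move_pair i \<circ> flip_pair i e = \<sigma>"
      by (simp add: fun_eq_iff flip_pair_involutory move_pair_involutory)
    ultimately show "(let i = (THE i. {\<sigma> (Inl i), \<sigma> (Inr i)} = {Inl k, Inr k}); e = (\<sigma> (Inl i) = Inr k) in (i, e, \<sigma> \<circ> flip_pair i e \<circ> move_pair i)) \<in> UNIV \<times> UNIV \<times> fiber_perms"
      "(case (let i = (THE i. {\<sigma> (Inl i), \<sigma> (Inr i)} = {Inl k, Inr k}); e = (\<sigma> (Inl i) = Inr k) in (i, e, \<sigma> \<circ> flip_pair i e \<circ> move_pair i)) of (i, e, \<tau>) \<Rightarrow> \<tau> \<circ> move_pair i \<circ> flip_pair i e) = \<sigma>"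
      unfolding Let_def i_def[symmetric] e_def[symmetric] by simp_all
  qed
  also have "\<dots> = (\<Sum>(i :: 'n, e :: bool, \<tau>)\<in>UNIV \<times> UNIV \<times> fiber_perms.
      ?b * (of_int (sign \<tau>) * (\<Prod>j\<in>- {k}. B (v (\<tau> (Inl j))) (v (\<tau> (Inr j))))))"
    by (rule sum.cong) (auto simp: pair_term_compose)
  also have "\<dots> = of_nat CARD('n) * (2 * (?b * ?W))"
    by (simp add: sum.cartesian_product[symmetric] sum_distrib_left)
  finally have eq: "(\<Sum>\<sigma> | \<sigma> permutes UNIV. pair_term \<sigma>) = of_nat CARD('n) * (2 * (?b * ?W))" .
  \<comment> \<open>The two orientations contribute a factor 2, which is absorbed by passing from
    2^n to 2^(n-1) in the normalisation; the n positions remain as the factor n.\<close>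
  have pow: "(2::real) ^ CARD('n) = 2 * 2 ^ card (- {k})"
  proof -
    have "CARD('n) = Suc (card (- {k}))"
      using card_Suc_Diff1[of UNIV k] by (simp add: Compl_eq_Diff_UNIV)
    then show ?thesis by simp
  qed
  have u: "UNIV <+> UNIV = (UNIV :: ('n + 'n) set)" by (simp add: UNIV_Plus_UNIV)
  show ?thesis unfolding wedge_power_def u pair_term_def[symmetric] eq pow by simp
qed

end


section \<open>Polar coordinates\<close>

text \<open>The branch of the argument with values in (a, a + 2 pi). Rotation by -(a + pi) carries
  the ray at angle a to the cut of \<open>Ln\<close>, so the branch is smooth on the complement of
  that ray, which is \<open>slit a\<close>.\<close>

definition angle :: "real \<Rightarrow> complex \<Rightarrow> real" where
  "angle a z = a + pi + Im (Ln (z * cis (- (a + pi))))"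

definition slit :: "real \<Rightarrow> complex set" where
  "slit a = {z. z * cis (- (a + pi)) \<notin> \<real>\<^sub>\<le>\<^sub>0}"

lemma polar_rotate: "of_real r * cis \<theta> * cis (- (a + pi)) = of_real r * cis (\<theta> - (a + pi))"
  by (simp only: mult.assoc cis_mult add_uminus_conv_diff)

lemma angle_polar:
  assumes "r > 0" "a < \<theta>" "\<theta> < a + 2 * pi"
  shows "angle a (of_real r * cis \<theta>) = \<theta>"
proof -
  let ?t = "\<theta> - (a + pi)"
  have "of_real r * cis ?t = exp (of_real (ln r) + \<i> * of_real ?t)"
    using assms(1) by (simp add: exp_add cis_conv_exp exp_of_real)
  moreover have "Ln (exp (of_real (ln r) + \<i> * of_real ?t)) = of_real (ln r) + \<i> * of_real ?t"
    using assms by (intro Ln_exp) auto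
  ultimately have "Im (Ln (of_real r * cis ?t)) = ?t" by simp
  then show ?thesis unfolding angle_def polar_rotate by simp
qed

lemma polar_in_slit:
  assumes "r > 0" "a < \<theta>" "\<theta> < a + 2 * pi"
  shows "of_real r * cis \<theta> \<in> slit a"
proof -
  let ?t = "\<theta> - (a + pi)"
  have t: "\<bar>?t\<bar> < pi" using assms by auto
  have "of_real r * cis ?t \<notin> \<real>\<^sub>\<le>\<^sub>0"
  proof
    assume "of_real r * cis ?t \<in> \<real>\<^sub>\<le>\<^sub>0"
    then have *: "r * cos ?t \<le> 0" "r * sin ?t = 0" by (simp_all add: complex_nonpos_Reals_iff)
    from *(2) have "?t = 0" using assms(1) sin_eq_0_pi[of ?t] t by auto
    with *(1) assms(1) show False by simp
  qed
  then show ?thesis unfolding slit_def mem_Collect_eq polar_rotate .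
qed

lemma slit_polar:
  assumes "z \<in> slit a"
  shows "z \<noteq> 0" "a < angle a z" "angle a z < a + 2 * pi" "z = of_real (norm z) * cis (angle a z)"
proof -
  define u where "u = z * cis (- (a + pi))"
  have u: "u \<notin> \<real>\<^sub>\<le>\<^sub>0" using assms by (simp add: slit_def u_def)
  then have u0: "u \<noteq> 0" by auto
  then show "z \<noteq> 0" by (auto simp: u_def)
  have im: "- pi < Im (Ln u)" "Im (Ln u) < pi"
    using mpi_less_Im_Ln[OF u0] Im_Ln_less_pi[OF u] by auto
  then show "a < angle a z" "angle a z < a + 2 * pi" by (simp_all add: angle_def u_def)
  have "u = of_real (norm u) * cis (Im (Ln u))"
    using exp_Ln[OF u0] exp_eq_polar[of "Ln u"] u0 by (simp add: exp_of_real[symmetric] Re_Ln)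
  moreover have "norm u = norm z" by (simp add: u_def norm_mult)
  moreover have "z = u * cis (a + pi)" by (simp add: u_def mult.assoc cis_mult)
  ultimately have "z = of_real (norm z) * (cis (Im (Ln u)) * cis (a + pi))" by (metis mult.assoc)
  then show "z = of_real (norm z) * cis (angle a z)"
    unfolding cis_mult by (simp add: angle_def u_def add.commute)
qed

lemma open_slit: "open (slit a)"
proof -
  have "open ((\<lambda>z. z * cis (- (a + pi))) -` (- \<real>\<^sub>\<le>\<^sub>0))"
    by (intro open_vimage continuous_intros open_Compl closed_nonpos_Reals_complex)
  then show ?thesis by (simp add: slit_def vimage_def)
qed

lemma smooth_on_angle: "smooth_on (slit a) (angle a)"
  unfolding angle_def
  by (intro smooth_on_add smooth_on_const smooth_on_bounded_linear_compose[OF bounded_linear_Im]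
      smooth_on_Ln smooth_on_mult smooth_on_id) (simp add: slit_def)

lemma slit_unit_circle:
  assumes "norm w = 1"
  shows "w \<in> cis ` {a<..<a + 2 * pi} \<longleftrightarrow> w \<in> slit a"
proof
  assume "w \<in> cis ` {a<..<a + 2 * pi}"
  then show "w \<in> slit a" using polar_in_slit[of 1 a] by auto
next
  assume "w \<in> slit a"
  from slit_polar[OF this] assms show "w \<in> cis ` {a<..<a + 2 * pi}" by auto
qed

text \<open>Replaces the description operator in \<open>cyl_chart\<close> by a function that is
  known to be smooth.\<close>

lemma the_angle:
  assumes "norm w = 1" "w \<in> slit a"
  shows "(THE \<theta>. \<theta> \<in> {a<..<a + 2 * pi} \<and> cis \<theta> = w) = angle a w"
proof (rule the_equality)
  show "angle a w \<in> {a<..<a + 2 * pi} \<and> cis (angle a w) = w"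
    using slit_polar[OF assms(2)] assms(1) by simp
  show "\<theta> = angle a w" if "\<theta> \<in> {a<..<a + 2 * pi} \<and> cis \<theta> = w" for \<theta>
    using angle_polar[of 1 a \<theta>] that by auto
qed

lemma slit_exists:
  assumes "z \<noteq> 0"
  obtains a where "z \<in> slit a"
proof -
  have "z = of_real (norm z) * cis (Arg z)" using rcis_cmod_Arg[of z] by (simp add: rcis_def)
  moreover have "of_real (norm z) * cis (Arg z) \<in> slit (Arg z - pi)"
    using assms by (intro polar_in_slit) auto
  ultimately show ?thesis using that by metis
qed

lemma slit_scale: "r > 0 \<Longrightarrow> of_real r * w \<in> slit a \<longleftrightarrow> w \<in> slit a"
proof -
  assume r: "r > 0"
  have "of_real r * u \<in> \<real>\<^sub>\<le>\<^sub>0 \<longleftrightarrow> u \<in> \<real>\<^sub>\<le>\<^sub>0" for u :: complex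
    using r by (auto simp: complex_nonpos_Reals_iff mult_le_0_iff)
  then show ?thesis by (simp only: slit_def mem_Collect_eq mult.assoc)
qed

lemma angle_scale:
  assumes "r > 0" "w \<in> slit a"
  shows "angle a (of_real r * w) = angle a w"
proof -
  have w: "w = of_real (norm w) * cis (angle a w)" "w \<noteq> 0" using slit_polar[OF assms(2)] by auto
  have e: "of_real r * w = of_real (r * norm w) * cis (angle a w)" using w(1) by (metis mult.assoc of_real_mult)
  show ?thesis unfolding e by (rule angle_polar) (use slit_polar[OF assms(2)] assms(1) w(2) in auto)
qed


section \<open>Splitting off two coordinates\<close>

text \<open>Together with \<open>drop_coord k\<close> this splits the coordinate space into fiber
  coordinates and one complex number. The same two slots hold (h, \<theta>) on the cylinder and sqrt
  (2h) cis \<theta> on the cap.\<close>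

definition zpart :: "'n::finite \<Rightarrow> 'n coords \<Rightarrow> complex" where
  "zpart k y = Complex (y $ Inl k) (y $ Inr k)"

definition cpart :: "'n::finite \<Rightarrow> complex \<Rightarrow> 'n coords" where
  "cpart k z = axis (Inl k) (Re z) + axis (Inr k) (Im z)"

lemma zpart_simps [simp]: "Re (zpart k y) = y $ Inl k" "Im (zpart k y) = y $ Inr k"
  by (simp_all add: zpart_def)

lemma cpart_nth: "cpart k z $ j = (if j = Inl k then Re z else if j = Inr k then Im z else 0)"
  by (auto simp: cpart_def axis_def)

lemma drop_coord_nth: "drop_coord k y $ j = (if j = Inl k \<or> j = Inr k then 0 else y $ j)"
  by (simp add: drop_coord_def)

lemma linear_drop_coord: "linear (drop_coord k)"
  by (rule linearI) (simp_all add: vec_eq_iff drop_coord_nth)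

lemma linear_zpart: "linear (zpart k)"
  by (rule linearI) (simp_all add: complex_eq_iff)

lemma linear_cpart: "linear (cpart k)"
  by (rule linearI) (simp_all add: vec_eq_iff cpart_nth)

lemmas bounded_linear_parts =
  linear_conv_bounded_linear[THEN iffD1, OF linear_drop_coord]
  linear_conv_bounded_linear[THEN iffD1, OF linear_zpart]
  linear_conv_bounded_linear[THEN iffD1, OF linear_cpart]

lemma drop_coord_in_model_space: "drop_coord k y \<in> model_space (- {k})"
  by (simp add: model_space_def drop_coord_nth)

lemma drop_coord_model_space: "x \<in> model_space (- {k}) \<Longrightarrow> drop_coord k x = x"
  by (auto simp: model_space_def vec_eq_iff drop_coord_nth)

lemma zpart_model_space: "x \<in> model_space (- {k}) \<Longrightarrow> zpart k x = 0"
  by (simp add: model_space_def complex_eq_iff)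

lemma drop_coord_cpart [simp]: "drop_coord k (cpart k z) = 0"
  by (simp add: vec_eq_iff drop_coord_nth cpart_nth)

lemma zpart_cpart [simp]: "zpart k (cpart k z) = z"
  by (simp add: complex_eq_iff cpart_nth)

lemma zpart_drop_coord [simp]: "zpart k (drop_coord k y) = 0"
  by (simp add: complex_eq_iff drop_coord_nth)

lemma drop_coord_idem [simp]: "drop_coord k (drop_coord k y) = drop_coord k y"
  by (simp add: vec_eq_iff drop_coord_nth)

lemma drop_coord_add_cpart: "x \<in> model_space (- {k}) \<Longrightarrow> drop_coord k (x + cpart k z) = x"
  by (simp add: linear_add[OF linear_drop_coord] drop_coord_model_space)

lemma zpart_add_cpart: "x \<in> model_space (- {k}) \<Longrightarrow> zpart k (x + cpart k z) = z"
  by (simp add: linear_add[OF linear_zpart] zpart_model_space)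

lemma drop_add_cpart_zpart: "drop_coord k y + cpart k (zpart k y) = y"
  by (auto simp: vec_eq_iff drop_coord_nth cpart_nth)

lemma open_drop_zpart:
  assumes "openin (top_of_set (model_space (- {k}))) S" "open T"
  shows "open {y. drop_coord k y \<in> S \<and> zpart k y \<in> T}"
proof -
  obtain R where R: "open R" "S = model_space (- {k}) \<inter> R" using assms(1) by (metis openin_open)
  have "{y. drop_coord k y \<in> S \<and> zpart k y \<in> T} = (drop_coord k -` R) \<inter> (zpart k -` T)"
    using R(2) drop_coord_in_model_space by auto
  then show ?thesis
    using R(1) assms(2) by (auto intro!: open_Int open_vimage linear_continuous_on bounded_linear_parts)
qed

lemma continuous_map_locally:
  assumes "\<And>p. p \<in> topspace X \<Longrightarrow> \<exists>N. openin X N \<and> p \<in> N \<and> continuous_map (subtopology X N) Y f"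
  shows "continuous_map X Y f"
  unfolding continuous_map_def
proof (intro conjI allI impI)
  show "f \<in> topspace X \<rightarrow> topspace Y"
  proof
    fix p assume p: "p \<in> topspace X"
    then obtain N where N: "openin X N" "p \<in> N" "continuous_map (subtopology X N) Y f" using assms by metis
    then show "f p \<in> topspace Y" using p unfolding continuous_map_def topspace_subtopology by auto
  qed
  fix U assume U: "openin Y U"
  show "openin X {x \<in> topspace X. f x \<in> U}"
  proof (subst openin_subopen, intro ballI)
    fix p assume p: "p \<in> {x \<in> topspace X. f x \<in> U}"
    then obtain N where N: "openin X N" "p \<in> N" "continuous_map (subtopology X N) Y f" using assms by auto
    have "openin (subtopology X N) {x \<in> topspace (subtopology X N). f x \<in> U}"
      using N(3) U unfolding continuous_map_def by simp
    then have "openin X {x \<in> topspace (subtopology X N). f x \<in> U}"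
      using N(1) openin_open_subtopology by blast
    moreover have "p \<in> {x \<in> topspace (subtopology X N). f x \<in> U}" using p N(2) by simp
    moreover have "{x \<in> topspace (subtopology X N). f x \<in> U} \<subseteq> {x \<in> topspace X. f x \<in> U}" by auto
    ultimately show "\<exists>T. openin X T \<and> p \<in> T \<and> T \<subseteq> {x \<in> topspace X. f x \<in> U}" by metis
  qed
qed


section \<open>The local model\<close>

text \<open>One component with its model. The region X enters only later, so these facts apply to
  each adjacent component separately.\<close>

locale collar =
  fixes k :: "'n::finite" and M :: "('a, 'n) atlas" and Z :: "'a set" and \<omega> :: "('a, 'n) form2"
    and act :: "complex^'n \<Rightarrow> 'a \<Rightarrow> 'a" and Z' :: "'a set" and L :: "('a, 'x, 'n) local_model"
  assumes M_charts: "atlas_charts UNIV M" and M_Hausdorff: "Hausdorff_space (mtop M)"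
    and model: "is_local_model k M Z \<omega> act Z' L"
begin

abbreviation "F \<equiv> fiber L"
abbreviation "\<epsilon> \<equiv> width L"
abbreviation "W \<equiv> nbhd L"
abbreviation "xx p \<equiv> fst (emb L p)"
abbreviation "ww p \<equiv> fst (snd (emb L p))"
abbreviation "hh p \<equiv> snd (snd (emb L p))"
abbreviation "cyl \<equiv> cyl_chart k \<epsilon>"
abbreviation "G \<equiv> inv_into W (emb L)"
abbreviation "cylinder \<equiv> carrier_of F \<times> sphere 0 1 \<times> {- \<epsilon><..<\<epsilon>}"

sublocale M: univ_atlas M by unfold_locales (rule M_charts)

lemma fiber_toric: "compact_symplectic_toric (- {k}) F (fiber_form L) (fiber_act L)"
  and width_pos: "\<epsilon> > 0" and coef_nonzero: "coef L \<noteq> 0" and nbhd_open: "openin (mtop M) W" 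
  and Z'_sub: "Z' \<subseteq> W" and nbhd_Z: "W \<inter> Z = Z'"
  and emb_bij: "bij_betw (emb L) W cylinder"
  and Z'_iff: "\<And>p. p \<in> W \<Longrightarrow> p \<in> Z' \<longleftrightarrow> hh p = 0"
  using model by (auto simp: is_local_model_def)

lemma fiber_charts: "atlas_charts (- {k}) F" and fiber_Hausdorff: "Hausdorff_space (mtop F)"
  and fiber_compact: "compact_space (mtop F)" and fiber_connected: "connected_space (mtop F)"
  using fiber_toric by (auto simp: compact_symplectic_toric_def smooth_manifold_iff)

lemma fiber_inj: "d \<in> F \<Longrightarrow> inj_on (snd d) (fst d)"
  and fiber_open: "d \<in> F \<Longrightarrow> openin (top_of_set (model_space (- {k}))) (snd d ` fst d)"
  using fiber_charts by (auto simp: atlas_charts_def)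

lemma fiber_model_space: "d \<in> F \<Longrightarrow> x \<in> fst d \<Longrightarrow> snd d x \<in> model_space (- {k})"
  using openin_imp_subset[OF fiber_open] by blast

lemma emb_mem:
  assumes "p \<in> W"
  shows "xx p \<in> carrier_of F" "norm (ww p) = 1" "- \<epsilon> < hh p" "hh p < \<epsilon>"
proof -
  have "emb L p \<in> cylinder" using emb_bij assms by (auto simp: bij_betw_def)
  then show "xx p \<in> carrier_of F" "norm (ww p) = 1" "- \<epsilon> < hh p" "hh p < \<epsilon>"
    by (auto simp: mem_Times_iff)
qed

lemma G_emb: "p \<in> W \<Longrightarrow> G (emb L p) = p"
  using emb_bij by (simp add: bij_betw_def)

lemma emb_G: "y \<in> cylinder \<Longrightarrow> emb L (G y) = y" and G_mem: "y \<in> cylinder \<Longrightarrow> G y \<in> W"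
  using emb_bij by (auto simp: bij_betw_def f_inv_into_f inv_into_into)

lemma cyl_dom: "w \<in> sphere 0 1 \<Longrightarrow> (x, w, h) \<in> fst (cyl d a) \<longleftrightarrow> x \<in> fst d \<and> w \<in> slit a \<and> - \<epsilon> < h \<and> h < \<epsilon>"
  using slit_unit_circle[of w a] by (auto simp: cyl_chart_def)

lemma cyl_dom_emb: "p \<in> W \<Longrightarrow> emb L p \<in> fst (cyl d a) \<longleftrightarrow> xx p \<in> fst d \<and> ww p \<in> slit a"
  using cyl_dom[of "ww p" "xx p" "hh p" d a] emb_mem[of p] by simp

lemma cyl_apply: "norm w = 1 \<Longrightarrow> w \<in> slit a \<Longrightarrow>
    snd (cyl d a) (x, w, h) = snd d x + cpart k (Complex h (angle a w))"
  using the_angle[of w a] by (simp add: cyl_chart_def cpart_def)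

lemma cyl_emb: "p \<in> W \<Longrightarrow> ww p \<in> slit a \<Longrightarrow>
    snd (cyl d a) (emb L p) = snd d (xx p) + cpart k (Complex (hh p) (angle a (ww p)))"
  using cyl_apply[of "ww p" a d "xx p" "hh p"] emb_mem[of p] by simp

lemma cyl_mem: "d \<in> F \<Longrightarrow> cyl d a \<in> cyl_atlas k \<epsilon> F"
  unfolding cyl_atlas_def by (rule CollectI, rule exI[of _ d], rule exI[of _ a]) simp

lemma emb_smooth:
  assumes "c \<in> M" "d \<in> F"
  shows "open (snd c ` {p \<in> fst c \<inter> W. emb L p \<in> fst (cyl d a)})"
    "smooth_on (snd c ` {p \<in> fst c \<inter> W. emb L p \<in> fst (cyl d a)}) (local_expr c (snd (cyl d a) \<circ> emb L))"
proof -
  have "smooth_map M (cyl_atlas k \<epsilon> F) W (emb L)" using model by (simp add: is_local_model_def)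
  then have *: "openin (top_of_set (snd c ` fst c)) (snd c ` {p \<in> fst c \<inter> W. emb L p \<in> fst (cyl d a)})"
    "smooth_on (snd c ` {p \<in> fst c \<inter> W. emb L p \<in> fst (cyl d a)}) (local_expr c (snd (cyl d a) \<circ> emb L))"
    using assms(1) cyl_mem[OF assms(2), of a] unfolding smooth_map_def case_prod_beta by simp_all
  show "open (snd c ` {p \<in> fst c \<inter> W. emb L p \<in> fst (cyl d a)})"
    using *(1) M.open_chart_image[OF assms(1)] openin_open_eq by blast
  show "smooth_on (snd c ` {p \<in> fst c \<inter> W. emb L p \<in> fst (cyl d a)}) (local_expr c (snd (cyl d a) \<circ> emb L))"
    by (rule *(2))
qed

text \<open>\<open>smooth_map\<close> provides openness only relative to a chart image; this makes
  it absolute for the inverse of the embedding.\<close>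

lemma cyl_image_open: "d \<in> F \<Longrightarrow> open (snd (cyl d a) ` fst (cyl d a))"
proof -
  assume d: "d \<in> F"
  have e: "snd (cyl d a) ` fst (cyl d a) =
    {y. drop_coord k y \<in> snd d ` fst d \<and> zpart k y \<in> {z. - \<epsilon> < Re z \<and> Re z < \<epsilon> \<and> a < Im z \<and> Im z < a + 2 * pi}}" (is "?A = ?B")
  proof
    show "?A \<subseteq> ?B"
    proof
      fix y assume "y \<in> ?A"
      then obtain x \<theta> h where y: "x \<in> fst d" "a < \<theta>" "\<theta> < a + 2 * pi" "- \<epsilon> < h" "h < \<epsilon>"
        "y = snd (cyl d a) (x, cis \<theta>, h)" by (auto simp: cyl_chart_def)
      have "cis \<theta> \<in> slit a" "angle a (cis \<theta>) = \<theta>"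
        using polar_in_slit[of 1 a \<theta>] angle_polar[of 1 a \<theta>] y by auto
      then have "y = snd d x + cpart k (Complex h \<theta>)" using y(6) cyl_apply[of "cis \<theta>" a d x h] by simp
      then have "drop_coord k y = snd d x" "zpart k y = Complex h \<theta>"
        using fiber_model_space[OF d y(1)] by (simp_all add: drop_coord_add_cpart zpart_add_cpart)
      then show "y \<in> ?B" using y by (simp del: zpart_simps)
    qed
    show "?B \<subseteq> ?A"
    proof
      fix y assume yB: "y \<in> ?B"
      then obtain x where x: "x \<in> fst d" "drop_coord k y = snd d x" by auto
      let ?h = "y $ Inl k" and ?t = "y $ Inr k"
      have t: "a < ?t" "?t < a + 2 * pi" and h: "- \<epsilon> < ?h" "?h < \<epsilon>" using yB by auto
      have "cis ?t \<in> slit a" "angle a (cis ?t) = ?t"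
        using polar_in_slit[of 1 a ?t] angle_polar[of 1 a ?t] t by auto
      then have "snd (cyl d a) (x, cis ?t, ?h) = snd d x + cpart k (Complex ?h ?t)"
        using cyl_apply[of "cis ?t" a d x ?h] by simp
      also have "\<dots> = y" using drop_add_cpart_zpart[of k y] x(2) by (simp add: zpart_def)
      finally have "y = snd (cyl d a) (x, cis ?t, ?h)" ..
      moreover have "(x, cis ?t, ?h) \<in> fst (cyl d a)" using x t h by (auto simp: cyl_chart_def)
      ultimately show "y \<in> ?A" by (rule image_eqI)
    qed
  qed
  have o: "open {z. - \<epsilon> < Re z \<and> Re z < \<epsilon> \<and> a < Im z \<and> Im z < a + 2 * pi}"
    by (intro open_Collect_conj open_Collect_less continuous_intros)
  show ?thesis unfolding e by (rule open_drop_zpart[OF fiber_open[OF d] o])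
qed

lemma cyl_inj: "d \<in> F \<Longrightarrow> inj_on (snd (cyl d a)) (fst (cyl d a))"
proof (rule inj_onI)
  fix y y' assume d: "d \<in> F" and y: "y \<in> fst (cyl d a)" "y' \<in> fst (cyl d a)" and eq: "snd (cyl d a) y = snd (cyl d a) y'"
  obtain x \<theta> h where y1: "y = (x, cis \<theta>, h)" "x \<in> fst d" "a < \<theta>" "\<theta> < a + 2 * pi" using y(1) by (auto simp: cyl_chart_def)
  obtain x' \<theta>' h' where y2: "y' = (x', cis \<theta>', h')" "x' \<in> fst d" "a < \<theta>'" "\<theta>' < a + 2 * pi" using y(2) by (auto simp: cyl_chart_def)
  have s: "cis \<theta> \<in> slit a" "angle a (cis \<theta>) = \<theta>" "cis \<theta>' \<in> slit a" "angle a (cis \<theta>') = \<theta>'"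
    using polar_in_slit[of 1 a] angle_polar[of 1 a] y1 y2 by auto
  have "snd d x + cpart k (Complex h \<theta>) = snd d x' + cpart k (Complex h' \<theta>')"
    using eq s by (simp add: y1(1) y2(1) cyl_apply)
  then have "drop_coord k (snd d x + cpart k (Complex h \<theta>)) = drop_coord k (snd d x' + cpart k (Complex h' \<theta>'))"
    "zpart k (snd d x + cpart k (Complex h \<theta>)) = zpart k (snd d x' + cpart k (Complex h' \<theta>'))" by auto
  then have "snd d x = snd d x'" "Complex h \<theta> = Complex h' \<theta>'"
    using fiber_model_space[OF d] y1(2) y2(2) by (simp_all add: drop_coord_add_cpart zpart_add_cpart)
  then show "y = y'" using fiber_inj[OF d] y1 y2 by (auto simp: inj_on_def)
qed

lemma G_smooth:
  assumes "c \<in> M" "d \<in> F"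
  shows "open (snd (cyl d a) ` {y \<in> fst (cyl d a). G y \<in> fst c})"
    "smooth_on (snd (cyl d a) ` {y \<in> fst (cyl d a). G y \<in> fst c}) (local_expr (cyl d a) (snd c \<circ> G))"
proof -
  have sm: "smooth_map (cyl_atlas k \<epsilon> F) M (carrier_of (cyl_atlas k \<epsilon> F)) G" using model by (simp add: is_local_model_def)
  have e: "fst (cyl d a) \<inter> carrier_of (cyl_atlas k \<epsilon> F) = fst (cyl d a)"
    using cyl_mem[OF assms(2), of a] by (auto simp: carrier_of_def)
  have *: "openin (top_of_set (snd (cyl d a) ` fst (cyl d a))) (snd (cyl d a) ` {y \<in> fst (cyl d a). G y \<in> fst c})"
    "smooth_on (snd (cyl d a) ` {y \<in> fst (cyl d a). G y \<in> fst c}) (local_expr (cyl d a) (snd c \<circ> G))"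
    using sm[unfolded smooth_map_def case_prod_beta prod.collapse, THEN bspec, OF cyl_mem[OF assms(2), of a], THEN bspec, OF assms(1)]
    unfolding e by simp_all
  show "open (snd (cyl d a) ` {y \<in> fst (cyl d a). G y \<in> fst c})"
    using *(1) cyl_image_open[OF assms(2), of a] openin_open_eq by blast
  show "smooth_on (snd (cyl d a) ` {y \<in> fst (cyl d a). G y \<in> fst c}) (local_expr (cyl d a) (snd c \<circ> G))" 
    by (rule *(2))
qed

lemma cyl_nbhd:
  assumes p: "p \<in> W"
  obtains N d a where "openin (mtop M) N" "p \<in> N" "N \<subseteq> W" "d \<in> F" "\<And>q. q \<in> N \<Longrightarrow> xx q \<in> fst d"
    "\<And>q. q \<in> N \<Longrightarrow> ww q \<in> slit a" "continuous_map (subtopology (mtop M) N) euclidean (\<lambda>q. snd (cyl d a) (emb L q))"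
proof -
  have "p \<in> carrier_of M" using p openin_subset[OF nbhd_open] by auto
  then obtain c where c: "c \<in> M" "p \<in> fst c" by (auto simp: carrier_of_def)
  obtain d where d: "d \<in> F" "xx p \<in> fst d" using emb_mem(1)[OF p] by (auto simp: carrier_of_def)
  have "ww p \<noteq> 0" using emb_mem(2)[OF p] by auto
  then obtain a where a: "ww p \<in> slit a" by (rule slit_exists)
  let ?N = "{p \<in> fst c \<inter> W. emb L p \<in> fst (cyl d a)}"
  let ?S = "snd c ` ?N" and ?f = "local_expr c (snd (cyl d a) \<circ> emb L)"
  have S: "open ?S" "smooth_on ?S ?f" by (rule emb_smooth[OF c(1) d(1)])+
  have NS: "?N = {q \<in> fst c. snd c q \<in> ?S}"
    using M.inj[OF c(1)] by (auto simp: inj_on_def)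
  have N: "openin (mtop M) ?N" by (subst NS) (rule openin_mtop_basic[OF c(1) S(1)])
  have "continuous_map (subtopology (mtop M) ?N) (top_of_set ?S) (snd c)"
  proof -
    have "continuous_map (subtopology (mtop M) ?N) euclidean (snd c)"
      by (rule continuous_map_from_subtopology_mono[OF continuous_map_chart[OF c(1)]]) auto
    then show ?thesis by (auto simp: continuous_map_in_subtopology)
  qed
  moreover have "continuous_map (top_of_set ?S) euclidean ?f"
    using smooth_on_imp_continuous_on[OF S(2)] by simp
  ultimately have "continuous_map (subtopology (mtop M) ?N) euclidean (?f \<circ> snd c)"
    by (rule continuous_map_compose)
  then have K: "continuous_map (subtopology (mtop M) ?N) euclidean (\<lambda>q. snd (cyl d a) (emb L q))"
    by (rule continuous_map_eq) (use M.inj[OF c(1)] in \<open>auto simp: local_expr_at\<close>)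
  have pN: "p \<in> ?N" and NW: "?N \<subseteq> W" using c p d a by (auto simp: cyl_dom_emb)
  have xw: "xx q \<in> fst d" "ww q \<in> slit a" if "q \<in> ?N" for q using that cyl_dom_emb[of q d a] by auto
  show ?thesis by (rule that[OF N pN NW d(1) xw(1) xw(2) K])
qed

text \<open>The model supplies smoothness only in cylinder charts. Locally h and the angle are the
  two extra coordinates, the circle point is \<open>cis\<close> of the angle, and the fiber point
  comes from the remaining coordinates through a fiber chart.\<close>

lemma continuous_hh: "continuous_map (subtopology (mtop M) W) euclidean (\<lambda>p. hh p)"
  and continuous_ww: "continuous_map (subtopology (mtop M) W) euclidean (\<lambda>p. ww p)"
  and continuous_xx: "continuous_map (subtopology (mtop M) W) (mtop F) (\<lambda>p. xx p)"
proof -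
  have "\<exists>N. openin (subtopology (mtop M) W) N \<and> p \<in> N \<and>
      continuous_map (subtopology (subtopology (mtop M) W) N) euclidean (\<lambda>p. hh p) \<and>
      continuous_map (subtopology (subtopology (mtop M) W) N) euclidean (\<lambda>p. ww p) \<and>
      continuous_map (subtopology (subtopology (mtop M) W) N) (mtop F) (\<lambda>p. xx p)" if p: "p \<in> W" for p
  proof -
    obtain N d a where N: "openin (mtop M) N" "p \<in> N" "N \<subseteq> W" "d \<in> F" "\<And>q. q \<in> N \<Longrightarrow> xx q \<in> fst d"
        "\<And>q. q \<in> N \<Longrightarrow> ww q \<in> slit a"
      and K: "continuous_map (subtopology (mtop M) N) euclidean (\<lambda>q. snd (cyl d a) (emb L q))"
      by (rule cyl_nbhd[OF p]) (rule that)
    let ?K = "\<lambda>q. snd (cyl d a) (emb L q)" and ?X = "subtopology (mtop M) N"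
    have e: "subtopology (subtopology (mtop M) W) N = ?X"
      using N(3) by (simp add: subtopology_subtopology Int_absorb1)
    have top: "topspace ?X = N" using openin_subset[OF N(1)] by auto
    have Kq: "?K q = snd d (xx q) + cpart k (Complex (hh q) (angle a (ww q)))" if "q \<in> N" for q
      using that N cyl_emb[of q a d] by auto
    have ms: "snd d (xx q) \<in> model_space (- {k})" if "q \<in> N" for q
      using N(4,5) that by (intro fiber_model_space)
    have z: "zpart k (?K q) = Complex (hh q) (angle a (ww q))" "drop_coord k (?K q) = snd d (xx q)" if "q \<in> N" for q
      using Kq[OF that] ms[OF that] by (simp_all add: zpart_add_cpart drop_coord_add_cpart)
    have cz: "continuous_map ?X euclidean (\<lambda>q. zpart k (?K q))" "continuous_map ?X euclidean (\<lambda>q. drop_coord k (?K q))"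
      using continuous_map_compose[OF K, of euclidean "zpart k"] continuous_map_compose[OF K, of euclidean "drop_coord k"]
        linear_continuous_on[OF bounded_linear_parts(2), of UNIV k] linear_continuous_on[OF bounded_linear_parts(1), of UNIV k]
      by (simp_all add: o_def)
    have "continuous_map ?X euclidean (\<lambda>q. Re (zpart k (?K q)))"
      using continuous_map_compose[OF cz(1), of euclidean Re] by (simp add: o_def continuous_on_Re continuous_on_id)
    then have h: "continuous_map ?X euclidean (\<lambda>p. hh p)"
      by (rule continuous_map_eq) (unfold top, simp only: z complex.sel)
    have "continuous_map ?X euclidean (\<lambda>q. cis (Im (zpart k (?K q))))"
      using continuous_map_compose[OF cz(1), of euclidean "\<lambda>u. cis (Im u)"]
      by (simp add: o_def continuous_intros)
    then have w: "continuous_map ?X euclidean (\<lambda>p. ww p)"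
    proof (rule continuous_map_eq)
      fix q assume "q \<in> topspace ?X"
      then have q: "q \<in> N" unfolding top .
      then have "norm (ww q) = 1" using N(3) emb_mem by blast
      with slit_polar(4)[OF N(6)[OF q]] show "cis (Im (zpart k (?K q))) = ww q"
        by (simp only: z[OF q] complex.sel) simp
    qed
    have "continuous_map ?X (top_of_set (snd d ` fst d)) (\<lambda>q. drop_coord k (?K q))"
      using cz(2) z(2) N(5) by (auto simp: continuous_map_in_subtopology top)
    from continuous_map_compose[OF this continuous_map_chart_inv[OF fiber_charts N(4)]]
    have "continuous_map ?X (mtop F) (\<lambda>q. inv_into (fst d) (snd d) (drop_coord k (?K q)))" by (simp add: o_def)
    then have x: "continuous_map ?X (mtop F) (\<lambda>p. xx p)"
      by (rule continuous_map_eq) (unfold top, use z(2) N(5) fiber_inj[OF N(4)] in simp)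
    show ?thesis
      using N h w x by (intro exI[of _ N]) (simp add: e openin_subtopology_Int2 openin_subset_topspace_eq openin_open_subtopology[OF nbhd_open])
  qed
  note * = this
  have top: "topspace (subtopology (mtop M) W) = W" using openin_subset[OF nbhd_open] by auto
  show "continuous_map (subtopology (mtop M) W) euclidean (\<lambda>p. hh p)"
  proof (rule continuous_map_locally, unfold top)
    fix p assume "p \<in> W"
    from *[OF this] show "\<exists>N. openin (subtopology (mtop M) W) N \<and> p \<in> N \<and>
      continuous_map (subtopology (subtopology (mtop M) W) N) euclidean (\<lambda>p. hh p)" by fast
  qed
  show "continuous_map (subtopology (mtop M) W) euclidean (\<lambda>p. ww p)"
  proof (rule continuous_map_locally, unfold top)
    fix p assume "p \<in> W"
    from *[OF this] show "\<exists>N. openin (subtopology (mtop M) W) N \<and> p \<in> N \<and>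
      continuous_map (subtopology (subtopology (mtop M) W) N) euclidean (\<lambda>p. ww p)" by fast
  qed
  show "continuous_map (subtopology (mtop M) W) (mtop F) (\<lambda>p. xx p)"
  proof (rule continuous_map_locally, unfold top)
    fix p assume "p \<in> W"
    from *[OF this] show "\<exists>N. openin (subtopology (mtop M) W) N \<and> p \<in> N \<and>
      continuous_map (subtopology (subtopology (mtop M) W) N) (mtop F) (\<lambda>p. xx p)" by fast
  qed
qed

text \<open>Smoothness of the inverse embedding is known in cylinder charts, while compactness and
  connectedness are known in the product topology of fiber, circle and interval. This lemma connects
  the two.\<close>

lemma continuous_G:
  "continuous_map (subtopology (prod_topology (mtop F) euclidean) cylinder) (mtop M) G"
proof (rule continuous_map_locally)
  let ?P = "prod_topology (mtop F) (euclidean :: (complex \<times> real) topology)"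
  let ?C = "subtopology ?P cylinder"
  fix y assume "y \<in> topspace ?C"
  then have y: "y \<in> cylinder" by auto
  obtain x w h where xwh: "y = (x, w, h)" by (cases y)
  have m: "x \<in> carrier_of F" "norm w = 1" "- \<epsilon> < h" "h < \<epsilon>" using y xwh by auto
  obtain d where d: "d \<in> F" "x \<in> fst d" using m(1) by (auto simp: carrier_of_def)
  have "w \<noteq> 0" using m(2) by auto
  then obtain a where a: "w \<in> slit a" by (rule slit_exists)
  have "G y \<in> carrier_of M" using G_mem[OF y] openin_subset[OF nbhd_open] by auto
  then obtain c where c: "c \<in> M" "G y \<in> fst c" by (auto simp: carrier_of_def)
  let ?Q = "snd (cyl d a) ` {y \<in> fst (cyl d a). G y \<in> fst c}" and ?f = "local_expr (cyl d a) (snd c \<circ> G)"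
  have Q: "open ?Q" "smooth_on ?Q ?f" by (rule G_smooth[OF c(1) d(1)])+
  let ?e = "\<lambda>y. snd d (fst y) + cpart k (Complex (snd (snd y)) (angle a (fst (snd y))))"
  define O1 where "O1 = fst d \<times> slit a \<times> (UNIV :: real set)"
  have O1: "openin ?P O1" unfolding O1_def
    by (intro openin_prod_Times_iff[THEN iffD2] disjI2 conjI openin_mtop_domain[OF d(1)])
       (simp add: open_Times open_slit)
  have e_cont: "continuous_map (subtopology ?P O1) euclidean ?e"
  proof -
    have "continuous_map (subtopology ?P O1) (subtopology (mtop F) (fst d)) fst"
      unfolding O1_def by (auto simp: continuous_map_in_subtopology intro: continuous_map_from_subtopology continuous_map_fst)
    from continuous_map_compose[OF this continuous_map_chart[OF d(1)]]
    have c1: "continuous_map (subtopology ?P O1) euclidean (\<lambda>y. snd d (fst y))" by (simp add: o_def)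
    have "continuous_map (subtopology ?P O1) (top_of_set (slit a \<times> UNIV)) snd"
      unfolding O1_def by (auto simp: continuous_map_in_subtopology intro: continuous_map_from_subtopology continuous_map_snd)
    moreover have "continuous_on (slit a \<times> (UNIV :: real set)) (\<lambda>u. cpart k (Complex (snd u) (angle a (fst u))))"
      unfolding Complex_eq
      by (intro linear_continuous_on_compose[OF _ linear_cpart] continuous_intros
          continuous_on_compose2[OF smooth_on_imp_continuous_on[OF smooth_on_angle]]) auto
    ultimately have "continuous_map (subtopology ?P O1) euclidean (\<lambda>y. cpart k (Complex (snd (snd y)) (angle a (fst (snd y)))))"
      using continuous_map_compose[of "subtopology ?P O1" "top_of_set (slit a \<times> UNIV)" snd euclidean "\<lambda>u. cpart k (Complex (snd u) (angle a (fst u)))"]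
      by (simp add: o_def)
    with c1 show ?thesis by (rule continuous_map_add)
  qed
  define O2 where "O2 = {y \<in> O1. ?e y \<in> ?Q}"
  have tO1: "topspace (subtopology ?P O1) = O1" using openin_subset[OF O1] by auto
  have "\<forall>U. openin euclidean U \<longrightarrow> openin (subtopology ?P O1) {y \<in> O1. ?e y \<in> U}"
    using e_cont unfolding continuous_map_def tO1 by blast
  then have "openin (subtopology ?P O1) O2" unfolding O2_def using Q(1) by simp
  then have O2: "openin ?P O2" using openin_open_subtopology[OF O1] by simp
  have eq: "snd (cyl d a) u = ?e u" if "u \<in> O1 \<inter> cylinder" for u
    using that cyl_apply[of "fst (snd u)" a d "fst u" "snd (snd u)"] by (auto simp: O1_def)
  have dom: "u \<in> fst (cyl d a)" if "u \<in> O1 \<inter> cylinder" for u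
    using that cyl_dom[of "fst (snd u)" "fst u" "snd (snd u)" d a] by (auto simp: O1_def)
  have yO1: "y \<in> O1 \<inter> cylinder" using y xwh d a by (auto simp: O1_def)
  have "snd (cyl d a) y \<in> ?Q" using dom[OF yO1] c(2) by blast
  then have "?e y \<in> ?Q" by (simp only: eq[OF yO1])
  then have yO2: "y \<in> O2" using yO1 by (simp add: O2_def)
  have Gu: "G u = inv_into (fst c) (snd c) (?f (?e u))" and fu: "?f (?e u) \<in> snd c ` fst c" if u: "u \<in> O2 \<inter> cylinder" for u
  proof -
    have u1: "u \<in> O1 \<inter> cylinder" using u by (auto simp: O2_def)
    have "snd (cyl d a) u \<in> ?Q" using u eq[OF u1] by (simp add: O2_def)
    then have "G u \<in> fst c" using cyl_inj[OF d(1), of a] dom[OF u1] by (auto simp: inj_on_def)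
    moreover have "?f (?e u) = snd c (G u)"
      unfolding eq[OF u1, symmetric] using cyl_inj[OF d(1), of a] dom[OF u1] by (simp add: local_expr_at)
    ultimately show "G u = inv_into (fst c) (snd c) (?f (?e u))" "?f (?e u) \<in> snd c ` fst c"
      using M.inj[OF c(1)] by auto
  qed
  let ?N = "O2 \<inter> cylinder"
  have sub: "subtopology ?C O2 = subtopology ?P ?N" by (simp add: subtopology_subtopology Int_commute)
  have cyltop: "cylinder \<subseteq> topspace ?P" by auto
  have tN: "topspace (subtopology ?P ?N) = ?N" using cyltop by auto
  have "continuous_map (subtopology ?P ?N) (top_of_set ?Q) ?e"
    using continuous_map_from_subtopology_mono[OF e_cont, of ?N]
    by (auto simp: continuous_map_in_subtopology O2_def)
  moreover have "continuous_map (top_of_set ?Q) euclidean ?f" using smooth_on_imp_continuous_on[OF Q(2)] by simp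
  ultimately have "continuous_map (subtopology ?P ?N) euclidean (?f \<circ> ?e)" by (rule continuous_map_compose)
  then have "continuous_map (subtopology ?P ?N) (top_of_set (snd c ` fst c)) (?f \<circ> ?e)"
    using fu by (auto simp: continuous_map_in_subtopology tN)
  from continuous_map_compose[OF this continuous_map_chart_inv[OF M_charts c(1)]]
  have "continuous_map (subtopology ?P ?N) (mtop M) G"
    by (rule continuous_map_eq) (use Gu in \<open>auto simp: tN\<close>)
  moreover have "openin ?C (O2 \<inter> cylinder)" using O2 by (rule openin_subtopology_Int)
  moreover have "subtopology ?C (O2 \<inter> cylinder) = subtopology ?P ?N"
    by (simp add: subtopology_subtopology Int_commute Int_left_commute)
  ultimately show "\<exists>N. openin ?C N \<and> y \<in> N \<and> continuous_map (subtopology ?C N) (mtop M) G"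
    using yO2 y by (intro exI[of _ ?N]) simp
qed

text \<open>The set is the image of a product of the compact fiber, the circle and [-s, s]. Since M
  is Hausdorff, closed collar pieces are closed in M, which later makes the complement of a collar
  piece open.\<close>

lemma compact_level:
  assumes "s < \<epsilon>"
  shows "compactin (mtop M) {p \<in> W. \<bar>hh p\<bar> \<le> s}"
proof -
  let ?P = "prod_topology (mtop F) (euclidean :: (complex \<times> real) topology)"
  let ?K = "carrier_of F \<times> (sphere 0 1 :: complex set) \<times> {- s..s}"
  have sub: "?K \<subseteq> cylinder" using assms by auto
  have "compactin (mtop F) (carrier_of F)" using fiber_compact by (metis compact_space_def topspace_mtop)
  moreover have "compactin euclidean ((sphere 0 1 :: complex set) \<times> {- s..s})" by (simp add: compact_Times)
  ultimately have "compactin ?P ?K" by (simp add: compactin_Times)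
  then have "compactin (subtopology ?P cylinder) ?K" using sub by (simp add: compactin_subtopology)
  then have "compactin (mtop M) (G ` ?K)" by (rule image_compactin[OF _ continuous_G])
  moreover have "G ` ?K = {p \<in> W. \<bar>hh p\<bar> \<le> s}"
  proof
    show "G ` ?K \<subseteq> {p \<in> W. \<bar>hh p\<bar> \<le> s}"
    proof
      fix p assume "p \<in> G ` ?K"
      then obtain y where y: "p = G y" "y \<in> ?K" by auto
      then have "y \<in> cylinder" using sub by blast
      then show "p \<in> {p \<in> W. \<bar>hh p\<bar> \<le> s}" using y by (auto simp: emb_G G_mem)
    qed
    show "{p \<in> W. \<bar>hh p\<bar> \<le> s} \<subseteq> G ` ?K"
    proof
      fix p assume p: "p \<in> {p \<in> W. \<bar>hh p\<bar> \<le> s}"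
      then have "emb L p \<in> ?K" using emb_mem[of p] by (auto simp: mem_Times_iff abs_le_iff)
      moreover have "p = G (emb L p)" using p G_emb by simp
      ultimately show "p \<in> G ` ?K" by (rule image_eqI[rotated])
    qed
  qed
  ultimately show ?thesis by simp
qed

lemma closed_level: "s < \<epsilon> \<Longrightarrow> closedin (mtop M) {p \<in> W. \<bar>hh p\<bar> \<le> s}"
  using compactin_imp_closedin[OF M_Hausdorff compact_level] .

text \<open>Fiber, circle and interval are connected. This is why two Hamiltonian functions for the
  same field differ by one constant on the whole positive side of a collar.\<close>

lemma connected_positive: "connectedin (mtop M) {p \<in> W. hh p > 0}"
proof -
  let ?P = "prod_topology (mtop F) (euclidean :: (complex \<times> real) topology)"
  let ?K = "carrier_of F \<times> (sphere 0 1 :: complex set) \<times> {0<..<\<epsilon>}"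
  have sub: "?K \<subseteq> cylinder" using width_pos by auto
  have "connectedin (mtop F) (carrier_of F)" using fiber_connected by (metis connectedin_topspace topspace_mtop)
  moreover have "connected ((sphere 0 1 :: complex set) \<times> {0<..<\<epsilon>})"
    by (intro connected_Times connected_sphere) auto
  ultimately have "connectedin ?P ?K" by (simp add: connectedin_Times)
  then have "connectedin (subtopology ?P cylinder) ?K" using sub by (simp add: connectedin_subtopology)
  then have "connectedin (mtop M) (G ` ?K)" by (rule connectedin_continuous_map_image[OF continuous_G])
  moreover have "G ` ?K = {p \<in> W. hh p > 0}"
  proof
    show "G ` ?K \<subseteq> {p \<in> W. hh p > 0}"
    proof
      fix p assume "p \<in> G ` ?K"
      then obtain y where y: "p = G y" "y \<in> ?K" by auto
      then have "y \<in> cylinder" using sub by blast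
      then show "p \<in> {p \<in> W. hh p > 0}" using y by (auto simp: emb_G G_mem)
    qed
    show "{p \<in> W. hh p > 0} \<subseteq> G ` ?K"
    proof
      fix p assume p: "p \<in> {p \<in> W. hh p > 0}"
      then have "emb L p \<in> ?K" using emb_mem[of p] by (auto simp: mem_Times_iff)
      moreover have "p = G (emb L p)" using p G_emb by simp
      ultimately show "p \<in> G ` ?K" by (rule image_eqI[rotated])
    qed
  qed
  ultimately show ?thesis by simp
qed

end


section \<open>Coordinates on the polar cap\<close>

text \<open>The model coordinate h expressed by z, since |z|^2 = 2h. In contrast to sqrt (2h) as a
  function of h, it is smooth at the pole too.\<close>

definition height :: "'n::finite \<Rightarrow> 'n coords \<Rightarrow> real" where
  "height k y = ((y $ Inl k)\<^sup>2 + (y $ Inr k)\<^sup>2) / 2"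

lemma height_zpart: "height k y = (norm (zpart k y))\<^sup>2 / 2"
  by (simp add: height_def cmod_power2)

lemma height_nonneg: "height k y \<ge> 0"
  by (simp add: height_def)

lemma norm_zpart: "norm (zpart k y) = sqrt (2 * height k y)"
  by (simp add: height_zpart)

lemma smooth_on_nth: "smooth_on U (\<lambda>y :: real^'m. y $ i)"
  by (rule smooth_on_bounded_linear[OF bounded_linear_vec_nth])

lemma smooth_on_height: "smooth_on U (height k)"
proof -
  have "smooth_on U (\<lambda>y. (1 / 2) * (y $ Inl k * y $ Inl k + y $ Inr k * y $ Inr k))"
    by (intro smooth_on_mult smooth_on_add smooth_on_nth smooth_on_const)
  then show ?thesis by (rule smooth_on_cong) (simp add: height_def power2_eq_square)
qed

lemma height_has_derivative:
  fixes k :: "'n::finite"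
  shows "(height k has_derivative (\<lambda>u. y $ Inl k * u $ Inl k + y $ Inr k * u $ Inr k)) (at y)"
proof -
  have c: "((\<lambda>y :: 'n coords. y $ j) has_derivative (\<lambda>u. u $ j)) (at y)" for j
    by (rule bounded_linear_imp_has_derivative[OF bounded_linear_vec_nth])
  have "((\<lambda>y. (1 / 2) * (y $ Inl k * y $ Inl k + y $ Inr k * y $ Inr k)) has_derivative
     (\<lambda>u. (1 / 2) * ((y $ Inl k * u $ Inl k + u $ Inl k * y $ Inl k) + (y $ Inr k * u $ Inr k + u $ Inr k * y $ Inr k)))) (at y)"
    by (intro has_derivative_mult_right has_derivative_add has_derivative_mult c)
  moreover have "(\<lambda>y. (1 / 2) * (y $ Inl k * y $ Inl k + y $ Inr k * y $ Inr k)) = height k"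
    by (simp add: height_def fun_eq_iff power2_eq_square)
  moreover have "(\<lambda>u. (1 / 2) * ((y $ Inl k * u $ Inl k + u $ Inl k * y $ Inl k) + (y $ Inr k * u $ Inr k + u $ Inr k * y $ Inr k)))
      = (\<lambda>u. y $ Inl k * u $ Inl k + y $ Inr k * u $ Inr k)"
    by (simp add: fun_eq_iff)
  ultimately show ?thesis by simp
qed

lemma smooth_on_drop: "smooth_on U (drop_coord k)" and smooth_on_zpart: "smooth_on U (zpart k)"
  by (rule smooth_on_bounded_linear[OF bounded_linear_parts(1)] smooth_on_bounded_linear[OF bounded_linear_parts(2)])+

lemma smooth_on_cpart_compose: "smooth_on U g \<Longrightarrow> smooth_on U (\<lambda>x. cpart k (g x))"
  by (rule smooth_on_bounded_linear_compose[OF bounded_linear_parts(3)])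

lemma smooth_on_of_real:
  fixes g :: "'e::real_normed_vector \<Rightarrow> real"
  shows "smooth_on U g \<Longrightarrow> smooth_on U (\<lambda>x. of_real (g x) :: complex)"
  by (rule smooth_on_bounded_linear_compose[OF bounded_linear_of_real])

lemma smooth_on_Complex:
  "smooth_on U f \<Longrightarrow> smooth_on U g \<Longrightarrow> smooth_on U (\<lambda>x. Complex (f x) (g x))"
  unfolding Complex_eq by (intro smooth_on_add smooth_on_mult smooth_on_const smooth_on_of_real)

lemma dir_deriv_drop: "dir_deriv (\<lambda>y. f (drop_coord k y)) x u = dir_deriv f (drop_coord k x) (drop_coord k u)"
  by (rule dir_deriv_cong_eventually)
    (simp add: linear_add[OF linear_drop_coord] linear_scale[OF linear_drop_coord])

text \<open>The coordinate change from (x, h, \<theta>) to (x, z). It and \<open>cyl_of_cap\<close>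
  are smooth only off the pole, which is enough because M and the cap are compared only where h >
  0.\<close>

definition cap_of_cyl :: "'n::finite \<Rightarrow> 'n coords \<Rightarrow> 'n coords" where
  "cap_of_cyl k y = drop_coord k y + cpart k (of_real (sqrt (2 * y $ Inl k)) * cis (y $ Inr k))"

definition cyl_of_cap :: "'n::finite \<Rightarrow> real \<Rightarrow> 'n coords \<Rightarrow> 'n coords" where
  "cyl_of_cap k a y = drop_coord k y + cpart k (Complex (height k y) (angle a (zpart k y)))"

lemma smooth_on_cap_of_cyl: "smooth_on {y. y $ Inl k > 0} (cap_of_cyl k)"
  unfolding cap_of_cyl_def
  by (intro smooth_on_add smooth_on_drop smooth_on_cpart_compose smooth_on_mult smooth_on_of_real smooth_on_sqrt
      smooth_on_cis smooth_on_nth smooth_on_const) auto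

lemma smooth_on_cyl_of_cap: "smooth_on {y. zpart k y \<in> slit a} (cyl_of_cap k a)"
  unfolding cyl_of_cap_def
  by (intro smooth_on_add smooth_on_drop smooth_on_cpart_compose smooth_on_Complex smooth_on_height
      smooth_on_compose[OF smooth_on_angle smooth_on_zpart]) auto

text \<open>This is \<open>dh \<and> d\<theta> = dx \<and> dy\<close>.\<close>

lemma cap_of_cyl_dir_deriv:
  fixes k :: "'n::finite" and y :: "'n coords"
  assumes "y $ Inl k > 0"
  shows "drop_coord k (dir_deriv (cap_of_cyl k) y u) = drop_coord k u"
    and "dir_deriv (cap_of_cyl k) y u $ Inl k * dir_deriv (cap_of_cyl k) y v $ Inr k -
      dir_deriv (cap_of_cyl k) y u $ Inr k * dir_deriv (cap_of_cyl k) y v $ Inl k =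
      u $ Inl k * v $ Inr k - u $ Inr k * v $ Inl k"
proof -
  let ?h = "y $ Inl k" and ?t = "y $ Inr k"
  let ?s = "sqrt (2 * ?h)"
  have s: "?s > 0" "?s * ?s = 2 * ?h" using assms by auto
  have c: "((\<lambda>y :: 'n coords. y $ j) has_derivative (\<lambda>u. u $ j)) (at y)" for j
    by (rule bounded_linear_imp_has_derivative[OF bounded_linear_vec_nth])
  have "(sqrt has_derivative (\<lambda>v. inverse ?s / 2 * v)) (at (2 * ?h))"
    by (rule DERIV_real_sqrt[of "2 * ?h", unfolded has_field_derivative_def]) (use assms in simp)
  from has_derivative_compose[OF has_derivative_mult_right[OF c[of "Inl k"], of 2] this]
  have ds: "((\<lambda>y. sqrt (2 * y $ Inl k)) has_derivative (\<lambda>u. u $ Inl k / ?s)) (at y)"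
    by (simp add: field_simps)
  have dc: "((\<lambda>y. cos (y $ Inr k)) has_derivative (\<lambda>u. - sin ?t * u $ Inr k)) (at y)"
    "((\<lambda>y. sin (y $ Inr k)) has_derivative (\<lambda>u. cos ?t * u $ Inr k)) (at y)"
    by (rule has_derivative_compose[OF c DERIV_cos[unfolded has_field_derivative_def]]
        has_derivative_compose[OF c DERIV_sin[unfolded has_field_derivative_def]])+
  have D: "(cap_of_cyl k has_derivative dir_deriv (cap_of_cyl k) y) (at y)"
  proof (rule smooth_on_has_derivative[OF smooth_on_cap_of_cyl])
    show "open {y :: 'n coords. y $ Inl k > 0}" by (intro open_Collect_less continuous_intros)
  qed (use assms in auto)
  have x: "dir_deriv (cap_of_cyl k) y u $ Inl k = ?s * (- sin ?t * u $ Inr k) + u $ Inl k / ?s * cos ?t" for u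
  proof -
    have "dir_deriv (\<lambda>y. cap_of_cyl k y $ Inl k) y u = ?s * (- sin ?t * u $ Inr k) + u $ Inl k / ?s * cos ?t"
    proof (rule dir_deriv_eq)
      have "(\<lambda>y. cap_of_cyl k y $ Inl k) = (\<lambda>y. sqrt (2 * y $ Inl k) * cos (y $ Inr k))"
        by (simp add: cap_of_cyl_def drop_coord_nth cpart_nth fun_eq_iff)
      then show "((\<lambda>y. cap_of_cyl k y $ Inl k) has_derivative (\<lambda>u. ?s * (- sin ?t * u $ Inr k) + u $ Inl k / ?s * cos ?t)) (at y)"
        using has_derivative_mult[OF ds dc(1)] by simp
    qed
    then show ?thesis unfolding dir_deriv_linear_image[OF bounded_linear_vec_nth D] .
  qed
  have z: "dir_deriv (cap_of_cyl k) y u $ Inr k = ?s * (cos ?t * u $ Inr k) + u $ Inl k / ?s * sin ?t" for u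
  proof -
    have "dir_deriv (\<lambda>y. cap_of_cyl k y $ Inr k) y u = ?s * (cos ?t * u $ Inr k) + u $ Inl k / ?s * sin ?t"
    proof (rule dir_deriv_eq)
      have "(\<lambda>y. cap_of_cyl k y $ Inr k) = (\<lambda>y. sqrt (2 * y $ Inl k) * sin (y $ Inr k))"
        by (simp add: cap_of_cyl_def drop_coord_nth cpart_nth fun_eq_iff)
      then show "((\<lambda>y. cap_of_cyl k y $ Inr k) has_derivative (\<lambda>u. ?s * (cos ?t * u $ Inr k) + u $ Inl k / ?s * sin ?t)) (at y)"
        using has_derivative_mult[OF ds dc(2)] by simp
    qed
    then show ?thesis unfolding dir_deriv_linear_image[OF bounded_linear_vec_nth D] .
  qed
  have "drop_coord k (dir_deriv (cap_of_cyl k) y u) = dir_deriv (\<lambda>y. drop_coord k (cap_of_cyl k y)) y u"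
    by (rule dir_deriv_linear_image[symmetric, OF bounded_linear_parts(1) D])
  also have "(\<lambda>y. drop_coord k (cap_of_cyl k y)) = drop_coord k"
    by (simp add: fun_eq_iff cap_of_cyl_def linear_add[OF linear_drop_coord])
  also have "dir_deriv (drop_coord k) y u = drop_coord k u"
    by (rule dir_deriv_eq[OF bounded_linear_imp_has_derivative[OF bounded_linear_parts(1)]])
  finally show "drop_coord k (dir_deriv (cap_of_cyl k) y u) = drop_coord k u" .
  \<comment> \<open>With s = sqrt (2h) the derivatives of z in h carry the factor 1/s and those in
    \<theta> the factor s, so the determinant reduces to cos^2 + sin^2.\<close>
  have alg: "(s * (- si * u2) + u1 / s * co) * (s * (co * v2) + v1 / s * si) -
      (s * (co * u2) + u1 / s * si) * (s * (- si * v2) + v1 / s * co) = (co * co + si * si) * (u1 * v2 - u2 * v1)"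
    if "s \<noteq> 0" for s co si u1 u2 v1 v2 :: real
    using that by (simp add: field_simps)
  have one: "cos ?t * cos ?t + sin ?t * sin ?t = 1"
    using sin_cos_squared_add2[of ?t] by (simp add: power2_eq_square)
  show "dir_deriv (cap_of_cyl k) y u $ Inl k * dir_deriv (cap_of_cyl k) y v $ Inr k -
      dir_deriv (cap_of_cyl k) y u $ Inr k * dir_deriv (cap_of_cyl k) y v $ Inl k =
      u $ Inl k * v $ Inr k - u $ Inr k * v $ Inl k"
    unfolding x z using alg[of ?s "sin ?t" "u $ Inr k" "u $ Inl k" "cos ?t" "v $ Inr k" "v $ Inl k"] s(1) one by simp
qed

lemma continuous_map_euclidean_Pair:
  fixes f :: "'a \<Rightarrow> 'b::topological_space" and g :: "'a \<Rightarrow> 'c::topological_space"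
  assumes f: "continuous_map X euclidean f" and g: "continuous_map X euclidean g"
  shows "continuous_map X euclidean (\<lambda>x. (f x, g x))"
  unfolding continuous_map_def
proof (intro conjI allI impI)
  fix T :: "('b \<times> 'c) set" assume "openin euclidean T"
  then have T: "open T" by simp
  show "openin X {x \<in> topspace X. (f x, g x) \<in> T}"
  proof (subst openin_subopen, intro ballI)
    fix x assume x: "x \<in> {x \<in> topspace X. (f x, g x) \<in> T}"
    then have "(f x, g x) \<in> T" by simp
    with T obtain A B where AB: "open A" "open B" "(f x, g x) \<in> A \<times> B" "A \<times> B \<subseteq> T" by (rule open_prod_elim)
    have "openin X {x \<in> topspace X. f x \<in> A}" "openin X {x \<in> topspace X. g x \<in> B}"
      using f g AB(1,2) unfolding continuous_map_def by simp_all
    then have "openin X ({x \<in> topspace X. f x \<in> A} \<inter> {x \<in> topspace X. g x \<in> B})" by (rule openin_Int)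
    moreover have "x \<in> {x \<in> topspace X. f x \<in> A} \<inter> {x \<in> topspace X. g x \<in> B}" using x AB(3) by simp
    moreover have "{x \<in> topspace X. f x \<in> A} \<inter> {x \<in> topspace X. g x \<in> B} \<subseteq> {x \<in> topspace X. (f x, g x) \<in> T}"
      using AB(4) by auto
    ultimately show "\<exists>U. openin X U \<and> x \<in> U \<and> U \<subseteq> {x \<in> topspace X. (f x, g x) \<in> T}" 
      by (intro exI conjI)
  qed
qed simp

section \<open>Cap coordinates of points of the collar\<close>

context collar
begin

text \<open>The cap coordinate as a function on M instead of the quotient. At h = 0 it forgets the
  angle, which is why it descends to the collapsed points.\<close>

definition capc :: "('x, 'n) chart \<Rightarrow> 'a \<Rightarrow> 'n coords" where
  "capc d p = snd d (xx p) + cpart k (of_real (sqrt (2 * hh p)) * ww p)"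

definition cap_image :: "('x, 'n) chart \<Rightarrow> 'n coords set" where
  "cap_image d = {y. drop_coord k y \<in> snd d ` fst d \<and> height k y < \<epsilon>}"

lemma capc_parts:
  assumes "d \<in> F" "xx p \<in> fst d"
  shows "drop_coord k (capc d p) = snd d (xx p)" "zpart k (capc d p) = of_real (sqrt (2 * hh p)) * ww p"
  using fiber_model_space[OF assms] by (simp_all add: capc_def drop_coord_add_cpart zpart_add_cpart)

lemma height_capc:
  assumes "d \<in> F" "p \<in> W" "xx p \<in> fst d" "hh p \<ge> 0"
  shows "height k (capc d p) = hh p"
  unfolding height_zpart capc_parts[OF assms(1,3)] using assms(4) emb_mem(2)[OF assms(2)]
  by (simp add: norm_mult)

lemma open_cap_region:
  assumes "openin (top_of_set (model_space (- {k}))) S"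
  shows "open {y. drop_coord k y \<in> S \<and> height k y < \<delta>}"
proof -
  have "open {z :: complex. (norm z)\<^sup>2 / 2 < \<delta>}" by (intro open_Collect_less continuous_intros) auto
  from open_drop_zpart[OF assms this] show ?thesis by (simp add: height_zpart)
qed

text \<open>At h = 0 the circle point cannot be recovered from z, so equality of the points
  themselves is claimed only for positive height.\<close>

lemma capc_inj:
  assumes d: "d \<in> F" and p: "p \<in> W" "xx p \<in> fst d" "hh p \<ge> 0" and q: "q \<in> W" "xx q \<in> fst d" "hh q \<ge> 0"
    and eq: "capc d p = capc d q"
  shows "xx p = xx q" "hh p = hh q" "hh p > 0 \<Longrightarrow> p = q"
proof -
  have "snd d (xx p) = snd d (xx q)" "of_real (sqrt (2 * hh p)) * ww p = of_real (sqrt (2 * hh q)) * ww q"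
    using capc_parts[OF d p(2)] capc_parts[OF d q(2)] eq by simp_all
  then show x: "xx p = xx q" using fiber_inj[OF d] p(2) q(2) by (simp add: inj_on_def)
  show h: "hh p = hh q" using height_capc[OF d p] height_capc[OF d q] eq by simp
  assume "hh p > 0"
  then have "ww p = ww q"
    using \<open>of_real (sqrt (2 * hh p)) * ww p = of_real (sqrt (2 * hh q)) * ww q\<close> h by simp
  then have "emb L p = emb L q" using x h by (simp add: prod_eq_iff)
  then show "p = q" using G_emb p(1) q(1) by metis
qed

lemma cap_surj:
  assumes d: "d \<in> F" and y: "drop_coord k y \<in> snd d ` fst d" "height k y < \<epsilon>"
  obtains p where "p \<in> W" "xx p \<in> fst d" "hh p = height k y" "capc d p = y"
proof -
  obtain x where x: "x \<in> fst d" "drop_coord k y = snd d x" using y(1) by auto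
  \<comment> \<open>At the pole any point of the circle would serve; 1 is chosen.\<close>
  define w where "w = (if zpart k y = 0 then 1 else sgn (zpart k y))"
  have w: "norm w = 1" by (simp add: w_def norm_sgn)
  have zw: "of_real (sqrt (2 * height k y)) * w = zpart k y"
    by (simp add: w_def norm_zpart[symmetric] sgn_eq)
  have cyl: "(x, w, height k y) \<in> cylinder"
    using x(1) d w y(2) height_nonneg[of k y] width_pos by (auto simp: carrier_of_def)
  let ?p = "G (x, w, height k y)"
  have e: "emb L ?p = (x, w, height k y)" by (rule emb_G[OF cyl])
  have "capc d ?p = drop_coord k y + cpart k (zpart k y)" unfolding capc_def e fst_conv snd_conv zw x(2) ..
  then have "capc d ?p = y" by (simp add: drop_add_cpart_zpart)
  then show ?thesis using that[of ?p] G_mem[OF cyl] e x(1) by simp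
qed

text \<open>The negative side of the collar may be included because \<open>sqrt\<close> is
  continuous on all reals, being extended there as an odd function.\<close>

lemma continuous_capc:
  assumes d: "d \<in> F"
  shows "continuous_map (subtopology (mtop M) {p \<in> W. xx p \<in> fst d}) euclidean (capc d)"
proof -
  let ?X = "subtopology (mtop M) {p \<in> W. xx p \<in> fst d}"
  have x: "continuous_map ?X (mtop F) (\<lambda>p. xx p)" and w: "continuous_map ?X euclidean (\<lambda>p. ww p)"
    and h: "continuous_map ?X euclidean (\<lambda>p. hh p)"
    by (rule continuous_map_from_subtopology_mono[OF continuous_xx], force)
       (rule continuous_map_from_subtopology_mono[OF continuous_ww], force,
        rule continuous_map_from_subtopology_mono[OF continuous_hh], force)
  have "continuous_map ?X (subtopology (mtop F) (fst d)) (\<lambda>p. xx p)"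
    using x by (auto simp: continuous_map_in_subtopology)
  from continuous_map_compose[OF this continuous_map_chart[OF d]]
  have 1: "continuous_map ?X euclidean (\<lambda>p. snd d (xx p))" by (simp add: o_def)
  have "continuous_map ?X euclidean (\<lambda>p. (ww p, hh p))"
    by (rule continuous_map_euclidean_Pair[OF w h])
  moreover have "continuous_on UNIV (\<lambda>u :: complex \<times> real. cpart k (of_real (sqrt (2 * snd u)) * fst u))"
    by (intro linear_continuous_on_compose[OF _ linear_cpart] continuous_intros)
  ultimately have "continuous_map ?X euclidean (\<lambda>p. cpart k (of_real (sqrt (2 * hh p)) * ww p))"
    using continuous_map_compose[of ?X euclidean "\<lambda>p. (ww p, hh p)" euclidean "\<lambda>u. cpart k (of_real (sqrt (2 * snd u)) * fst u)"]
    by (simp add: o_def)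
  from continuous_map_add[OF 1 this] show ?thesis by (simp add: capc_def[abs_def])
qed

lemma capc_eq_cap_of_cyl:
  assumes "d \<in> F" "p \<in> W" "xx p \<in> fst d" "ww p \<in> slit a"
  shows "capc d p = cap_of_cyl k (snd (cyl d a) (emb L p))" "snd (cyl d a) (emb L p) $ Inl k = hh p"
proof -
  have ms: "snd d (xx p) \<in> model_space (- {k})" by (rule fiber_model_space[OF assms(1,3)])
  have e: "snd (cyl d a) (emb L p) = snd d (xx p) + cpart k (Complex (hh p) (angle a (ww p)))"
    by (rule cyl_emb[OF assms(2,4)])
  have z: "snd d (xx p) $ Inl k = 0" "snd d (xx p) $ Inr k = 0" using ms by (simp_all add: model_space_def)
  show "snd (cyl d a) (emb L p) $ Inl k = hh p" unfolding e by (simp add: z cpart_nth)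
  have "cis (angle a (ww p)) = ww p" using slit_polar(4)[OF assms(4)] emb_mem(2)[OF assms(2)] by simp
  then show "capc d p = cap_of_cyl k (snd (cyl d a) (emb L p))"
    unfolding e cap_of_cyl_def capc_def using ms by (simp add: drop_coord_add_cpart z cpart_nth)
qed

lemma cyl_of_cap_capc:
  assumes "d \<in> F" "p \<in> W" "xx p \<in> fst d" "ww p \<in> slit a" "hh p > 0"
  shows "zpart k (capc d p) \<in> slit a" "cyl_of_cap k a (capc d p) = snd (cyl d a) (emb L p)"
proof -
  have s: "sqrt (2 * hh p) > 0" using assms(5) by simp
  show "zpart k (capc d p) \<in> slit a"
    unfolding capc_parts[OF assms(1,3)] slit_scale[OF s] by (rule assms(4))
  show "cyl_of_cap k a (capc d p) = snd (cyl d a) (emb L p)"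
    unfolding cyl_of_cap_def cyl_emb[OF assms(2,4)] height_capc[OF assms(1,2,3) less_imp_le[OF assms(5)]]
      capc_parts[OF assms(1,3)] angle_scale[OF s assms(4)] ..
qed

text \<open>Near p the circle point stays in one slit, and there the cap coordinate is the embedding
  in a cylinder chart followed by \<open>cap_of_cyl\<close>.\<close>

lemma capc_smooth:
  assumes c: "c \<in> M" and d: "d \<in> F" and p: "p \<in> fst c" "p \<in> W" "xx p \<in> fst d" "hh p > 0" 
  obtains S where "open S" "snd c p \<in> S" "S \<subseteq> snd c ` {q \<in> fst c \<inter> W. xx q \<in> fst d \<and> hh q > 0}"
    "smooth_on S (local_expr c (capc d))"
proof -
  have "ww p \<noteq> 0" using emb_mem(2)[OF p(2)] by auto
  then obtain a where a: "ww p \<in> slit a" by (rule slit_exists)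
  let ?N = "{p \<in> fst c \<inter> W. emb L p \<in> fst (cyl d a)}" and ?Y = "local_expr c (snd (cyl d a) \<circ> emb L)"
  have N: "open (snd c ` ?N)" "smooth_on (snd c ` ?N) ?Y" by (rule emb_smooth[OF c d])+
  have pos: "open {y :: 'n coords. y $ Inl k > 0}" by (intro open_Collect_less continuous_intros)
  define S where "S = snd c ` ?N \<inter> ?Y -` {y. y $ Inl k > 0}"
  have "open S" unfolding S_def
    by (rule continuous_open_preimage[OF smooth_on_imp_continuous_on[OF N(2)] N(1) pos])
  moreover have Y: "?Y (snd c q) = snd (cyl d a) (emb L q)" if "q \<in> fst c" for q
    using that M.inj[OF c] by (simp add: local_expr_at)
  have q: "\<exists>q. y = snd c q \<and> q \<in> fst c \<and> q \<in> W \<and> xx q \<in> fst d \<and> ww q \<in> slit a \<and> hh q > 0" if y: "y \<in> S" for y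
  proof -
    obtain q where q: "y = snd c q" "q \<in> fst c" "q \<in> W" "emb L q \<in> fst (cyl d a)" using y by (auto simp: S_def)
    have "xx q \<in> fst d" "ww q \<in> slit a" using q cyl_dom_emb by auto
    moreover have "hh q > 0" using y Y[OF q(2)] capc_eq_cap_of_cyl(2)[OF d q(3) calculation] by (simp add: S_def q(1))
    ultimately show ?thesis using q by auto
  qed
  moreover have "snd c p \<in> S"
    using p a cyl_dom_emb[OF p(2)] Y[OF p(1)] capc_eq_cap_of_cyl(2)[OF d p(2,3) a] by (auto simp: S_def)
  moreover have "S \<subseteq> snd c ` {q \<in> fst c \<inter> W. xx q \<in> fst d \<and> hh q > 0}" using q by fast
  moreover have "smooth_on S (\<lambda>y. cap_of_cyl k (?Y y))"
    by (rule smooth_on_compose[OF smooth_on_cap_of_cyl smooth_on_subset[OF N(2)]]) (auto simp: S_def)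
  then have "smooth_on S (local_expr c (capc d))"
  proof (rule smooth_on_cong)
    fix y assume "y \<in> S"
    from q[OF this] obtain q where q: "y = snd c q" "q \<in> fst c" "q \<in> W" "xx q \<in> fst d" "ww q \<in> slit a" by auto
    show "cap_of_cyl k (?Y y) = local_expr c (capc d) y"
      unfolding q(1) Y[OF q(2)] capc_eq_cap_of_cyl(1)[OF d q(3,4,5), symmetric] using q(2) M.inj[OF c] by (simp add: local_expr_at)
  qed
  ultimately show ?thesis by (intro that)
qed

text \<open>The opposite coordinate change: a branch of the angle recovers cylinder coordinates, and
  the smooth inverse of the embedding returns to M. The function g is kept abstract so that the
  choice of slit does not appear.\<close>

lemma capc_inverse_smooth:
  assumes c: "c \<in> M" and d: "d \<in> F" and p: "p \<in> fst c" "p \<in> W" "xx p \<in> fst d" "hh p > 0" 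
  obtains S g where "open S" "capc d p \<in> S" "S \<subseteq> capc d ` {q \<in> fst c \<inter> W. xx q \<in> fst d \<and> hh q > 0}"
    "smooth_on S g" "\<And>q. q \<in> W \<Longrightarrow> xx q \<in> fst d \<Longrightarrow> hh q > 0 \<Longrightarrow> capc d q \<in> S \<Longrightarrow> q \<in> fst c \<and> g (capc d q) = snd c q"
proof -
  have "ww p \<noteq> 0" using emb_mem(2)[OF p(2)] by auto
  then obtain a where a: "ww p \<in> slit a" by (rule slit_exists)
  let ?Q = "snd (cyl d a) ` {y \<in> fst (cyl d a). G y \<in> fst c}" and ?H = "local_expr (cyl d a) (snd c \<circ> G)"
  have Q: "open ?Q" "smooth_on ?Q ?H" by (rule G_smooth[OF c d])+
  let ?D = "{y. drop_coord k y \<in> snd d ` fst d \<and> zpart k y \<in> slit a \<inter> {z. (norm z)\<^sup>2 / 2 < \<epsilon>}}"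
  have "open (slit a \<inter> {z :: complex. (norm z)\<^sup>2 / 2 < \<epsilon>})"
    by (intro open_Int open_slit open_Collect_less continuous_intros) auto
  then have D: "open ?D" by (rule open_drop_zpart[OF fiber_open[OF d]])
  have T: "smooth_on ?D (cyl_of_cap k a)" by (rule smooth_on_subset[OF smooth_on_cyl_of_cap]) auto
  define S where "S = ?D \<inter> cyl_of_cap k a -` ?Q"
  have S: "open S" unfolding S_def
    by (rule continuous_open_preimage[OF smooth_on_imp_continuous_on[OF T] D Q(1)])
  have dom: "emb L q \<in> fst (cyl d a)" if "q \<in> W" "xx q \<in> fst d" "ww q \<in> slit a" for q
    using that cyl_dom_emb by auto
  have pS: "capc d p \<in> S"
  proof -
    have "capc d p \<in> ?D"
      using p cyl_of_cap_capc(1)[OF d p(2,3) a p(4)] capc_parts(1)[OF d p(3)]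
        height_capc[OF d p(2,3) less_imp_le[OF p(4)]] emb_mem(4)[OF p(2)] by (simp add: height_zpart)
    moreover have "snd (cyl d a) (emb L p) \<in> ?Q" using dom[OF p(2,3) a] p(1) G_emb[OF p(2)] by auto
    ultimately show ?thesis using cyl_of_cap_capc(2)[OF d p(2,3) a p(4)] by (simp add: S_def)
  qed
  have key: "q \<in> fst c \<and> ?H (cyl_of_cap k a (capc d q)) = snd c q"
    if q: "q \<in> W" "xx q \<in> fst d" "hh q > 0" "capc d q \<in> S" for q
  proof -
    have s: "sqrt (2 * hh q) > 0" using q(3) by simp
    have "zpart k (capc d q) \<in> slit a" using q(4) by (simp add: S_def)
    then have w: "ww q \<in> slit a" unfolding capc_parts[OF d q(2)] slit_scale[OF s] .
    have "cyl_of_cap k a (capc d q) \<in> ?Q" using q(4) by (simp add: S_def)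
    then have "snd (cyl d a) (emb L q) \<in> ?Q" unfolding cyl_of_cap_capc(2)[OF d q(1,2) w q(3)] .
    then obtain y where y: "y \<in> fst (cyl d a)" "G y \<in> fst c" "snd (cyl d a) (emb L q) = snd (cyl d a) y" by auto
    then have "emb L q = y" using cyl_inj[OF d, of a] dom[OF q(1,2) w] by (simp add: inj_on_def)
    then have qc: "q \<in> fst c" using y(2) G_emb[OF q(1)] by simp
    have "?H (cyl_of_cap k a (capc d q)) = snd c q"
      unfolding cyl_of_cap_capc(2)[OF d q(1,2) w q(3)]
      using cyl_inj[OF d, of a] dom[OF q(1,2) w] G_emb[OF q(1)] by (simp add: local_expr_at)
    with qc show ?thesis by simp
  qed
  have "S \<subseteq> capc d ` {q \<in> fst c \<inter> W. xx q \<in> fst d \<and> hh q > 0}"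
  proof
    fix y assume y: "y \<in> S"
    then have yD: "drop_coord k y \<in> snd d ` fst d" "height k y < \<epsilon>" "zpart k y \<in> slit a"
      by (simp_all add: S_def height_zpart)
    obtain q where q: "q \<in> W" "xx q \<in> fst d" "hh q = height k y" "capc d q = y"
      by (rule cap_surj[OF d yD(1,2)])
    have "zpart k y \<noteq> 0" by (rule slit_polar(1)[OF yD(3)])
    then have "hh q > 0" unfolding q(3) height_zpart by simp
    then show "y \<in> capc d ` {q \<in> fst c \<inter> W. xx q \<in> fst d \<and> hh q > 0}"
      using q key[of q] y by auto
  qed
  moreover have "smooth_on S (\<lambda>y. ?H (cyl_of_cap k a y))"
    by (rule smooth_on_compose[OF Q(2) smooth_on_subset[OF T]]) (auto simp: S_def)
  ultimately show ?thesis using that[OF S pS] key by blast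
qed

text \<open>The profile is a parameter so that the singular form (profile 1/h) and its replacement
  are the same expression in cap coordinates; they then agree wherever the two profiles do.\<close>

definition capform :: "(real \<Rightarrow> real) \<Rightarrow> ('x, 'n) chart \<Rightarrow> 'n coords \<Rightarrow> 'n coords \<Rightarrow> 'n coords \<Rightarrow> real" where
  "capform \<phi> d y u v = fiber_form L d (drop_coord k y) (drop_coord k u) (drop_coord k v) +
     coef L * \<phi> (height k y) * (u $ Inl k * v $ Inr k - u $ Inr k * v $ Inl k)"

text \<open>The model form in cylinder coordinates is transported by \<open>cap_of_cyl\<close>,
  under which dh \<and> d\<theta> becomes dx \<and> dy and the fiber part is unchanged.\<close>

lemma form_eq_capform:
  assumes c: "c \<in> M" and d: "d \<in> F" and p: "p \<in> fst c" "p \<in> W" "xx p \<in> fst d" "hh p > 0"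
  shows "\<omega> c (snd c p) u v = capform (\<lambda>h. 1 / h) d (capc d p) (differential c (capc d) p u) (differential c (capc d) p v)"
proof -
  have "ww p \<noteq> 0" using emb_mem(2)[OF p(2)] by auto
  then obtain a where a: "ww p \<in> slit a" by (rule slit_exists)
  let ?N = "{p \<in> fst c \<inter> W. emb L p \<in> fst (cyl d a)}" and ?Y = "local_expr c (snd (cyl d a) \<circ> emb L)"
  let ?D = "differential c (snd (cyl d a) \<circ> emb L) p" and ?y = "snd (cyl d a) (emb L p)"
  have N: "open (snd c ` ?N)" "smooth_on (snd c ` ?N) ?Y" by (rule emb_smooth[OF c d])+
  have dom: "emb L p \<in> fst (cyl d a)" using p a cyl_dom_emb by auto
  have pZ: "p \<notin> Z" using Z'_iff[OF p(2)] p(2,4) nbhd_Z by auto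
  have 1: "\<omega> c (snd c p) u v = cyl_form k (fiber_form L) (coef L) d ?y (?D u) (?D v)"
  proof -
    have "\<forall>c\<in>M. \<forall>d\<in>F. \<forall>a. \<forall>p\<in>(fst c \<inter> W) - Z. \<forall>u v.
        let e = cyl d a in emb L p \<in> fst e \<longrightarrow>
        \<omega> c (snd c p) u v = cyl_form k (fiber_form L) (coef L) d (snd e (emb L p))
            (differential c (snd e \<circ> emb L) p u) (differential c (snd e \<circ> emb L) p v)"
      using model unfolding is_local_model_def by (elim conjE)
    from this[rule_format, of c d p a u v] show ?thesis using c d p pZ dom by (simp add: Let_def)
  qed
  have yh: "?y $ Inl k = hh p" by (rule capc_eq_cap_of_cyl(2)[OF d p(2,3) a])
  have Yp: "?Y (snd c p) = ?y" using p(1) M.inj[OF c] by (simp add: local_expr_at)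
  have dY: "(?Y has_derivative ?D) (at (snd c p))"
    unfolding differential_def[abs_def] by (rule smooth_on_has_derivative[OF N(2,1)]) (use p dom in auto)
  have pos: "open {y :: 'n coords. y $ Inl k > 0}" by (intro open_Collect_less continuous_intros)
  have dC: "(cap_of_cyl k has_derivative dir_deriv (cap_of_cyl k) ?y) (at (?Y (snd c p)))"
    unfolding Yp by (rule smooth_on_has_derivative[OF smooth_on_cap_of_cyl pos]) (use yh p(4) in simp)
  have D: "differential c (capc d) p u = dir_deriv (cap_of_cyl k) ?y (?D u)" for u
  proof -
    have "differential c (capc d) p u = dir_deriv (\<lambda>x. cap_of_cyl k (?Y x)) (snd c p) u"
      unfolding differential_def
    proof (rule dir_deriv_cong[OF N(1)])
      show "snd c p \<in> snd c ` ?N" using p dom by auto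
      fix y assume "y \<in> snd c ` ?N"
      then obtain q where q: "y = snd c q" "q \<in> fst c" "q \<in> W" "emb L q \<in> fst (cyl d a)" by auto
      then show "local_expr c (capc d) y = cap_of_cyl k (?Y y)"
        using cyl_dom_emb[OF q(3)] capc_eq_cap_of_cyl(1)[OF d q(3)] M.inj[OF c] by (simp add: local_expr_at)
    qed
    also have "\<dots> = dir_deriv (cap_of_cyl k) ?y (?D u)" by (rule dir_deriv_compose[OF dY dC])
    finally show ?thesis .
  qed
  have yp: "?y $ Inl k > 0" using yh p(4) by simp
  have dy: "drop_coord k ?y = drop_coord k (capc d p)"
    unfolding capc_eq_cap_of_cyl(1)[OF d p(2,3) a] by (simp add: cap_of_cyl_def linear_add[OF linear_drop_coord])
  show ?thesis
    unfolding 1 cyl_form_def capform_def D cap_of_cyl_dir_deriv[OF yp] dy yh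
      height_capc[OF d p(2,3) less_imp_le[OF p(4)]] ..
qed

end


section \<open>The form with a general profile on the cap\<close>

context collar
begin

lemma fiber_form_props: 
  assumes d: "d \<in> F"
  shows "coeff_form2 (- {k}) (snd d ` fst d) (fiber_form L d)"
    and "\<And>x u v w. x \<in> snd d ` fst d \<Longrightarrow> u \<in> model_space (- {k}) \<Longrightarrow> v \<in> model_space (- {k}) \<Longrightarrow>
      w \<in> model_space (- {k}) \<Longrightarrow> ext_d2 (fiber_form L d) x u v w = 0"
    and "\<And>x. x \<in> snd d ` fst d \<Longrightarrow> \<exists>v. (\<forall>j. v j \<in> model_space (- {k})) \<and> wedge_power (- {k}) (fiber_form L d x) v \<noteq> 0"
    and "\<And>d' x u v. d' \<in> F \<Longrightarrow> x \<in> fst d \<Longrightarrow> x \<in> fst d' \<Longrightarrow> u \<in> model_space (- {k}) \<Longrightarrow> v \<in> model_space (- {k}) \<Longrightarrow>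
      fiber_form L d (snd d x) u v = fiber_form L d' (snd d' x) (differential d (snd d') x u) (differential d (snd d') x v)"
proof -
  have s: "symplectic_form (- {k}) F (fiber_form L)" using fiber_toric by (simp add: compact_symplectic_toric_def)
  then have t: "two_form (- {k}) F (carrier_of F) (fiber_form L)" by (simp add: symplectic_form_def)
  have "fst d \<inter> carrier_of F = fst d" using d by (auto simp: carrier_of_def)
  then show "coeff_form2 (- {k}) (snd d ` fst d) (fiber_form L d)"
    using t[unfolded two_form_def case_prod_beta prod.collapse, THEN conjunct1, THEN bspec, OF d] by simp
  show "ext_d2 (fiber_form L d) x u v w = 0"
    if "x \<in> snd d ` fst d" "u \<in> model_space (- {k})" "v \<in> model_space (- {k})" "w \<in> model_space (- {k})" for x u v w
    using s[unfolded symplectic_form_def, THEN conjunct2, THEN bspec, OF d, THEN bspec, OF that(1)] that(2-) by blast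
  show "\<exists>v. (\<forall>j. v j \<in> model_space (- {k})) \<and> wedge_power (- {k}) (fiber_form L d x) v \<noteq> 0" if "x \<in> snd d ` fst d" for x
    using s[unfolded symplectic_form_def, THEN conjunct2, THEN bspec, OF d, THEN bspec, OF that] by blast
  show "fiber_form L d (snd d x) u v = fiber_form L d' (snd d' x) (differential d (snd d') x u) (differential d (snd d') x v)"
    if "d' \<in> F" "x \<in> fst d" "x \<in> fst d'" "u \<in> model_space (- {k})" "v \<in> model_space (- {k})" for d' x u v
    by (rule t[unfolded two_form_def, THEN conjunct2, rule_format])
       (use that d in \<open>auto simp: carrier_of_def\<close>)
qed

lemma fiber_form_at:
  assumes "d \<in> F" "x \<in> snd d ` fst d"
  shows "bilinear (fiber_form L d x)" "u \<in> model_space (- {k}) \<Longrightarrow> fiber_form L d x u u = 0"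
  using fiber_form_props(1)[OF assms(1), unfolded coeff_form2_def, THEN conjunct1, THEN bspec, OF assms(2)] by auto

lemma fiber_form_smooth:
  assumes "d \<in> F" "u \<in> model_space (- {k})" "v \<in> model_space (- {k})"
  shows "smooth_on (snd d ` fst d) (\<lambda>x. fiber_form L d x u v)"
  by (rule fiber_form_props(1)[OF assms(1), unfolded coeff_form2_def, THEN conjunct2, THEN bspec, OF assms(2), THEN bspec, OF assms(3)])

text \<open>The part of a cap chart on which a profile defined on [0, \<delta>] is
  available.\<close>

definition cap_region :: "real \<Rightarrow> ('x, 'n) chart \<Rightarrow> 'n coords set" where
  "cap_region \<delta> d = {y. drop_coord k y \<in> snd d ` fst d \<and> height k y < \<delta>}"

lemma open_cap_region': "d \<in> F \<Longrightarrow> open (cap_region \<delta> d)"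
  unfolding cap_region_def by (rule open_cap_region[OF fiber_open])

text \<open>Heights lie in [0, \<delta>), so smoothness of the profile within the closed interval
  suffices and no continuation to negative h has to be constructed.\<close>

lemma smooth_on_height_compose:
  assumes "smooth_on {0..\<delta>} \<phi>"
  shows "smooth_on (cap_region \<delta> d) (\<lambda>y. \<phi> (height k y))"
  by (rule smooth_on_compose[OF assms smooth_on_height]) (auto simp: cap_region_def height_nonneg)

lemma bilinear_capform:
  assumes d: "d \<in> F" and y: "drop_coord k y \<in> snd d ` fst d"
  shows "bilinear (capform \<phi> d y)"
proof -
  have b: "bilinear (fiber_form L d (drop_coord k y))"
    by (rule fiber_form_at(1)[OF d y])
  have l1: "linear (\<lambda>u. fiber_form L d (drop_coord k y) (drop_coord k u) w)" for w
    using linear_compose[OF linear_drop_coord, of "\<lambda>u. fiber_form L d (drop_coord k y) u w" k] b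
    by (simp add: bilinear_def o_def)
  have l2: "linear (\<lambda>v. fiber_form L d (drop_coord k y) w (drop_coord k v))" for w
    using linear_compose[OF linear_drop_coord, of "\<lambda>u. fiber_form L d (drop_coord k y) w u" k] b
    by (simp add: bilinear_def o_def)
  have l3: "linear (\<lambda>u :: 'n coords. c * (u $ Inl k * v $ Inr k - u $ Inr k * v $ Inl k))" 
    "linear (\<lambda>u :: 'n coords. c * (v $ Inl k * u $ Inr k - v $ Inr k * u $ Inl k))" for c and v :: "'n coords"
    by (rule linearI; simp add: algebra_simps)+
  show ?thesis unfolding bilinear_def capform_def
    by (intro conjI allI linear_compose_add l1 l2 l3)
qed

lemma coeff_form2_capform:
  assumes d: "d \<in> F" and \<phi>: "smooth_on {0..\<delta>} \<phi>"
  shows "coeff_form2 UNIV (cap_region \<delta> d) (capform \<phi> d)"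
  unfolding coeff_form2_def model_space_UNIV
proof (intro conjI ballI)
  fix y assume "y \<in> cap_region \<delta> d"
  then have y: "drop_coord k y \<in> snd d ` fst d" by (simp add: cap_region_def)
  show "bilinear (capform \<phi> d y)" by (rule bilinear_capform[OF d y])
  show "capform \<phi> d y u u = 0" for u
    using fiber_form_at(2)[OF d y drop_coord_in_model_space] by (simp add: capform_def)
next
  fix u v
  have "smooth_on (snd d ` fst d) (\<lambda>x. fiber_form L d x (drop_coord k u) (drop_coord k v))"
    by (rule fiber_form_smooth[OF d drop_coord_in_model_space drop_coord_in_model_space])
  then have "smooth_on (cap_region \<delta> d) (\<lambda>y. fiber_form L d (drop_coord k y) (drop_coord k u) (drop_coord k v))"
    by (rule smooth_on_compose[OF _ smooth_on_drop]) (auto simp: cap_region_def)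
  then show "smooth_on (cap_region \<delta> d) (\<lambda>y. capform \<phi> d y u v)"
    unfolding capform_def
    by (intro smooth_on_add smooth_on_mult smooth_on_const smooth_on_height_compose[OF \<phi>])
qed

text \<open>The derivative of \<Phi> may be one-sided at 0, because the height never becomes
  negative. The set I is left open: it will be [0, \<delta>] for the new primitive and the positive
  reals for the logarithm.\<close>

lemma height_compose_derivative:
  assumes y: "y \<in> cap_region \<delta> d" and d: "d \<in> F"
    and \<Phi>: "(\<Phi> has_real_derivative c) (at (height k y) within I)"
    and S: "open S" "y \<in> S" "height k ` S \<subseteq> I"
  shows "((\<lambda>y. \<Phi> (height k y)) has_derivative (\<lambda>u. c * (y $ Inl k * u $ Inl k + y $ Inr k * u $ Inr k))) (at y)"
proof -
  have "(height k has_derivative (\<lambda>u. y $ Inl k * u $ Inl k + y $ Inr k * u $ Inr k)) (at y within S)"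
    using height_has_derivative by (rule has_derivative_at_withinI)
  moreover have "(\<Phi> has_derivative (\<lambda>t. c * t)) (at (height k y) within height k ` S)"
    using \<Phi> S(3) unfolding has_field_derivative_def by (rule has_derivative_subset)
  ultimately have "((\<lambda>y. \<Phi> (height k y)) has_derivative (\<lambda>u. c * (y $ Inl k * u $ Inl k + y $ Inr k * u $ Inr k))) (at y within S)"
    by (rule has_derivative_in_compose)
  then show ?thesis by (simp only: at_within_open[OF S(2,1)])
qed

text \<open>The coefficient of dx \<and> dy depends on x and y only, so its differential lies in the
  span of dx and dy and the wedge product with dx \<and> dy is zero. What remains is the closed form
  of the fiber.\<close>

lemma capform_closed:
  assumes d: "d \<in> F" and \<phi>: "smooth_on {0..\<delta>} \<phi>" and y: "y \<in> cap_region \<delta> d"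
  shows "ext_d2 (capform \<phi> d) y u v w = 0"
proof -
  have im: "height k ` cap_region \<delta> d \<subseteq> {0..\<delta>}" by (auto simp: cap_region_def height_nonneg)
  have "Ck_on (Suc 0) {0..\<delta>} \<phi>" using \<phi> by (simp add: smooth_on_def del: Ck_on.simps)
  then obtain \<phi>' where \<phi>': "(\<phi> has_derivative \<phi>') (at (height k y) within {0..\<delta>})"
    using im y by auto
  define c where "c = \<phi>' 1"
  have "\<phi>' = (\<lambda>t. c * t)"
  proof
    fix t
    have "\<phi>' (t *\<^sub>R 1) = t *\<^sub>R \<phi>' 1" by (rule linear_scale[OF has_derivative_linear[OF \<phi>']])
    then show "\<phi>' t = c * t" by (simp add: c_def mult.commute)
  qed
  then have "(\<phi> has_real_derivative c) (at (height k y) within {0..\<delta>})"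
    using \<phi>' unfolding has_field_derivative_def by simp
  from height_compose_derivative[OF y d this open_cap_region'[OF d] y im]
  have h: "((\<lambda>y. \<phi> (height k y)) has_derivative (\<lambda>u. c * (y $ Inl k * u $ Inl k + y $ Inr k * u $ Inr k))) (at y)" .
  have D: "dir_deriv (\<lambda>y. capform \<phi> d y p q) y r =
     dir_deriv (\<lambda>z. fiber_form L d z (drop_coord k p) (drop_coord k q)) (drop_coord k y) (drop_coord k r) +
     coef L * (c * (y $ Inl k * r $ Inl k + y $ Inr k * r $ Inr k)) * (p $ Inl k * q $ Inr k - p $ Inr k * q $ Inl k)" for p q r
  proof -
    have "smooth_on (snd d ` fst d) (\<lambda>x. fiber_form L d x (drop_coord k p) (drop_coord k q))"
      by (rule fiber_form_smooth[OF d drop_coord_in_model_space drop_coord_in_model_space])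
    then have "smooth_on (cap_region \<delta> d) (\<lambda>y. fiber_form L d (drop_coord k y) (drop_coord k p) (drop_coord k q))"
      by (rule smooth_on_compose[OF _ smooth_on_drop]) (auto simp: cap_region_def)
    from smooth_on_has_derivative[OF this open_cap_region'[OF d] y]
    have f: "((\<lambda>y. fiber_form L d (drop_coord k y) (drop_coord k p) (drop_coord k q)) has_derivative
       (\<lambda>r. dir_deriv (\<lambda>z. fiber_form L d z (drop_coord k p) (drop_coord k q)) (drop_coord k y) (drop_coord k r))) (at y)"
      unfolding dir_deriv_drop[abs_def, of "\<lambda>z. fiber_form L d z (drop_coord k p) (drop_coord k q)"] .
    show ?thesis unfolding capform_def
      by (intro dir_deriv_eq has_derivative_add f has_derivative_mult_left has_derivative_mult_right h)
  qed
  have "ext_d2 (capform \<phi> d) y u v w = ext_d2 (fiber_form L d) (drop_coord k y) (drop_coord k u) (drop_coord k v) (drop_coord k w)"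
    unfolding ext_d2_def D by (simp add: algebra_simps)
  also have "\<dots> = 0"
    using y by (intro fiber_form_props(2)[OF d] drop_coord_in_model_space) (simp add: cap_region_def)
  finally show ?thesis .
qed

text \<open>The fiber and the plane of z are orthogonal, so the top power is a multiple of the
  product of the fiber's top power with c \<phi>(h).\<close>

lemma capform_nondegenerate:
  assumes d: "d \<in> F" and y: "drop_coord k y \<in> snd d ` fst d" and \<phi>: "\<phi> (height k y) \<noteq> 0"
  shows "\<exists>v. wedge_power (UNIV :: 'n set) (capform \<phi> d y) v \<noteq> 0"
proof -
  obtain v0 where v0: "\<And>j. v0 j \<in> model_space (- {k})" "wedge_power (- {k}) (fiber_form L d (drop_coord k y)) v0 \<noteq> 0"
    using fiber_form_props(3)[OF d y] by auto
  \<comment> \<open>A frame on which the fiber form has nonzero top power, completed by the unit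
    vectors of the plane.\<close>
  define v where "v j = (if j = Inl k then cpart k 1 else if j = Inr k then cpart k \<i> else v0 j)" for j
  let ?B = "capform \<phi> d y"
  have b: "bilinear (fiber_form L d (drop_coord k y))"
    by (rule fiber_form_at(1)[OF d y])
  have z: "v0 j $ Inl k = 0" "v0 j $ Inr k = 0" "drop_coord k (v0 j) = v0 j" for j
    using v0(1)[of j] by (simp_all add: model_space_def drop_coord_model_space[OF v0(1)])
  have block: "?B (v j) (v j') = 0 \<and> ?B (v j') (v j) = 0" if "j \<in> {Inl k, Inr k}" "j' \<notin> {Inl k, Inr k}" for j j'
    using that by (auto simp: v_def capform_def z cpart_nth bilinear_lzero[OF b] bilinear_rzero[OF b])
  have kk: "?B (v (Inl k)) (v (Inr k)) = coef L * \<phi> (height k y)" "?B (v (Inr k)) (v (Inl k)) = - (coef L * \<phi> (height k y))"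
    "?B (v (Inl k)) (v (Inl k)) = 0" "?B (v (Inr k)) (v (Inr k)) = 0"
    by (simp_all add: v_def capform_def cpart_nth bilinear_lzero[OF b])
  have "wedge_power UNIV ?B v = of_nat CARD('n) * ?B (v (Inl k)) (v (Inr k)) * wedge_power (- {k}) ?B v"
    by (rule wedge_power_block) (use block kk in simp_all)
  moreover have "wedge_power (- {k}) ?B v = wedge_power (- {k}) (fiber_form L d (drop_coord k y)) v0"
  proof -
    \<comment> \<open>\<sigma> moves fiber indices only, so the two plane vectors do not
      enter.\<close>
    have "?B (v (\<sigma> (Inl i))) (v (\<sigma> (Inr i))) = fiber_form L d (drop_coord k y) (v0 (\<sigma> (Inl i))) (v0 (\<sigma> (Inr i)))"
      if \<sigma>: "\<sigma> permutes (- {k} <+> - {k})" and i: "i \<in> - {k}" for \<sigma> i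
    proof -
      have "\<sigma> (Inl i) \<in> - {k} <+> - {k}" "\<sigma> (Inr i) \<in> - {k} <+> - {k}"
        using permutes_in_image[OF \<sigma>] i by auto
      then have "v (\<sigma> (Inl i)) = v0 (\<sigma> (Inl i))" "v (\<sigma> (Inr i)) = v0 (\<sigma> (Inr i))"
        by (auto simp: v_def)
      then show ?thesis by (simp add: capform_def z)
    qed
    then show ?thesis unfolding wedge_power_def by (intro arg_cong2[of _ _ _ _ "(/)"] sum.cong prod.cong arg_cong2[of _ _ _ _ "(*)"]) auto
  qed
  ultimately have "wedge_power UNIV ?B v \<noteq> 0" using v0(2) \<phi> coef_nonzero by (simp add: kk)
  then show ?thesis by (rule exI[of "\<lambda>v. wedge_power (UNIV :: 'n set) ?B v \<noteq> 0"])
qed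

text \<open>The transition between cap charts over one component: it changes the fiber chart and
  leaves z alone, so it is smooth through the pole.\<close>

definition fib_trans :: "('x, 'n) chart \<Rightarrow> ('x, 'n) chart \<Rightarrow> 'n coords \<Rightarrow> 'n coords" where
  "fib_trans d d' y = local_expr d (snd d') (drop_coord k y) + cpart k (zpart k y)"

lemma fiber_overlap:
  assumes "d \<in> F" "d' \<in> F"
  shows "openin (top_of_set (model_space (- {k}))) (snd d ` (fst d \<inter> fst d'))"
    and "smooth_on (snd d ` (fst d \<inter> fst d')) (local_expr d (snd d'))"
  using fiber_charts assms by (auto simp: atlas_charts_def)

lemma open_fib_overlap:
  assumes "d \<in> F" "d' \<in> F"
  shows "open {y. drop_coord k y \<in> snd d ` (fst d \<inter> fst d')}"
  using open_drop_zpart[OF fiber_overlap(1)[OF assms] open_UNIV] by simp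

lemma smooth_fib_trans:
  assumes "d \<in> F" "d' \<in> F"
  shows "smooth_on {y. drop_coord k y \<in> snd d ` (fst d \<inter> fst d')} (fib_trans d d')"
  unfolding fib_trans_def
  by (intro smooth_on_add smooth_on_cpart_compose smooth_on_zpart
      smooth_on_compose[OF fiber_overlap(2)[OF assms] smooth_on_drop]) auto

lemma fib_trans_capc:
  assumes "d \<in> F" "d' \<in> F" "xx p \<in> fst d" "xx p \<in> fst d'"
  shows "fib_trans d d' (capc d p) = capc d' p"
  unfolding fib_trans_def capc_parts[OF assms(1,3)]
  using assms fiber_inj[OF assms(1)] by (simp add: local_expr_at capc_def)

text \<open>The differential of the transition is that of the fiber transition times the identity in
  z, and the height is preserved; the claim thus reduces to invariance of the fiber form.\<close>

lemma capform_fib_trans: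
  assumes d: "d \<in> F" "d' \<in> F" and y: "drop_coord k y \<in> snd d ` (fst d \<inter> fst d')"
  shows "capform \<phi> d y u v = capform \<phi> d' (fib_trans d d' y) (dir_deriv (fib_trans d d') y u) (dir_deriv (fib_trans d d') y v)"
proof -
  let ?S = "{y. drop_coord k y \<in> snd d ` (fst d \<inter> fst d')}" and ?T = "fib_trans d d'" and ?l = "local_expr d (snd d')"
  obtain x where x: "drop_coord k y = snd d x" "x \<in> fst d" "x \<in> fst d'" using y by auto
  have D: "(?T has_derivative dir_deriv ?T y) (at y)"
    by (rule smooth_on_has_derivative[OF smooth_fib_trans[OF d] open_fib_overlap[OF d]]) (use y in simp)
  have ms: "?l (drop_coord k z) \<in> model_space (- {k})" if "z \<in> ?S" for z
    using that fiber_inj[OF d(1)] fiber_model_space[OF d(2)] by (auto simp: local_expr_at)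
  have dT: "drop_coord k (dir_deriv ?T y u) = differential d (snd d') x (drop_coord k u)" for u
  proof -
    have "drop_coord k (dir_deriv ?T y u) = dir_deriv (\<lambda>y. drop_coord k (?T y)) y u"
      by (rule dir_deriv_linear_image[symmetric, OF bounded_linear_parts(1) D])
    also have "\<dots> = dir_deriv (\<lambda>y. ?l (drop_coord k y)) y u"
      by (rule dir_deriv_cong[OF open_fib_overlap[OF d]]) (use y ms in \<open>auto simp: fib_trans_def drop_coord_add_cpart\<close>)
    also have "\<dots> = differential d (snd d') x (drop_coord k u)"
      unfolding dir_deriv_drop differential_def x(1) ..
    finally show ?thesis .
  qed
  have zT: "zpart k (dir_deriv ?T y u) = zpart k u" for u
  proof -
    have "zpart k (dir_deriv ?T y u) = dir_deriv (\<lambda>y. zpart k (?T y)) y u"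
      by (rule dir_deriv_linear_image[symmetric, OF bounded_linear_parts(2) D])
    also have "\<dots> = dir_deriv (zpart k) y u"
      by (rule dir_deriv_cong[OF open_fib_overlap[OF d]]) (use y ms in \<open>auto simp: fib_trans_def zpart_add_cpart\<close>)
    also have "\<dots> = zpart k u"
      by (rule dir_deriv_eq[OF bounded_linear_imp_has_derivative[OF bounded_linear_parts(2)]])
    finally show ?thesis .
  qed
  have c: "dir_deriv ?T y u $ Inl k = u $ Inl k" "dir_deriv ?T y u $ Inr k = u $ Inr k" for u
    using zT[of u] by (simp_all add: zpart_def)
  have T: "drop_coord k (?T y) = snd d' x" "zpart k (?T y) = zpart k y"
    using ms[of y] y x fiber_inj[OF d(1)]
    by (simp_all add: fib_trans_def drop_coord_add_cpart zpart_add_cpart local_expr_at)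
  show ?thesis
    unfolding capform_def dT c T height_zpart x(1)
    using fiber_form_props(4)[OF d(1) d(2) x(2,3) drop_coord_in_model_space drop_coord_in_model_space] by simp
qed


subsection \<open>The torus action on the cap\<close>

text \<open>The map of Lie algebras induced by the splitting; \<open>lift \<xi> $ k\<close> is the
  speed with which \<xi> rotates the circle factor.\<close>

definition lift :: "real^'n \<Rightarrow> real^'n" where
  "lift = (SOME f. linear f \<and> (\<forall>\<xi>. splitting L (torus_exp \<xi>) = torus_exp (f \<xi>)))"

lemma linear_lift: "linear lift" and splitting_exp: "splitting L (torus_exp \<xi>) = torus_exp (lift \<xi>)"
proof -
  have "torus_automorphism (splitting L)" using model by (simp add: is_local_model_def)
  then obtain f where "linear f" "\<And>\<xi>. splitting L (torus_exp \<xi>) = torus_exp (f \<xi>)"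
    by (rule torus_automorphism_lift) (rule that)
  then have "\<exists>f. linear f \<and> (\<forall>\<xi>. splitting L (torus_exp \<xi>) = torus_exp (f \<xi>))" by (intro exI[of _ f]) simp
  from someI_ex[OF this] have "linear lift \<and> (\<forall>\<xi>. splitting L (torus_exp \<xi>) = torus_exp (lift \<xi>))"
    unfolding lift_def .
  then show "linear lift" "splitting L (torus_exp \<xi>) = torus_exp (lift \<xi>)" by blast+
qed

definition fiber_lift :: "real^'n \<Rightarrow> real^'n" where
  "fiber_lift \<xi> = (\<chi> i. if i = k then 0 else lift \<xi> $ i)"

lemma linear_fiber_lift: "linear fiber_lift"
  by (rule linearI) (simp_all add: vec_eq_iff fiber_lift_def linear_add[OF linear_lift] linear_scale[OF linear_lift])

lemma fiber_lift_mem: "fiber_lift \<xi> \<in> torus_lie (- {k})"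
  by (simp add: fiber_lift_def torus_lie_def)

lemma torus_fiber_part_exp: "torus_fiber_part k (torus_exp (lift \<xi>)) = torus_exp (fiber_lift \<xi>)"
  by (simp add: torus_fiber_part_def torus_exp_def fiber_lift_def vec_eq_iff)

lemma emb_act:
  assumes "t \<in> torus UNIV" "p \<in> W"
  shows "act t p \<in> W"
    "emb L (act t p) = (fiber_act L (torus_fiber_part k (splitting L t)) (xx p), splitting L t $ k * ww p, hh p)"
proof -
  have "\<forall>t\<in>torus UNIV. \<forall>p\<in>W. act t p \<in> W \<and> emb L (act t p) = (case emb L p of (x, w, h) \<Rightarrow>
             (fiber_act L (torus_fiber_part k (splitting L t)) x, splitting L t $ k * w, h))"
    using model unfolding is_local_model_def by (elim conjE)
  with assms show "act t p \<in> W"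
    "emb L (act t p) = (fiber_act L (torus_fiber_part k (splitting L t)) (xx p), splitting L t $ k * ww p, hh p)"
    by (simp_all add: case_prod_beta)
qed

lemma emb_act_exp:
  assumes "p \<in> W"
  shows "act (torus_exp \<xi>) p \<in> W" "xx (act (torus_exp \<xi>) p) = fiber_act L (torus_exp (fiber_lift \<xi>)) (xx p)"
    "ww (act (torus_exp \<xi>) p) = cis (lift \<xi> $ k) * ww p" "hh (act (torus_exp \<xi>) p) = hh p"
  using emb_act[of "torus_exp \<xi>" p] assms torus_exp_in_torus[of \<xi> UNIV]
  by (simp_all add: splitting_exp torus_fiber_part_exp) (simp add: torus_exp_def)

lemma capc_act_exp:
  assumes "p \<in> W" "xx p \<in> fst d" "d \<in> F"
  shows "capc d' (act (torus_exp \<xi>) p) =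
    snd d' (fiber_act L (torus_exp (fiber_lift \<xi>)) (xx p)) + cpart k (cis (lift \<xi> $ k) * zpart k (capc d p))"
  unfolding capc_parts[OF assms(3,2)] unfolding capc_def emb_act_exp[OF assms(1)] by (simp add: mult.left_commute)

lemma fiber_action: "smooth_torus_action (- {k}) F (fiber_act L)"
  using fiber_toric by (simp add: compact_symplectic_toric_def)

text \<open>In cap coordinates the action is the fiber action together with multiplication of z by
  \<open>cis (lift \<eta> $ k)\<close>. This is linear in z and hence smooth at z = 0, where the
  angle is not defined.\<close>

lemma capc_act_smooth:
  assumes d: "d \<in> F" "d' \<in> F" and p: "p \<in> W" "hh p \<ge> 0" "xx p \<in> fst d" "xx (act (torus_exp \<xi>) p) \<in> fst d'"
  obtains S g where "open S" "(\<xi>, capc d p) \<in> S" "smooth_on S g" "\<And>\<eta> y. (\<eta>, y) \<in> S \<Longrightarrow> y \<in> cap_image d"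
    "\<And>\<eta> q. q \<in> W \<Longrightarrow> xx q \<in> fst d \<Longrightarrow> hh q \<ge> 0 \<Longrightarrow> (\<eta>, capc d q) \<in> S \<Longrightarrow>
      xx (act (torus_exp \<eta>) q) \<in> fst d' \<and> capc d' (act (torus_exp \<eta>) q) = g (\<eta>, capc d q)"
proof -
  define D where "D = {(\<xi>, x). \<xi> \<in> torus_lie (- {k}) \<and> x \<in> snd d ` fst d \<and>
                         fiber_act L (torus_exp \<xi>) (inv_into (fst d) (snd d) x) \<in> fst d'}"
  define f where "f = (\<lambda>(\<xi>, x). snd d' (fiber_act L (torus_exp \<xi>) (inv_into (fst d) (snd d) x)))"
  let ?V = "torus_lie (- {k}) \<times> model_space (- {k})"
  have "openin (top_of_set (torus_lie (- {k}) \<times> snd d ` fst d)) D \<and> smooth_on D f"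
    using fiber_action[unfolded smooth_torus_action_def, THEN conjunct2, THEN conjunct2, THEN conjunct2, THEN bspec, OF d(1)]
      d(2) unfolding D_def f_def case_prod_beta prod.collapse Let_def by blast
  then have Dop: "openin (top_of_set (torus_lie (- {k}) \<times> snd d ` fst d)) D" and Ds: "smooth_on D f" by auto
  have "openin (top_of_set ?V) (torus_lie (- {k}) \<times> snd d ` fst d)"
    using fiber_open[OF d(1)] by (intro openin_Times) auto
  then have "openin (top_of_set ?V) D" using Dop openin_trans by blast
  then obtain T where T: "open T" "D = ?V \<inter> T" by (metis openin_open)
  \<comment> \<open>Linear passage to the arguments of the fiber action. It takes values in the
    subspace in which the domain \<open>D\<close> is relatively open, so the preimage of
    \<open>D\<close> is open in the full space.\<close>
  define m where "m z = (fiber_lift (fst z), drop_coord k (snd z))" for z :: "(real^'n) \<times> 'n coords"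
  have ml: "bounded_linear m" unfolding m_def
    using linear_fiber_lift linear_drop_coord[of k]
    by (intro bounded_linear_Pair bounded_linear_compose[OF _ bounded_linear_fst] bounded_linear_compose[OF _ bounded_linear_snd])
       (simp_all add: linear_conv_bounded_linear)
  have mV: "m z \<in> ?V" for z by (simp add: m_def fiber_lift_mem drop_coord_in_model_space)
  define S where "S = m -` T \<inter> {z. height k (snd z) < \<epsilon>}"
  have "open (m -` T)" by (intro open_vimage T(1) linear_continuous_on ml)
  moreover have "open {z :: (real^'n) \<times> 'n coords. height k (snd z) < \<epsilon>}"
    unfolding height_def by (intro open_Collect_less continuous_intros) auto
  ultimately have So: "open S" unfolding S_def by (rule open_Int)
  have Sm: "z \<in> S \<longleftrightarrow> m z \<in> D \<and> height k (snd z) < \<epsilon>" for z using T(2) mV by (auto simp: S_def)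
  define g where "g z = f (m z) + cpart k (cis (lift (fst z) $ k) * zpart k (snd z))" for z
  have gs: "smooth_on S g"
  proof -
    have a: "smooth_on S (\<lambda>z. f (m z))"
      by (rule smooth_on_compose[OF Ds smooth_on_bounded_linear[OF ml]]) (use Sm in auto)
    have "bounded_linear (\<lambda>z :: (real^'n) \<times> 'n coords. lift (fst z) $ k)"
      using linear_lift by (intro bounded_linear_compose[OF bounded_linear_vec_nth] bounded_linear_compose[OF _ bounded_linear_fst])
        (simp add: linear_conv_bounded_linear)
    then have b: "smooth_on S (\<lambda>z. lift (fst z) $ k)" by (rule smooth_on_bounded_linear)
    have "bounded_linear (\<lambda>z :: (real^'n) \<times> 'n coords. zpart k (snd z))"
      by (intro bounded_linear_compose[OF bounded_linear_parts(2)] bounded_linear_snd)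
    then have c: "smooth_on S (\<lambda>z. zpart k (snd z))" by (rule smooth_on_bounded_linear)
    show ?thesis unfolding g_def
      by (intro smooth_on_add smooth_on_cpart_compose smooth_on_mult smooth_on_cis a b c)
  qed
  have mq: "m (\<eta>, capc d q) \<in> D \<longleftrightarrow> xx (act (torus_exp \<eta>) q) \<in> fst d'" if q: "q \<in> W" "xx q \<in> fst d" for \<eta> q
    using q fiber_inj[OF d(1)] fiber_lift_mem[of \<eta>]
    by (auto simp: m_def D_def capc_parts[OF d(1) q(2)] emb_act_exp[OF q(1)])
  have pS: "(\<xi>, capc d p) \<in> S"
    unfolding Sm using mq[OF p(1,3)] p(4) height_capc[OF d(1) p(1,3,2)] emb_mem(4)[OF p(1)] by simp
  have img: "y \<in> cap_image d" if "(\<eta>, y) \<in> S" for \<eta> y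
    using that unfolding Sm by (auto simp: cap_image_def m_def D_def)
  have act: "xx (act (torus_exp \<eta>) q) \<in> fst d' \<and> capc d' (act (torus_exp \<eta>) q) = g (\<eta>, capc d q)"
    if q: "q \<in> W" "xx q \<in> fst d" "hh q \<ge> 0" "(\<eta>, capc d q) \<in> S" for \<eta> q
  proof -
    have "capc d' (act (torus_exp \<eta>) q) = g (\<eta>, capc d q)"
      unfolding g_def capc_act_exp[OF q(1,2) d(1)] using q fiber_inj[OF d(1)]
      by (simp add: f_def m_def capc_parts[OF d(1) q(2)])
    then show ?thesis using mq[OF q(1,2)] q(4) unfolding Sm by simp
  qed
  show ?thesis by (rule that[OF So pS gs img act])
qed

text \<open>The velocity of the orbit in cap coordinates; the rotation of z with speed b contributes
  i b z.\<close>

definition cap_field :: "('x, 'n) chart \<Rightarrow> real^'n \<Rightarrow> 'a \<Rightarrow> 'n coords" where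
  "cap_field d \<xi> p = fundamental_field (fiber_act L) d (fiber_lift \<xi>) (xx p) + cpart k (\<i> * of_real (lift \<xi> $ k) * zpart k (capc d p))"

text \<open>The orbit stays in the subspace of fiber coordinates, and the linear projection that
  fixes the curve fixes its velocity.\<close>

lemma fiber_field_mem:
  assumes d: "d \<in> F" and x: "x \<in> fst d" and \<xi>: "\<xi> \<in> torus_lie (- {k})"
  shows "fundamental_field (fiber_act L) d \<xi> x \<in> model_space (- {k})"
proof -
  let ?g = "\<lambda>s. snd d (fiber_act L (torus_exp (s *\<^sub>R \<xi>)) x)" and ?w = "fundamental_field (fiber_act L) d \<xi> x"
  have c: "(?g has_vector_derivative ?w) (at 0)" and e: "\<forall>\<^sub>F s in nhds 0. fiber_act L (torus_exp (s *\<^sub>R \<xi>)) x \<in> fst d"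
    by (rule action_curve[OF fiber_charts fiber_action d x \<xi>])+
  have "((\<lambda>s. drop_coord k (?g s)) has_vector_derivative drop_coord k ?w) (at 0)"
    by (rule bounded_linear.has_vector_derivative[OF bounded_linear_parts(1) c])
  then have "vector_derivative (\<lambda>s. drop_coord k (?g s)) (at 0) = drop_coord k ?w" by (rule vector_derivative_at)
  moreover have "vector_derivative (\<lambda>s. drop_coord k (?g s)) (at 0) = vector_derivative ?g (at 0)"
  proof (intro vector_derivative_cong_eq refl)
    show "\<forall>\<^sub>F s in nhds 0. s \<in> UNIV \<longrightarrow> drop_coord k (?g s) = ?g s"
      using e by eventually_elim (simp add: drop_coord_model_space fiber_model_space[OF d])
  qed auto
  moreover have "vector_derivative ?g (at 0) = ?w" using c by (rule vector_derivative_at)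
  ultimately have "?w = drop_coord k ?w" by simp
  then show ?thesis using drop_coord_in_model_space[of k ?w] by metis
qed

lemma cap_field_parts:
  assumes d: "d \<in> F" and p: "xx p \<in> fst d"
  shows "drop_coord k (cap_field d \<xi> p) = fundamental_field (fiber_act L) d (fiber_lift \<xi>) (xx p)"
    "cap_field d \<xi> p $ Inl k = - lift \<xi> $ k * capc d p $ Inr k"
    "cap_field d \<xi> p $ Inr k = lift \<xi> $ k * capc d p $ Inl k"
proof -
  have m: "fundamental_field (fiber_act L) d (fiber_lift \<xi>) (xx p) \<in> model_space (- {k})"
    by (rule fiber_field_mem[OF d p fiber_lift_mem])
  then show "drop_coord k (cap_field d \<xi> p) = fundamental_field (fiber_act L) d (fiber_lift \<xi>) (xx p)"
    by (simp add: cap_field_def drop_coord_add_cpart)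
  show "cap_field d \<xi> p $ Inl k = - lift \<xi> $ k * capc d p $ Inr k"
    "cap_field d \<xi> p $ Inr k = lift \<xi> $ k * capc d p $ Inl k"
    using m by (simp_all add: cap_field_def cpart_nth model_space_def)
qed

lemma capc_curve:
  assumes d: "d \<in> F" and p: "p \<in> W" "xx p \<in> fst d"
  shows "vector_derivative (\<lambda>s. capc d (act (torus_exp (s *\<^sub>R \<xi>)) p)) (at 0) = cap_field d \<xi> p"
proof (rule vector_derivative_at)
  let ?g = "\<lambda>s. snd d (fiber_act L (torus_exp (s *\<^sub>R fiber_lift \<xi>)) (xx p))"
  have 1: "(?g has_vector_derivative fundamental_field (fiber_act L) d (fiber_lift \<xi>) (xx p)) (at 0)"
    by (rule action_curve(1)[OF fiber_charts fiber_action d p(2) fiber_lift_mem])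
  have "((\<lambda>s. cis (s * lift \<xi> $ k)) has_vector_derivative \<i> * of_real (lift \<xi> $ k)) (at 0)"
  proof -
    have "((\<lambda>s. exp (\<i> * of_real (lift \<xi> $ k) * of_real s)) has_vector_derivative
        exp (\<i> * of_real (lift \<xi> $ k) * of_real 0) * (\<i> * of_real (lift \<xi> $ k) * 1)) (at (0 :: real))"
      by (rule has_vector_derivative_real_field) (auto intro!: derivative_eq_intros)
    moreover have "(\<lambda>s. exp (\<i> * of_real (lift \<xi> $ k) * of_real s)) = (\<lambda>s. cis (s * lift \<xi> $ k))"
      by (simp add: fun_eq_iff cis_conv_exp mult_ac)
    ultimately show ?thesis by simp
  qed
  then have "((\<lambda>s. cis (s * lift \<xi> $ k) * zpart k (capc d p)) has_vector_derivative \<i> * of_real (lift \<xi> $ k) * zpart k (capc d p)) (at 0)"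
    by (rule bounded_linear.has_vector_derivative[OF bounded_linear_mult_left])
  then have 2: "((\<lambda>s. cpart k (cis (s * lift \<xi> $ k) * zpart k (capc d p))) has_vector_derivative
      cpart k (\<i> * of_real (lift \<xi> $ k) * zpart k (capc d p))) (at 0)"
    by (rule bounded_linear.has_vector_derivative[OF bounded_linear_parts(3)])
  have e: "capc d (act (torus_exp (s *\<^sub>R \<xi>)) p) = ?g s + cpart k (cis (s * lift \<xi> $ k) * zpart k (capc d p))" for s
    unfolding capc_act_exp[OF p d] by (simp add: linear_scale[OF linear_fiber_lift] linear_scale[OF linear_lift])
  show "((\<lambda>s. capc d (act (torus_exp (s *\<^sub>R \<xi>)) p)) has_vector_derivative cap_field d \<xi> p) (at 0)"
    unfolding e cap_field_def by (rule has_vector_derivative_add[OF 1 2])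
qed

text \<open>In the plane both fields are real multiples of i z, on which dx \<and> dy vanishes; the
  fiber parts are isotropic because the fiber is Hamiltonian.\<close>

lemma cap_isotropic:
  assumes d: "d \<in> F" and p: "xx p \<in> fst d"
  shows "capform \<phi> d (capc d p) (cap_field d \<xi> p) (cap_field d \<eta> p) = 0"
proof -
  have "hamiltonian_action (- {k}) F (fiber_form L) (fiber_act L)"
    using fiber_toric by (simp add: compact_symplectic_toric_def)
  then have "fiber_form L d (snd d (xx p)) (fundamental_field (fiber_act L) d (fiber_lift \<xi>) (xx p))
      (fundamental_field (fiber_act L) d (fiber_lift \<eta>) (xx p)) = 0"
    using d p fiber_lift_mem unfolding hamiltonian_action_def by blast
  then show ?thesis unfolding capform_def cap_field_parts[OF d p] capc_parts(1)[OF d p] by simp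
qed

definition fiber_moment :: "real^'n \<Rightarrow> 'x \<Rightarrow> real" where
  "fiber_moment \<xi> = (SOME \<mu>. smooth_fun F \<mu> \<and> (\<forall>d\<in>F. \<forall>x\<in>fst d. \<forall>u\<in>model_space (- {k}).
     fiber_form L d (snd d x) (fundamental_field (fiber_act L) d (fiber_lift \<xi>) x) u = differential d \<mu> x u))"

lemma fiber_moment:
  shows "d \<in> F \<Longrightarrow> smooth_on (snd d ` fst d) (local_expr d (fiber_moment \<xi>))"
    and "d \<in> F \<Longrightarrow> x \<in> fst d \<Longrightarrow> u \<in> model_space (- {k}) \<Longrightarrow>
     fiber_form L d (snd d x) (fundamental_field (fiber_act L) d (fiber_lift \<xi>) x) u = differential d (fiber_moment \<xi>) x u"
proof -
  have "hamiltonian_action (- {k}) F (fiber_form L) (fiber_act L)"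
    using fiber_toric by (simp add: compact_symplectic_toric_def)
  then have ex: "\<exists>\<mu>. smooth_fun F \<mu> \<and> (\<forall>d\<in>F. \<forall>x\<in>fst d. \<forall>u\<in>model_space (- {k}).
     fiber_form L d (snd d x) (fundamental_field (fiber_act L) d (fiber_lift \<xi>) x) u = differential d \<mu> x u)"
    using fiber_lift_mem unfolding hamiltonian_action_def by blast
  have *: "smooth_fun F (fiber_moment \<xi>) \<and> (\<forall>d\<in>F. \<forall>x\<in>fst d. \<forall>u\<in>model_space (- {k}).
     fiber_form L d (snd d x) (fundamental_field (fiber_act L) d (fiber_lift \<xi>) x) u = differential d (fiber_moment \<xi>) x u)"
    unfolding fiber_moment_def by (rule someI_ex[OF ex])
  show "smooth_on (snd d ` fst d) (local_expr d (fiber_moment \<xi>))" if "d \<in> F"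
    using conjunct1[OF *, unfolded smooth_fun_def case_prod_beta prod.collapse] that by blast
  show "fiber_form L d (snd d x) (fundamental_field (fiber_act L) d (fiber_lift \<xi>) x) u = differential d (fiber_moment \<xi>) x u"
    if "d \<in> F" "x \<in> fst d" "u \<in> model_space (- {k})"
    using conjunct2[OF *] that by blast
qed

text \<open>A Hamiltonian function on the cap, where \<open>\<Phi>\<close> is a primitive of the profile \<open>\<phi>\<close>.\<close>

definition cap_moment :: "(real \<Rightarrow> real) \<Rightarrow> real^'n \<Rightarrow> 'a \<Rightarrow> real" where
  "cap_moment \<Phi> \<xi> p = fiber_moment \<xi> (xx p) - coef L * lift \<xi> $ k * \<Phi> (hh p)"

definition cap_moment_expr :: "(real \<Rightarrow> real) \<Rightarrow> real^'n \<Rightarrow> ('x, 'n) chart \<Rightarrow> 'n coords \<Rightarrow> real" where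
  "cap_moment_expr \<Phi> \<xi> d y = local_expr d (fiber_moment \<xi>) (drop_coord k y) - coef L * lift \<xi> $ k * \<Phi> (height k y)"

lemma cap_moment_expr_capc:
  assumes "d \<in> F" "p \<in> W" "xx p \<in> fst d" "hh p \<ge> 0"
  shows "cap_moment_expr \<Phi> \<xi> d (capc d p) = cap_moment \<Phi> \<xi> p"
  unfolding cap_moment_expr_def cap_moment_def height_capc[OF assms] capc_parts(1)[OF assms(1,3)]
  using fiber_inj[OF assms(1)] assms(3) by (simp add: local_expr_at)

lemma smooth_on_cap_moment:
  assumes d: "d \<in> F" and \<Phi>: "smooth_on {0..\<delta>} \<Phi>"
  shows "smooth_on (cap_region \<delta> d) (cap_moment_expr \<Phi> \<xi> d)"
  unfolding cap_moment_expr_def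
  by (intro smooth_on_diff smooth_on_mult smooth_on_const smooth_on_height_compose[OF \<Phi>]
      smooth_on_compose[OF fiber_moment(1)[OF d] smooth_on_drop]) (auto simp: cap_region_def)

text \<open>Contracting dx \<and> dy with i b z gives -b (x dx + y dy) = -b dh. This accounts for
  the minus sign in \<open>cap_moment\<close>, and for \<Phi> with derivative \<phi> the plane term
  becomes the differential of -c b \<Phi>(h).\<close>

lemma cap_moment_derivative:
  assumes d: "d \<in> F" and p: "p \<in> W" "xx p \<in> fst d" "hh p \<ge> 0"
    and \<Phi>: "(\<Phi> has_real_derivative \<phi> (hh p)) (at (hh p) within I)"
    and S: "open S" "capc d p \<in> S" "height k ` S \<subseteq> I"
  shows "(cap_moment_expr \<Phi> \<xi> d has_derivative capform \<phi> d (capc d p) (cap_field d \<xi> p)) (at (capc d p))"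
proof -
  let ?y = "capc d p"
  have y: "drop_coord k ?y \<in> snd d ` fst d" "?y \<in> cap_region (hh p + 1) d"
    using capc_parts(1)[OF d p(2)] p(2) height_capc[OF d p] by (simp_all add: cap_region_def)
  have "smooth_on (cap_region (hh p + 1) d) (\<lambda>y. local_expr d (fiber_moment \<xi>) (drop_coord k y))"
    by (rule smooth_on_compose[OF fiber_moment(1)[OF d] smooth_on_drop]) (auto simp: cap_region_def)
  from smooth_on_has_derivative[OF this open_cap_region'[OF d] y(2)]
  have f: "((\<lambda>y. local_expr d (fiber_moment \<xi>) (drop_coord k y)) has_derivative
      (\<lambda>u. dir_deriv (local_expr d (fiber_moment \<xi>)) (drop_coord k ?y) (drop_coord k u))) (at ?y)"
    unfolding dir_deriv_drop[abs_def, of "local_expr d (fiber_moment \<xi>)"] .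
  have h: "((\<lambda>y. \<Phi> (height k y)) has_derivative (\<lambda>u. \<phi> (hh p) * (?y $ Inl k * u $ Inl k + ?y $ Inr k * u $ Inr k))) (at ?y)"
    by (rule height_compose_derivative[OF y(2) d _ S]) (use \<Phi> height_capc[OF d p] in simp)
  have "(cap_moment_expr \<Phi> \<xi> d has_derivative (\<lambda>u. dir_deriv (local_expr d (fiber_moment \<xi>)) (drop_coord k ?y) (drop_coord k u) -
      coef L * lift \<xi> $ k * (\<phi> (hh p) * (?y $ Inl k * u $ Inl k + ?y $ Inr k * u $ Inr k)))) (at ?y)"
    unfolding cap_moment_expr_def by (intro has_derivative_diff f has_derivative_mult_right h)
  moreover have "capform \<phi> d ?y (cap_field d \<xi> p) u = dir_deriv (local_expr d (fiber_moment \<xi>)) (drop_coord k ?y) (drop_coord k u) -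
      coef L * lift \<xi> $ k * (\<phi> (hh p) * (?y $ Inl k * u $ Inl k + ?y $ Inr k * u $ Inr k))" for u
    using fiber_moment(2)[OF d p(2) drop_coord_in_model_space, of \<xi> u]
    unfolding capform_def cap_field_parts[OF d p(2)] capc_parts(1)[OF d p(2)] height_capc[OF d p] differential_def
    by (simp add: algebra_simps)
  then have "capform \<phi> d ?y (cap_field d \<xi> p) = (\<lambda>u. dir_deriv (local_expr d (fiber_moment \<xi>)) (drop_coord k ?y) (drop_coord k u) -
      coef L * lift \<xi> $ k * (\<phi> (hh p) * (?y $ Inl k * u $ Inl k + ?y $ Inr k * u $ Inr k)))"
    by (rule ext)
  ultimately show ?thesis by (simp only:)
qed

end


section \<open>Thin collars around a component\<close>

context collar
begin

text \<open>Keeping the fiber and circle points and increasing h slightly from 0 moves p into the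
  positive side, by continuity of the inverse embedding.\<close>

lemma Z'_adherent:
  assumes U: "openin (mtop M) U" and p: "p \<in> Z'" "p \<in> U"
  shows "\<exists>q\<in>U \<inter> W. hh q > 0"
proof -
  have pW: "p \<in> W" using p Z'_sub by auto
  have h0: "hh p = 0" using Z'_iff[OF pW] p(1) by simp
  let ?P = "prod_topology (mtop F) (euclidean :: (complex \<times> real) topology)"
  let ?f = "\<lambda>s. (xx p, ww p, s)"
  have mem: "?f s \<in> cylinder" if "s \<in> {- \<epsilon><..<\<epsilon>}" for s using emb_mem[OF pW] that by simp
  have "continuous_map (top_of_set {- \<epsilon><..<\<epsilon>}) ?P ?f"
    using emb_mem(1)[OF pW] by (intro continuous_map_pairedI) (auto intro!: continuous_intros)
  then have "continuous_map (top_of_set {- \<epsilon><..<\<epsilon>}) (subtopology ?P cylinder) ?f"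
    using mem by (auto simp: continuous_map_in_subtopology)
  from continuous_map_compose[OF this continuous_G]
  have c: "continuous_map (top_of_set {- \<epsilon><..<\<epsilon>}) (mtop M) (\<lambda>s. G (?f s))" by (simp add: o_def)
  have "openin (top_of_set {- \<epsilon><..<\<epsilon>}) {s \<in> {- \<epsilon><..<\<epsilon>}. G (?f s) \<in> U}"
    using c U unfolding continuous_map_def by simp
  then have o: "open {s \<in> {- \<epsilon><..<\<epsilon>}. G (?f s) \<in> U}" using openin_open_eq open_greaterThanLessThan by blast
  have "?f 0 = emb L p" using h0 by (simp add: prod_eq_iff)
  then have "G (?f 0) = p" using G_emb[OF pW] by simp
  then have "0 \<in> {s \<in> {- \<epsilon><..<\<epsilon>}. G (?f s) \<in> U}" using p(2) width_pos by simp
  with o obtain e where e: "e > 0" "ball 0 e \<subseteq> {s \<in> {- \<epsilon><..<\<epsilon>}. G (?f s) \<in> U}" by (rule openE)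
  have "e / 2 \<in> ball 0 e" using e(1) by simp
  from subsetD[OF e(2) this] have s: "e / 2 \<in> {- \<epsilon><..<\<epsilon>}" "G (?f (e / 2)) \<in> U" by simp_all
  then show ?thesis using emb_G[OF mem[OF s(1)]] G_mem[OF mem[OF s(1)]] e(1)
    by (intro bexI[of _ "G (?f (e / 2))"]) auto
qed

lemma Z'_eq_level: "Z' = {p \<in> W. \<bar>hh p\<bar> \<le> 0}"
  using Z'_iff Z'_sub by auto

lemma compact_Z': "compactin (mtop M) Z'"
  unfolding Z'_eq_level by (rule compact_level[OF width_pos])

text \<open>A tube argument: the part of a closed collar outside U is compact, so its heights form a
  closed set, and this set does not contain 0.\<close>

lemma level_in_open:
  assumes U: "openin (mtop M) U" "Z' \<subseteq> U"
  obtains s where "0 < s" "s < \<epsilon>" "{p \<in> W. \<bar>hh p\<bar> \<le> s} \<subseteq> U"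
proof -
  let ?K = "{p \<in> W. \<bar>hh p\<bar> \<le> \<epsilon> / 2} - U"
  have "compactin (mtop M) ({p \<in> W. \<bar>hh p\<bar> \<le> \<epsilon> / 2} \<inter> (topspace (mtop M) - U))"
    using compact_level[of "\<epsilon> / 2"] width_pos U(1)
    by (intro compact_Int_closedin closedin_diff closedin_topspace) auto
  moreover have "{p \<in> W. \<bar>hh p\<bar> \<le> \<epsilon> / 2} \<inter> (topspace (mtop M) - U) = ?K"
    using openin_subset[OF nbhd_open] by auto
  ultimately have "compactin (mtop M) ?K" by simp
  then have "compactin (subtopology (mtop M) W) ?K" by (auto simp: compactin_subtopology)
  then have "compactin euclidean ((\<lambda>p. hh p) ` ?K)" by (rule image_compactin[OF _ continuous_hh])
  then have "closed ((\<lambda>p. hh p) ` ?K)" by (simp add: compact_imp_closed)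
  moreover have "0 \<notin> (\<lambda>p. hh p) ` ?K"
  proof
    assume "0 \<in> (\<lambda>p. hh p) ` ?K"
    then obtain p where p: "p \<in> W" "p \<notin> U" "hh p = 0" by auto
    then have "p \<in> Z'" using Z'_iff[OF p(1)] by simp
    then show False using U(2) p(2) by blast
  qed
  ultimately have "open (- (\<lambda>p. hh p) ` ?K)" "0 \<in> - (\<lambda>p. hh p) ` ?K" by auto
  then obtain e where e: "e > 0" "ball 0 e \<subseteq> - (\<lambda>p. hh p) ` ?K" by (rule openE)
  \<comment> \<open>The first bound avoids the heights attained outside U, the second stays within
    the collar piece that was examined.\<close>
  define s where "s = min (e / 2) (\<epsilon> / 2)"
  have s: "0 < s" "s < \<epsilon>" using e(1) width_pos by (auto simp: s_def)
  have "p \<in> U" if p: "p \<in> W" "\<bar>hh p\<bar> \<le> s" for p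
  proof (rule ccontr)
    assume "p \<notin> U"
    then have "p \<in> ?K" using p by (simp add: s_def)
    then have "hh p \<notin> ball 0 e" using e(2) by auto
    then show False using p(2) e(1) by (simp add: s_def dist_real_def)
  qed
  then show ?thesis using that[OF s] by auto
qed

end


section \<open>The component and its closure\<close>

locale collapse =
  fixes k :: "'n::finite" and M :: "('a, 'n) atlas" and Z X :: "'a set" and \<omega> :: "('a, 'n) form2"
    and act :: "complex^'n \<Rightarrow> 'a \<Rightarrow> 'a" and L :: "'a set \<Rightarrow> ('a, 'x, 'n) local_model"
  assumes toric: "b_symplectic_toric M Z \<omega> act"
    and compact: "compact_space (mtop M)"
    and connected: "connected_space (mtop M)"
    and component: "X \<in> connected_components_of (subtopology (mtop M) (carrier_of M - Z))"
    and models: "\<And>Z'. Z' \<in> adjacent_components M Z X \<Longrightarrow> is_local_model k M Z \<omega> act Z' (L Z')"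
    and side: "\<And>Z' p. Z' \<in> adjacent_components M Z X \<Longrightarrow> p \<in> nbhd (L Z') \<Longrightarrow>
                 p \<in> X \<longleftrightarrow> snd (snd (emb (L Z') p)) > 0"
begin

definition C :: "'a set set" where "C = adjacent_components M Z X"
definition P :: "'a set" where "P = X \<union> \<Union>C"

abbreviation "W Z' \<equiv> nbhd (L Z')"
abbreviation "xx Z' p \<equiv> fst (emb (L Z') p)"
abbreviation "hh Z' p \<equiv> snd (snd (emb (L Z') p))"
abbreviation "FF Z' \<equiv> fiber (L Z')"

lemma M_manifold: "smooth_manifold UNIV M" and Z_closed: "closedin (mtop M) Z"
  and b_form: "b_symplectic_form M Z \<omega>" and M_action: "smooth_torus_action UNIV M act"
  and act_Z: "\<And>t p. t \<in> torus UNIV \<Longrightarrow> p \<in> Z \<Longrightarrow> act t p \<in> Z"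
  and b_ham: "b_hamiltonian_action M Z \<omega> act" and M_effective: "effective_action UNIV M act"
  using toric by (auto simp: b_symplectic_toric_def b_manifold_def)

lemma M_charts: "atlas_charts UNIV M" and M_Hausdorff: "Hausdorff_space (mtop M)"
  using M_manifold by (auto simp: smooth_manifold_iff)

sublocale M: univ_atlas M by unfold_locales (rule M_charts)

lemma collar: "Z' \<in> C \<Longrightarrow> collar k M Z \<omega> act Z' (L Z')"
  by unfold_locales (use M_charts M_Hausdorff models C_def in auto)

lemma X_sub: "X \<subseteq> carrier_of M" "X \<inter> Z = {}" and X_nonempty: "X \<noteq> {}"
proof -
  have "X \<subseteq> topspace (subtopology (mtop M) (carrier_of M - Z))"
    using component by (rule connected_components_of_subset)
  then show "X \<subseteq> carrier_of M" "X \<inter> Z = {}" by auto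
  show "X \<noteq> {}" using component by (rule nonempty_connected_components_of)
qed

lemma complement_open: "openin (mtop M) (carrier_of M - Z)"
  using Z_closed by (metis openin_diff openin_topspace topspace_mtop)

lemma X_maximal:
  assumes "connectedin (mtop M) S" "S \<subseteq> carrier_of M - Z" "S \<inter> X \<noteq> {}"
  shows "S \<subseteq> X"
  by (rule connected_components_of_maximal[OF component])
    (use assms in \<open>auto simp: connectedin_subtopology disjnt_def\<close>)

lemma X_connected: "connectedin (mtop M) X"
  using connectedin_connected_components_of[OF component] by (simp add: connectedin_subtopology)

text \<open>M is locally connected: the preimage of a coordinate ball avoiding Z is connected, so it
  lies in the component of its center.\<close>

lemma X_open: "openin (mtop M) X"
proof (subst openin_subopen, intro ballI)
  fix p assume p: "p \<in> X"
  then obtain c where c: "c \<in> M" "p \<in> fst c" using X_sub by (auto simp: carrier_of_def)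
  have "open (snd c ` ((carrier_of M - Z) \<inter> fst c))" by (rule M.open_image[OF c(1) complement_open])
  moreover have "snd c p \<in> snd c ` ((carrier_of M - Z) \<inter> fst c)" using p c X_sub by auto
  ultimately obtain e where e: "e > 0" "ball (snd c p) e \<subseteq> snd c ` ((carrier_of M - Z) \<inter> fst c)" by (rule openE)
  let ?B = "ball (snd c p) e" and ?i = "inv_into (fst c) (snd c)"
  let ?N = "{q \<in> fst c. snd c q \<in> ?B}"
  have sub: "?B \<subseteq> snd c ` fst c" using e(2) by auto
  have N: "?N = ?i ` ?B"
  proof
    show "?N \<subseteq> ?i ` ?B" using M.inj[OF c(1)] by (auto simp: image_iff) (metis inv_into_f_f mem_ball)
    show "?i ` ?B \<subseteq> ?N" using sub by (auto simp: f_inv_into_f inv_into_into subset_iff)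
  qed
  have "connectedin (top_of_set (snd c ` fst c)) ?B" using sub by (simp add: connectedin_subtopology)
  then have "connectedin (mtop M) ?N" unfolding N
    by (rule connectedin_continuous_map_image[OF continuous_map_chart_inv[OF M_charts c(1)]])
  moreover have "?N \<subseteq> carrier_of M - Z"
  proof
    fix q assume q: "q \<in> ?N"
    then have "snd c q \<in> snd c ` ((carrier_of M - Z) \<inter> fst c)" using e(2) by blast
    then show "q \<in> carrier_of M - Z" using q M.inj[OF c(1)] by (auto simp: inj_on_def)
  qed
  moreover have pN: "p \<in> ?N" using c(2) e(1) by simp
  ultimately have "?N \<subseteq> X" using p by (intro X_maximal) auto
  then show "\<exists>T. openin (mtop M) T \<and> p \<in> T \<and> T \<subseteq> X"
    using openin_mtop_basic[OF c(1) open_ball] pN by (intro exI[of _ ?N]) simp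
qed

lemma C_sub: "Z' \<in> C \<Longrightarrow> Z' \<subseteq> Z" and C_nonempty: "Z' \<in> C \<Longrightarrow> Z' \<noteq> {}"
  and C_disjoint: "Z' \<in> C \<Longrightarrow> Z'' \<in> C \<Longrightarrow> p \<in> Z' \<Longrightarrow> p \<in> Z'' \<Longrightarrow> Z' = Z''"
proof -
  have comp: "Z' \<in> connected_components_of (subtopology (mtop M) Z)" if "Z' \<in> C" for Z'
    using that by (simp add: C_def adjacent_components_def)
  show "Z' \<subseteq> Z" if "Z' \<in> C" using connected_components_of_subset[OF comp[OF that]] by auto
  show "Z' \<noteq> {}" if "Z' \<in> C" using nonempty_connected_components_of[OF comp[OF that]] .
  show "Z' = Z''" if "Z' \<in> C" "Z'' \<in> C" "p \<in> Z'" "p \<in> Z''"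
    using pairwise_disjoint_connected_components_of[of "subtopology (mtop M) Z"] comp[OF that(1)] comp[OF that(2)] that(3,4)
    by (auto simp: pairwise_def disjnt_def)
qed

lemma C_not_X: "Z' \<in> C \<Longrightarrow> p \<in> Z' \<Longrightarrow> p \<notin> X"
  using C_sub X_sub by blast

lemma C_W: "Z' \<in> C \<Longrightarrow> Z' \<subseteq> W Z'"
  by (rule collar.Z'_sub[OF collar])

text \<open>A model neighbourhood meets Z only in its own component, and distinct components are
  disjoint.\<close>

lemma W_meets_C: "Z' \<in> C \<Longrightarrow> Z'' \<in> C \<Longrightarrow> p \<in> W Z' \<Longrightarrow> p \<in> Z'' \<Longrightarrow> Z'' = Z'"
  using collar.nbhd_Z[OF collar, of Z'] C_sub[of Z''] C_disjoint[of Z' Z'' p] by blast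

lemma X_side: "Z' \<in> C \<Longrightarrow> p \<in> W Z' \<Longrightarrow> p \<in> X \<longleftrightarrow> hh Z' p > 0"
  using side by (simp add: C_def)

lemma P_side: "Z' \<in> C \<Longrightarrow> p \<in> W Z' \<Longrightarrow> p \<in> P \<longleftrightarrow> hh Z' p \<ge> 0"
proof -
  assume Z': "Z' \<in> C" and p: "p \<in> W Z'"
  have "p \<in> \<Union>C \<longleftrightarrow> p \<in> Z'" using W_meets_C[OF Z' _ p] Z' by blast
  then show ?thesis using X_side[OF Z' p] collar.Z'_iff[OF collar[OF Z'] p] unfolding P_def by auto
qed

text \<open>In this form P inherits compactness from M and connectedness from X. Points of adjacent
  components are limits from the side h > 0; conversely X is closed in the complement of Z, and a
  point of Z in the closure of X lies on an adjacent component by definition.\<close>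

lemma P_eq_closure: "P = mtop M closure_of X"
proof
  show "P \<subseteq> mtop M closure_of X"
  proof
    fix p assume "p \<in> P"
    then consider "p \<in> X" | Z' where "Z' \<in> C" "p \<in> Z'" by (auto simp: P_def)
    then show "p \<in> mtop M closure_of X"
    proof cases
      case 1
      then show ?thesis using closure_of_subset[of X "mtop M"] X_sub by auto
    next
      case 2
      have "p \<in> carrier_of M" using 2 C_sub closedin_subset[OF Z_closed] by fastforce
      moreover have "\<exists>y. y \<in> X \<and> y \<in> T" if pT: "p \<in> T \<and> openin (mtop M) T" for T
      proof -
        obtain q where "q \<in> T \<inter> W Z'" "hh Z' q > 0"
          using collar.Z'_adherent[OF collar[OF 2(1)] conjunct2[OF pT] 2(2) conjunct1[OF pT]] by auto
        then show ?thesis using X_side[OF 2(1), of q] by auto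
      qed
      ultimately show ?thesis unfolding in_closure_of topspace_mtop by blast
    qed
  qed
  show "mtop M closure_of X \<subseteq> P"
  proof
    fix p assume p: "p \<in> mtop M closure_of X"
    then have pM: "p \<in> carrier_of M" using closure_of_subset_topspace[of "mtop M" X] by auto
    show "p \<in> P"
    proof (cases "p \<in> Z")
      case True
      have "\<Union>(connected_components_of (subtopology (mtop M) Z)) = Z"
        using Union_connected_components_of[of "subtopology (mtop M) Z"] closedin_subset[OF Z_closed] by auto
      then obtain Z' where "Z' \<in> connected_components_of (subtopology (mtop M) Z)" "p \<in> Z'" using True by blast
      moreover from this have "Z' \<in> C" using p by (auto simp: C_def adjacent_components_def)
      ultimately show ?thesis by (auto simp: P_def)
    next
      case False
      have "closedin (subtopology (mtop M) (carrier_of M - Z)) X"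
        using component by (rule closedin_connected_components_of)
      then obtain T where T: "closedin (mtop M) T" "X = T \<inter> (carrier_of M - Z)" by (auto simp: closedin_subtopology)
      have "mtop M closure_of X \<subseteq> T" using T by (intro closure_of_minimal) auto
      then have "p \<in> T \<inter> (carrier_of M - Z)" using p pM False by blast
      then show ?thesis unfolding T(2)[symmetric] P_def by blast
    qed
  qed
qed

lemma P_closed: "closedin (mtop M) P"
  by (simp add: P_eq_closure)

lemma P_sub: "P \<subseteq> carrier_of M"
  using closedin_subset[OF P_closed] by simp

lemma P_compact: "compactin (mtop M) P"
  by (rule closedin_compact_space[OF compact P_closed])

lemma P_connected: "connectedin (mtop M) P"
  unfolding P_eq_closure by (rule connectedin_closure_of[OF X_connected])

text \<open>Each collar contains points of one collapsed component only. A finite family of collars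
  covering the compact set P \<inter> Z must therefore include the collar of every
  component.\<close>

lemma finite_C: "finite C"
proof -
  have e: "\<Union>C = P \<inter> Z" using C_sub X_sub by (auto simp: P_def)
  have cpt: "compactin (mtop M) (\<Union>C)"
    unfolding e by (rule closedin_compact_space[OF compact closedin_Int[OF P_closed Z_closed]])
  have op: "openin (mtop M) U" if "U \<in> (\<lambda>Z'. W Z') ` C" for U
    using that collar.nbhd_open[OF collar] by auto
  have cov: "\<Union>C \<subseteq> \<Union>((\<lambda>Z'. W Z') ` C)" using C_W by blast
  have "\<exists>\<F>. finite \<F> \<and> \<F> \<subseteq> (\<lambda>Z'. W Z') ` C \<and> \<Union>C \<subseteq> \<Union>\<F>"
    by (rule compactinD[OF cpt _ cov]) (rule op)
  then obtain \<F> where \<F>: "finite \<F>" "\<F> \<subseteq> (\<lambda>Z'. W Z') ` C" "\<Union>C \<subseteq> \<Union>\<F>"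
    by (elim exE conjE) (rule that)
  from finite_subset_image[OF \<F>(1,2)] obtain C0 where C0: "finite C0" "C0 \<subseteq> C" "\<F> = (\<lambda>Z'. W Z') ` C0" by auto
  have C0': "Z' \<in> C0" if Z': "Z' \<in> C" for Z'
  proof -
    obtain p where p: "p \<in> Z'" using C_nonempty[OF Z'] by auto
    then have "p \<in> \<Union>\<F>" using \<F>(3) Z' by blast
    then obtain Z'' where "Z'' \<in> C0" "p \<in> W Z''" using C0(3) by auto
    moreover from this have "Z' = Z''" using W_meets_C[of Z'' Z' p] C0(2) Z' p by blast
    ultimately show ?thesis by simp
  qed
  have "C \<subseteq> C0" using C0' by (rule subsetI)
  then show ?thesis using C0(1) by (rule finite_subset)
qed

lemma positive_lower_bound:
  assumes "finite S" "\<And>x. x \<in> S \<Longrightarrow> (0::real) < x"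
  shows "\<exists>\<delta>>0. \<forall>x\<in>S. \<delta> \<le> x"
proof -
  have "finite (insert 1 S)" "insert 1 S \<noteq> {}" using assms(1) by auto
  then have "0 < Min (insert 1 S)" "\<forall>x\<in>S. Min (insert 1 S) \<le> x" using assms(2) by auto
  then show ?thesis by blast
qed

text \<open>Disjoint compact sets in a Hausdorff space have disjoint open neighbourhoods, and each
  of these contains a thin collar by \<open>level_in_open\<close>.\<close>

lemma separate_levels:
  assumes "Z' \<in> C" "Z'' \<in> C" "Z' \<noteq> Z''"
  shows "\<exists>s>0. {p \<in> W Z'. \<bar>hh Z' p\<bar> \<le> s} \<inter> {p \<in> W Z''. \<bar>hh Z'' p\<bar> \<le> s} = {}"
proof -
  have "disjnt Z' Z''" using C_disjoint assms by (auto simp: disjnt_def)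
  then obtain U V where UV: "openin (mtop M) U" "openin (mtop M) V" "Z' \<subseteq> U" "Z'' \<subseteq> V" "disjnt U V"
    by (rule Hausdorff_space_compact_separation[OF M_Hausdorff collar.compact_Z'[OF collar[OF assms(1)]]
      collar.compact_Z'[OF collar[OF assms(2)]]]) (rule that)
  obtain s where s: "0 < s" "{p \<in> W Z'. \<bar>hh Z' p\<bar> \<le> s} \<subseteq> U"
    by (rule collar.level_in_open[OF collar[OF assms(1)] UV(1,3)]) (rule that)
  obtain s' where s': "0 < s'" "{p \<in> W Z''. \<bar>hh Z'' p\<bar> \<le> s'} \<subseteq> V"
    by (rule collar.level_in_open[OF collar[OF assms(2)] UV(2,4)]) (rule that)
  have "{p \<in> W Z'. \<bar>hh Z' p\<bar> \<le> min s s'} \<subseteq> U" "{p \<in> W Z''. \<bar>hh Z'' p\<bar> \<le> min s s'} \<subseteq> V"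
    using s(2) s'(2) by auto
  then have "{p \<in> W Z'. \<bar>hh Z' p\<bar> \<le> min s s'} \<inter> {p \<in> W Z''. \<bar>hh Z'' p\<bar> \<le> min s s'} = {}"
    using UV(5) unfolding disjnt_def by blast
  then show ?thesis using s(1) s'(1) by (intro exI[of _ "min s s'"]) simp
qed

lemma common_width:
  obtains \<delta> where "0 < \<delta>" "\<And>Z'. Z' \<in> C \<Longrightarrow> \<delta> < width (L Z')"
    "\<And>Z' Z'' p. Z' \<in> C \<Longrightarrow> Z'' \<in> C \<Longrightarrow> p \<in> W Z' \<Longrightarrow> p \<in> W Z'' \<Longrightarrow> \<bar>hh Z' p\<bar> \<le> \<delta> \<Longrightarrow> \<bar>hh Z'' p\<bar> \<le> \<delta> \<Longrightarrow> Z' = Z''"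
proof -
  have ex: "\<exists>s. 0 < s \<and> (Z' \<in> C \<longrightarrow> Z'' \<in> C \<longrightarrow> Z' \<noteq> Z'' \<longrightarrow>
     {p \<in> W Z'. \<bar>hh Z' p\<bar> \<le> s} \<inter> {p \<in> W Z''. \<bar>hh Z'' p\<bar> \<le> s} = {})" for Z' Z''
    using separate_levels[of Z' Z''] zero_less_one by blast
  define s where "s Z' Z'' = (SOME s. 0 < s \<and> (Z' \<in> C \<longrightarrow> Z'' \<in> C \<longrightarrow> Z' \<noteq> Z'' \<longrightarrow>
     {p \<in> W Z'. \<bar>hh Z' p\<bar> \<le> s} \<inter> {p \<in> W Z''. \<bar>hh Z'' p\<bar> \<le> s} = {}))" for Z' Z''
  have s0: "0 < s Z' Z'' \<and> (Z' \<in> C \<longrightarrow> Z'' \<in> C \<longrightarrow> Z' \<noteq> Z'' \<longrightarrow>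
     {p \<in> W Z'. \<bar>hh Z' p\<bar> \<le> s Z' Z''} \<inter> {p \<in> W Z''. \<bar>hh Z'' p\<bar> \<le> s Z' Z''} = {})" for Z' Z''
    unfolding s_def by (rule someI_ex[OF ex])
  have s: "\<And>Z' Z''. 0 < s Z' Z''" "\<And>Z' Z''. Z' \<in> C \<Longrightarrow> Z'' \<in> C \<Longrightarrow> Z' \<noteq> Z'' \<Longrightarrow>
     {p \<in> W Z'. \<bar>hh Z' p\<bar> \<le> s Z' Z''} \<inter> {p \<in> W Z''. \<bar>hh Z'' p\<bar> \<le> s Z' Z''} = {}"
    by (rule conjunct1[OF s0], rule conjunct2[OF s0, rule_format])
  \<comment> \<open>Half widths are included so that \<delta> ends up strictly below every
    width.\<close>
  let ?S = "(\<lambda>(Z', Z''). s Z' Z'') ` (C \<times> C) \<union> (\<lambda>Z'. width (L Z') / 2) ` C"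
  have fin: "finite ?S" using finite_C by auto
  have pos: "0 < x" if "x \<in> ?S" for x using that s(1) collar.width_pos[OF collar] by auto
  from positive_lower_bound[OF fin pos] obtain \<delta> where \<delta>: "0 < \<delta>" "\<And>x. x \<in> ?S \<Longrightarrow> \<delta> \<le> x" by auto
  show ?thesis
  proof (rule that[OF \<delta>(1)])
    show "\<delta> < width (L Z')" if "Z' \<in> C" for Z'
    proof -
      have "\<delta> \<le> width (L Z') / 2" using that by (intro \<delta>(2)) auto
      then show ?thesis using collar.width_pos[OF collar[OF that]] by linarith
    qed
    show "Z' = Z''" if h: "Z' \<in> C" "Z'' \<in> C" "p \<in> W Z'" "p \<in> W Z''" "\<bar>hh Z' p\<bar> \<le> \<delta>" "\<bar>hh Z'' p\<bar> \<le> \<delta>" for Z' Z'' p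
    proof (rule ccontr)
      assume ne: "Z' \<noteq> Z''"
      have "\<delta> \<le> s Z' Z''" using h(1,2) by (intro \<delta>(2)) force
      then have "p \<in> {p \<in> W Z'. \<bar>hh Z' p\<bar> \<le> s Z' Z''} \<inter> {p \<in> W Z''. \<bar>hh Z'' p\<bar> \<le> s Z' Z''}" using h by auto
      with s(2)[OF h(1,2) ne] show False by blast
    qed
  qed
qed

end


section \<open>The charts of the quotient\<close>

context collapse
begin

definition R :: "('a \<times> 'a) set" where "R = collapse_rel X C L"
definition \<pi> :: "'a \<Rightarrow> 'a set" where "\<pi> p = R `` {p}"
definition A :: "('a set, 'n) atlas" where "A = quotient_atlas k M X C L"

abbreviation "oc \<equiv> open_part_chart R X"
abbreviation "cc Z' \<equiv> cap_chart k R P (L Z')"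
abbreviation "capc Z' \<equiv> collar.capc k (L Z')"

lemma R_iff: "(p, q) \<in> R \<longleftrightarrow> p \<in> P \<and> q \<in> P \<and> (p = q \<or> (\<exists>Z'\<in>C. p \<in> Z' \<and> q \<in> Z' \<and> xx Z' p = xx Z' q))"
  by (simp add: R_def collapse_rel_def P_def)

lemma equiv_R: "equiv P R"
proof (rule equivI)
  show "R \<subseteq> P \<times> P" by (auto simp: R_iff)
  show "refl_on P R" by (auto simp: refl_on_def R_iff)
  show "sym R"
  proof (rule symI)
    fix p q assume pq: "(p, q) \<in> R"
    show "(q, p) \<in> R"
    proof (cases "p = q")
      case False
      then obtain Z1 where "Z1 \<in> C" "p \<in> Z1" "q \<in> Z1" "xx Z1 p = xx Z1 q" using pq unfolding R_iff by blast
      then have "\<exists>Z'\<in>C. q \<in> Z' \<and> p \<in> Z' \<and> xx Z' q = xx Z' p" by (intro bexI[of _ Z1]) simp_all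
      then show ?thesis using pq unfolding R_iff by simp
    qed (use pq in simp)
  qed
  show "trans R"
  proof (rule transI)
    fix p q r assume pq: "(p, q) \<in> R" and qr: "(q, r) \<in> R"
    show "(p, r) \<in> R"
    proof (cases "p = q \<or> q = r")
      case True
      then show ?thesis using pq qr by auto
    next
      case False
      obtain Z1 where 1: "Z1 \<in> C" "p \<in> Z1" "q \<in> Z1" "xx Z1 p = xx Z1 q" using pq False unfolding R_iff by blast
      obtain Z2 where 2: "Z2 \<in> C" "q \<in> Z2" "r \<in> Z2" "xx Z2 q = xx Z2 r" using qr False unfolding R_iff by blast
      have "Z2 = Z1" by (rule C_disjoint[OF 2(1) 1(1) 2(2) 1(3)])
      then have "\<exists>Z'\<in>C. p \<in> Z' \<and> r \<in> Z' \<and> xx Z' p = xx Z' r" using 1 2 by (intro bexI[of _ Z1]) simp_all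
      then show ?thesis using pq qr unfolding R_iff by simp
    qed
  qed
qed

lemma \<pi>_eq_iff: "p \<in> P \<Longrightarrow> q \<in> P \<Longrightarrow> \<pi> p = \<pi> q \<longleftrightarrow> p = q \<or> (\<exists>Z'\<in>C. p \<in> Z' \<and> q \<in> Z' \<and> xx Z' p = xx Z' q)"
  unfolding \<pi>_def using eq_equiv_class_iff[OF equiv_R, of p q] by (auto simp: R_iff)

lemma mem_\<pi>:
  assumes "p \<in> P"
  shows "q \<in> \<pi> p \<longleftrightarrow> q \<in> P \<and> \<pi> q = \<pi> p"
proof
  { assume "q \<in> \<pi> p"
    then have "(p, q) \<in> R" by (simp add: \<pi>_def)
    then show "q \<in> P \<and> \<pi> q = \<pi> p" using equiv_class_eq[OF equiv_R] R_iff unfolding \<pi>_def by blast }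
  { assume "q \<in> P \<and> \<pi> q = \<pi> p"
    then show "q \<in> \<pi> p" using equiv_class_self[OF equiv_R, of q] unfolding \<pi>_def by blast }
qed

lemma X_P: "p \<in> X \<Longrightarrow> p \<in> P" and C_P: "Z' \<in> C \<Longrightarrow> p \<in> Z' \<Longrightarrow> p \<in> P"
  by (auto simp: P_def)

lemma \<pi>_X_eq: "p \<in> X \<Longrightarrow> q \<in> P \<Longrightarrow> \<pi> p = \<pi> q \<longleftrightarrow> p = q"
  using \<pi>_eq_iff[OF X_P, of p q] C_not_X by blast

lemma \<pi>_X: "p \<in> X \<Longrightarrow> \<pi> p = {p}"
  using mem_\<pi>[OF X_P, of p] \<pi>_X_eq[of p] X_P by blast

text \<open>Collapsing forgets only the angle, and only at h = 0. So x and h, and whatever is built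
  from them on a collar, descend to the quotient.\<close>

lemma \<pi>_same_collar:
  assumes "Z' \<in> C" "p \<in> P" "q \<in> P" "\<pi> p = \<pi> q" "p \<in> W Z'"
  shows "q \<in> W Z'" "xx Z' q = xx Z' p" "hh Z' q = hh Z' p" "p \<noteq> q \<Longrightarrow> p \<in> Z' \<and> q \<in> Z'"
proof -
  have "p = q \<or> (p \<in> Z' \<and> q \<in> Z' \<and> xx Z' p = xx Z' q)"
    using \<pi>_eq_iff[OF assms(2,3)] assms(4) W_meets_C[OF assms(1) _ assms(5)] by metis
  then show "q \<in> W Z'" "xx Z' q = xx Z' p" "hh Z' q = hh Z' p" "p \<noteq> q \<Longrightarrow> p \<in> Z' \<and> q \<in> Z'"
    using assms(5) C_W[OF assms(1)] collar.Z'_iff[OF collar[OF assms(1)]] by fastforce+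
qed

lemma capc_same:
  assumes "Z' \<in> C" "p \<in> P" "q \<in> P" "\<pi> p = \<pi> q" "p \<in> W Z'"
  shows "capc Z' d q = capc Z' d p"
proof (cases "p = q")
  case False
  then have "p \<in> Z'" "q \<in> Z'" using \<pi>_same_collar[OF assms] by auto
  then have "hh Z' p = 0" "hh Z' q = 0"
    using collar.Z'_iff[OF collar[OF assms(1)]] C_W[OF assms(1)] by auto
  then show ?thesis
    using \<pi>_same_collar(2)[OF assms] by (simp add: collar.capc_def[OF collar[OF assms(1)]])
qed simp

lemma oc_apply: "p \<in> X \<Longrightarrow> snd (oc c) (\<pi> p) = snd c p"
  by (simp add: open_part_chart_def \<pi>_X)

lemma oc_dom: "fst (oc c) = \<pi> ` (fst c \<inter> X)"
  by (simp add: open_part_chart_def \<pi>_def)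

lemma oc_mem: "p \<in> P \<Longrightarrow> \<pi> p \<in> fst (oc c) \<longleftrightarrow> p \<in> fst c \<and> p \<in> X"
  unfolding oc_dom using \<pi>_X_eq by fastforce

text \<open>\<open>cap_chart\<close> evaluates at an arbitrary representative of the class;
  \<open>capc_same\<close> makes the choice harmless.\<close>

lemma cc_apply:
  assumes Z': "Z' \<in> C" and p: "p \<in> P" "p \<in> W Z'"
  shows "snd (cc Z' d) (\<pi> p) = capc Z' d p"
proof -
  define q where "q = (SOME q. q \<in> \<pi> p)"
  have "p \<in> \<pi> p" using mem_\<pi>[OF p(1)] p(1) by simp
  then have "q \<in> \<pi> p" unfolding q_def by (rule someI)
  then have q: "q \<in> P" "\<pi> q = \<pi> p" using mem_\<pi>[OF p(1)] by auto
  have "snd (cc Z' d) (\<pi> p) = capc Z' d q"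
    unfolding cap_chart_def snd_conv q_def[symmetric]
    by (simp add: case_prod_beta Let_def collar.capc_def[OF collar[OF Z']] cpart_def add.assoc)
  also have "\<dots> = capc Z' d p" by (rule capc_same[OF Z' p(1) q(1) q(2)[symmetric] p(2)])
  finally show ?thesis .
qed

lemma cc_dom: "fst (cc Z' d) = \<pi> ` {p \<in> W Z' \<inter> P. xx Z' p \<in> fst d}"
  by (simp add: cap_chart_def \<pi>_def)

lemma cc_mem:
  assumes "Z' \<in> C" "p \<in> P"
  shows "\<pi> p \<in> fst (cc Z' d) \<longleftrightarrow> p \<in> W Z' \<and> xx Z' p \<in> fst d"
proof
  assume "\<pi> p \<in> fst (cc Z' d)"
  then obtain q where q: "q \<in> W Z'" "q \<in> P" "xx Z' q \<in> fst d" "\<pi> q = \<pi> p" unfolding cc_dom by auto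
  then show "p \<in> W Z' \<and> xx Z' p \<in> fst d" using \<pi>_same_collar[OF assms(1) q(2) assms(2) q(4,1)] by simp
next
  assume "p \<in> W Z' \<and> xx Z' p \<in> fst d"
  then show "\<pi> p \<in> fst (cc Z' d)" unfolding cc_dom using assms(2) by blast
qed

lemma A_cases:
  assumes "e \<in> A"
  obtains c where "c \<in> M" "e = oc c" | Z' d where "Z' \<in> C" "d \<in> FF Z'" "e = cc Z' d"
  using assms unfolding A_def quotient_atlas_def R_def[symmetric] P_def[symmetric] by blast

lemma oc_A: "c \<in> M \<Longrightarrow> oc c \<in> A" and cc_A: "Z' \<in> C \<Longrightarrow> d \<in> FF Z' \<Longrightarrow> cc Z' d \<in> A"
  unfolding A_def quotient_atlas_def R_def[symmetric] P_def[symmetric] by blast+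

lemma oc_inj:
  assumes "c \<in> M"
  shows "inj_on (snd (oc c)) (fst (oc c))"
proof (rule inj_onI)
  fix a b assume ab: "a \<in> fst (oc c)" "b \<in> fst (oc c)" "snd (oc c) a = snd (oc c) b"
  then obtain p q where "a = \<pi> p" "p \<in> fst c" "p \<in> X" "b = \<pi> q" "q \<in> fst c" "q \<in> X" unfolding oc_dom by auto
  then show "a = b" using ab(3) M.inj[OF assms] oc_apply by (metis inj_on_def)
qed

lemma cc_inj:
  assumes Z': "Z' \<in> C" and d: "d \<in> FF Z'"
  shows "inj_on (snd (cc Z' d)) (fst (cc Z' d))"
proof (rule inj_onI)
  fix a b assume ab: "a \<in> fst (cc Z' d)" "b \<in> fst (cc Z' d)" "snd (cc Z' d) a = snd (cc Z' d) b"
  then obtain p q where p: "a = \<pi> p" "p \<in> P" "p \<in> W Z'" "xx Z' p \<in> fst d"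
    and q: "b = \<pi> q" "q \<in> P" "q \<in> W Z'" "xx Z' q \<in> fst d" unfolding cc_dom by auto
  have h: "hh Z' p \<ge> 0" "hh Z' q \<ge> 0" using P_side[OF Z'] p q by auto
  have eq: "capc Z' d p = capc Z' d q" using ab(3) cc_apply[OF Z'] p q by simp
  note i = collar.capc_inj[OF collar[OF Z'] d p(3,4) h(1) q(3,4) h(2) eq]
  show "a = b"
  proof (cases "hh Z' p > 0")
    case True then show ?thesis using i(3) p(1) q(1) by simp
  next
    case False
    then have "hh Z' p = 0" "hh Z' q = 0" using h i(2) by auto
    then have "p \<in> Z'" "q \<in> Z'" using collar.Z'_iff[OF collar[OF Z']] p q by auto
    then show ?thesis unfolding p(1) q(1) \<pi>_eq_iff[OF p(2) q(2)] using i(1) Z' by blast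
  qed
qed

lemma local_expr_oc:
  assumes "c \<in> M" "p \<in> fst c" "p \<in> X"
  shows "local_expr (oc c) f (snd c p) = f (\<pi> p)"
  using local_expr_at[OF oc_inj[OF assms(1)], of "\<pi> p" f] assms oc_mem[OF X_P[OF assms(3)], of c] oc_apply[OF assms(3), of c]
  by simp

lemma local_expr_cc:
  assumes "Z' \<in> C" "d \<in> FF Z'" "p \<in> P" "p \<in> W Z'" "xx Z' p \<in> fst d"
  shows "local_expr (cc Z' d) f (capc Z' d p) = f (\<pi> p)"
  using local_expr_at[OF cc_inj[OF assms(1,2)], of "\<pi> p" f] assms(4,5) cc_mem[OF assms(1,3), of d] cc_apply[OF assms(1,3,4), of d]
  by simp

lemma carrier_A: "carrier_of A = \<pi> ` P"
proof
  show "carrier_of A \<subseteq> \<pi> ` P"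
  proof
    fix q assume "q \<in> carrier_of A"
    then obtain e where e: "e \<in> A" "q \<in> fst e" by (auto simp: carrier_of_def)
    from e(1) show "q \<in> \<pi> ` P"
      by (cases rule: A_cases) (use e(2) X_P in \<open>auto simp: oc_dom cc_dom\<close>)
  qed
  show "\<pi> ` P \<subseteq> carrier_of A"
  proof
    fix q assume "q \<in> \<pi> ` P"
    then obtain p where p: "q = \<pi> p" "p \<in> P" by auto
    from p(2) consider "p \<in> X" | Z' where "Z' \<in> C" "p \<in> Z'" by (auto simp: P_def)
    then show "q \<in> carrier_of A"
    proof cases
      case 1
      then obtain c where "c \<in> M" "p \<in> fst c" using X_sub by (auto simp: carrier_of_def)
      then show ?thesis using oc_A[of c] oc_mem[OF p(2), of c] 1 p(1) unfolding carrier_of_def by blast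
    next
      case 2
      have pW: "p \<in> W Z'" using 2 C_W by auto
      obtain d where d: "d \<in> FF Z'" "xx Z' p \<in> fst d"
        using collar.emb_mem(1)[OF collar[OF 2(1)] pW] by (auto simp: carrier_of_def)
      then show ?thesis using cc_A[OF 2(1) d(1)] cc_mem[OF 2(1) p(2), of d] pW p(1) unfolding carrier_of_def by blast
    qed
  qed
qed

lemma carrier_quotient: "carrier_of A = P // R"
  unfolding carrier_A quotient_def \<pi>_def by auto

text \<open>Open part charts cover only X, and the collar of another component misses
  \<open>Z'\<close>. Hence no mixed pair of charts meets at a pole.\<close>

lemma charts_at_collapsed:
  assumes "e \<in> A" "\<pi> p \<in> fst e" "Z' \<in> C" "p \<in> Z'"
  obtains d where "d \<in> FF Z'" "e = cc Z' d" "xx Z' p \<in> fst d"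
  using assms(1)
proof (cases rule: A_cases)
  case (1 c)
  then show ?thesis using assms(2) oc_mem[OF C_P[OF assms(3,4)], of c] C_not_X[OF assms(3,4)] by auto
next
  case (2 Z'' d)
  have "p \<in> W Z''" "xx Z'' p \<in> fst d" using assms(2) cc_mem[OF 2(1) C_P[OF assms(3,4)], of d] 2(3) by auto
  moreover from this have "Z' = Z''" using W_meets_C[OF 2(1) assms(3)] assms(4) by auto
  ultimately show ?thesis using 2 that by auto
qed

lemma compat_oc_oc:
  assumes c: "c \<in> M" "c' \<in> M" and p: "p \<in> X" "p \<in> fst c" "p \<in> fst c'"
  shows "compat_at (oc c) (oc c') (\<pi> p)"
proof -
  let ?S = "snd c ` ((X \<inter> fst c') \<inter> fst c)"
  have "open ?S" by (rule M.open_image[OF c(1) openin_Int[OF X_open openin_mtop_domain[OF c(2)]]])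
  moreover have "snd (oc c) (\<pi> p) \<in> ?S" unfolding oc_apply[OF p(1)] using p by auto
  moreover have "?S \<subseteq> snd (oc c) ` (fst (oc c) \<inter> fst (oc c'))"
  proof
    fix y assume "y \<in> ?S"
    then obtain q where q: "y = snd c q" "q \<in> X" "q \<in> fst c" "q \<in> fst c'" by auto
    then have "y = snd (oc c) (\<pi> q)" "\<pi> q \<in> fst (oc c) \<inter> fst (oc c')"
      using oc_apply[OF q(2), of c] unfolding oc_dom by auto
    then show "y \<in> snd (oc c) ` (fst (oc c) \<inter> fst (oc c'))" by (rule image_eqI)
  qed
  moreover have "smooth_on ?S (local_expr c (snd c'))"
    by (rule smooth_on_subset[OF M.smooth_transition[OF c]]) auto
  then have "smooth_on ?S (local_expr (oc c) (snd (oc c')))"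
  proof (rule smooth_on_cong)
    fix y assume "y \<in> ?S"
    then obtain q where q: "y = snd c q" "q \<in> X" "q \<in> fst c" "q \<in> fst c'" by auto
    show "local_expr c (snd c') y = local_expr (oc c) (snd (oc c')) y"
      unfolding q(1) local_expr_oc[OF c(1) q(3,2)] oc_apply[OF q(2)] using M.inj[OF c(1)] q(3) by (simp add: local_expr_at)
  qed
  ultimately show ?thesis unfolding compat_at_def using p oc_mem[OF X_P[OF p(1)]] by blast
qed

text \<open>Off the pole the two coordinate changes are given by \<open>capc_smooth\<close> and
  \<open>capc_inverse_smooth\<close>; neither follows from the other, since compatibility asserts
  smoothness in one direction.\<close>

lemma compat_oc_cc:
  assumes c: "c \<in> M" and Z': "Z' \<in> C" "d \<in> FF Z'" and p: "p \<in> X" "p \<in> fst c" "p \<in> W Z'" "xx Z' p \<in> fst d"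
  shows "compat_at (oc c) (cc Z' d) (\<pi> p)" "compat_at (cc Z' d) (oc c) (\<pi> p)"
proof -
  note cl = collar[OF Z'(1)]
  have hp: "hh Z' p > 0" using X_side[OF Z'(1) p(3)] p(1) by simp
  have mem: "\<pi> p \<in> fst (oc c)" "\<pi> p \<in> fst (cc Z' d)"
    using oc_mem[OF X_P[OF p(1)], of c] cc_mem[OF Z'(1) X_P[OF p(1)], of d] p by auto
  have qX: "q \<in> X" if "q \<in> W Z'" "hh Z' q > 0" for q using X_side[OF Z'(1) that(1)] that(2) by simp
  obtain S where S: "open S" "snd c p \<in> S" "S \<subseteq> snd c ` {q \<in> fst c \<inter> W Z'. xx Z' q \<in> fst d \<and> hh Z' q > 0}"
    "smooth_on S (local_expr c (capc Z' d))"
    by (rule collar.capc_smooth[OF cl c Z'(2) p(2,3,4) hp]) (rule that)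
  have Sq: "\<exists>q. y = snd c q \<and> q \<in> fst c \<and> q \<in> W Z' \<and> xx Z' q \<in> fst d \<and> q \<in> X" if y: "y \<in> S" for y
    using subsetD[OF S(3) y] qX by auto
  show "compat_at (oc c) (cc Z' d) (\<pi> p)"
    unfolding compat_at_def
  proof (intro conjI mem exI[of _ S] S(1))
    show "snd (oc c) (\<pi> p) \<in> S" unfolding oc_apply[OF p(1)] by (rule S(2))
    show "S \<subseteq> snd (oc c) ` (fst (oc c) \<inter> fst (cc Z' d))"
    proof
      fix y assume "y \<in> S"
      then obtain q where q: "y = snd c q" "q \<in> fst c" "q \<in> W Z'" "xx Z' q \<in> fst d" "q \<in> X" using Sq by blast
      then have "y = snd (oc c) (\<pi> q)" "\<pi> q \<in> fst (oc c) \<inter> fst (cc Z' d)"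
        using oc_apply[OF q(5), of c] oc_mem[OF X_P[OF q(5)], of c] cc_mem[OF Z'(1) X_P[OF q(5)], of d] by auto
      then show "y \<in> snd (oc c) ` (fst (oc c) \<inter> fst (cc Z' d))" by (rule image_eqI)
    qed
    show "smooth_on S (local_expr (oc c) (snd (cc Z' d)))"
    proof (rule smooth_on_cong[OF S(4)])
      fix y assume "y \<in> S"
      then obtain q where q: "y = snd c q" "q \<in> fst c" "q \<in> W Z'" "xx Z' q \<in> fst d" "q \<in> X" using Sq by blast
      show "local_expr c (capc Z' d) y = local_expr (oc c) (snd (cc Z' d)) y"
        unfolding q(1) local_expr_oc[OF c q(2,5)] cc_apply[OF Z'(1) X_P[OF q(5)] q(3)]
        using M.inj[OF c] q(2) by (simp add: local_expr_at)
    qed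
  qed
  obtain S g where S: "open S" "capc Z' d p \<in> S" "S \<subseteq> capc Z' d ` {q \<in> fst c \<inter> W Z'. xx Z' q \<in> fst d \<and> hh Z' q > 0}"
    "smooth_on S g" and g: "\<And>q. q \<in> W Z' \<Longrightarrow> xx Z' q \<in> fst d \<Longrightarrow> hh Z' q > 0 \<Longrightarrow> capc Z' d q \<in> S \<Longrightarrow> q \<in> fst c \<and> g (capc Z' d q) = snd c q"
    by (rule collar.capc_inverse_smooth[OF cl c Z'(2) p(2,3,4) hp]) (rule that; assumption)
  have Sq: "\<exists>q. y = capc Z' d q \<and> q \<in> fst c \<and> q \<in> W Z' \<and> xx Z' q \<in> fst d \<and> q \<in> X \<and> hh Z' q > 0" if y: "y \<in> S" for y
    using subsetD[OF S(3) y] qX by auto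
  show "compat_at (cc Z' d) (oc c) (\<pi> p)"
    unfolding compat_at_def
  proof (intro conjI mem exI[of _ S] S(1))
    show "snd (cc Z' d) (\<pi> p) \<in> S" unfolding cc_apply[OF Z'(1) X_P[OF p(1)] p(3)] by (rule S(2))
    show "S \<subseteq> snd (cc Z' d) ` (fst (cc Z' d) \<inter> fst (oc c))"
    proof
      fix y assume "y \<in> S"
      then obtain q where q: "y = capc Z' d q" "q \<in> fst c" "q \<in> W Z'" "xx Z' q \<in> fst d" "q \<in> X" using Sq by blast
      then have "y = snd (cc Z' d) (\<pi> q)" "\<pi> q \<in> fst (cc Z' d) \<inter> fst (oc c)"
        using cc_apply[OF Z'(1) X_P[OF q(5)] q(3), of d] oc_mem[OF X_P[OF q(5)], of c] cc_mem[OF Z'(1) X_P[OF q(5)], of d] by auto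
      then show "y \<in> snd (cc Z' d) ` (fst (cc Z' d) \<inter> fst (oc c))" by (rule image_eqI)
    qed
    show "smooth_on S (local_expr (cc Z' d) (snd (oc c)))"
    proof (rule smooth_on_cong[OF S(4)])
      fix y assume yS: "y \<in> S"
      then obtain q where q: "y = capc Z' d q" "q \<in> fst c" "q \<in> W Z'" "xx Z' q \<in> fst d" "q \<in> X" "hh Z' q > 0" using Sq by blast
      show "g y = local_expr (cc Z' d) (snd (oc c)) y"
        unfolding q(1) local_expr_cc[OF Z' X_P[OF q(5)] q(3,4)] oc_apply[OF q(5)]
        using g[OF q(3,4,6)] yS q(1) by simp
    qed
  qed
qed

lemma cap_overlap:
  assumes Z': "Z' \<in> C" "d \<in> FF Z'" "d' \<in> FF Z'"
    and y: "drop_coord k y \<in> snd d ` (fst d \<inter> fst d')" "height k y < width (L Z')"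
  obtains q where "q \<in> P" "q \<in> W Z'" "xx Z' q \<in> fst d" "xx Z' q \<in> fst d'" "capc Z' d q = y" "hh Z' q = height k y"
proof -
  note cl = collar[OF Z'(1)]
  have "drop_coord k y \<in> snd d ` fst d" using y(1) by auto
  then obtain q where q: "q \<in> W Z'" "xx Z' q \<in> fst d" "hh Z' q = height k y" "capc Z' d q = y"
    by (rule collar.cap_surj[OF cl Z'(2) _ y(2)])
  have "snd d (xx Z' q) \<in> snd d ` (fst d \<inter> fst d')"
    using y(1) collar.capc_parts(1)[OF cl Z'(2) q(2)] q(4) by simp
  then have "xx Z' q \<in> fst d'" using collar.fiber_inj[OF cl Z'(2)] q(2) by (auto simp: inj_on_def)
  moreover have "q \<in> P" using P_side[OF Z'(1) q(1)] q(3) height_nonneg[of k y] by simp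
  ultimately show ?thesis using that q by simp
qed

text \<open>Over one component the transition is \<open>fib_trans\<close>, which does not touch z,
  so no polar coordinates appear and the pole needs no special treatment.\<close>

lemma compat_cc_cc:
  assumes Z': "Z' \<in> C" "d \<in> FF Z'" "d' \<in> FF Z'" and p: "p \<in> P" "p \<in> W Z'" "xx Z' p \<in> fst d" "xx Z' p \<in> fst d'"
  shows "compat_at (cc Z' d) (cc Z' d') (\<pi> p)"
proof -
  note cl = collar[OF Z'(1)]
  let ?S = "{y. drop_coord k y \<in> snd d ` (fst d \<inter> fst d') \<and> height k y < width (L Z')}"
  have hp: "hh Z' p \<ge> 0" using P_side[OF Z'(1) p(2)] p(1) by simp
  have op: "open ?S" by (rule collar.open_cap_region[OF cl collar.fiber_overlap(1)[OF cl Z'(2,3)]])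
  have mem: "\<pi> p \<in> fst (cc Z' d)" "\<pi> p \<in> fst (cc Z' d')"
    using cc_mem[OF Z'(1) p(1), of d] cc_mem[OF Z'(1) p(1), of d'] p by auto
  show ?thesis unfolding compat_at_def
  proof (intro conjI mem exI[of _ ?S] op)
    show "snd (cc Z' d) (\<pi> p) \<in> ?S"
      unfolding cc_apply[OF Z'(1) p(1,2)] using collar.capc_parts(1)[OF cl Z'(2) p(3)] p(3,4)
        collar.height_capc[OF cl Z'(2) p(2,3) hp] collar.emb_mem(4)[OF cl p(2)] by auto
    show "?S \<subseteq> snd (cc Z' d) ` (fst (cc Z' d) \<inter> fst (cc Z' d'))"
    proof
      fix y assume "y \<in> ?S"
      then have y: "drop_coord k y \<in> snd d ` (fst d \<inter> fst d')" "height k y < width (L Z')" by auto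
      obtain q where q: "q \<in> P" "q \<in> W Z'" "xx Z' q \<in> fst d" "xx Z' q \<in> fst d'" "capc Z' d q = y"
        by (rule cap_overlap[OF Z' y])
      then have "y = snd (cc Z' d) (\<pi> q)" "\<pi> q \<in> fst (cc Z' d) \<inter> fst (cc Z' d')"
        using cc_apply[OF Z'(1) q(1,2), of d] cc_mem[OF Z'(1) q(1), of d] cc_mem[OF Z'(1) q(1), of d'] by auto
      then show "y \<in> snd (cc Z' d) ` (fst (cc Z' d) \<inter> fst (cc Z' d'))" by (rule image_eqI)
    qed
    have "smooth_on ?S (collar.fib_trans k d d')"
      by (rule smooth_on_subset[OF collar.smooth_fib_trans[OF cl Z'(2,3)]]) auto
    then show "smooth_on ?S (local_expr (cc Z' d) (snd (cc Z' d')))"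
    proof (rule smooth_on_cong)
      fix y assume "y \<in> ?S"
      then have y: "drop_coord k y \<in> snd d ` (fst d \<inter> fst d')" "height k y < width (L Z')" by auto
      obtain q where q: "q \<in> P" "q \<in> W Z'" "xx Z' q \<in> fst d" "xx Z' q \<in> fst d'" "capc Z' d q = y"
        by (rule cap_overlap[OF Z' y])
      show "collar.fib_trans k d d' y = local_expr (cc Z' d) (snd (cc Z' d')) y"
        unfolding q(5)[symmetric] local_expr_cc[OF Z'(1,2) q(1,2,3)] cc_apply[OF Z'(1) q(1,2)]
        by (rule collar.fib_trans_capc[OF cl Z'(2,3) q(3,4)])
    qed
  qed
qed

lemma compat_X:
  assumes c: "c \<in> M" "p \<in> fst c" "p \<in> X" and e: "e \<in> A" "\<pi> p \<in> fst e"
  shows "compat_at (oc c) e (\<pi> p)" "compat_at e (oc c) (\<pi> p)"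
proof -
  have "compat_at (oc c) e (\<pi> p) \<and> compat_at e (oc c) (\<pi> p)"
    using e(1)
  proof (cases rule: A_cases)
    case (1 c')
    then have "p \<in> fst c'" using e(2) oc_mem[OF X_P[OF c(3)], of c'] by auto
    then show ?thesis unfolding 1(2) using compat_oc_oc[OF c(1) 1(1) c(3,2)] compat_oc_oc[OF 1(1) c(1) c(3) _ c(2)] by blast
  next
    case (2 Z' d)
    then have "p \<in> W Z'" "xx Z' p \<in> fst d" using e(2) cc_mem[OF 2(1) X_P[OF c(3)], of d] 2(3) by auto
    then show ?thesis unfolding 2(3) using compat_oc_cc[OF c(1) 2(1,2) c(3,2)] by blast
  qed
  then show "compat_at (oc c) e (\<pi> p)" "compat_at e (oc c) (\<pi> p)" by auto
qed

lemma A_inj: "e \<in> A \<Longrightarrow> inj_on (snd e) (fst e)"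
  by (erule A_cases) (auto intro: oc_inj cc_inj)

text \<open>At a point of X any two charts, even cap charts of different components, are compared
  through an open part chart. At a collapsed point only cap charts of one component occur.\<close>

lemma A_charts: "atlas_charts UNIV A"
proof (rule atlas_charts_UNIV_I[OF A_inj])
  fix e e' q assume e: "e \<in> A" "e' \<in> A" "q \<in> fst e" "q \<in> fst e'"
  then have "q \<in> carrier_of A" by (auto simp: carrier_of_def)
  then obtain p where p: "q = \<pi> p" "p \<in> P" unfolding carrier_A by auto
  from p(2) consider "p \<in> X" | Z' where "Z' \<in> C" "p \<in> Z'" by (auto simp: P_def)
  then show "compat_at e e' q"
  proof cases
    case 1
    then obtain c where c: "c \<in> M" "p \<in> fst c" using X_sub by (auto simp: carrier_of_def)
    show ?thesis unfolding p(1)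
      using compat_at_trans[OF A_inj[OF e(1)] A_inj[OF oc_A[OF c(1)]]] compat_X[OF c 1] e p(1) by auto
  next
    case 2
    obtain d where d: "d \<in> FF Z'" "e = cc Z' d" "xx Z' p \<in> fst d"
      by (rule charts_at_collapsed[OF e(1) e(3)[unfolded p(1)] 2])
    obtain d' where d': "d' \<in> FF Z'" "e' = cc Z' d'" "xx Z' p \<in> fst d'"
      by (rule charts_at_collapsed[OF e(2) e(4)[unfolded p(1)] 2])
    show ?thesis unfolding p(1) d(2) d'(2)
      using compat_cc_cc[OF 2(1) d(1) d'(1) p(2) _ d(3) d'(3)] C_W[OF 2(1)] 2(2) by auto
  qed
qed auto

sublocale A: univ_atlas A by unfold_locales (rule A_charts)

lemma differential_oc:
  assumes c: "c \<in> M" and p: "p \<in> X" "p \<in> fst c"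
  shows "differential (oc c) f (\<pi> p) u = differential c (\<lambda>p. f (\<pi> p)) p u"
  unfolding differential_def oc_apply[OF p(1)]
proof (rule dir_deriv_cong[OF M.open_image[OF c X_open]])
  show "snd c p \<in> snd c ` (X \<inter> fst c)" using p by auto
  fix y assume "y \<in> snd c ` (X \<inter> fst c)"
  then obtain q where q: "y = snd c q" "q \<in> X" "q \<in> fst c" by auto
  show "local_expr (oc c) f y = local_expr c (\<lambda>p. f (\<pi> p)) y"
    unfolding q(1) local_expr_oc[OF c q(3,2)] using M.inj[OF c] q(3) by (simp add: local_expr_at)
qed

lemma differential_oc_cc:
  assumes c: "c \<in> M" and Z': "Z' \<in> C" "d \<in> FF Z'" and p: "p \<in> X" "p \<in> fst c" "p \<in> W Z'" "xx Z' p \<in> fst d"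
  shows "differential (oc c) (snd (cc Z' d)) (\<pi> p) u = differential c (capc Z' d) p u"
  unfolding differential_oc[OF c p(1,2)] unfolding differential_def
proof (rule dir_deriv_cong[OF M.open_image[OF c openin_Int[OF X_open collar.nbhd_open[OF collar[OF Z'(1)]]]]])
  show "snd c p \<in> snd c ` (X \<inter> W Z' \<inter> fst c)" using p by auto
  fix y assume "y \<in> snd c ` (X \<inter> W Z' \<inter> fst c)"
  then obtain q where q: "y = snd c q" "q \<in> X" "q \<in> W Z'" "q \<in> fst c" by auto
  show "local_expr c (\<lambda>p. snd (cc Z' d) (\<pi> p)) y = local_expr c (capc Z' d) y"
    unfolding q(1) using M.inj[OF c] q cc_apply[OF Z'(1) X_P[OF q(2)] q(3), of d] by (simp add: local_expr_at)
qed

lemma differential_cc_cc: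
  assumes Z': "Z' \<in> C" "d \<in> FF Z'" "d' \<in> FF Z'" and p: "p \<in> P" "p \<in> W Z'" "xx Z' p \<in> fst d" "xx Z' p \<in> fst d'"
  shows "differential (cc Z' d) (snd (cc Z' d')) (\<pi> p) u = dir_deriv (collar.fib_trans k d d') (capc Z' d p) u"
  unfolding differential_def cc_apply[OF Z'(1) p(1,2)]
proof (rule dir_deriv_cong)
  note cl = collar[OF Z'(1)]
  let ?S = "{y. drop_coord k y \<in> snd d ` (fst d \<inter> fst d') \<and> height k y < width (L Z')}"
  have hp: "hh Z' p \<ge> 0" using P_side[OF Z'(1) p(2)] p(1) by simp
  show "open ?S" by (rule collar.open_cap_region[OF cl collar.fiber_overlap(1)[OF cl Z'(2,3)]])
  show "capc Z' d p \<in> ?S"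
    using collar.capc_parts(1)[OF cl Z'(2) p(3)] p(3,4)
        collar.height_capc[OF cl Z'(2) p(2,3) hp] collar.emb_mem(4)[OF cl p(2)] by auto
  fix y assume "y \<in> ?S"
  then have y: "drop_coord k y \<in> snd d ` (fst d \<inter> fst d')" "height k y < width (L Z')" by auto
  obtain q where q: "q \<in> P" "q \<in> W Z'" "xx Z' q \<in> fst d" "xx Z' q \<in> fst d'" "capc Z' d q = y"
    by (rule cap_overlap[OF Z' y])
  show "local_expr (cc Z' d) (snd (cc Z' d')) y = collar.fib_trans k d d' y"
    unfolding q(5)[symmetric] local_expr_cc[OF Z'(1,2) q(1,2,3)] cc_apply[OF Z'(1) q(1,2)]
    by (rule collar.fib_trans_capc[OF cl Z'(2,3) q(3,4), symmetric])
qed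

end


section \<open>Open sets cut out by model coordinates\<close>

context collar
begin

lemma open_xx:
  assumes "openin (mtop F) U"
  shows "openin (mtop M) {p \<in> W. xx p \<in> U}"
proof -
  have t: "topspace (subtopology (mtop M) W) = W" using openin_subset[OF nbhd_open] by auto
  have "openin (subtopology (mtop M) W) {p \<in> topspace (subtopology (mtop M) W). xx p \<in> U}"
    by (rule openin_continuous_map_preimage[OF continuous_xx assms])
  then show ?thesis unfolding t using openin_open_subtopology[OF nbhd_open] by simp
qed

lemma open_capc:
  assumes d: "d \<in> F" and S: "open S"
  shows "openin (mtop M) {p \<in> W. xx p \<in> fst d \<and> capc d p \<in> S}"
proof -
  let ?Y = "{p \<in> W. xx p \<in> fst d}"
  have Y: "openin (mtop M) ?Y" by (rule open_xx[OF openin_mtop_domain[OF d]])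
  have t: "topspace (subtopology (mtop M) ?Y) = ?Y" using openin_subset[OF Y] by auto
  have "openin (subtopology (mtop M) ?Y) {p \<in> topspace (subtopology (mtop M) ?Y). capc d p \<in> S}"
    by (rule openin_continuous_map_preimage[OF continuous_capc[OF d]]) (use S in simp)
  then have "openin (mtop M) {p \<in> ?Y. capc d p \<in> S}" unfolding t using openin_open_subtopology[OF Y] by simp
  moreover have "{p \<in> ?Y. capc d p \<in> S} = {p \<in> W. xx p \<in> fst d \<and> capc d p \<in> S}" by auto
  ultimately show ?thesis by simp
qed

end


section \<open>The topology of the quotient\<close>

context collapse
begin

text \<open>It is enough to test the sets that generate the topology, one kind of chart at a time.
  Compactness and connectedness of P then pass to the quotient.\<close>

lemma continuous_\<pi>: "continuous_map (subtopology (mtop M) P) (mtop A) \<pi>"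
proof -
  have top: "topspace (subtopology (mtop M) P) = P" using P_sub by auto
  have *: "openin (subtopology (mtop M) P) {p \<in> P. \<pi> p \<in> fst e \<and> snd e (\<pi> p) \<in> S}" if e: "e \<in> A" and S: "open S" for e S
    using e
  proof (cases rule: A_cases)
    case (1 c)
    have "{p \<in> P. \<pi> p \<in> fst e \<and> snd e (\<pi> p) \<in> S} = (X \<inter> {p \<in> fst c. snd c p \<in> S}) \<inter> P"
    proof (intro set_eqI)
      fix p
      show "p \<in> {p \<in> P. \<pi> p \<in> fst e \<and> snd e (\<pi> p) \<in> S} \<longleftrightarrow> p \<in> (X \<inter> {p \<in> fst c. snd c p \<in> S}) \<inter> P"
        using oc_mem[of p c] oc_apply[of p c] X_P unfolding 1(2) by auto
    qed
    moreover have "openin (mtop M) (X \<inter> {p \<in> fst c. snd c p \<in> S})"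
      by (intro openin_Int X_open openin_mtop_basic 1(1) S)
    ultimately show ?thesis by (auto simp: openin_subtopology)
  next
    case (2 Z' d)
    have "{p \<in> P. \<pi> p \<in> fst e \<and> snd e (\<pi> p) \<in> S} = {p \<in> W Z'. xx Z' p \<in> fst d \<and> capc Z' d p \<in> S} \<inter> P"
    proof (intro set_eqI)
      fix p
      show "p \<in> {p \<in> P. \<pi> p \<in> fst e \<and> snd e (\<pi> p) \<in> S} \<longleftrightarrow> p \<in> {p \<in> W Z'. xx Z' p \<in> fst d \<and> capc Z' d p \<in> S} \<inter> P"
        using cc_mem[OF 2(1), of p d] cc_apply[OF 2(1), of p d] unfolding 2(3) by auto
    qed
    then show ?thesis using collar.open_capc[OF collar[OF 2(1)] 2(2) S] by (auto simp: openin_subtopology)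
  qed
  show ?thesis unfolding mtop_def[of A]
  proof (rule continuous_on_generated_topo)
    fix U assume "U \<in> {{p \<in> V. \<psi> p \<in> S} |V \<psi> S. (V, \<psi>) \<in> A \<and> open S}"
    then obtain V \<psi> S where U: "U = {p \<in> V. \<psi> p \<in> S}" "(V, \<psi>) \<in> A" "open S" by auto
    have "\<pi> -` U \<inter> topspace (subtopology (mtop M) P) = {p \<in> P. \<pi> p \<in> fst (V, \<psi>) \<and> snd (V, \<psi>) (\<pi> p) \<in> S}"
      unfolding top U(1) by auto
    then show "openin (subtopology (mtop M) P) (\<pi> -` U \<inter> topspace (subtopology (mtop M) P))" using *[OF U(2,3)] by simp
  next
    show "\<pi> ` topspace (subtopology (mtop M) P) \<subseteq> \<Union>{{p \<in> V. \<psi> p \<in> S} |V \<psi> S. (V, \<psi>) \<in> A \<and> open S}"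
    proof -
      have "\<Union>{{p \<in> V. \<psi> p \<in> S} |V \<psi> S. (V, \<psi>) \<in> A \<and> open S} = \<pi> ` P"
        using topspace_mtop[of A] unfolding mtop_def[of A] topology_generated_by_topspace carrier_A .
      then show ?thesis unfolding top by (rule equalityD2)
    qed
  qed
qed

lemma A_compact: "compact_space (mtop A)"
proof -
  have "compactin (subtopology (mtop M) P) P" using P_compact by (simp add: compactin_subtopology)
  then have "compactin (mtop A) (\<pi> ` P)" by (rule image_compactin[OF _ continuous_\<pi>])
  then show ?thesis by (simp add: compact_space_def carrier_A)
qed

lemma A_connected: "connected_space (mtop A)"
proof -
  have "connectedin (subtopology (mtop M) P) P" using P_connected by (simp add: connectedin_subtopology)
  then have "connectedin (mtop A) (\<pi> ` P)" by (rule connectedin_continuous_map_image[OF continuous_\<pi>])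
  then show ?thesis using connectedin_topspace[of "mtop A"] by (simp add: carrier_A)
qed

lemma \<pi>_open_X:
  assumes O: "openin (mtop M) U" "U \<subseteq> X"
  shows "openin (mtop A) (\<pi> ` U)"
proof (subst openin_subopen, intro ballI)
  fix q assume "q \<in> \<pi> ` U"
  then obtain p where p: "q = \<pi> p" "p \<in> U" by auto
  then obtain c where c: "c \<in> M" "p \<in> fst c" using O X_sub by (auto simp: carrier_of_def)
  let ?S = "snd c ` (U \<inter> fst c)"
  let ?T = "{q \<in> fst (oc c). snd (oc c) q \<in> ?S}"
  have "openin (mtop A) ?T" by (rule openin_mtop_basic[OF oc_A[OF c(1)] M.open_image[OF c(1) O(1)]])
  moreover have "q \<in> ?T" using p c O(2) oc_apply[of p c] oc_mem[OF X_P, of p c] by auto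
  moreover have "?T \<subseteq> \<pi> ` U"
  proof
    fix z assume z: "z \<in> ?T"
    then obtain p' where p': "z = \<pi> p'" "p' \<in> fst c" "p' \<in> X" by (auto simp: oc_dom)
    then have "snd c p' \<in> ?S" using z oc_apply[of p' c] by simp
    then have "p' \<in> U" using M.inj[OF c(1)] p'(2) by (auto simp: inj_on_def)
    then show "z \<in> \<pi> ` U" using p'(1) by simp
  qed
  ultimately show "\<exists>T. openin (mtop A) T \<and> q \<in> T \<and> T \<subseteq> \<pi> ` U" by (intro exI conjI)
qed

text \<open>A set described by x and h alone is saturated, and in cap coordinates its image is open
  because h is the continuous function |z|^2 / 2.\<close>

lemma \<pi>_open_cap:
  assumes Z': "Z' \<in> C" and U: "openin (mtop (FF Z')) U" and T: "open T"
  shows "openin (mtop A) (\<pi> ` {p \<in> W Z' \<inter> P. xx Z' p \<in> U \<and> hh Z' p \<in> T})"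
proof (subst openin_subopen, intro ballI)
  note cl = collar[OF Z']
  fix q assume "q \<in> \<pi> ` {p \<in> W Z' \<inter> P. xx Z' p \<in> U \<and> hh Z' p \<in> T}"
  then obtain p where p: "q = \<pi> p" "p \<in> W Z'" "p \<in> P" "xx Z' p \<in> U" "hh Z' p \<in> T" by auto
  obtain d where d: "d \<in> FF Z'" "xx Z' p \<in> fst d"
    using collar.emb_mem(1)[OF cl p(2)] by (auto simp: carrier_of_def)
  let ?S = "{y. drop_coord k y \<in> snd d ` (U \<inter> fst d) \<and> zpart k y \<in> {z. (norm z)\<^sup>2 / 2 \<in> T}}"
  have "open ((\<lambda>z :: complex. (norm z)\<^sup>2 / 2) -` T)" by (intro open_vimage T continuous_intros) auto
  then have S: "open ?S"
    by (intro open_drop_zpart openin_mtop_image[OF collar.fiber_charts[OF cl] d(1) U]) (simp add: vimage_def)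
  let ?N = "{q \<in> fst (cc Z' d). snd (cc Z' d) q \<in> ?S}"
  have Sp: "capc Z' d p' \<in> ?S \<longleftrightarrow> xx Z' p' \<in> U \<and> hh Z' p' \<in> T" if p': "p' \<in> W Z'" "p' \<in> P" "xx Z' p' \<in> fst d" for p'
  proof -
    have h: "hh Z' p' \<ge> 0" using P_side[OF Z' p'(1)] p'(2) by simp
    have "snd d (xx Z' p') \<in> snd d ` (U \<inter> fst d) \<longleftrightarrow> xx Z' p' \<in> U"
      using collar.fiber_inj[OF cl d(1)] p'(3) by (auto simp: inj_on_def)
    then show ?thesis
      using collar.capc_parts(1)[OF cl d(1) p'(3)] collar.height_capc[OF cl d(1) p'(1,3) h] by (simp add: height_zpart)
  qed
  have "openin (mtop A) ?N" by (rule openin_mtop_basic[OF cc_A[OF Z' d(1)] S])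
  moreover have "q \<in> ?N"
    using cc_mem[OF Z' p(3), of d] cc_apply[OF Z' p(3,2), of d] Sp[OF p(2,3) d(2)] p d by simp
  moreover have "?N \<subseteq> \<pi> ` {p \<in> W Z' \<inter> P. xx Z' p \<in> U \<and> hh Z' p \<in> T}"
  proof
    fix z assume z: "z \<in> ?N"
    then obtain p' where p': "z = \<pi> p'" "p' \<in> W Z'" "p' \<in> P" "xx Z' p' \<in> fst d" by (auto simp: cc_dom)
    then have "xx Z' p' \<in> U \<and> hh Z' p' \<in> T" using z Sp[OF p'(2,3,4)] cc_apply[OF Z' p'(3,2), of d] by simp
    then show "z \<in> \<pi> ` {p \<in> W Z' \<inter> P. xx Z' p \<in> U \<and> hh Z' p \<in> T}" using p' by auto
  qed
  ultimately show "\<exists>N. openin (mtop A) N \<and> q \<in> N \<and> N \<subseteq> \<pi> ` {p \<in> W Z' \<inter> P. xx Z' p \<in> U \<and> hh Z' p \<in> T}"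
    by (intro exI conjI)
qed

lemma \<pi>_open_cap':
  assumes Z': "Z' \<in> C" and T: "open T"
  shows "openin (mtop A) (\<pi> ` {p \<in> W Z' \<inter> P. hh Z' p \<in> T})"
proof -
  have "{p \<in> W Z' \<inter> P. hh Z' p \<in> T} = {p \<in> W Z' \<inter> P. xx Z' p \<in> carrier_of (FF Z') \<and> hh Z' p \<in> T}"
    using collar.emb_mem(1)[OF collar[OF Z']] by auto
  then show ?thesis using \<pi>_open_cap[OF Z' _ T, of "carrier_of (FF Z')"] openin_topspace[of "mtop (FF Z')"] by simp
qed

text \<open>Three cases: q lies in the collar over another fiber point, and the Hausdorff property
  of the fiber separates; q lies over the same fiber point at positive height, and the height
  separates; or q lies outside the collar, and a small cap is separated from the rest.\<close>

lemma separate_collapsed: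
  assumes Z': "Z' \<in> C" and p: "p \<in> Z'" and q: "q \<in> P" and ne: "\<pi> p \<noteq> \<pi> q"
  shows "\<exists>U V. openin (mtop A) U \<and> openin (mtop A) V \<and> \<pi> p \<in> U \<and> \<pi> q \<in> V \<and> disjnt U V"
proof -
  note cl = collar[OF Z']
  have pW: "p \<in> W Z'" and pP: "p \<in> P" using C_W[OF Z'] p C_P[OF Z'] by auto
  have hp: "hh Z' p = 0" using collar.Z'_iff[OF cl pW] p by simp
  consider "q \<in> W Z'" "xx Z' p \<noteq> xx Z' q" | "q \<in> W Z'" "xx Z' p = xx Z' q" | "q \<notin> W Z'" by blast
  then show ?thesis
  proof cases
    case 1
    have "xx Z' p \<in> topspace (mtop (FF Z'))" "xx Z' q \<in> topspace (mtop (FF Z'))"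
      using collar.emb_mem(1)[OF cl] pW 1(1) by auto
    then obtain U V where UV: "openin (mtop (FF Z')) U" "openin (mtop (FF Z')) V" "xx Z' p \<in> U" "xx Z' q \<in> V" "disjnt U V"
      using collar.fiber_Hausdorff[OF cl] 1(2) unfolding Hausdorff_space_def by meson
    let ?U = "\<lambda>U. \<pi> ` {p \<in> W Z' \<inter> P. xx Z' p \<in> U \<and> hh Z' p \<in> UNIV}"
    have "disjnt (?U U) (?U V)"
      unfolding disjnt_iff
    proof (intro allI notI)
      fix z assume "z \<in> ?U U \<and> z \<in> ?U V"
      then obtain a b where "a \<in> W Z'" "a \<in> P" "xx Z' a \<in> U" "b \<in> P" "xx Z' b \<in> V" "\<pi> a = \<pi> b" by auto
      then show False using \<pi>_same_collar(2)[OF Z', of a b] UV(5) unfolding disjnt_iff by metis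
    qed
    moreover have "\<pi> p \<in> ?U U" "\<pi> q \<in> ?U V" using pW pP q 1(1) UV by auto
    ultimately show ?thesis using \<pi>_open_cap[OF Z' UV(1) open_UNIV] \<pi>_open_cap[OF Z' UV(2) open_UNIV]
      by (intro exI[of _ "?U U"] exI[of _ "?U V"]) simp
  next
    case 2
    have "q \<notin> Z'" using ne \<pi>_eq_iff[OF pP q] Z' p 2(2) by blast
    then have hq: "hh Z' q > 0" using collar.Z'_iff[OF cl 2(1)] P_side[OF Z' 2(1)] q by force
    let ?U = "\<lambda>T. \<pi> ` {p \<in> W Z' \<inter> P. hh Z' p \<in> T}"
    let ?T = "{..<hh Z' q / 2}" and ?T' = "{hh Z' q / 2<..}"
    have "disjnt (?U ?T) (?U ?T')"
      unfolding disjnt_iff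
    proof (intro allI notI)
      fix z assume "z \<in> ?U ?T \<and> z \<in> ?U ?T'"
      then obtain a b where "a \<in> W Z'" "a \<in> P" "hh Z' a \<in> ?T" "b \<in> P" "hh Z' b \<in> ?T'" "\<pi> a = \<pi> b" by auto
      then show False using \<pi>_same_collar(3)[OF Z', of a b] by simp
    qed
    moreover have "\<pi> p \<in> ?U ?T" "\<pi> q \<in> ?U ?T'" using pW pP q 2(1) hp hq by auto
    ultimately show ?thesis using \<pi>_open_cap'[OF Z' open_lessThan[of "hh Z' q / 2"]] \<pi>_open_cap'[OF Z' open_greaterThan[of "hh Z' q / 2"]]
      by (intro exI[of _ "?U ?T"] exI[of _ "?U ?T'"]) simp
  next
    case 3
    obtain \<delta> where \<delta>: "0 < \<delta>" "\<And>Z'. Z' \<in> C \<Longrightarrow> \<delta> < width (L Z')"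
      "\<And>Z' Z'' p. Z' \<in> C \<Longrightarrow> Z'' \<in> C \<Longrightarrow> p \<in> W Z' \<Longrightarrow> p \<in> W Z'' \<Longrightarrow> \<bar>hh Z' p\<bar> \<le> \<delta> \<Longrightarrow> \<bar>hh Z'' p\<bar> \<le> \<delta> \<Longrightarrow> Z' = Z''"
      by (rule common_width) (rule that; assumption)
    let ?cap = "\<lambda>Z'. {p \<in> W Z' \<inter> P. hh Z' p \<in> {..<\<delta>}}"
    let ?K = "{p \<in> W Z'. \<bar>hh Z' p\<bar> \<le> \<delta>}"
    \<comment> \<open>Besides X without a closed collar piece this contains the caps of the other
      components, so that it also contains \<open>\<pi> q\<close> when q is itself
      collapsed.\<close>
    let ?V = "\<pi> ` (X - ?K) \<union> (\<Union>Z''\<in>C - {Z'}. \<pi> ` ?cap Z'')"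
    have "openin (mtop M) (X - ?K)" by (intro openin_diff X_open collar.closed_level[OF cl \<delta>(2)[OF Z']])
    then have "openin (mtop A) (\<pi> ` (X - ?K))" by (rule \<pi>_open_X) auto
    moreover have "openin (mtop A) (\<Union>Z''\<in>C - {Z'}. \<pi> ` ?cap Z'')"
    proof (rule openin_Union)
      fix S assume "S \<in> (\<lambda>Z''. \<pi> ` ?cap Z'') ` (C - {Z'})"
      then obtain Z'' where "Z'' \<in> C" "S = \<pi> ` ?cap Z''" by blast
      then show "openin (mtop A) S" using \<pi>_open_cap'[of Z'' "{..<\<delta>}"] by simp
    qed
    ultimately have V: "openin (mtop A) ?V" by (rule openin_Un)
    have U: "openin (mtop A) (\<pi> ` ?cap Z')" by (rule \<pi>_open_cap'[OF Z' open_lessThan])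
    have "\<pi> p \<in> \<pi> ` ?cap Z'" using pW pP hp \<delta>(1) by auto
    moreover have "\<pi> q \<in> ?V"
    proof (cases "q \<in> X")
      case True then show ?thesis using 3 by auto
    next
      case False
      then obtain Z'' where Z'': "Z'' \<in> C" "q \<in> Z''" using q by (auto simp: P_def)
      moreover have "Z'' \<noteq> Z'" using Z''(2) 3 C_W[OF Z'] by auto
      moreover have "q \<in> W Z''" using Z'' C_W by auto
      moreover have "hh Z'' q = 0" using collar.Z'_iff[OF collar[OF Z''(1)] \<open>q \<in> W Z''\<close>] Z''(2) by simp
      ultimately have "q \<in> ?cap Z''" "Z'' \<in> C - {Z'}" using q \<delta>(1) by auto
      then show ?thesis by blast
    qed
    moreover have "disjnt (\<pi> ` ?cap Z') ?V"
      unfolding disjnt_iff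
    proof (intro allI notI)
      fix z assume z: "z \<in> \<pi> ` ?cap Z' \<and> z \<in> ?V"
      then obtain a where a: "z = \<pi> a" "a \<in> W Z'" "a \<in> P" "hh Z' a < \<delta>" by auto
      have ha: "\<bar>hh Z' a\<bar> \<le> \<delta>" using P_side[OF Z' a(2)] a(3,4) by auto
      from z consider b where "z = \<pi> b" "b \<in> X" "b \<notin> ?K" |
        b Z'' where "z = \<pi> b" "Z'' \<in> C" "Z'' \<noteq> Z'" "b \<in> W Z''" "b \<in> P" "hh Z'' b < \<delta>" by auto
      then show False
      proof cases
        case 1
        have "\<pi> b = \<pi> a" by (rule trans[OF 1(1)[symmetric] a(1)])
        then have "b = a" by (rule iffD1[OF \<pi>_X_eq[OF 1(2) a(3)]])
        then show False using 1(3) a(2) ha by simp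
      next
        case 2
        have hb: "\<bar>hh Z'' b\<bar> \<le> \<delta>" using P_side[OF 2(2,4)] 2(5,6) by auto
        have eq: "\<pi> a = \<pi> b" using a(1) 2(1) by simp
        show False
        proof (cases "a = b")
          case True then show False using \<delta>(3)[OF Z' 2(2) a(2) _ ha] 2(3,4) hb by auto
        next
          case False
          then have "b \<in> Z'" using \<pi>_same_collar(4)[OF Z' a(3) 2(5) eq a(2)] by simp
          then show False using W_meets_C[OF 2(2) Z' 2(4)] 2(3) by simp
        qed
      qed
    qed
    ultimately show ?thesis using U V by blast
  qed
qed

lemma A_Hausdorff: "Hausdorff_space (mtop A)"
  unfolding Hausdorff_space_def
proof (intro allI impI)
  fix x y assume xy: "x \<in> topspace (mtop A) \<and> y \<in> topspace (mtop A) \<and> x \<noteq> y"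
  then obtain p q where p: "x = \<pi> p" "p \<in> P" and q: "y = \<pi> q" "q \<in> P" by (auto simp: carrier_A)
  have ne: "\<pi> p \<noteq> \<pi> q" using xy p q by simp
  consider "p \<in> X" "q \<in> X" | Z' where "Z' \<in> C" "p \<in> Z'" | Z' where "Z' \<in> C" "q \<in> Z'"
    using p(2) q(2) by (auto simp: P_def)
  then show "\<exists>U V. openin (mtop A) U \<and> openin (mtop A) V \<and> x \<in> U \<and> y \<in> V \<and> disjnt U V"
  proof cases
    case 1
    have "p \<in> topspace (mtop M)" "q \<in> topspace (mtop M)" "p \<noteq> q" using 1 X_sub ne by auto
    then obtain U V where UV: "openin (mtop M) U" "openin (mtop M) V" "p \<in> U" "q \<in> V" "disjnt U V"
      using M_Hausdorff unfolding Hausdorff_space_def by meson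
    have "disjnt (\<pi> ` (U \<inter> X)) (\<pi> ` (V \<inter> X))"
      unfolding disjnt_iff
    proof (intro allI notI)
      fix z assume "z \<in> \<pi> ` (U \<inter> X) \<and> z \<in> \<pi> ` (V \<inter> X)"
      then obtain a b where "a \<in> U" "a \<in> X" "b \<in> V" "b \<in> X" "\<pi> a = \<pi> b" by auto
      then show False using \<pi>_X_eq[of a b] X_P UV(5) unfolding disjnt_iff by blast
    qed
    moreover have "openin (mtop A) (\<pi> ` (U \<inter> X))" "openin (mtop A) (\<pi> ` (V \<inter> X))"
      by (intro \<pi>_open_X openin_Int UV X_open; auto)+
    moreover have "x \<in> \<pi> ` (U \<inter> X)" "y \<in> \<pi> ` (V \<inter> X)" using p q 1 UV by auto
    ultimately show ?thesis by blast
  next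
    case 2
    show ?thesis unfolding p(1) q(1) by (rule separate_collapsed[OF 2 q(2) ne])
  next
    case 3
    obtain U V where "openin (mtop A) U" "openin (mtop A) V" "\<pi> q \<in> U" "\<pi> p \<in> V" "disjnt U V"
      using separate_collapsed[OF 3 p(2) ne[symmetric]] by blast
    then show ?thesis unfolding p(1) q(1) by (intro exI[of _ V] exI[of _ U]) (simp add: disjnt_sym)
  qed
qed

lemma A_manifold: "smooth_manifold UNIV A"
  unfolding smooth_manifold_iff
  using A_charts A_Hausdorff compact_atlas_second_countable[OF A_charts A_compact] by simp

end


section \<open>The glued symplectic form\<close>

text \<open>Off the hypersurface a b-tangent vector is (df(u)/f, u), so the form equals \<alpha>
  \<and> d ln |f| + \<beta>. Since d ln |f| is closed, the formally defined
  \<open>b_form_diff\<close> is the ordinary exterior derivative there, and the two notions of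
  nondegeneracy agree.\<close>

lemma b_form_off_hypersurface:
  fixes b :: "'n::finite coords \<Rightarrow> 'n coords \<Rightarrow> 'n coords \<Rightarrow> real"
  assumes D: "open D" "x \<in> D" "x \<notin> S" and repr: "b_form_repr D S b f \<alpha> \<beta>"
    and closed: "\<forall>\<xi>\<in>b_tangent f x. \<forall>\<eta>\<in>b_tangent f x. \<forall>\<zeta>\<in>b_tangent f x. b_form_diff \<alpha> \<beta> x \<xi> \<eta> \<zeta> = 0"
    and nondeg: "\<exists>v. (\<forall>j. v j \<in> b_tangent f x) \<and> wedge_power (UNIV :: 'n set) (b_form_value \<alpha> \<beta> x) v \<noteq> 0"
  shows "ext_d2 b x u v w = 0" "\<exists>v. wedge_power (UNIV :: 'n set) (b x) v \<noteq> 0"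
proof -
  have df: "defining_function D S f" and \<alpha>: "\<And>x. x \<in> D \<Longrightarrow> linear (\<alpha> x)" "\<And>u. smooth_on D (\<lambda>x. \<alpha> x u)"
    and \<beta>: "coeff_form2 UNIV D \<beta>"
    and bv: "\<And>x u v. x \<in> D \<Longrightarrow> x \<notin> S \<Longrightarrow> b x u v =
        b_form_value \<alpha> \<beta> x (dir_deriv f x u / f x, u) (dir_deriv f x v / f x, v)"
    using repr by (auto simp: b_form_repr_def)
  have f: "smooth_on D f" and zero: "\<And>x. x \<in> D \<Longrightarrow> x \<in> S \<longleftrightarrow> f x = 0" using df by (auto simp: defining_function_def)
  have fx: "f x \<noteq> 0" using zero D by auto
  let ?l = "\<lambda>u y. dir_deriv f y u / f y"
  have tangent: "(a, u) \<in> b_tangent f x \<longleftrightarrow> a = ?l u x" for a u using fx by (auto simp: b_tangent_def field_simps)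
  define E where "E = D \<inter> f -` (- {0})"
  have E: "open E" unfolding E_def
    by (rule continuous_open_preimage[OF smooth_on_imp_continuous_on[OF f] D(1)]) auto
  have xE: "x \<in> E" using D(2) fx by (simp add: E_def)
  have val: "b y p q = \<alpha> y p * ?l q y - \<alpha> y q * ?l p y + \<beta> y p q" if "y \<in> E" for y p q
    using that bv[of y p q] zero[of y] by (auto simp: E_def b_form_value_def)
  let ?H = "\<lambda>p q. dir_deriv (\<lambda>y. dir_deriv f y p) x q"
  \<comment> \<open>The second derivative of ln |f|; its symmetry expresses that d ln |f| is
    closed.\<close>
  let ?m = "\<lambda>p q. ?H p q / f x - dir_deriv f x p * dir_deriv f x q / (f x * f x)"
  have hf: "(f has_derivative dir_deriv f x) (at x)" by (rule smooth_on_has_derivative[OF f D(1,2)])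
  have hl: "(?l p has_derivative (\<lambda>q. ?m p q)) (at x)" for p
  proof -
    have h: "((\<lambda>y. dir_deriv f y p) has_derivative ?H p) (at x)"
      by (rule smooth_on_has_derivative[OF smooth_on_dir_deriv[OF f D(1)] D(1,2)])
    have "(?l p has_derivative (\<lambda>q. (?H p q * f x - dir_deriv f x p * dir_deriv f x q) / (f x * f x))) (at x)"
      by (rule has_derivative_divide'[OF h hf fx])
    moreover have "(\<lambda>q. (?H p q * f x - dir_deriv f x p * dir_deriv f x q) / (f x * f x)) = (\<lambda>q. ?m p q)"
      using fx by (simp add: fun_eq_iff diff_divide_distrib)
    ultimately show ?thesis by simp
  qed
  have ha: "((\<lambda>y. \<alpha> y p) has_derivative dir_deriv (\<lambda>y. \<alpha> y p) x) (at x)" for p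
    by (rule smooth_on_has_derivative[OF \<alpha>(2) D(1,2)])
  have hb: "((\<lambda>y. \<beta> y p q) has_derivative dir_deriv (\<lambda>y. \<beta> y p q) x) (at x)" for p q
    by (rule smooth_on_has_derivative[OF coeff_form2_smooth[OF \<beta>] D(1,2)])
  have d: "dir_deriv (\<lambda>y. b y p q) x r =
      (\<alpha> x p * ?m q r + dir_deriv (\<lambda>y. \<alpha> y p) x r * ?l q x) - (\<alpha> x q * ?m p r + dir_deriv (\<lambda>y. \<alpha> y q) x r * ?l p x)
      + dir_deriv (\<lambda>y. \<beta> y p q) x r" for p q r
  proof -
    have "dir_deriv (\<lambda>y. b y p q) x r = dir_deriv (\<lambda>y. \<alpha> y p * ?l q y - \<alpha> y q * ?l p y + \<beta> y p q) x r"
      by (rule dir_deriv_cong[OF E xE val])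
    also have "\<dots> = (\<alpha> x p * ?m q r + dir_deriv (\<lambda>y. \<alpha> y p) x r * ?l q x) - (\<alpha> x q * ?m p r + dir_deriv (\<lambda>y. \<alpha> y q) x r * ?l p x)
      + dir_deriv (\<lambda>y. \<beta> y p q) x r"
      by (intro dir_deriv_eq has_derivative_add has_derivative_diff has_derivative_mult ha hb hl)
    finally show ?thesis .
  qed
  have sym: "?m p q = ?m q p" for p q
    using dir_deriv_commute[OF f D(1,2), of p q] by (simp add: mult.commute)
  have "b_form_diff \<alpha> \<beta> x (?l u x, u) (?l v x, v) (?l w x, w) = 0"
    using closed tangent by blast
  then have z: "ext_d1 \<alpha> x u v * ?l w x - ext_d1 \<alpha> x u w * ?l v x + ext_d1 \<alpha> x v w * ?l u x + ext_d2 \<beta> x u v w = 0"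
    by (simp add: b_form_diff_def)
  \<comment> \<open>Terms with second derivatives of ln |f| cancel by symmetry, and the remaining
    ones are those of \<open>b_form_diff\<close>. Stating this for plain real variables separates
    the cancellation from the derivatives.\<close>
  have alg: "((av * mwu + duv * lw) - (aw * mvu + duw * lv) + bu) - ((au * mwv + dvu * lw) - (aw * muv + dvw * lu) + bb)
      + ((au * mvw + dwu * lv) - (av * muw + dwv * lu) + bw)
     = (duv - dvu) * lw - (duw - dwu) * lv + (dvw - dwv) * lu + (bu - bb + bw)"
    if "mwu = muw" "mvu = muv" "mwv = mvw"
    for av mwu duv lw aw mvu duw lv bu au mwv dvu muv dvw lu bb mvw dwu muw dwv bw :: real
    using that by (simp add: algebra_simps)
  show "ext_d2 b x u v w = 0"
    unfolding ext_d2_def d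
    by (subst alg[OF sym sym sym]) (use z in \<open>simp only: ext_d1_def ext_d2_def\<close>)
  obtain v where v: "\<And>j. v j \<in> b_tangent f x" "wedge_power (UNIV :: 'n set) (b_form_value \<alpha> \<beta> x) v \<noteq> 0"
    using nondeg by auto
  have vj: "v j = (?l (snd (v j)) x, snd (v j))" for j
    using v(1)[of j] tangent[of "fst (v j)" "snd (v j)"] by (simp add: prod_eq_iff)
  have "wedge_power (UNIV :: 'n set) (b x) (\<lambda>j. snd (v j)) = wedge_power (UNIV :: 'n set) (b_form_value \<alpha> \<beta> x) v"
    by (rule wedge_power_cong) (use bv[OF D(2,3)] vj in metis)
  then show "\<exists>v. wedge_power (UNIV :: 'n set) (b x) v \<noteq> 0" using v(2) by metis
qed

lemma coeff_form2_subset: "coeff_form2 I D b \<Longrightarrow> D' \<subseteq> D \<Longrightarrow> coeff_form2 I D' b"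
  unfolding coeff_form2_def
  by (intro conjI ballI) (blast, blast, meson smooth_on_subset)

context collapse
begin

lemma form_off_Z:
  assumes c: "c \<in> M" and p: "p \<in> fst c" "p \<notin> Z"
  shows "ext_d2 (\<omega> c) (snd c p) u v w = 0" "\<exists>v. wedge_power (UNIV :: 'n set) (\<omega> c (snd c p)) v \<noteq> 0"
proof -
  have "\<exists>D f \<alpha> \<beta>. open D \<and> snd c p \<in> D \<and> D \<subseteq> snd c ` fst c \<and>
        b_form_repr D (snd c ` (fst c \<inter> Z)) (\<omega> c) f \<alpha> \<beta> \<and>
        (\<forall>y\<in>D. (\<forall>\<xi>\<in>b_tangent f y. \<forall>\<eta>\<in>b_tangent f y. \<forall>\<zeta>\<in>b_tangent f y. b_form_diff \<alpha> \<beta> y \<xi> \<eta> \<zeta> = 0) \<and>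
           (\<exists>v. (\<forall>j. v j \<in> b_tangent f y) \<and> wedge_power (UNIV :: 'n set) (b_form_value \<alpha> \<beta> y) v \<noteq> 0))"
    using b_form[unfolded b_symplectic_form_def case_prod_beta prod.collapse, THEN conjunct2, THEN bspec, OF c] p(1) by blast
  then obtain D f \<alpha> \<beta> where D: "open D" "snd c p \<in> D" "b_form_repr D (snd c ` (fst c \<inter> Z)) (\<omega> c) f \<alpha> \<beta>"
    and y: "\<And>y. y \<in> D \<Longrightarrow> (\<forall>\<xi>\<in>b_tangent f y. \<forall>\<eta>\<in>b_tangent f y. \<forall>\<zeta>\<in>b_tangent f y. b_form_diff \<alpha> \<beta> y \<xi> \<eta> \<zeta> = 0) \<and>
           (\<exists>v. (\<forall>j. v j \<in> b_tangent f y) \<and> wedge_power (UNIV :: 'n set) (b_form_value \<alpha> \<beta> y) v \<noteq> 0)" by metis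
  have nS: "snd c p \<notin> snd c ` (fst c \<inter> Z)" using M.inj[OF c] p by (auto simp: inj_on_def)
  show "ext_d2 (\<omega> c) (snd c p) u v w = 0" "\<exists>v. wedge_power (UNIV :: 'n set) (\<omega> c (snd c p)) v \<noteq> 0"
    using b_form_off_hypersurface[OF D(1,2) nS D(3) conjunct1[OF y[OF D(2)]] conjunct2[OF y[OF D(2)]]] by auto
qed

lemma form_coeff:
  assumes "c \<in> M"
  shows "coeff_form2 UNIV (snd c ` (fst c \<inter> (carrier_of M - Z))) (\<omega> c)"
  using b_form[unfolded b_symplectic_form_def two_form_def case_prod_beta prod.collapse, THEN conjunct1, THEN conjunct1, THEN bspec, OF assms] .

lemma form_transform:
  assumes "c \<in> M" "c' \<in> M" "p \<in> fst c" "p \<in> fst c'" "p \<in> X"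
  shows "\<omega> c (snd c p) u v = \<omega> c' (snd c' p) (differential c (snd c') p u) (differential c (snd c') p v)"
  by (rule b_form[unfolded b_symplectic_form_def two_form_def, THEN conjunct1, THEN conjunct2, rule_format])
     (use assms X_sub in auto)

end

text \<open>A single \<delta>, r and profile for all components. The bounds on \<delta> place every
  cap inside its model neighbourhood and keep caps of different components apart.\<close>

locale collapse_profile = collapse k M Z X \<omega> act L
  for k :: "'n::finite" and M :: "('a, 'n) atlas" and Z X :: "'a set" and \<omega> :: "('a, 'n) form2"
    and act :: "complex^'n \<Rightarrow> 'a \<Rightarrow> 'a" and L :: "'a set \<Rightarrow> ('a, 'x, 'n) local_model" +
  fixes \<delta> r :: real and \<phi> \<Phi> :: "real \<Rightarrow> real"
  assumes \<delta>_width: "\<And>Z'. Z' \<in> C \<Longrightarrow> \<delta> < width (L Z')"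
    and \<delta>_disjoint: "\<And>Z' Z'' p. Z' \<in> C \<Longrightarrow> Z'' \<in> C \<Longrightarrow> p \<in> W Z' \<Longrightarrow> p \<in> W Z'' \<Longrightarrow>
      \<bar>hh Z' p\<bar> \<le> \<delta> \<Longrightarrow> \<bar>hh Z'' p\<bar> \<le> \<delta> \<Longrightarrow> Z' = Z''"
    and r: "0 < r" "r < \<delta>"
    and \<phi>_smooth: "smooth_on {0..\<delta>} \<phi>" and \<phi>_pos: "\<And>h. h \<in> {0..\<delta>} \<Longrightarrow> \<phi> h > 0"
    and \<Phi>_deriv: "\<And>h. h \<in> {0..\<delta>} \<Longrightarrow> (\<Phi> has_real_derivative \<phi> h) (at h within {0..\<delta>})"
    and \<Phi>_smooth: "smooth_on {0..\<delta>} \<Phi>"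
    and \<phi>_outer: "\<And>h. h \<in> {r..\<delta>} \<Longrightarrow> \<phi> h = 1 / h" and \<Phi>_outer: "\<And>h. h \<in> {r..\<delta>} \<Longrightarrow> \<Phi> h = ln h"
begin

text \<open>The region where the given form is kept. It overlaps a cap exactly in r < h < \<delta>,
  where the profile is 1/h.\<close>

definition core :: "'a set" where "core = X - (\<Union>Z'\<in>C. {p \<in> W Z'. \<bar>hh Z' p\<bar> \<le> r})"

definition cap :: "'a set \<Rightarrow> 'a set" where "cap Z' = {p \<in> W Z' \<inter> P. hh Z' p < \<delta>}"

lemma core_X: "p \<in> core \<Longrightarrow> p \<in> X"
  by (simp add: core_def)

lemma core_open: "openin (mtop M) core"
  unfolding core_def
proof (rule openin_diff[OF X_open])
  show "closedin (mtop M) (\<Union>Z'\<in>C. {p \<in> W Z'. \<bar>hh Z' p\<bar> \<le> r})"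
    using finite_C \<delta>_width r(2) by (intro closedin_Union) (force intro: collar.closed_level[OF collar])+
qed

text \<open>Points of one class have the same height in a collar, so disjointness of the caps
  survives the passage to the quotient.\<close>

lemma cap_same: "Z' \<in> C \<Longrightarrow> Z'' \<in> C \<Longrightarrow> p \<in> cap Z' \<Longrightarrow> q \<in> cap Z'' \<Longrightarrow> \<pi> p = \<pi> q \<Longrightarrow> Z' = Z''"
proof -
  assume a: "Z' \<in> C" "Z'' \<in> C" "p \<in> cap Z'" "q \<in> cap Z''" "\<pi> p = \<pi> q"
  then have p: "p \<in> W Z'" "p \<in> P" "hh Z' p < \<delta>" and q: "q \<in> W Z''" "q \<in> P" "hh Z'' q < \<delta>" by (auto simp: cap_def)
  have q': "q \<in> W Z'" "hh Z' q = hh Z' p" using \<pi>_same_collar[OF a(1) p(2) q(2) a(5) p(1)] by auto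
  show "Z' = Z''"
    by (rule \<delta>_disjoint[OF a(1,2) q'(1) q(1)]) (use q' P_side[OF a(1) p(1)] P_side[OF a(2) q(1)] p q in auto)
qed

lemma core_or_cap:
  assumes "p \<in> P"
  shows "p \<in> core \<or> (\<exists>Z'\<in>C. p \<in> cap Z')"
proof (cases "p \<in> core")
  case False
  have "\<exists>Z'\<in>C. p \<in> W Z' \<and> hh Z' p < \<delta>"
  proof (cases "p \<in> X")
    case True
    then obtain Z' where "Z' \<in> C" "p \<in> W Z'" "\<bar>hh Z' p\<bar> \<le> r" using False by (auto simp: core_def)
    then show ?thesis using r(2) by (intro bexI[of _ Z']) auto
  next
    case False
    then obtain Z' where Z': "Z' \<in> C" "p \<in> Z'" using assms by (auto simp: P_def)
    then have "p \<in> W Z'" using C_W by auto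
    moreover have "hh Z' p = 0" using collar.Z'_iff[OF collar[OF Z'(1)] calculation] Z'(2) by simp
    ultimately show ?thesis using Z'(1) r by (intro bexI[of _ Z']) auto
  qed
  then show ?thesis using assms by (auto simp: cap_def)
qed simp

lemma core_cap_height: "Z' \<in> C \<Longrightarrow> p \<in> core \<Longrightarrow> p \<in> cap Z' \<Longrightarrow> r < hh Z' p \<and> hh Z' p < \<delta> \<and> p \<in> X \<and> p \<in> W Z'"
  using P_side[of Z' p] by (force simp: core_def cap_def)

text \<open>On the overlap the profile equals 1/h, so the new form is the given one written in cap
  coordinates.\<close>

lemma cap_form_eq:
  assumes c: "c \<in> M" "p \<in> fst c" "p \<in> core" and Z': "Z' \<in> C" "d \<in> FF Z'" "p \<in> cap Z'" "xx Z' p \<in> fst d"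
  shows "\<omega> c (snd c p) u v = collar.capform k (L Z') \<phi> d (capc Z' d p)
    (differential (oc c) (snd (cc Z' d)) (\<pi> p) u) (differential (oc c) (snd (cc Z' d)) (\<pi> p) v)"
proof -
  note cl = collar[OF Z'(1)]
  have h: "r < hh Z' p" "hh Z' p < \<delta>" "p \<in> X" "p \<in> W Z'" using core_cap_height[OF Z'(1) c(3) Z'(3)] by auto
  have hp: "hh Z' p > 0" using h r by simp
  have "\<phi> (height k (capc Z' d p)) = 1 / height k (capc Z' d p)"
    using collar.height_capc[OF cl Z'(2) h(4) Z'(4)] hp h \<phi>_outer by simp
  then show ?thesis
    unfolding collar.form_eq_capform[OF cl c(1) Z'(2) c(2) h(4) Z'(4) hp]
      differential_oc_cc[OF c(1) Z'(1,2) h(3) c(2) h(4) Z'(4)] collar.capform_def[OF cl] by simp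
qed

lemma glued_form:
  obtains \<omega>' where "symplectic_form UNIV A \<omega>'"
    "\<And>c p u v. c \<in> M \<Longrightarrow> p \<in> fst c \<Longrightarrow> p \<in> core \<Longrightarrow> \<omega>' (oc c) (snd c p) u v = \<omega> c (snd c p) u v"
    "\<And>Z' d p u v. Z' \<in> C \<Longrightarrow> d \<in> FF Z' \<Longrightarrow> p \<in> cap Z' \<Longrightarrow> xx Z' p \<in> fst d \<Longrightarrow>
      \<omega>' (cc Z' d) (capc Z' d p) u v = collar.capform k (L Z') \<phi> d (capc Z' d p) u v"
proof -
  \<comment> \<open>The pieces to be glued are the charts of M restricted to the core and, for each
    component and each fiber chart, the cap below height \<delta>. The facts 1 to 8 are the
    hypotheses of \<open>glue_symplectic_form\<close> in their order.\<close>
  define J :: "(('a, 'n) chart + 'a set \<times> ('x, 'n) chart) set" where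
    "J = Inl ` M \<union> Inr ` (SIGMA Z':C. FF Z')"
  define ch :: "('a, 'n) chart + 'a set \<times> ('x, 'n) chart \<Rightarrow> ('a set, 'n) chart" where
    "ch = case_sum oc (\<lambda>(Z', d). cc Z' d)"
  define dm :: "('a, 'n) chart + 'a set \<times> ('x, 'n) chart \<Rightarrow> 'a set set" where
    "dm = case_sum (\<lambda>c. \<pi> ` (fst c \<inter> core)) (\<lambda>(Z', d). \<pi> ` {p \<in> cap Z'. xx Z' p \<in> fst d})"
  define b :: "('a, 'n) chart + 'a set \<times> ('x, 'n) chart \<Rightarrow> 'n coords \<Rightarrow> 'n coords \<Rightarrow> 'n coords \<Rightarrow> real" where
    "b = case_sum \<omega> (\<lambda>(Z', d). collar.capform k (L Z') \<phi> d)"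
  have J_cases: thesis if "j \<in> J" "\<And>c. j = Inl c \<Longrightarrow> c \<in> M \<Longrightarrow> thesis" "\<And>Z' d. j = Inr (Z', d) \<Longrightarrow> Z' \<in> C \<Longrightarrow> d \<in> FF Z' \<Longrightarrow> thesis" for j thesis
    using that unfolding J_def by auto
  have ch1: "ch (Inl c) = oc c" and ch2: "ch (Inr (Z', d)) = cc Z' d" for c Z' d by (simp_all add: ch_def)
  have dm1: "dm (Inl c) = \<pi> ` (fst c \<inter> core)" and dm2: "dm (Inr (Z', d)) = \<pi> ` {p \<in> cap Z'. xx Z' p \<in> fst d}" for c Z' d
    by (simp_all add: dm_def)
  have b1: "b (Inl c) = \<omega> c" and b2: "b (Inr (Z', d)) = collar.capform k (L Z') \<phi> d" for c Z' d by (simp_all add: b_def)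
  have capP: "p \<in> W Z'" "p \<in> P" "hh Z' p \<ge> 0" "hh Z' p < \<delta>" if "Z' \<in> C" "p \<in> cap Z'" for Z' p
    using that P_side[of Z' p] by (auto simp: cap_def)
  have dm_oc: "\<exists>p. q = \<pi> p \<and> p \<in> fst c \<and> p \<in> core" if "q \<in> dm (Inl c)" for q c using that unfolding dm1 by auto
  have dm_cc: "\<exists>p. q = \<pi> p \<and> p \<in> cap Z' \<and> xx Z' p \<in> fst d" if "q \<in> dm (Inr (Z', d))" for q Z' d using that unfolding dm2 by auto
  have capreg: "capc Z' d p \<in> collar.cap_region k \<delta> d" if "Z' \<in> C" "d \<in> FF Z'" "p \<in> cap Z'" "xx Z' p \<in> fst d" for Z' d p
    using that collar.capc_parts(1)[OF collar[OF that(1)] that(2,4)]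
      collar.height_capc[OF collar[OF that(1)] that(2) capP(1)[OF that(1,3)] that(4) capP(3)[OF that(1,3)]] capP(4)[OF that(1,3)]
    by (simp add: collar.cap_region_def[OF collar[OF that(1)]])
  have 1: "ch j \<in> A" if "j \<in> J" for j by (rule J_cases[OF that]) (auto simp: ch1 ch2 oc_A cc_A)
  have 2: "dm j \<subseteq> fst (ch j)" if "j \<in> J" for j
    by (rule J_cases[OF that]) (use core_X in \<open>auto simp: ch1 ch2 dm1 dm2 oc_dom cc_dom cap_def\<close>)
  have 3: "openin (mtop A) (dm j)" if j: "j \<in> J" for j
  proof (rule J_cases[OF j])
    fix c assume c: "j = Inl c" "c \<in> M"
    have "dm j = {q \<in> fst (oc c). snd (oc c) q \<in> snd c ` (core \<inter> fst c)}" (is "_ = ?T")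
    proof
      show "dm j \<subseteq> ?T"
      proof
        fix q assume "q \<in> dm j"
        then obtain p where p: "q = \<pi> p" "p \<in> fst c" "p \<in> core" using dm_oc c(1) by blast
        then show "q \<in> ?T" using core_X oc_apply[OF core_X[OF p(3)], of c] by (auto simp: oc_dom)
      qed
      show "?T \<subseteq> dm j"
      proof
        fix q assume q: "q \<in> ?T"
        then obtain p where p: "q = \<pi> p" "p \<in> fst c" "p \<in> X" by (auto simp: oc_dom)
        then have "snd c p \<in> snd c ` (core \<inter> fst c)" using q oc_apply[OF p(3), of c] by simp
        then have "p \<in> core" using M.inj[OF c(2)] p(2) by (auto simp: inj_on_def)
        then show "q \<in> dm j" using p unfolding c(1) dm1 by auto
      qed
    qed
    then show ?thesis using openin_mtop_basic[OF oc_A[OF c(2)] M.open_image[OF c(2) core_open]] by simp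
  next
    fix Z' d assume d: "j = Inr (Z', d)" "Z' \<in> C" "d \<in> FF Z'"
    have "dm j = {q \<in> fst (cc Z' d). snd (cc Z' d) q \<in> collar.cap_region k \<delta> d}" (is "_ = ?T")
    proof
      show "dm j \<subseteq> ?T"
      proof
        fix q assume "q \<in> dm j"
        then obtain p where p: "q = \<pi> p" "p \<in> cap Z'" "xx Z' p \<in> fst d" using dm_cc d(1) by blast
        note pc = capP[OF d(2) p(2)]
        show "q \<in> ?T" using cc_mem[OF d(2) pc(2), of d] cc_apply[OF d(2) pc(2,1), of d] capreg[OF d(2,3) p(2,3)] pc p by simp
      qed
      show "?T \<subseteq> dm j"
      proof
        fix q assume q: "q \<in> ?T"
        then obtain p where p: "q = \<pi> p" "p \<in> W Z'" "p \<in> P" "xx Z' p \<in> fst d" by (auto simp: cc_dom)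
        have h: "hh Z' p \<ge> 0" using P_side[OF d(2) p(2)] p(3) by simp
        have "capc Z' d p \<in> collar.cap_region k \<delta> d" using q cc_apply[OF d(2) p(3,2), of d] p(1) by simp
        then have "hh Z' p < \<delta>" using collar.height_capc[OF collar[OF d(2)] d(3) p(2,4) h]
          by (simp add: collar.cap_region_def[OF collar[OF d(2)]])
        then show "q \<in> dm j" using p unfolding d(1) dm2 cap_def by auto
      qed
    qed
    then show ?thesis using openin_mtop_basic[OF cc_A[OF d(2,3)] collar.open_cap_region'[OF collar[OF d(2)] d(3)]] by simp
  qed
  have 4: "carrier_of A \<subseteq> (\<Union>j\<in>J. dm j)"
  proof
    fix q assume "q \<in> carrier_of A"
    then obtain p where p: "q = \<pi> p" "p \<in> P" unfolding carrier_A by auto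
    from core_or_cap[OF p(2)] show "q \<in> (\<Union>j\<in>J. dm j)"
    proof
      assume pc: "p \<in> core"
      then have "p \<in> carrier_of M" using core_X X_sub by blast
      then obtain c where c: "c \<in> M" "p \<in> fst c" by (auto simp: carrier_of_def)
      then have "Inl c \<in> J" "q \<in> dm (Inl c)" using p pc unfolding dm1 J_def by auto
      then show ?thesis by blast
    next
      assume "\<exists>Z'\<in>C. p \<in> cap Z'"
      then obtain Z' where Z': "Z' \<in> C" "p \<in> cap Z'" by auto
      obtain d where d: "d \<in> FF Z'" "xx Z' p \<in> fst d"
        using collar.emb_mem(1)[OF collar[OF Z'(1)] capP(1)[OF Z']] by (auto simp: carrier_of_def)
      then have "Inr (Z', d) \<in> J" "q \<in> dm (Inr (Z', d))" using p Z' unfolding dm2 J_def by auto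
      then show ?thesis by blast
    qed
  qed
  have 5: "coeff_form2 UNIV (snd (ch j) ` dm j) (b j)" if j: "j \<in> J" for j
  proof (rule J_cases[OF j])
    fix c assume c: "j = Inl c" "c \<in> M"
    have "snd (ch j) ` dm j \<subseteq> snd c ` (fst c \<inter> (carrier_of M - Z))"
    proof
      fix y assume "y \<in> snd (ch j) ` dm j"
      then obtain p where p: "y = snd (oc c) (\<pi> p)" "p \<in> fst c" "p \<in> core" unfolding c(1) ch1 dm1 by auto
      then show "y \<in> snd c ` (fst c \<inter> (carrier_of M - Z))"
        using oc_apply[OF core_X[OF p(3)], of c] core_X[OF p(3)] X_sub by auto
    qed
    then show ?thesis unfolding c(1) b1 using coeff_form2_subset[OF form_coeff[OF c(2)]] by simp
  next
    fix Z' d assume d: "j = Inr (Z', d)" "Z' \<in> C" "d \<in> FF Z'"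
    have "snd (ch j) ` dm j \<subseteq> collar.cap_region k \<delta> d"
    proof
      fix y assume "y \<in> snd (ch j) ` dm j"
      then obtain p where p: "y = snd (cc Z' d) (\<pi> p)" "p \<in> cap Z'" "xx Z' p \<in> fst d" unfolding d(1) ch2 dm2 by auto
      then show "y \<in> collar.cap_region k \<delta> d"
        using cc_apply[OF d(2) capP(2,1)[OF d(2) p(2)], of d] capreg[OF d(2,3) p(2,3)] by simp
    qed
    then show ?thesis unfolding d(1) b2
      using coeff_form2_subset[OF collar.coeff_form2_capform[OF collar[OF d(2)] d(3) \<phi>_smooth]] by simp
  qed
  have 6: "ext_d2 (b j) (snd (ch j) q) u v w = 0" if j: "j \<in> J" and q: "q \<in> dm j" for j q u v w
  proof (rule J_cases[OF j])
    fix c assume c: "j = Inl c" "c \<in> M"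
    obtain p where p: "q = \<pi> p" "p \<in> fst c" "p \<in> core" using dm_oc q c(1) by blast
    have "p \<notin> Z" using core_X[OF p(3)] X_sub by blast
    then show ?thesis unfolding c(1) ch1 b1 p(1) oc_apply[OF core_X[OF p(3)]] by (rule form_off_Z(1)[OF c(2) p(2)])
  next
    fix Z' d assume d: "j = Inr (Z', d)" "Z' \<in> C" "d \<in> FF Z'"
    obtain p where p: "q = \<pi> p" "p \<in> cap Z'" "xx Z' p \<in> fst d" using dm_cc q d(1) by blast
    show ?thesis unfolding d(1) ch2 b2 p(1) cc_apply[OF d(2) capP(2,1)[OF d(2) p(2)]]
      by (rule collar.capform_closed[OF collar[OF d(2)] d(3) \<phi>_smooth capreg[OF d(2,3) p(2,3)]])
  qed
  have 7: "\<exists>v. wedge_power (UNIV :: 'n set) (b j (snd (ch j) q)) v \<noteq> 0" if j: "j \<in> J" and q: "q \<in> dm j" for j q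
  proof (rule J_cases[OF j])
    fix c assume c: "j = Inl c" "c \<in> M"
    obtain p where p: "q = \<pi> p" "p \<in> fst c" "p \<in> core" using dm_oc q c(1) by blast
    have "p \<notin> Z" using core_X[OF p(3)] X_sub by blast
    then show ?thesis unfolding c(1) ch1 b1 p(1) oc_apply[OF core_X[OF p(3)]] by (rule form_off_Z(2)[OF c(2) p(2)])
  next
    fix Z' d assume d: "j = Inr (Z', d)" "Z' \<in> C" "d \<in> FF Z'"
    obtain p where p: "q = \<pi> p" "p \<in> cap Z'" "xx Z' p \<in> fst d" using dm_cc q d(1) by blast
    note cl = collar[OF d(2)] and pc = capP[OF d(2) p(2)]
    have y: "drop_coord k (capc Z' d p) \<in> snd d ` fst d" using collar.capc_parts(1)[OF cl d(3) p(3)] p(3) by simp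
    have "\<phi> (height k (capc Z' d p)) > 0" using collar.height_capc[OF cl d(3) pc(1) p(3) pc(3)] pc \<phi>_pos by simp
    then have "\<phi> (height k (capc Z' d p)) \<noteq> 0" by simp
    then show ?thesis unfolding d(1) ch2 b2 p(1) cc_apply[OF d(2) pc(2,1)]
      by (rule collar.capform_nondegenerate[OF cl d(3) y])
  qed
  \<comment> \<open>Agreement of two pieces in one direction implies it in the other through the
    inverse differential, so a core piece and a cap need be compared only once.\<close>
  have inv: "b j (snd (ch j) q) u v = b i (snd (ch i) q) (differential (ch j) (snd (ch i)) q u) (differential (ch j) (snd (ch i)) q v)"
    if ji: "j \<in> J" "i \<in> J" "q \<in> dm j" "q \<in> dm i"
      and h: "\<And>u v. b i (snd (ch i) q) u v = b j (snd (ch j) q) (differential (ch i) (snd (ch j)) q u) (differential (ch i) (snd (ch j)) q v)"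
    for i j q u v
  proof -
    have m: "q \<in> fst (ch j)" "q \<in> fst (ch i)" using 2 ji by auto
    show ?thesis unfolding h A.differential_inverse[OF 1[OF ji(1)] 1[OF ji(2)] m] ..
  qed
  have 8: "b j (snd (ch j) q) u v = b i (snd (ch i) q) (differential (ch j) (snd (ch i)) q u) (differential (ch j) (snd (ch i)) q v)"
    if ji: "j \<in> J" "i \<in> J" "q \<in> dm j" "q \<in> dm i" for i j q u v
  proof -
    have mixed: "b (Inl c) (snd (oc c) q) u v = b (Inr (Z', d)) (snd (cc Z' d) q) (differential (oc c) (snd (cc Z' d)) q u) (differential (oc c) (snd (cc Z' d)) q v)"
      if c: "c \<in> M" "q \<in> dm (Inl c)" and d: "Z' \<in> C" "d \<in> FF Z'" "q \<in> dm (Inr (Z', d))" for c Z' d u v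
    proof -
      obtain p where p: "q = \<pi> p" "p \<in> fst c" "p \<in> core" using dm_oc[OF c(2)] by blast
      obtain p' where p': "q = \<pi> p'" "p' \<in> cap Z'" "xx Z' p' \<in> fst d" using dm_cc[OF d(3)] by blast
      have "p = p'" using \<pi>_X_eq[OF core_X[OF p(3)] capP(2)[OF d(1) p'(2)]] p(1) p'(1) by simp
      with p' have pc: "p \<in> cap Z'" "xx Z' p \<in> fst d" by auto
      show ?thesis unfolding p(1) b1 b2 oc_apply[OF core_X[OF p(3)]] cc_apply[OF d(1) capP(2,1)[OF d(1) pc(1)]]
        by (rule cap_form_eq[OF c(1) p(2,3) d(1,2) pc])
    qed
    show ?thesis
    proof (rule J_cases[OF ji(1)])
      fix c assume c: "j = Inl c" "c \<in> M"
      have qc: "q \<in> dm (Inl c)" using ji(3) c(1) by simp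
      show ?thesis
      proof (rule J_cases[OF ji(2)])
        fix c' assume c': "i = Inl c'" "c' \<in> M"
        obtain p where p: "q = \<pi> p" "p \<in> fst c" "p \<in> core" using dm_oc[OF qc] by blast
        have pX: "p \<in> X" by (rule core_X[OF p(3)])
        obtain p' where p': "q = \<pi> p'" "p' \<in> fst c'" "p' \<in> core" using dm_oc ji(4) c'(1) by blast
        have "p = p'" using \<pi>_X_eq[OF pX X_P[OF core_X[OF p'(3)]]] p(1) p'(1) by simp
        with p' have pc': "p \<in> fst c'" by simp
        have D: "differential (oc c) (snd (oc c')) (\<pi> p) u = differential c (snd c') p u" for u
          unfolding differential_oc[OF c(2) pX p(2)] unfolding differential_def
        proof (rule dir_deriv_cong[OF M.open_image[OF c(2) X_open]])
          show "snd c p \<in> snd c ` (X \<inter> fst c)" using p pX by auto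
          fix y assume "y \<in> snd c ` (X \<inter> fst c)"
          then obtain p'' where q: "y = snd c p''" "p'' \<in> X" "p'' \<in> fst c" by auto
          show "local_expr c (\<lambda>p. snd (oc c') (\<pi> p)) y = local_expr c (snd c') y"
            unfolding q(1) using M.inj[OF c(2)] q oc_apply[OF q(2), of c'] by (simp add: local_expr_at)
        qed
        show ?thesis unfolding c(1) c'(1) ch1 b1 p(1) oc_apply[OF pX] D
          by (rule form_transform[OF c(2) c'(2) p(2) pc' pX])
      next
        fix Z' d assume d: "i = Inr (Z', d)" "Z' \<in> C" "d \<in> FF Z'"
        show ?thesis unfolding c(1) d(1) ch1 ch2 by (rule mixed[OF c(2) qc d(2,3)]) (use ji(4) d(1) in simp)
      qed
    next
      fix Z' d assume d: "j = Inr (Z', d)" "Z' \<in> C" "d \<in> FF Z'"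
      have qd: "q \<in> dm (Inr (Z', d))" using ji(3) d(1) by simp
      show ?thesis
      proof (rule J_cases[OF ji(2)])
        fix c assume c: "i = Inl c" "c \<in> M"
        show ?thesis
          by (rule inv[OF ji]) (unfold c(1) d(1) ch1 ch2, rule mixed[OF c(2) _ d(2,3) qd], use ji(4) c(1) in simp)
      next
        fix Z'' d' assume d': "i = Inr (Z'', d')" "Z'' \<in> C" "d' \<in> FF Z''"
        obtain p where p: "q = \<pi> p" "p \<in> cap Z'" "xx Z' p \<in> fst d" using dm_cc[OF qd] by blast
        obtain p' where p': "q = \<pi> p'" "p' \<in> cap Z''" "xx Z'' p' \<in> fst d'" using dm_cc ji(4) d'(1) by blast
        \<comment> \<open>Caps of different components are disjoint, so two overlapping caps belong
          to the same one and differ only by a fiber transition.\<close>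
        have e: "Z'' = Z'" using cap_same[OF d(2) d'(2) p(2) p'(2)] p(1) p'(1) by simp
        note pc = capP[OF d(2) p(2)] and cl = collar[OF d(2)]
        have d'F: "d' \<in> FF Z'" and p'c: "p' \<in> P" using d'(3) capP[OF d'(2) p'(2)] e by auto
        have "xx Z' p' = xx Z' p" using \<pi>_same_collar(2)[OF d(2) pc(2) p'c _ pc(1)] p(1) p'(1) by simp
        then have xd': "xx Z' p \<in> fst d'" using p'(3) e by simp
        have y: "drop_coord k (capc Z' d p) \<in> snd d ` (fst d \<inter> fst d')"
          using collar.capc_parts(1)[OF cl d(3) p(3)] p(3) xd' by simp
        show ?thesis unfolding d(1) d'(1) ch2 b2 e p(1) cc_apply[OF d(2) pc(2,1)]
            differential_cc_cc[OF d(2,3) d'F pc(2,1) p(3) xd'] collar.fib_trans_capc[OF cl d(3) d'F p(3) xd', symmetric]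
          by (rule collar.capform_fib_trans[OF cl d(3) d'F y])
      qed
    qed
  qed
  obtain \<omega>' where \<omega>': "symplectic_form UNIV A \<omega>'"
    "\<And>j q u v. j \<in> J \<Longrightarrow> q \<in> dm j \<Longrightarrow> \<omega>' (ch j) (snd (ch j) q) u v = b j (snd (ch j) q) u v"
    by (rule A.glue_symplectic_form[of J ch dm b, OF 1 2 3 4 5 6 7 8]) (assumption | rule that)+
  show ?thesis
  proof (rule that[OF \<omega>'(1)])
    fix c p u v assume c: "c \<in> M" "p \<in> fst c" "p \<in> core"
    have "\<omega>' (ch (Inl c)) (snd (ch (Inl c)) (\<pi> p)) u v = b (Inl c) (snd (ch (Inl c)) (\<pi> p)) u v"
      by (rule \<omega>'(2)) (use c in \<open>auto simp: J_def dm1\<close>)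
    then show "\<omega>' (oc c) (snd c p) u v = \<omega> c (snd c p) u v" unfolding ch1 b1 oc_apply[OF core_X[OF c(3)]] .
  next
    fix Z' d p u v assume d: "Z' \<in> C" "d \<in> FF Z'" "p \<in> cap Z'" "xx Z' p \<in> fst d"
    have "\<omega>' (ch (Inr (Z', d))) (snd (ch (Inr (Z', d))) (\<pi> p)) u v = b (Inr (Z', d)) (snd (ch (Inr (Z', d))) (\<pi> p)) u v"
      by (rule \<omega>'(2)) (use d in \<open>auto simp: J_def dm2\<close>)
    then show "\<omega>' (cc Z' d) (capc Z' d p) u v = collar.capform k (L Z') \<phi> d (capc Z' d p) u v"
      unfolding ch2 b2 cc_apply[OF d(1) capP(2,1)[OF d(1,3)]] .
  qed
qed

end


section \<open>The induced action\<close>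

lemma (in univ_atlas) smooth_torus_actionD:
  assumes act: "smooth_torus_action UNIV A act" and c: "c \<in> A" "c' \<in> A"
  shows "open {(\<eta>, x). x \<in> snd c ` fst c \<and> act (torus_exp \<eta>) (inv_into (fst c) (snd c) x) \<in> fst c'}" (is "open ?D")
    and "smooth_on {(\<eta>, x). x \<in> snd c ` fst c \<and> act (torus_exp \<eta>) (inv_into (fst c) (snd c) x) \<in> fst c'}
      (\<lambda>(\<eta>, x). snd c' (act (torus_exp \<eta>) (inv_into (fst c) (snd c) x)))"
proof -
  have *: "openin (top_of_set (UNIV \<times> snd c ` fst c)) ?D \<and>
     smooth_on ?D (\<lambda>(\<eta>, x). snd c' (act (torus_exp \<eta>) (inv_into (fst c) (snd c) x)))"
    using act c unfolding smooth_torus_action_def Let_def torus_lie_UNIV case_prod_beta by simp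
  have "open (UNIV \<times> snd c ` fst c)" by (intro open_Times open_UNIV open_chart_image c)
  then show "open ?D" using * openin_open_eq by blast
  show "smooth_on ?D (\<lambda>(\<eta>, x). snd c' (act (torus_exp \<eta>) (inv_into (fst c) (snd c) x)))" using * by simp
qed

context collapse
begin

lemma act_carrier: "t \<in> torus UNIV \<Longrightarrow> p \<in> carrier_of M \<Longrightarrow> act t p \<in> carrier_of M"
  and act_one: "p \<in> carrier_of M \<Longrightarrow> act 1 p = p"
  and act_mult: "s \<in> torus UNIV \<Longrightarrow> t \<in> torus UNIV \<Longrightarrow> p \<in> carrier_of M \<Longrightarrow> act (s * t) p = act s (act t p)"
  using M_action unfolding smooth_torus_action_def by simp_all

lemma act_undo:
  assumes "t \<in> torus UNIV"
  obtains s where "s \<in> torus UNIV" "\<And>p. p \<in> carrier_of M \<Longrightarrow> act s (act t p) = p" "\<And>p. p \<in> carrier_of M \<Longrightarrow> act t (act s p) = p"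
proof -
  obtain s where s: "s \<in> torus UNIV" "s * t = 1" "t * s = 1" by (rule torus_inverse[OF assms])
  show ?thesis
  proof (rule that[OF s(1)])
    show "act s (act t p) = p" if "p \<in> carrier_of M" for p
      using act_mult[OF s(1) assms that] s(2) act_one[OF that] by simp
    show "act t (act s p) = p" if "p \<in> carrier_of M" for p
      using act_mult[OF assms s(1) that] s(3) act_one[OF that] by simp
  qed
qed

lemma act_not_Z:
  assumes t: "t \<in> torus UNIV" and p: "p \<in> carrier_of M" "p \<notin> Z"
  shows "act t p \<notin> Z"
proof
  assume a: "act t p \<in> Z"
  obtain s where s: "s \<in> torus UNIV" "\<And>p. p \<in> carrier_of M \<Longrightarrow> act s (act t p) = p" by (rule act_undo[OF t]) (rule that)
  show False using act_Z[OF s(1) a] s(2)[OF p(1)] p(2) by simp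
qed

lemma continuous_orbit:
  assumes p: "p \<in> carrier_of M"
  shows "continuous_map euclidean (mtop M) (\<lambda>s :: real. act (torus_exp (s *\<^sub>R \<xi>)) p)" (is "continuous_map _ _ ?g")
proof -
  obtain c where c: "c \<in> M" "p \<in> fst c" using p by (auto simp: carrier_of_def)
  have inv: "inv_into (fst c) (snd c) (snd c p) = p" using M.inj[OF c(1)] c(2) by simp
  have exp: "torus_exp (s *\<^sub>R \<xi>) \<in> torus UNIV" for s by (rule torus_exp_in_torus) simp
  have open_pre: "open {s. ?g s \<in> fst c' \<and> snd c' (?g s) \<in> S}" if c': "c' \<in> M" and S: "open S" for c' S
  proof -
    let ?D = "{(\<eta>, x). x \<in> snd c ` fst c \<and> act (torus_exp \<eta>) (inv_into (fst c) (snd c) x) \<in> fst c'}"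
    let ?f = "\<lambda>(\<eta>, x). snd c' (act (torus_exp \<eta>) (inv_into (fst c) (snd c) x))"
    note D = M.smooth_torus_actionD[OF M_action c(1) c']
    have "open (?f -` S \<inter> ?D)"
      using continuous_on_open_vimage[OF D(1)] smooth_on_imp_continuous_on[OF D(2)] S by blast
    then have "open ((\<lambda>s. (s *\<^sub>R \<xi>, snd c p)) -` (?f -` S \<inter> ?D))"
      by (rule open_vimage) (intro continuous_intros)
    moreover have "(\<lambda>s. (s *\<^sub>R \<xi>, snd c p)) -` (?f -` S \<inter> ?D) = {s. ?g s \<in> fst c' \<and> snd c' (?g s) \<in> S}"
      using c(2) by (auto simp: inv)
    ultimately show ?thesis by simp
  qed
  show ?thesis unfolding mtop_def[of M]
  proof (rule continuous_on_generated_topo)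
    fix U assume "U \<in> {{p \<in> V. \<psi> p \<in> S} |V \<psi> S. (V, \<psi>) \<in> M \<and> open S}"
    then obtain V \<psi> S where U: "U = {p \<in> V. \<psi> p \<in> S}" "(V, \<psi>) \<in> M" "open S" by auto
    have "?g -` U \<inter> topspace euclidean = {s. ?g s \<in> fst (V, \<psi>) \<and> snd (V, \<psi>) (?g s) \<in> S}" unfolding U(1) by auto
    then show "openin euclidean (?g -` U \<inter> topspace euclidean)" using open_pre[OF U(2,3)] by simp
  next
    have "\<Union>{{p \<in> V. \<psi> p \<in> S} |V \<psi> S. (V, \<psi>) \<in> M \<and> open S} = carrier_of M"
      using topspace_mtop[of M] unfolding mtop_def[of M] topology_generated_by_topspace .
    then show "?g ` topspace euclidean \<subseteq> \<Union>{{p \<in> V. \<psi> p \<in> S} |V \<psi> S. (V, \<psi>) \<in> M \<and> open S}"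
      using act_carrier[OF exp p] by auto
  qed
qed

text \<open>The curve \<open>torus_exp (s \<xi>)\<close> applied to p joins p to its translate. It
  is continuous and cannot enter the invariant set Z, so it stays in the component.\<close>

lemma act_X:
  assumes t: "t \<in> torus UNIV" and p: "p \<in> X"
  shows "act t p \<in> X"
proof -
  obtain \<xi> where \<xi>: "torus_exp \<xi> = t" by (rule torus_exp_surj[OF t]) (rule that)
  let ?g = "\<lambda>s :: real. act (torus_exp (s *\<^sub>R \<xi>)) p"
  have pM: "p \<in> carrier_of M" "p \<notin> Z" using p X_sub by auto
  have exp: "torus_exp (s *\<^sub>R \<xi>) \<in> torus UNIV" for s by (rule torus_exp_in_torus) simp
  have "connectedin (mtop M) (?g ` UNIV)"
    by (rule connectedin_continuous_map_image[OF continuous_orbit[OF pM(1)]]) simp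
  moreover have "?g ` UNIV \<subseteq> carrier_of M - Z" using act_carrier[OF exp pM(1)] act_not_Z[OF exp pM] by auto
  moreover have "?g 0 = p" using act_one[OF pM(1)] by simp
  then have "p \<in> ?g ` UNIV" by (rule range_eqI[OF sym])
  then have "?g ` UNIV \<inter> X \<noteq> {}" using p by blast
  ultimately have "?g ` UNIV \<subseteq> X" by (rule X_maximal)
  moreover have "?g 1 = act t p" using \<xi> by simp
  ultimately show ?thesis by (metis rangeI subsetD)
qed

lemma act_W:
  assumes "Z' \<in> C" "t \<in> torus UNIV" "p \<in> W Z'"
  shows "act t p \<in> W Z'" "hh Z' (act t p) = hh Z' p"
    "xx Z' (act t p) = fiber_act (L Z') (torus_fiber_part k (splitting (L Z') t)) (xx Z' p)"
  using collar.emb_act[OF collar[OF assms(1)] assms(2,3)] by simp_all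

lemma act_P:
  assumes t: "t \<in> torus UNIV" and p: "p \<in> P"
  shows "act t p \<in> P"
proof (cases "p \<in> X")
  case True then show ?thesis using act_X[OF t] X_P by simp
next
  case False
  then obtain Z' where Z': "Z' \<in> C" "p \<in> Z'" using p by (auto simp: P_def)
  then have W: "p \<in> W Z'" using C_W by auto
  show ?thesis using P_side[OF Z'(1) W] P_side[OF Z'(1) act_W(1)[OF Z'(1) t W]] act_W(2)[OF Z'(1) t W] p by simp
qed

text \<open>The action changes the fiber point independently of the angle and preserves h, so it
  respects the collapsing relation.\<close>

lemma \<pi>_act_cong:
  assumes t: "t \<in> torus UNIV" and p: "p \<in> P" and q: "q \<in> P" and eq: "\<pi> p = \<pi> q"
  shows "\<pi> (act t p) = \<pi> (act t q)"
proof (cases "p = q")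
  case False
  then obtain Z' where Z': "Z' \<in> C" "p \<in> Z'" "q \<in> Z'" "xx Z' p = xx Z' q"
    using eq \<pi>_eq_iff[OF p q] by blast
  have W: "p \<in> W Z'" "q \<in> W Z'" using Z' C_W by auto
  note cl = collar[OF Z'(1)]
  have "act t p \<in> Z'" "act t q \<in> Z'"
    using collar.Z'_iff[OF cl W(1)] collar.Z'_iff[OF cl W(2)] Z'(2,3)
      collar.Z'_iff[OF cl act_W(1)[OF Z'(1) t W(1)]] collar.Z'_iff[OF cl act_W(1)[OF Z'(1) t W(2)]]
      act_W(2)[OF Z'(1) t W(1)] act_W(2)[OF Z'(1) t W(2)] by simp_all
  moreover have "xx Z' (act t p) = xx Z' (act t q)"
    unfolding act_W(3)[OF Z'(1) t W(1)] act_W(3)[OF Z'(1) t W(2)] Z'(4) ..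
  ultimately show ?thesis using \<pi>_eq_iff[OF act_P[OF t p] act_P[OF t q]] Z'(1) by blast
qed simp

text \<open>\<open>induced_action\<close> is the image of a class as a set. This image is all of the
  class of \<open>act t p\<close> because the inverse of t also respects classes.\<close>

lemma induced_\<pi>:
  assumes t: "t \<in> torus UNIV" and p: "p \<in> P"
  shows "induced_action act t (\<pi> p) = \<pi> (act t p)"
  unfolding induced_action_def
proof
  show "act t ` \<pi> p \<subseteq> \<pi> (act t p)"
  proof
    fix y assume "y \<in> act t ` \<pi> p"
    then obtain q where q: "y = act t q" "q \<in> P" "\<pi> q = \<pi> p" using mem_\<pi>[OF p] by auto
    show "y \<in> \<pi> (act t p)"
      unfolding mem_\<pi>[OF act_P[OF t p]] q(1) using act_P[OF t q(2)] \<pi>_act_cong[OF t q(2) p q(3)] by simp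
  qed
  show "\<pi> (act t p) \<subseteq> act t ` \<pi> p"
  proof
    fix q assume "q \<in> \<pi> (act t p)"
    then have q: "q \<in> P" "\<pi> q = \<pi> (act t p)" using mem_\<pi>[OF act_P[OF t p]] by auto
    obtain s where s: "s \<in> torus UNIV" "\<And>p. p \<in> carrier_of M \<Longrightarrow> act s (act t p) = p"
        "\<And>p. p \<in> carrier_of M \<Longrightarrow> act t (act s p) = p"
      by (rule act_undo[OF t]) (rule that)
    have pM: "p \<in> carrier_of M" "q \<in> carrier_of M" using p q(1) P_sub by auto
    have "\<pi> (act s q) = \<pi> p" using \<pi>_act_cong[OF s(1) q(1) act_P[OF t p] q(2)] s(2)[OF pM(1)] by simp
    then have "act s q \<in> \<pi> p" unfolding mem_\<pi>[OF p] using act_P[OF s(1) q(1)] by simp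
    then show "q \<in> act t ` \<pi> p" using s(3)[OF pM(2)] by force
  qed
qed

lemma inv_oc:
  assumes "c \<in> M" "p \<in> fst c" "p \<in> X"
  shows "inv_into (fst (oc c)) (snd (oc c)) (snd c p) = \<pi> p"
  using local_expr_oc[OF assms, of "\<lambda>q. q"] by (simp add: local_expr_apply)

lemma inv_cc:
  assumes "Z' \<in> C" "d \<in> FF Z'" "p \<in> P" "p \<in> W Z'" "xx Z' p \<in> fst d"
  shows "inv_into (fst (cc Z' d)) (snd (cc Z' d)) (capc Z' d p) = \<pi> p"
  using local_expr_cc[OF assms, of "\<lambda>q. q"] by (simp add: local_expr_apply)

lemma induced_smooth_X:
  assumes p: "p \<in> X"
  shows "\<exists>c\<in>A. \<exists>c'\<in>A. \<pi> p \<in> fst c \<and> (\<exists>S. open S \<and> (\<xi>, snd c (\<pi> p)) \<in> S \<and>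
      (\<forall>\<eta> x. (\<eta>, x) \<in> S \<longrightarrow> x \<in> snd c ` fst c \<and> induced_action act (torus_exp \<eta>) (inv_into (fst c) (snd c) x) \<in> fst c') \<and>
      smooth_on S (\<lambda>(\<eta>, x). snd c' (induced_action act (torus_exp \<eta>) (inv_into (fst c) (snd c) x))))"
proof -
  have exp: "torus_exp \<eta> \<in> torus UNIV" for \<eta> by (rule torus_exp_in_torus) simp
  have pM: "p \<in> carrier_of M" "act (torus_exp \<xi>) p \<in> carrier_of M" using p X_sub act_carrier[OF exp] by auto
  obtain c where c: "c \<in> M" "p \<in> fst c" using pM(1) by (auto simp: carrier_of_def)
  obtain c' where c': "c' \<in> M" "act (torus_exp \<xi>) p \<in> fst c'" using pM(2) by (auto simp: carrier_of_def)
  have inv: "inv_into (fst c) (snd c) (snd c q) = q" if "q \<in> fst c" for q using M.inj[OF c(1)] that by simp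
  let ?D = "{(\<eta>, x). x \<in> snd c ` fst c \<and> act (torus_exp \<eta>) (inv_into (fst c) (snd c) x) \<in> fst c'}"
  let ?S = "?D \<inter> UNIV \<times> snd c ` (X \<inter> fst c)"
  note D = M.smooth_torus_actionD[OF M_action c(1) c'(1)]
  have S: "open ?S" by (intro open_Int D(1) open_Times open_UNIV M.open_image[OF c(1) X_open])
  have S_at: "\<exists>q. q \<in> X \<and> q \<in> fst c \<and> x = snd c q \<and> act (torus_exp \<eta>) q \<in> fst c' \<and>
      induced_action act (torus_exp \<eta>) (inv_into (fst (oc c)) (snd (oc c)) x) = \<pi> (act (torus_exp \<eta>) q)"
    if "(\<eta>, x) \<in> ?S" for \<eta> x
  proof -
    obtain q where q: "q \<in> X" "q \<in> fst c" "x = snd c q" using \<open>(\<eta>, x) \<in> ?S\<close> by auto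
    have "act (torus_exp \<eta>) q \<in> fst c'" using \<open>(\<eta>, x) \<in> ?S\<close> inv[OF q(2)] q(3) by simp
    then show ?thesis using q inv_oc[OF c(1) q(2,1)] induced_\<pi>[OF exp X_P[OF q(1)]] by (intro exI[of _ q]) simp
  qed
  show ?thesis
  proof (rule bexI[OF bexI[OF _ oc_A[OF c'(1)]] oc_A[OF c(1)]], intro conjI exI[of _ ?S] S allI impI)
    show "\<pi> p \<in> fst (oc c)" using oc_mem[OF X_P[OF p], of c] p c(2) by simp
    show "(\<xi>, snd (oc c) (\<pi> p)) \<in> ?S" using p c(2) c'(2) inv[OF c(2)] by (auto simp: oc_apply)
    show "x \<in> snd (oc c) ` fst (oc c)" if z: "(\<eta>, x) \<in> ?S" for \<eta> x
    proof -
      obtain q where "q \<in> X" "q \<in> fst c" "x = snd c q" using S_at[OF z] by auto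
      then show ?thesis using oc_apply[of q c] by (intro image_eqI[of _ _ "\<pi> q"]) (auto simp: oc_dom)
    qed
    show "induced_action act (torus_exp \<eta>) (inv_into (fst (oc c)) (snd (oc c)) x) \<in> fst (oc c')" if z: "(\<eta>, x) \<in> ?S" for \<eta> x
    proof -
      obtain q where q: "q \<in> X" "act (torus_exp \<eta>) q \<in> fst c'"
        "induced_action act (torus_exp \<eta>) (inv_into (fst (oc c)) (snd (oc c)) x) = \<pi> (act (torus_exp \<eta>) q)"
        using S_at[OF z] by auto
      show ?thesis unfolding q(3) using oc_mem[OF X_P[OF act_X[OF exp q(1)]], of \<eta> c'] act_X[OF exp q(1)] q(2) by simp
    qed
    have "smooth_on ?S (\<lambda>(\<eta>, x). snd c' (act (torus_exp \<eta>) (inv_into (fst c) (snd c) x)))"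
      by (rule smooth_on_subset[OF D(2)]) simp
    then show "smooth_on ?S (\<lambda>(\<eta>, x). snd (oc c') (induced_action act (torus_exp \<eta>) (inv_into (fst (oc c)) (snd (oc c)) x)))"
    proof (rule smooth_on_cong)
      fix z assume z: "z \<in> ?S"
      then have "(fst z, snd z) \<in> ?S" by simp
      from S_at[OF this] obtain q where q: "q \<in> X" "q \<in> fst c" "snd z = snd c q" 
        "induced_action act (torus_exp (fst z)) (inv_into (fst (oc c)) (snd (oc c)) (snd z)) = \<pi> (act (torus_exp (fst z)) q)"
        by blast
      have "snd (oc c') (\<pi> (act (torus_exp (fst z)) q)) = snd c' (act (torus_exp (fst z)) (inv_into (fst c) (snd c) (snd z)))"
        unfolding oc_apply[OF act_X[OF exp q(1)]] q(3) inv[OF q(2)] ..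
      then show "(case z of (\<eta>, x) \<Rightarrow> snd c' (act (torus_exp \<eta>) (inv_into (fst c) (snd c) x))) =
         (case z of (\<eta>, x) \<Rightarrow> snd (oc c') (induced_action act (torus_exp \<eta>) (inv_into (fst (oc c)) (snd (oc c)) x)))"
        unfolding case_prod_beta q(4) by simp
    qed
  qed
qed

text \<open>Source and target charts are taken over the same component, since the collar is
  invariant; in them the induced action is the expression of \<open>capc_act_smooth\<close>, smooth
  through the pole.\<close>

lemma induced_smooth_collapsed:
  assumes Z': "Z' \<in> C" and p: "p \<in> P" "p \<in> W Z'"
  shows "\<exists>c\<in>A. \<exists>c'\<in>A. \<pi> p \<in> fst c \<and> (\<exists>S. open S \<and> (\<xi>, snd c (\<pi> p)) \<in> S \<and>
      (\<forall>\<eta> x. (\<eta>, x) \<in> S \<longrightarrow> x \<in> snd c ` fst c \<and> induced_action act (torus_exp \<eta>) (inv_into (fst c) (snd c) x) \<in> fst c') \<and>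
      smooth_on S (\<lambda>(\<eta>, x). snd c' (induced_action act (torus_exp \<eta>) (inv_into (fst c) (snd c) x))))"
proof -
  have exp: "torus_exp \<eta> \<in> torus UNIV" for \<eta> by (rule torus_exp_in_torus) simp
  note cl = collar[OF Z']
  have hp: "hh Z' p \<ge> 0" using P_side[OF Z' p(2)] p(1) by simp
  obtain d where d: "d \<in> FF Z'" "xx Z' p \<in> fst d" using collar.emb_mem(1)[OF cl p(2)] by (auto simp: carrier_of_def)
  obtain d' where d': "d' \<in> FF Z'" "xx Z' (act (torus_exp \<xi>) p) \<in> fst d'"
    using collar.emb_mem(1)[OF cl act_W(1)[OF Z' exp p(2)], of \<xi>] by (auto simp: carrier_of_def)
  obtain S g where S: "open S" "(\<xi>, capc Z' d p) \<in> S" "smooth_on S g"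
      "\<And>\<eta> y. (\<eta>, y) \<in> S \<Longrightarrow> y \<in> collar.cap_image k (L Z') d"
    and g: "\<And>\<eta> q. q \<in> W Z' \<Longrightarrow> xx Z' q \<in> fst d \<Longrightarrow> hh Z' q \<ge> 0 \<Longrightarrow> (\<eta>, capc Z' d q) \<in> S \<Longrightarrow>
      xx Z' (act (torus_exp \<eta>) q) \<in> fst d' \<and> capc Z' d' (act (torus_exp \<eta>) q) = g (\<eta>, capc Z' d q)"
    by (rule collar.capc_act_smooth[OF cl d(1) d'(1) p(2) hp d(2) d'(2)]) (rule that; assumption)
  let ?I = "\<lambda>\<eta> x. induced_action act (torus_exp \<eta>) (inv_into (fst (cc Z' d)) (snd (cc Z' d)) x)"
  have S_at: "x \<in> snd (cc Z' d) ` fst (cc Z' d) \<and> ?I \<eta> x \<in> fst (cc Z' d') \<and> snd (cc Z' d') (?I \<eta> x) = g (\<eta>, x)"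
    if x: "(\<eta>, x) \<in> S" for \<eta> x
  proof -
    have "drop_coord k x \<in> snd d ` fst d" "height k x < width (L Z')"
      using S(4)[OF x] by (auto simp: collar.cap_image_def[OF cl])
    then obtain q where q: "q \<in> W Z'" "xx Z' q \<in> fst d" "hh Z' q = height k x" "capc Z' d q = x"
      by (rule collar.cap_surj[OF cl d(1)]) (rule that)
    have hq: "hh Z' q \<ge> 0" using q(3) height_nonneg by simp
    have qP: "q \<in> P" using P_side[OF Z' q(1)] hq by simp
    have I: "?I \<eta> x = \<pi> (act (torus_exp \<eta>) q)"
      using inv_cc[OF Z' d(1) qP q(1,2)] q(4) induced_\<pi>[OF exp qP] by simp
    note aP = act_P[OF exp qP, of \<eta>] and aW = act_W(1)[OF Z' exp q(1), of \<eta>]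
    have gq: "xx Z' (act (torus_exp \<eta>) q) \<in> fst d'" "capc Z' d' (act (torus_exp \<eta>) q) = g (\<eta>, x)"
      using g[OF q(1,2) hq, of \<eta>] x q(4) by simp_all
    have "x = snd (cc Z' d) (\<pi> q)" using cc_apply[OF Z' qP q(1)] q(4) by simp
    moreover have "\<pi> q \<in> fst (cc Z' d)" using cc_mem[OF Z' qP] q by simp
    ultimately show ?thesis unfolding I using cc_mem[OF Z' aP] cc_apply[OF Z' aP aW] aW gq by simp
  qed
  show ?thesis
  proof (rule bexI[OF bexI[OF _ cc_A[OF Z' d'(1)]] cc_A[OF Z' d(1)]], intro conjI exI[of _ S] S(1) allI impI)
    show "\<pi> p \<in> fst (cc Z' d)" using cc_mem[OF Z' p(1)] p(2) d(2) by simp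
    show "(\<xi>, snd (cc Z' d) (\<pi> p)) \<in> S" using S(2) cc_apply[OF Z' p] by simp
    show "x \<in> snd (cc Z' d) ` fst (cc Z' d)" "?I \<eta> x \<in> fst (cc Z' d')" if "(\<eta>, x) \<in> S" for \<eta> x
      using S_at[OF that] by simp_all
    show "smooth_on S (\<lambda>(\<eta>, x). snd (cc Z' d') (?I \<eta> x))"
    proof (rule smooth_on_cong[OF S(3)])
      fix z assume "z \<in> S"
      then have "(fst z, snd z) \<in> S" by simp
      then show "g z = (case z of (\<eta>, x) \<Rightarrow> snd (cc Z' d') (?I \<eta> x))" using S_at[of "fst z" "snd z"] by (simp add: case_prod_beta)
    qed
  qed
qed

lemma induced_smooth: "smooth_torus_action UNIV A (induced_action act)"
proof (rule A.smooth_torus_actionI)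
  fix t q assume t: "t \<in> torus (UNIV :: 'n set)" and "q \<in> carrier_of A"
  then obtain p where p: "q = \<pi> p" "p \<in> P" unfolding carrier_A by auto
  show "induced_action act t q \<in> carrier_of A"
    unfolding carrier_A p(1) induced_\<pi>[OF t p(2)] using act_P[OF t p(2)] by simp
next
  fix q assume "q \<in> carrier_of A"
  then obtain p where p: "q = \<pi> p" "p \<in> P" unfolding carrier_A by auto
  then show "induced_action act 1 q = q" using induced_\<pi>[OF one_in_torus p(2)] act_one[of p] P_sub by auto
next
  fix s t q assume s: "s \<in> torus (UNIV :: 'n set)" and t: "t \<in> torus (UNIV :: 'n set)" and "q \<in> carrier_of A"
  then obtain p where p: "q = \<pi> p" "p \<in> P" unfolding carrier_A by auto
  have "p \<in> carrier_of M" using p(2) P_sub by auto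
  then show "induced_action act (s * t) q = induced_action act s (induced_action act t q)"
    unfolding p(1) induced_\<pi>[OF torus_mult_closed[OF s t] p(2)] induced_\<pi>[OF t p(2)] induced_\<pi>[OF s act_P[OF t p(2)]]
    using act_mult[OF s t] by simp
next
  fix q \<xi> assume "q \<in> carrier_of A"
  then obtain p where p: "q = \<pi> p" "p \<in> P" unfolding carrier_A by auto
  show "\<exists>c\<in>A. \<exists>c'\<in>A. q \<in> fst c \<and> (\<exists>S. open S \<and> (\<xi>, snd c q) \<in> S \<and>
      (\<forall>\<eta> x. (\<eta>, x) \<in> S \<longrightarrow> x \<in> snd c ` fst c \<and> induced_action act (torus_exp \<eta>) (inv_into (fst c) (snd c) x) \<in> fst c') \<and>
      smooth_on S (\<lambda>(\<eta>, x). snd c' (induced_action act (torus_exp \<eta>) (inv_into (fst c) (snd c) x))))"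
  proof (cases "p \<in> X")
    case True then show ?thesis unfolding p(1) by (rule induced_smooth_X)
  next
    case False
    then obtain Z' where Z': "Z' \<in> C" "p \<in> Z'" using p(2) by (auto simp: P_def)
    have "p \<in> W Z'" using C_W[OF Z'(1)] Z'(2) by auto
    then show ?thesis unfolding p(1) by (rule induced_smooth_collapsed[OF Z'(1) p(2)])
  qed
qed

lemma induced_field_oc:
  assumes p: "p \<in> X"
  shows "fundamental_field (induced_action act) (oc c) \<xi> (\<pi> p) = fundamental_field act c \<xi> p"
proof -
  have "snd (oc c) (induced_action act (torus_exp \<eta>) (\<pi> p)) = snd c (act (torus_exp \<eta>) p)" for \<eta>
  proof -
    have exp: "torus_exp \<eta> \<in> torus UNIV" by (rule torus_exp_in_torus) simp
    show ?thesis unfolding induced_\<pi>[OF exp X_P[OF p]] oc_apply[OF act_X[OF exp p]] ..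
  qed
  then show ?thesis unfolding fundamental_field_def by simp
qed

lemma induced_field_cc:
  assumes Z': "Z' \<in> C" "d \<in> FF Z'" and p: "p \<in> P" "p \<in> W Z'" "xx Z' p \<in> fst d"
  shows "fundamental_field (induced_action act) (cc Z' d) \<xi> (\<pi> p) = collar.cap_field k (L Z') d \<xi> p"
proof -
  have "snd (cc Z' d) (induced_action act (torus_exp \<eta>) (\<pi> p)) = capc Z' d (act (torus_exp \<eta>) p)" for \<eta>
  proof -
    have exp: "torus_exp \<eta> \<in> torus UNIV" by (rule torus_exp_in_torus) simp
    show ?thesis unfolding induced_\<pi>[OF exp p(1)] cc_apply[OF Z'(1) act_P[OF exp p(1)] act_W(1)[OF Z'(1) exp p(2)]] ..
  qed
  then show ?thesis
    unfolding fundamental_field_def using collar.capc_curve[OF collar[OF Z'(1)] Z'(2) p(2,3)] by simp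
qed

end


section \<open>The moment maps\<close>

lemma connectedin_locally_constant:
  assumes Q: "connectedin T Q" and loc: "\<And>p. p \<in> Q \<Longrightarrow> \<exists>N. openin T N \<and> p \<in> N \<and> (\<forall>q\<in>N. g q = g p)"
    and pq: "p \<in> Q" "q \<in> Q"
  shows "g p = g q"
proof (rule ccontr)
  assume ne: "g p \<noteq> g q"
  let ?U = "\<Union>{N. openin T N \<and> (\<forall>x\<in>N. g x = g p)}" and ?V = "\<Union>{N. openin T N \<and> (\<forall>x\<in>N. g x \<noteq> g p)}"
  have open_UV: "openin T ?U" "openin T ?V" by (rule openin_Union, drule CollectD, erule conjunct1)+
  have cover: "x \<in> ?U \<union> ?V" if x: "x \<in> Q" for x
  proof -
    obtain N where N: "openin T N" "x \<in> N" "\<forall>y\<in>N. g y = g x" using loc[OF x] by auto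
    show ?thesis
    proof (cases "g x = g p")
      case True
      have "\<forall>y\<in>N. g y = g p" by (intro ballI trans[OF bspec[OF N(3)] True])
      then have "x \<in> ?U" using N(1,2) by blast
      then show ?thesis by (rule UnI1)
    next
      case False
      have "\<forall>y\<in>N. g y \<noteq> g p"
      proof
        fix y assume "y \<in> N"
        then have "g y = g x" by (rule bspec[OF N(3)])
        then show "g y \<noteq> g p" using False by simp
      qed
      then have "x \<in> ?V" using N(1,2) by blast
      then show ?thesis by (rule UnI2)
    qed
  qed
  have "p \<notin> ?V" by blast
  then have "p \<in> ?U" using cover[OF pq(1)] by blast
  have "q \<notin> ?U" using ne by force
  then have "q \<in> ?V" using cover[OF pq(2)] by blast
  with \<open>p \<in> ?U\<close> have "?U \<inter> Q \<noteq> {}" "?V \<inter> Q \<noteq> {}" using pq by blast+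
  moreover have "?U \<inter> ?V \<inter> Q = {}" by blast
  moreover have "Q \<subseteq> ?U \<union> ?V" using cover by (rule subsetI)
  ultimately have "\<exists>E1 E2. openin T E1 \<and> openin T E2 \<and> Q \<subseteq> E1 \<union> E2 \<and> E1 \<inter> E2 \<inter> Q = {} \<and> E1 \<inter> Q \<noteq> {} \<and> E2 \<inter> Q \<noteq> {}"
    by (intro exI[of _ ?U] exI[of _ ?V] conjI open_UV)
  then show False using Q unfolding connectedin by simp
qed

context collapse
begin

text \<open>Off Z the defining function does not vanish, so the logarithmic term of a b-function is
  smooth there.\<close>

lemma b_function_smooth:
  assumes \<mu>: "b_function M Z \<mu>" and c: "c \<in> M" "p \<in> fst c" "p \<in> X"
  obtains S where "open S" "snd c p \<in> S" "S \<subseteq> snd c ` (X \<inter> fst c)" "smooth_on S (local_expr c \<mu>)"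
proof -
  have "\<exists>D a y f. open D \<and> snd c p \<in> D \<and> D \<subseteq> snd c ` fst c \<and> defining_function D (snd c ` (fst c \<inter> Z)) y \<and>
      smooth_on D f \<and> (\<forall>x'\<in>D - snd c ` (fst c \<inter> Z). local_expr c \<mu> x' = a * ln \<bar>y x'\<bar> + f x')"
    using \<mu>[unfolded b_function_def case_prod_beta prod.collapse, THEN bspec, OF c(1)] c(2) by blast
  then obtain D a y f where D: "open D" "snd c p \<in> D" and y: "defining_function D (snd c ` (fst c \<inter> Z)) y"
    and f: "smooth_on D f" and eq: "\<And>x'. x' \<in> D - snd c ` (fst c \<inter> Z) \<Longrightarrow> local_expr c \<mu> x' = a * ln \<bar>y x'\<bar> + f x'" by blast
  let ?S = "D \<inter> snd c ` (X \<inter> fst c)"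
  have off: "x \<in> D - snd c ` (fst c \<inter> Z)" if x: "x \<in> ?S" for x
  proof -
    obtain q where q: "x = snd c q" "q \<in> X" "q \<in> fst c" using x by auto
    have "q \<notin> Z" using q(2) X_sub by auto
    then have "x \<notin> snd c ` (fst c \<inter> Z)" unfolding q(1) using M.inj[OF c(1)] q(3) by (auto simp: inj_on_def)
    then show ?thesis using x by simp
  qed
  have y0: "y x \<noteq> 0" if "x \<in> ?S" for x
    using off[OF that] y unfolding defining_function_def by blast
  have ys: "smooth_on ?S y" using y unfolding defining_function_def by (auto intro: smooth_on_subset)
  \<comment> \<open>c ln |y| is rewritten as (c/2) ln (y^2), which avoids the absolute value; the
    constant is called \<open>a\<close> here.\<close>
  have "smooth_on ?S (\<lambda>x. (a / 2) * ln (y x * y x) + f x)"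
    by (intro smooth_on_add smooth_on_mult[OF smooth_on_const] smooth_on_ln smooth_on_mult ys smooth_on_subset[OF f] Int_lower1)
      (use y0 in \<open>simp add: zero_less_mult_iff linorder_neq_iff, blast\<close>)
  then have "smooth_on ?S (local_expr c \<mu>)"
  proof (rule smooth_on_cong)
    fix x assume x: "x \<in> ?S"
    have "ln (y x * y x) = 2 * ln \<bar>y x\<bar>"
      unfolding abs_mult_self_eq[of "y x", symmetric] using y0[OF x] by (subst ln_mult) simp_all
    then show "(a / 2) * ln (y x * y x) + f x = local_expr c \<mu> x" using eq[OF off[OF x]] by simp
  qed
  moreover have "open ?S" by (intro open_Int D(1) M.open_image[OF c(1) X_open])
  ultimately show ?thesis using that D(2) c(2,3) by blast
qed

text \<open>Both terms of the difference have the differential \<open>\<iota>\<^sub>\<xi> \<omega>\<close>.\<close>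

lemma moment_locally_constant:
  assumes \<mu>: "b_function M Z \<mu>"
      "\<And>c p u. c \<in> M \<Longrightarrow> p \<in> fst c \<Longrightarrow> p \<notin> Z \<Longrightarrow> \<omega> c (snd c p) (fundamental_field act c \<xi> p) u = differential c \<mu> p u"
    and Z': "Z' \<in> C" and p: "p \<in> W Z'" "hh Z' p > 0"
  shows "\<exists>N. openin (mtop M) N \<and> p \<in> N \<and>
    (\<forall>q\<in>N. \<mu> q - collar.cap_moment k (L Z') ln \<xi> q = \<mu> p - collar.cap_moment k (L Z') ln \<xi> p)"
proof -
  note cl = collar[OF Z']
  let ?m = "collar.cap_moment k (L Z') ln \<xi>"
  have pX: "p \<in> X" using X_side[OF Z' p(1)] p(2) by simp
  obtain c where c: "c \<in> M" "p \<in> fst c" using pX X_sub by (auto simp: carrier_of_def)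
  obtain d where d: "d \<in> FF Z'" "xx Z' p \<in> fst d" using collar.emb_mem(1)[OF cl p(1)] by (auto simp: carrier_of_def)
  obtain S where S: "open S" "snd c p \<in> S" "S \<subseteq> snd c ` (X \<inter> fst c)" "smooth_on S (local_expr c \<mu>)"
    by (rule b_function_smooth[OF \<mu>(1) c pX]) (rule that)
  obtain S' where S': "open S'" "snd c p \<in> S'" "S' \<subseteq> snd c ` {q \<in> fst c \<inter> W Z'. xx Z' q \<in> fst d \<and> hh Z' q > 0}"
    "smooth_on S' (local_expr c (capc Z' d))"
    by (rule collar.capc_smooth[OF cl c(1) d(1) c(2) p(1) d(2) p(2)]) (rule that)
  obtain e where e: "e > 0" "ball (snd c p) e \<subseteq> S \<inter> S'"
    using openE[OF open_Int[OF S(1) S'(1)] IntI[OF S(2) S'(2)]] by blast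
  let ?B = "ball (snd c p) e"
  let ?f = "\<lambda>x. local_expr c \<mu> x - collar.cap_moment_expr k (L Z') ln \<xi> d (local_expr c (capc Z' d) x)"
  have at: "\<exists>q. q \<in> fst c \<and> q \<in> W Z' \<and> xx Z' q \<in> fst d \<and> hh Z' q > 0 \<and> x = snd c q \<and> ?f x = \<mu> q - ?m q" if x: "x \<in> ?B" for x
  proof -
    obtain q where q: "q \<in> fst c" "q \<in> W Z'" "xx Z' q \<in> fst d" "hh Z' q > 0" "x = snd c q"
      using subsetD[OF e(2) x] S'(3) by auto
    have "?f x = \<mu> q - ?m q"
      unfolding q(5) local_expr_at[OF M.inj[OF c(1)] q(1)]
      using collar.cap_moment_expr_capc[OF cl d(1) q(2,3), of ln \<xi>] q(4) by simp
    then show ?thesis using q by blast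
  qed
  have deriv: "(?f has_derivative (\<lambda>u. 0)) (at x)" if x: "x \<in> ?B" for x
  proof -
    obtain q where q: "q \<in> fst c" "q \<in> W Z'" "xx Z' q \<in> fst d" "hh Z' q > 0" "x = snd c q" using at[OF x] by blast
    have qX: "q \<in> X" "q \<in> P" "q \<notin> Z" using X_side[OF Z' q(2)] q(4) X_P X_sub by auto
    have xS: "x \<in> S" "x \<in> S'" using e(2) x by auto
    let ?T = "local_expr c (capc Z' d)"
    have T: "?T x = capc Z' d q" unfolding q(5) by (rule local_expr_at[OF M.inj[OF c(1)] q(1)])
    have dT: "(?T has_derivative differential c (capc Z' d) q) (at x)"
      using smooth_on_has_derivative[OF S'(4,1) xS(2)] unfolding differential_def q(5) .
    have d\<mu>: "(local_expr c \<mu> has_derivative differential c \<mu> q) (at x)"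
      using smooth_on_has_derivative[OF S(4,1) xS(1)] unfolding differential_def q(5) .
    let ?h = "\<lambda>h :: real. 1 / h"
    \<comment> \<open>Here the given function is compared with the model function for the unmodified
      profile 1/h, whose primitive is ln.\<close>
    have ln: "(ln has_real_derivative ?h (hh Z' q)) (at (hh Z' q) within {0<..})"
      by (rule has_field_derivative_at_within[OF DERIV_ln_divide[OF q(4)]])
    let ?O = "{y. height k y > 0}"
    have O: "open ?O" by (rule open_Collect_less) (auto intro!: continuous_intros smooth_on_imp_continuous_on[OF smooth_on_height])
    have "capc Z' d q \<in> ?O" using collar.height_capc[OF cl d(1) q(2,3)] q(4) by simp
    from collar.cap_moment_derivative[where \<phi> = ?h, OF cl d(1) q(2,3) less_imp_le[OF q(4)] ln O this, of \<xi>]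
    have dm: "(collar.cap_moment_expr k (L Z') ln \<xi> d has_derivative
        collar.capform k (L Z') ?h d (?T x) (collar.cap_field k (L Z') d \<xi> q)) (at (?T x))"
      unfolding T by auto
    \<comment> \<open>Both sides represent the induced field at \<open>\<pi> q\<close>, in a cap
      chart and in an open part chart, so the general transformation rule relates them.\<close>
    have ff: "collar.cap_field k (L Z') d \<xi> q = differential c (capc Z' d) q (fundamental_field act c \<xi> q)"
      unfolding induced_field_cc[OF Z' d(1) qX(2) q(2,3), symmetric] 
        A.fundamental_field_transform[OF induced_smooth oc_A[OF c(1)] cc_A[OF Z' d(1)]
          iffD2[OF oc_mem[OF qX(2)] conjI[OF q(1) qX(1)]] iffD2[OF cc_mem[OF Z' qX(2)] conjI[OF q(2,3)]]]
        induced_field_oc[OF qX(1)] differential_oc_cc[OF c(1) Z' d(1) qX(1) q(1,2,3)] ..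
    have "(?f has_derivative (\<lambda>u. differential c \<mu> q u - collar.capform k (L Z') ?h d (?T x)
        (collar.cap_field k (L Z') d \<xi> q) (differential c (capc Z' d) q u))) (at x)"
      by (intro has_derivative_diff d\<mu> has_derivative_compose[OF dT dm])
    moreover have "differential c \<mu> q u - collar.capform k (L Z') ?h d (?T x)
        (collar.cap_field k (L Z') d \<xi> q) (differential c (capc Z' d) q u) = 0" for u
      unfolding T ff \<mu>(2)[OF c(1) q(1) qX(3), symmetric] collar.form_eq_capform[OF cl c(1) d(1) q(1,2,3,4)] by simp
    ultimately show ?thesis by simp
  qed
  have "\<exists>a. \<forall>x\<in>?B. ?f x = a"
    by (rule has_derivative_zero_constant[OF convex_ball]) (rule has_derivative_at_withinI[OF deriv])
  then obtain a where a: "\<And>x. x \<in> ?B \<Longrightarrow> ?f x = a" by blast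
  let ?N = "{q \<in> fst c. snd c q \<in> ?B}"
  have val: "\<mu> q - ?m q = a" if q: "q \<in> ?N" for q
  proof -
    have qB: "snd c q \<in> ?B" "q \<in> fst c" using q by auto
    obtain q' where q': "q' \<in> fst c" "snd c q = snd c q'" "?f (snd c q) = \<mu> q' - ?m q'" using at[OF qB(1)] by blast
    have "q' = q" using M.inj[OF c(1)] q'(1,2) qB(2) by (auto simp: inj_on_def)
    then show ?thesis using q'(3) a[OF qB(1)] by simp
  qed
  have "p \<in> ?N" using c(2) e(1) by simp
  then show ?thesis
    by (intro exI[of _ ?N] conjI ballI openin_mtop_basic[OF c(1) open_ball]) (simp_all only: val)
qed

text \<open>The difference is locally constant and the positive side of the collar is connected, so
  a single constant \<kappa> serves the whole collar.\<close>

lemma moment_on_collar: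
  assumes \<mu>: "b_function M Z \<mu>"
      "\<And>c p u. c \<in> M \<Longrightarrow> p \<in> fst c \<Longrightarrow> p \<notin> Z \<Longrightarrow> \<omega> c (snd c p) (fundamental_field act c \<xi> p) u = differential c \<mu> p u"
    and Z': "Z' \<in> C"
  obtains \<kappa> where "\<And>p. p \<in> W Z' \<Longrightarrow> hh Z' p > 0 \<Longrightarrow> \<mu> p = collar.cap_moment k (L Z') ln \<xi> p + \<kappa>"
proof -
  let ?m = "collar.cap_moment k (L Z') ln \<xi>" and ?Q = "{p \<in> W Z'. hh Z' p > 0}"
  have const: "\<mu> p - ?m p = \<mu> q - ?m q" if "p \<in> ?Q" "q \<in> ?Q" for p q
    by (rule connectedin_locally_constant[OF collar.connected_positive[OF collar[OF Z']] _ that])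
      (rule moment_locally_constant[OF \<mu> Z'], auto)
  show ?thesis
  proof (cases "?Q = {}")
    case True then show ?thesis using that by blast
  next
    case False
    then obtain q where q: "q \<in> ?Q" by blast
    show ?thesis
    proof (rule that)
      fix p assume "p \<in> W Z'" "hh Z' p > 0"
      then show "\<mu> p = ?m p + (\<mu> q - ?m q)" using const[OF _ q, of p] by simp
    qed
  qed
qed

end

section \<open>Gluing the Hamiltonian functions\<close>

context collapse_profile
begin

text \<open>Replacing ln by \<Phi> in the collar formula, with the same constant, changes nothing
  for r < h < \<delta> and continues the function over the pole. Each component keeps its own
  constant.\<close>

lemma glued_moment:
  assumes \<kappa>: "\<And>Z' p. Z' \<in> C \<Longrightarrow> p \<in> W Z' \<Longrightarrow> hh Z' p > 0 \<Longrightarrow> \<mu> p = collar.cap_moment k (L Z') ln \<xi> p + \<kappa> Z'"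
  obtains \<nu> where "\<And>p. p \<in> core \<Longrightarrow> \<nu> (\<pi> p) = \<mu> p"
    "\<And>Z' p. Z' \<in> C \<Longrightarrow> p \<in> cap Z' \<Longrightarrow> \<nu> (\<pi> p) = collar.cap_moment k (L Z') \<Phi> \<xi> p + \<kappa> Z'"
proof -
  let ?m = "\<lambda>Z' p. collar.cap_moment k (L Z') \<Phi> \<xi> p + \<kappa> Z'"
  \<comment> \<open>A class may lie in the core and in a cap at once, so the admissible values are
    first collected in a relation, whose single-valuedness is then checked on the overlaps.\<close>
  define rel where "rel q v \<longleftrightarrow> (\<exists>p\<in>core. q = \<pi> p \<and> v = \<mu> p) \<or> (\<exists>Z'\<in>C. \<exists>p\<in>cap Z'. q = \<pi> p \<and> v = ?m Z' p)" for q v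
  have core_core: "\<mu> p = \<mu> p'" if "p \<in> core" "p' \<in> core" "\<pi> p = \<pi> p'" for p p'
    using \<pi>_X_eq[OF core_X[OF that(1)] X_P[OF core_X[OF that(2)]]] that(3) by simp
  have core_cap: "\<mu> p = ?m Z' p'" if "p \<in> core" "Z' \<in> C" "p' \<in> cap Z'" "\<pi> p = \<pi> p'" for p p' Z'
  proof -
    have "p' \<in> P" using that(3) by (simp add: cap_def)
    then have pp: "p = p'" using \<pi>_X_eq[OF core_X[OF that(1)]] that(4) by blast
    have h: "r < hh Z' p" "hh Z' p < \<delta>" "p \<in> W Z'" using core_cap_height[OF that(2,1)] that(3) pp by auto
    have "hh Z' p > 0" using h(1) r(1) by simp
    moreover have "\<Phi> (hh Z' p) = ln (hh Z' p)" by (rule \<Phi>_outer) (use h in simp)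
    ultimately show ?thesis using \<kappa>[OF that(2) h(3)] pp by (simp add: collar.cap_moment_def[OF collar[OF that(2)]])
  qed
  have cap_cap: "?m Z' p = ?m Z'' p'" if "Z' \<in> C" "Z'' \<in> C" "p \<in> cap Z'" "p' \<in> cap Z''" "\<pi> p = \<pi> p'" for p p' Z' Z''
  proof -
    have z: "Z'' = Z'" using cap_same[OF that] by simp
    have "p \<in> P" "p' \<in> P" "p \<in> W Z'" using that(3,4) by (simp_all add: cap_def)
    then show ?thesis unfolding z using \<pi>_same_collar(2,3)[OF that(1) _ _ that(5)]
      by (simp add: collar.cap_moment_def[OF collar[OF that(1)]])
  qed
  have unique: "v = v'" if "rel q v" "rel q v'" for q v v'
    using that(1) unfolding rel_def
  proof
    assume "\<exists>p\<in>core. q = \<pi> p \<and> v = \<mu> p"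
    then obtain p where p: "p \<in> core" "q = \<pi> p" "v = \<mu> p" by blast
    show ?thesis using that(2) unfolding rel_def
    proof
      assume "\<exists>p\<in>core. q = \<pi> p \<and> v' = \<mu> p"
      then obtain p' where p': "p' \<in> core" "q = \<pi> p'" "v' = \<mu> p'" by blast
      show ?thesis unfolding p(3) p'(3) by (rule core_core[OF p(1) p'(1)]) (use p(2) p'(2) in simp)
    next
      assume "\<exists>Z'\<in>C. \<exists>p\<in>cap Z'. q = \<pi> p \<and> v' = ?m Z' p"
      then obtain Z' p' where p': "Z' \<in> C" "p' \<in> cap Z'" "q = \<pi> p'" "v' = ?m Z' p'" by blast
      show ?thesis unfolding p(3) p'(4) by (rule core_cap[OF p(1) p'(1,2)]) (use p(2) p'(3) in simp)
    qed
  next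
    assume "\<exists>Z'\<in>C. \<exists>p\<in>cap Z'. q = \<pi> p \<and> v = ?m Z' p"
    then obtain Z' p where p: "Z' \<in> C" "p \<in> cap Z'" "q = \<pi> p" "v = ?m Z' p" by blast
    show ?thesis using that(2) unfolding rel_def
    proof
      assume "\<exists>p\<in>core. q = \<pi> p \<and> v' = \<mu> p"
      then obtain p' where p': "p' \<in> core" "q = \<pi> p'" "v' = \<mu> p'" by blast
      show ?thesis unfolding p(4) p'(3) by (rule core_cap[OF p'(1) p(1,2), symmetric]) (use p(3) p'(2) in simp)
    next
      assume "\<exists>Z'\<in>C. \<exists>p\<in>cap Z'. q = \<pi> p \<and> v' = ?m Z' p"
      then obtain Z'' p' where p': "Z'' \<in> C" "p' \<in> cap Z''" "q = \<pi> p'" "v' = ?m Z'' p'" by blast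
      show ?thesis unfolding p(4) p'(4) by (rule cap_cap[OF p(1) p'(1) p(2) p'(2)]) (use p(3) p'(3) in simp)
    qed
  qed
  have the: "(THE v. rel q v) = v" if "rel q v" for q v
    by (rule the_equality[of "rel q" v, OF that]) (rule unique[OF _ that])
  show ?thesis
  proof (rule that[of "\<lambda>q. THE v. rel q v"])
    show "(THE v. rel (\<pi> p) v) = \<mu> p" if "p \<in> core" for p
      by (rule the) (use that in \<open>auto simp: rel_def\<close>)
    show "(THE v. rel (\<pi> p) v) = ?m Z' p" if "Z' \<in> C" "p \<in> cap Z'" for Z' p
      by (rule the) (use that in \<open>auto simp: rel_def\<close>)
  qed
qed

end


section \<open>The moment map equation for the glued form\<close>

context collapse_profile
begin

lemma moment_map_core:
  assumes form: "\<And>c p u v. c \<in> M \<Longrightarrow> p \<in> fst c \<Longrightarrow> p \<in> core \<Longrightarrow> \<omega>' (oc c) (snd c p) u v = \<omega> c (snd c p) u v"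
    and \<mu>: "b_function M Z \<mu>"
      "\<And>c p u. c \<in> M \<Longrightarrow> p \<in> fst c \<Longrightarrow> p \<notin> Z \<Longrightarrow> \<omega> c (snd c p) (fundamental_field act c \<xi> p) u = differential c \<mu> p u"
    and \<nu>: "\<And>p. p \<in> core \<Longrightarrow> \<nu> (\<pi> p) = \<mu> p"
    and p: "p \<in> core"
  shows "\<exists>e\<in>A. \<pi> p \<in> fst e \<and> (\<exists>S. open S \<and> snd e (\<pi> p) \<in> S \<and> smooth_on S (local_expr e \<nu>)) \<and>
    (\<forall>u. \<omega>' e (snd e (\<pi> p)) (fundamental_field (induced_action act) e \<xi> (\<pi> p)) u = differential e \<nu> (\<pi> p) u)"
proof -
  have pX: "p \<in> X" "p \<notin> Z" using core_X[OF p] X_sub by auto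
  obtain c where c: "c \<in> M" "p \<in> fst c" using pX X_sub by (auto simp: carrier_of_def)
  obtain S where S: "open S" "snd c p \<in> S" "S \<subseteq> snd c ` (X \<inter> fst c)" "smooth_on S (local_expr c \<mu>)"
    by (rule b_function_smooth[OF \<mu>(1) c pX(1)]) (rule that)
  let ?S = "S \<inter> snd c ` (core \<inter> fst c)"
  have S': "open ?S" "snd c p \<in> ?S" using S(2) p c(2) by (auto intro: open_Int[OF S(1) M.open_image[OF c(1) core_open]])
  have eq: "local_expr c \<mu> x = local_expr (oc c) \<nu> x" if x: "x \<in> ?S" for x
  proof -
    obtain q where q: "x = snd c q" "q \<in> core" "q \<in> fst c" using x by auto
    show ?thesis unfolding q(1) local_expr_oc[OF c(1) q(3) core_X[OF q(2)]] \<nu>[OF q(2)]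
      by (rule local_expr_at[OF M.inj[OF c(1)] q(3)])
  qed
  have sm: "smooth_on ?S (local_expr (oc c) \<nu>)"
    by (rule smooth_on_cong[OF smooth_on_subset[OF S(4) Int_lower1] eq])
  have d: "differential (oc c) \<nu> (\<pi> p) u = differential c \<mu> p u" for u
    unfolding differential_def oc_apply[OF pX(1)] by (rule dir_deriv_cong[OF S' eq[symmetric]])
  show ?thesis
  proof (intro bexI[OF _ oc_A[OF c(1)]] conjI exI[of _ ?S] S'(1) sm allI)
    show "\<pi> p \<in> fst (oc c)" using oc_mem[OF X_P[OF pX(1)], of c] c(2) pX(1) by simp
    show "snd (oc c) (\<pi> p) \<in> ?S" unfolding oc_apply[OF pX(1)] by (rule S'(2))
    show "\<omega>' (oc c) (snd (oc c) (\<pi> p)) (fundamental_field (induced_action act) (oc c) \<xi> (\<pi> p)) u = differential (oc c) \<nu> (\<pi> p) u" for u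
      unfolding d oc_apply[OF pX(1)] form[OF c p] induced_field_oc[OF pX(1)] by (rule \<mu>(2)[OF c pX(2)])
  qed
qed

text \<open>In the cap chart the function is \<open>cap_moment_expr\<close> up to a constant, so
  smoothness and the differential extend to the pole without a limiting argument.\<close>

lemma moment_map_cap:
  assumes form: "\<And>Z' d p u v. Z' \<in> C \<Longrightarrow> d \<in> FF Z' \<Longrightarrow> p \<in> cap Z' \<Longrightarrow> xx Z' p \<in> fst d \<Longrightarrow>
      \<omega>' (cc Z' d) (capc Z' d p) u v = collar.capform k (L Z') \<phi> d (capc Z' d p) u v"
    and \<nu>: "\<And>p. p \<in> cap Z' \<Longrightarrow> \<nu> (\<pi> p) = collar.cap_moment k (L Z') \<Phi> \<xi> p + \<kappa>"
    and Z': "Z' \<in> C" and p: "p \<in> cap Z'"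
  shows "\<exists>e\<in>A. \<pi> p \<in> fst e \<and> (\<exists>S. open S \<and> snd e (\<pi> p) \<in> S \<and> smooth_on S (local_expr e \<nu>)) \<and>
    (\<forall>u. \<omega>' e (snd e (\<pi> p)) (fundamental_field (induced_action act) e \<xi> (\<pi> p)) u = differential e \<nu> (\<pi> p) u)"
proof -
  note cl = collar[OF Z']
  have pP: "p \<in> W Z'" "p \<in> P" "hh Z' p < \<delta>" using p by (simp_all add: cap_def)
  have hp: "hh Z' p \<ge> 0" using P_side[OF Z' pP(1)] pP(2) by simp
  obtain d where d: "d \<in> FF Z'" "xx Z' p \<in> fst d" using collar.emb_mem(1)[OF cl pP(1)] by (auto simp: carrier_of_def)
  let ?S = "collar.cap_region k \<delta> d" and ?m = "collar.cap_moment_expr k (L Z') \<Phi> \<xi> d"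
  have S: "open ?S" by (rule collar.open_cap_region'[OF cl d(1)])
  have pS: "capc Z' d p \<in> ?S"
    using collar.capc_parts(1)[OF cl d] d(2) collar.height_capc[OF cl d(1) pP(1) d(2) hp] pP(3)
    by (simp add: collar.cap_region_def[OF cl])
  have hS: "height k ` ?S \<subseteq> {0..\<delta>}" using height_nonneg by (auto simp: collar.cap_region_def[OF cl])
  have eq: "?m y + \<kappa> = local_expr (cc Z' d) \<nu> y" if y: "y \<in> ?S" for y
  proof -
    have y': "drop_coord k y \<in> snd d ` fst d" "height k y < \<delta>" using y by (auto simp: collar.cap_region_def[OF cl])
    have "height k y < width (L Z')" using y'(2) \<delta>_width[OF Z'] by simp
    then obtain q where q: "q \<in> W Z'" "xx Z' q \<in> fst d" "hh Z' q = height k y" "capc Z' d q = y"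
      by (rule collar.cap_surj[OF cl d(1) y'(1)]) (rule that)
    have hq: "hh Z' q \<ge> 0" using q(3) height_nonneg by simp
    have qP: "q \<in> P" using P_side[OF Z' q(1)] hq by simp
    have "q \<in> cap Z'" using q(1,3) qP y'(2) by (simp add: cap_def)
    then show ?thesis
      unfolding q(4)[symmetric] local_expr_cc[OF Z' d(1) qP q(1,2)] collar.cap_moment_expr_capc[OF cl d(1) q(1,2) hq] by (rule \<nu>[symmetric])
  qed
  have sm: "smooth_on ?S (local_expr (cc Z' d) \<nu>)"
    by (rule smooth_on_cong[OF smooth_on_add[OF collar.smooth_on_cap_moment[OF cl d(1) \<Phi>_smooth] smooth_on_const] eq])
  have "(?m has_derivative collar.capform k (L Z') \<phi> d (capc Z' d p) (collar.cap_field k (L Z') d \<xi> p)) (at (capc Z' d p))"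
    by (rule collar.cap_moment_derivative[where \<phi> = \<phi>, OF cl d(1) pP(1) d(2) hp \<Phi>_deriv S pS hS]) (use hp pP(3) in simp)
  then have "((\<lambda>y. ?m y + \<kappa>) has_derivative collar.capform k (L Z') \<phi> d (capc Z' d p) (collar.cap_field k (L Z') d \<xi> p)) (at (capc Z' d p))"
    using has_derivative_add[OF _ has_derivative_const] by fastforce
  then have "(local_expr (cc Z' d) \<nu> has_derivative collar.capform k (L Z') \<phi> d (capc Z' d p) (collar.cap_field k (L Z') d \<xi> p)) (at (capc Z' d p))"
    by (rule has_derivative_transform_within_open[OF _ S pS eq])
  then have dd: "differential (cc Z' d) \<nu> (\<pi> p) u = collar.capform k (L Z') \<phi> d (capc Z' d p) (collar.cap_field k (L Z') d \<xi> p) u" for u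
    unfolding differential_def cc_apply[OF Z' pP(2,1)] by (rule dir_deriv_eq)
  show ?thesis
  proof (intro bexI[OF _ cc_A[OF Z' d(1)]] conjI exI[of _ ?S] S sm allI)
    show "\<pi> p \<in> fst (cc Z' d)" using cc_mem[OF Z' pP(2), of d] pP(1) d(2) by simp
    show "snd (cc Z' d) (\<pi> p) \<in> ?S" unfolding cc_apply[OF Z' pP(2,1)] by (rule pS)
    show "\<omega>' (cc Z' d) (snd (cc Z' d) (\<pi> p)) (fundamental_field (induced_action act) (cc Z' d) \<xi> (\<pi> p)) u =
        differential (cc Z' d) \<nu> (\<pi> p) u" for u
      unfolding dd cc_apply[OF Z' pP(2,1)] induced_field_cc[OF Z' d(1) pP(2,1) d(2)] by (rule form[OF Z' d(1) p d(2)])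
  qed
qed

lemma induced_hamiltonian:
  assumes symp: "symplectic_form UNIV A \<omega>'"
    and core: "\<And>c p u v. c \<in> M \<Longrightarrow> p \<in> fst c \<Longrightarrow> p \<in> core \<Longrightarrow> \<omega>' (oc c) (snd c p) u v = \<omega> c (snd c p) u v"
    and caps: "\<And>Z' d p u v. Z' \<in> C \<Longrightarrow> d \<in> FF Z' \<Longrightarrow> p \<in> cap Z' \<Longrightarrow> xx Z' p \<in> fst d \<Longrightarrow>
      \<omega>' (cc Z' d) (capc Z' d p) u v = collar.capform k (L Z') \<phi> d (capc Z' d p) u v"
  shows "hamiltonian_action UNIV A \<omega>' (induced_action act)"
proof (rule A.hamiltonian_actionI[OF induced_smooth])
  show "two_form UNIV A (carrier_of A) \<omega>'" using symp by (simp add: symplectic_form_def)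
next
  fix \<xi>
  obtain \<mu> where \<mu>: "b_function M Z \<mu>"
    "\<And>c p u. c \<in> M \<Longrightarrow> p \<in> fst c \<Longrightarrow> p \<notin> Z \<Longrightarrow> \<omega> c (snd c p) (fundamental_field act c \<xi> p) u = differential c \<mu> p u"
    using conjunct1[OF b_ham[unfolded b_hamiltonian_action_def], rule_format, of \<xi>] by blast
  have "\<exists>\<kappa>. \<forall>p. p \<in> W Z' \<longrightarrow> hh Z' p > 0 \<longrightarrow> \<mu> p = collar.cap_moment k (L Z') ln \<xi> p + \<kappa>" if Z': "Z' \<in> C" for Z'
  proof -
    obtain a where "\<And>p. p \<in> W Z' \<Longrightarrow> hh Z' p > 0 \<Longrightarrow> \<mu> p = collar.cap_moment k (L Z') ln \<xi> p + a"
      by (rule moment_on_collar[OF \<mu>(1) _ Z'], rule \<mu>(2), assumption+, rule that)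
    then show ?thesis by (intro exI[of _ a]) simp
  qed
  then have "\<forall>Z'\<in>C. \<exists>\<kappa>. \<forall>p. p \<in> W Z' \<longrightarrow> hh Z' p > 0 \<longrightarrow> \<mu> p = collar.cap_moment k (L Z') ln \<xi> p + \<kappa>" by (rule ballI)
  from bchoice[OF this] obtain \<kappa> where
    \<kappa>: "\<forall>Z'\<in>C. \<forall>p. p \<in> W Z' \<longrightarrow> hh Z' p > 0 \<longrightarrow> \<mu> p = collar.cap_moment k (L Z') ln \<xi> p + \<kappa> Z'" ..
  obtain \<nu> where \<nu>: "\<And>p. p \<in> core \<Longrightarrow> \<nu> (\<pi> p) = \<mu> p"
    "\<And>Z' p. Z' \<in> C \<Longrightarrow> p \<in> cap Z' \<Longrightarrow> \<nu> (\<pi> p) = collar.cap_moment k (L Z') \<Phi> \<xi> p + \<kappa> Z'"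
    by (rule glued_moment[of \<mu> \<xi> \<kappa>]) (rule \<kappa>[rule_format], assumption+, rule that, assumption+)
  show "\<exists>\<mu>. \<forall>q\<in>carrier_of A. \<exists>c\<in>A. q \<in> fst c \<and>
       (\<exists>S. open S \<and> snd c q \<in> S \<and> smooth_on S (local_expr c \<mu>)) \<and>
       (\<forall>u. \<omega>' c (snd c q) (fundamental_field (induced_action act) c \<xi> q) u = differential c \<mu> q u)"
  proof (intro exI[of _ \<nu>] ballI)
    fix q assume "q \<in> carrier_of A"
    then obtain p where p: "q = \<pi> p" "p \<in> P" unfolding carrier_A by auto
    show "\<exists>c\<in>A. q \<in> fst c \<and> (\<exists>S. open S \<and> snd c q \<in> S \<and> smooth_on S (local_expr c \<nu>)) \<and>
       (\<forall>u. \<omega>' c (snd c q) (fundamental_field (induced_action act) c \<xi> q) u = differential c \<nu> q u)"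
      unfolding p(1) using core_or_cap[OF p(2)]
    proof (elim disjE bexE)
      assume pc: "p \<in> core"
      show "\<exists>c\<in>A. \<pi> p \<in> fst c \<and> (\<exists>S. open S \<and> snd c (\<pi> p) \<in> S \<and> smooth_on S (local_expr c \<nu>)) \<and>
       (\<forall>u. \<omega>' c (snd c (\<pi> p)) (fundamental_field (induced_action act) c \<xi> (\<pi> p)) u = differential c \<nu> (\<pi> p) u)"
        by (rule moment_map_core[OF core \<mu> \<nu>(1) pc])
    next
      fix Z' assume Z': "Z' \<in> C" and pc: "p \<in> cap Z'"
      show "\<exists>c\<in>A. \<pi> p \<in> fst c \<and> (\<exists>S. open S \<and> snd c (\<pi> p) \<in> S \<and> smooth_on S (local_expr c \<nu>)) \<and>
       (\<forall>u. \<omega>' c (snd c (\<pi> p)) (fundamental_field (induced_action act) c \<xi> (\<pi> p)) u = differential c \<nu> (\<pi> p) u)"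
        by (rule moment_map_cap[OF caps \<nu>(2)[OF Z'] Z' pc])
    qed
  qed
next
  fix \<xi> \<eta> q assume "q \<in> carrier_of A"
  then obtain p where p: "q = \<pi> p" "p \<in> P" unfolding carrier_A by auto
  show "\<exists>c\<in>A. q \<in> fst c \<and>
       \<omega>' c (snd c q) (fundamental_field (induced_action act) c \<xi> q) (fundamental_field (induced_action act) c \<eta> q) = 0"
    using core_or_cap[OF p(2)]
  proof (elim disjE bexE)
    assume pc: "p \<in> core"
    have pX: "p \<in> X" "p \<notin> Z" using core_X[OF pc] X_sub by auto
    obtain c where c: "c \<in> M" "p \<in> fst c" using pX X_sub by (auto simp: carrier_of_def)
    have "\<omega> c (snd c p) (fundamental_field act c \<xi> p) (fundamental_field act c \<eta> p) = 0"
      using conjunct2[OF b_ham[unfolded b_hamiltonian_action_def], rule_format, of c p \<xi> \<eta>] c pX(2) by simp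
    then show ?thesis
      using oc_mem[OF p(2), of c] pX(1) c
      by (intro bexI[OF _ oc_A[OF c(1)]]) (simp add: p(1) oc_apply induced_field_oc core[OF c pc])
  next
    fix Z' assume Z': "Z' \<in> C" and pc: "p \<in> cap Z'"
    note cl = collar[OF Z']
    have pP: "p \<in> W Z'" using pc by (simp add: cap_def)
    obtain d where d: "d \<in> FF Z'" "xx Z' p \<in> fst d" using collar.emb_mem(1)[OF cl pP] by (auto simp: carrier_of_def)
    show ?thesis
      using cc_mem[OF Z' p(2), of d] pP d
      by (intro bexI[OF _ cc_A[OF Z' d(1)]])
        (simp add: p(1) cc_apply[OF Z' p(2) pP] induced_field_cc[OF Z' d(1) p(2) pP d(2)] caps[OF Z' d(1) pc d(2)]
          collar.cap_isotropic[OF cl d])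
  qed
qed

end

section \<open>Effectiveness of the induced action and conclusion\<close>

context collapse
begin

text \<open>Classes of points of X are singletons, so t fixes X pointwise. If some component is
  adjacent, its collar determines the splitting of t on both factors: rotation by 1 on the circle,
  and the identity on the fiber, where effectiveness is known.\<close>

lemma induced_effective: "effective_action UNIV A (induced_action act)"
  unfolding effective_action_def
proof (intro ballI impI)
  fix t :: "complex^'n" assume t: "t \<in> torus UNIV" and fix_all: "\<forall>q\<in>carrier_of A. induced_action act t q = q"
  have fix_X: "act t p = p" if p: "p \<in> X" for p
  proof -
    have "\<pi> (act t p) = \<pi> p" using fix_all induced_\<pi>[OF t X_P[OF p]] X_P[OF p] unfolding carrier_A by force
    then show ?thesis using \<pi>_X_eq[OF act_X[OF t p] X_P[OF p]] by simp
  qed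
  show "t = 1"
  proof (cases "C = {}")
    case True
    \<comment> \<open>Without adjacent components X is open and closed in the connected M, hence all
      of M.\<close>
    then have "closedin (mtop M) X" using P_closed by (simp add: P_def)
    then have "X = carrier_of M"
      using connected X_open X_nonempty unfolding connected_space_clopen_in by fastforce
    then show ?thesis using M_effective t fix_X unfolding effective_action_def by simp
  next
    case False
    then obtain Z' where Z': "Z' \<in> C" by blast
    note cl = collar[OF Z']
    let ?s = "splitting (L Z') t"
    have autom: "torus_automorphism (splitting (L Z'))" and F: "compact_symplectic_toric (- {k}) (FF Z') (fiber_form (L Z')) (fiber_act (L Z'))"
      using models Z' unfolding C_def is_local_model_def by blast+
    have s: "?s \<in> torus UNIV" using autom t unfolding torus_automorphism_def bij_betw_def by blast
    have fixed: "fiber_act (L Z') (torus_fiber_part k ?s) x = x \<and> ?s $ k = 1" if x: "x \<in> carrier_of (FF Z')" for x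
    proof -
      \<comment> \<open>A sample point over x at positive height, hence in X. Its circle point is 1,
        so the rotation by t is directly the value of its circle coordinate.\<close>
      let ?y = "(x, 1 :: complex, width (L Z') / 2)"
      have y: "?y \<in> carrier_of (FF Z') \<times> sphere 0 1 \<times> {- width (L Z')<..<width (L Z')}"
        using x collar.width_pos[OF cl] by simp
      define p where "p = inv_into (W Z') (emb (L Z')) ?y"
      have p: "p \<in> W Z'" "emb (L Z') p = ?y" unfolding p_def
        by (rule collar.G_mem[OF cl y], rule collar.emb_G[OF cl y])
      have "p \<in> X" using X_side[OF Z' p(1)] p(2) collar.width_pos[OF cl] by simp
      then show ?thesis using collar.emb_act(2)[OF cl t p(1)] fix_X[of p] p(2) by simp
    qed
    obtain p where "p \<in> Z'" using C_nonempty[OF Z'] by blast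
    then have "xx Z' p \<in> carrier_of (FF Z')" using collar.emb_mem(1)[OF cl] C_W[OF Z'] by blast
    then have sk: "?s $ k = 1" using fixed by blast
    have "torus_fiber_part k ?s \<in> torus (- {k})" using s by (auto simp: torus_def torus_fiber_part_def)
    moreover have "effective_action (- {k}) (FF Z') (fiber_act (L Z'))" using F by (simp add: compact_symplectic_toric_def)
    ultimately have f1: "torus_fiber_part k ?s = 1" using fixed unfolding effective_action_def by blast
    have "?s $ i = 1" for i
      using arg_cong[OF f1, of "\<lambda>v. v $ i"] sk by (cases "i = k") (simp_all add: torus_fiber_part_def)
    then have s1: "?s = 1" by (simp add: vec_eq_iff)
    \<comment> \<open>Multiplicativity makes the image of 1 an idempotent of the torus, which must
      be 1.\<close>
    have "splitting (L Z') (1 * 1) = splitting (L Z') 1 * splitting (L Z') 1" and e: "splitting (L Z') 1 \<in> torus UNIV"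
      using autom one_in_torus unfolding torus_automorphism_def bij_betw_def by blast+
    then have "splitting (L Z') 1 $ i = splitting (L Z') 1 $ i * splitting (L Z') 1 $ i" "splitting (L Z') 1 $ i \<noteq> 0" for i
    proof -
      show "splitting (L Z') 1 $ i = splitting (L Z') 1 $ i * splitting (L Z') 1 $ i"
        using arg_cong[OF \<open>splitting (L Z') (1 * 1) = splitting (L Z') 1 * splitting (L Z') 1\<close>, of "\<lambda>v. v $ i"] by simp
      have "norm (splitting (L Z') 1 $ i) = 1" using e by (simp add: torus_def)
      then show "splitting (L Z') 1 $ i \<noteq> 0" by auto
    qed
    then have "splitting (L Z') 1 = 1" by (simp add: vec_eq_iff)
    with s1 have eq: "splitting (L Z') t = splitting (L Z') 1" by (rule trans[OF _ sym])
    have "inj_on (splitting (L Z')) (torus UNIV)" using autom by (simp add: torus_automorphism_def bij_betw_def)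
    then show ?thesis by (rule inj_onD[OF _ eq t one_in_torus])
  qed
qed

lemma quotient_toric: "\<exists>\<omega>'. compact_symplectic_toric UNIV A \<omega>' (induced_action act)"
proof -
  obtain \<delta> where \<delta>: "0 < \<delta>" "\<And>Z'. Z' \<in> C \<Longrightarrow> \<delta> < width (L Z')"
      "\<And>Z' Z'' p. Z' \<in> C \<Longrightarrow> Z'' \<in> C \<Longrightarrow> p \<in> W Z' \<Longrightarrow> p \<in> W Z'' \<Longrightarrow> \<bar>hh Z' p\<bar> \<le> \<delta> \<Longrightarrow> \<bar>hh Z'' p\<bar> \<le> \<delta> \<Longrightarrow> Z' = Z''"
    by (rule common_width) (rule that; assumption)
  \<comment> \<open>The inner height r is taken to be \<delta>/2; only 0 < r < \<delta>
    matters.\<close>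
  have r: "0 < \<delta> / 2" "\<delta> / 2 < \<delta>" using \<delta>(1) by auto
  obtain \<phi> \<Phi> where \<phi>: "smooth_on {0..\<delta>} \<phi>" "smooth_on {0..\<delta>} \<Phi>" "\<And>h. h \<in> {0..\<delta>} \<Longrightarrow> \<phi> h > 0"
      "\<And>h. h \<in> {0..\<delta>} \<Longrightarrow> (\<Phi> has_real_derivative \<phi> h) (at h within {0..\<delta>})"
      "\<And>h. h \<in> {\<delta> / 2..\<delta>} \<Longrightarrow> \<phi> h = 1 / h" "\<And>h. h \<in> {\<delta> / 2..\<delta>} \<Longrightarrow> \<Phi> h = ln h"
    by (rule cap_profile[OF r]) (rule that; assumption)
  interpret collapse_profile k M Z X \<omega> act L \<delta> "\<delta> / 2" \<phi> \<Phi>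
    by unfold_locales (fact \<delta>(2), fact \<delta>(3), fact r(1), fact r(2), fact \<phi>(1), fact \<phi>(3), fact \<phi>(4), fact \<phi>(2), fact \<phi>(5), fact \<phi>(6))
  obtain \<omega>' where \<omega>': "symplectic_form UNIV A \<omega>'"
    "\<And>c p u v. c \<in> M \<Longrightarrow> p \<in> fst c \<Longrightarrow> p \<in> core \<Longrightarrow> \<omega>' (oc c) (snd c p) u v = \<omega> c (snd c p) u v"
    "\<And>Z' d p u v. Z' \<in> C \<Longrightarrow> d \<in> FF Z' \<Longrightarrow> p \<in> cap Z' \<Longrightarrow> xx Z' p \<in> fst d \<Longrightarrow>
      \<omega>' (cc Z' d) (capc Z' d p) u v = collar.capform k (L Z') \<phi> d (capc Z' d p) u v"
    by (rule glued_form) (rule that; assumption)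
  have "compact_symplectic_toric UNIV A \<omega>' (induced_action act)"
    unfolding compact_symplectic_toric_def
    by (intro conjI A_manifold A_compact A_connected \<omega>'(1) induced_smooth induced_hamiltonian[OF \<omega>'] induced_effective)
  then show ?thesis by blast
qed

end

theorem mainTheorem2:
  fixes M :: "('a, 'n::finite) atlas" and Z X :: "'a set"
    and \<omega> :: "('a, 'n) form2" and act :: "complex^'n \<Rightarrow> 'a \<Rightarrow> 'a"
    and k :: 'n and L :: "'a set \<Rightarrow> ('a, 'x, 'n) local_model"
  assumes toric: "b_symplectic_toric M Z \<omega> act"
    and compact: "compact_space (mtop M)"
    and connected: "connected_space (mtop M)"
    and component: "X \<in> connected_components_of (subtopology (mtop M) (carrier_of M - Z))"
    and models: "\<And>Z'. Z' \<in> adjacent_components M Z X \<Longrightarrow> is_local_model k M Z \<omega> act Z' (L Z')"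
    and side: "\<And>Z' p. Z' \<in> adjacent_components M Z X \<Longrightarrow> p \<in> nbhd (L Z') \<Longrightarrow>
                 p \<in> X \<longleftrightarrow> snd (snd (emb (L Z') p)) > 0"
  shows "carrier_of (quotient_atlas k M X (adjacent_components M Z X) L) =
           (X \<union> \<Union>(adjacent_components M Z X)) // collapse_rel X (adjacent_components M Z X) L \<and>
         (\<exists>\<omega>'. compact_symplectic_toric UNIV
           (quotient_atlas k M X (adjacent_components M Z X) L) \<omega>' (induced_action act))"
proof -
  interpret collapse k M Z X \<omega> act L
    by unfold_locales (fact toric, fact compact, fact connected, fact component, fact models, fact side)
  show ?thesis using carrier_quotient quotient_toric unfolding A_def R_def P_def C_def by (rule conjI)
qed

end
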